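(* Consider the single-input single-output plant $y=W(s)u$, $W(s)=k_pZ(s)/P(s)$, with $Z,P$ monic real polynomials with unknown coefficients, $\deg P=n$, $Z$ Hurwitz (minimum phase), known relative degree $n^*=\deg P-\deg Z\ge1$, and known high frequency gain $k_p$, normalized so that $k_p=k_m=1$. Let the closed-loop reference model be $$\dot x_m=A_mx_m+b_mr+\ell(y-y_m),\qquad y_m=c_m^Tx_m,$$ where $W_m(s)=Z_m(s)/P_m(s)=c_m^T(sI-A_m)^{-1}b_m$ has relative degree $n^*$, $P_m$ is Hurwitz, and $r$ is a bounded piecewise continuous reference signal. Let $F(s)=1/f(s)$ with $f$ a monic Hurwitz polynomial of degree $n^*-1$, and suppose $\ell\in\mathbb R^m$ is chosen such that $$W_f'(s)=W_e'(s)F^{-1}(s),\qquad W_e'(s)=\frac{Z_m(s)}{P_m(s)+k_\ell Z_\ell(s)},\qquad \frac{k_\ell Z_\ell(s)}{P_m(s)}=c_m^T(sI-A_m)^{-1}\ell,$$ is strictly positive real. Let the controller be $$\dot\omega_1=\Lambda\omega_1+b_\lambda u,\quad \dot\omega_2=\Lambda\omega_2+b_\lambda y,\quad \bar\omega=[\omega_1^T,\ y,\ \omega_2^T]^T,\quad u=r+\bar\theta^T(t)\bar\omega(t),$$ with $\bar\theta=[\theta_1^T,\theta_0,\theta_2^T]^T\in\mathbb R^{2n-1}$. Define $e_y=y-y_m$, $\bar\zeta=F(s)I\bar\omega$ and $$e_\chi=\bar\theta^T\bar\zeta-F(s)[\bar\theta^T\bar\omega],\qquad e_a=e_y+W_f'(s)\big[e_\chi-e_a\bar\zeta^T\bar\zeta\big],$$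 and let the update law be $\dot{\bar\theta}=-\gamma e_a\bar\zeta$, $\gamma>0$. Then the adaptive system is globally stable, i.e. for all initial conditions all its signals are bounded on $[0,\infty)$, and the model following error satisfies $\lim_{t\to\infty}e_y(t)=0$.
   Context: Transfer functions act as operators on time signals ($s$ is the differential operator), each realized by a finite-dimensional linear system (minimal for $F$ and $W_f'$); $F(s)I$ applies $F(s)$ to each component, $I$ being the $(2n-1)\times(2n-1)$ identity. The plant is realized by $\dot x_p=A_px_p+b_pu$, $y=k_pc_p^Tx_p$, $x_p\in\mathbb R^n$, with $\det(sI-A_p)=P(s)$ and $k_pc_p^T(sI-A_p)^{-1}b_p=W(s)$. "All signals" means the states of the plant, of the filters $\omega_1,\omega_2$, of the reference model, and of the filters $F$ and $W_f'$, together with $\bar\theta,\ u,\ y,\ y_m,\ \bar\zeta,\ e_\chi,\ e_a$. Reference model: $Z_m,P_m$ are monic real polynomials, $\deg P_m=m$, $\deg Z_m=m-n^*$; $(A_m,b_m,c_m^T)$ is in $m$-dimensional observer canonical form with $\det(sI-A_m)=P_m(s)$ and $c_m^T=[0\ \cdots\ 0\ 1]$, so that $k_\ell Z_\ell(s)$ is the polynomial of degree at most $m-1$ whose coefficients are the entries of $\ell$. Controller filters: $\Lambda\in\mathbb R^{(n-1)\times(n-1)}$ is Hurwitz, $b_\lambda\in\mathbb R^{n-1}$, $(\Lambda,b_\lambda)$ is controllable, $\omega_1,\omega_2,\theta_1,\theta_2\in\mathbb R^{n-1}$, $\theta_0\in\mathbb R$, and $\lambda(s)=\det(sI-\Lambda)$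 is divisible by $Z_m(s)$. This ensures that there is a constant $\bar\theta^*$ for which the closed loop with $\bar\theta(t)\equiv\bar\theta^*$ has transfer function $W_m(s)$ from $r$ to $y$. A polynomial (matrix) is Hurwitz if all its roots (eigenvalues) have negative real part. A real rational function $H(s)\not\equiv0$ is positive real if it is analytic in $\mathrm{Re}\,s>0$ with $\mathrm{Re}\,H(s)\ge0$ there, and strictly positive real (SPR) if $H(s-\varepsilon)$ is positive real for some $\varepsilon>0$. *)

theory Defs
  imports
    "HOL-Analysis.Analysis"
    "HOL-Computational_Algebra.Computational_Algebra"
    "HOL-Computational_Algebra.Field_as_Ring"
    "Jordan_Normal_Form.Char_Poly"
    "Jordan_Normal_Form.DL_Rank"
begin

text \<open>
  Vectors and matrices are those of \<^theory>\<open>Jordan_Normal_Form.Matrix\<close>, so that dimensions are natural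
  numbers and may be zero; the names shared with HOL-Analysis are qualified. Real rational
  functions in \<open>s\<close> are elements of \<^typ>\<open>real poly fract\<close>.
\<close>

section \<open>Polynomials and rational functions\<close>

definition hurwitz_poly :: "real poly \<Rightarrow> bool" where
  "hurwitz_poly p \<longleftrightarrow> (\<forall>s::complex. poly (map_poly complex_of_real p) s = 0 \<longrightarrow> Re s < 0)"

definition hurwitz_mat :: "real Matrix.mat \<Rightarrow> bool" where
  "hurwitz_mat A \<longleftrightarrow> (\<forall>s::complex. eigenvalue (map_mat complex_of_real A) s \<longrightarrow> Re s < 0)"

text \<open>
  The value of a rational function is computed from its reduced fraction, so that removable
  singularities are removed. At a pole the value is \<open>0\<close> because of \<open>x / 0 = 0\<close>, and the function
  is not analytic there.
\<close>

definition rat_eval :: "real poly fract \<Rightarrow> complex \<Rightarrow> complex" where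
  "rat_eval H s =
     poly (map_poly complex_of_real (fst (quot_of_fract H))) s /
     poly (map_poly complex_of_real (snd (quot_of_fract H))) s"

definition positive_real :: "(complex \<Rightarrow> complex) \<Rightarrow> bool" where
  "positive_real h \<longleftrightarrow>
     h analytic_on {s. 0 < Re s} \<and> (\<forall>s. 0 < Re s \<longrightarrow> 0 \<le> Re (h s))"

definition strictly_positive_real :: "real poly fract \<Rightarrow> bool" where
  "strictly_positive_real H \<longleftrightarrow>
     H \<noteq> 0 \<and> (\<exists>\<epsilon>>0. positive_real (\<lambda>s. rat_eval H (s - complex_of_real \<epsilon>)))"

section \<open>Linear systems\<close>

text \<open>
  The rational function \<open>c\<^sup>T (s I - A)\<^sup>-\<^sup>1 b\<close>, with the inverse of \<open>s I - A\<close> written as its adjugate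
  divided by its determinant; \<^term>\<open>char_poly_matrix A\<close> is the polynomial matrix \<open>s I - A\<close>.
\<close>

definition transfer_fun ::
    "real Matrix.mat \<Rightarrow> real Matrix.vec \<Rightarrow> real Matrix.vec \<Rightarrow> real poly fract" where
  "transfer_fun A b c =
     Fraction_Field.Fract (scalar_prod (map_vec (\<lambda>a. [:a:]) c)
              (mult_mat_vec (adj_mat (char_poly_matrix A)) (map_vec (\<lambda>a. [:a:]) b)))
           (char_poly A)"

record state_space =
  ss_A :: "real Matrix.mat"
  ss_b :: "real Matrix.vec"
  ss_c :: "real Matrix.vec"
  ss_d :: real

abbreviation ss_dim :: "state_space \<Rightarrow> nat" where
  "ss_dim G \<equiv> dim_row (ss_A G)"

definition realizes :: "state_space \<Rightarrow> real poly fract \<Rightarrow> bool" where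
  "realizes G H \<longleftrightarrow>
     ss_A G \<in> carrier_mat (ss_dim G) (ss_dim G) \<and>
     ss_b G \<in> carrier_vec (ss_dim G) \<and> ss_c G \<in> carrier_vec (ss_dim G) \<and>
     transfer_fun (ss_A G) (ss_b G) (ss_c G) + Fraction_Field.Fract [:ss_d G:] 1 = H"

definition minimal_realization :: "state_space \<Rightarrow> real poly fract \<Rightarrow> bool" where
  "minimal_realization G H \<longleftrightarrow>
     realizes G H \<and> (\<forall>G'. realizes G' H \<longrightarrow> ss_dim G \<le> ss_dim G')"

definition controllable :: "nat \<Rightarrow> real Matrix.mat \<Rightarrow> real Matrix.vec \<Rightarrow> bool" where
  "controllable N A b \<longleftrightarrow>
     vec_space.rank N (mat_of_cols N (map (\<lambda>k. mult_mat_vec (A ^\<^sub>m k) b) [0..<N])) = N"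

text \<open>
  The state matrix of the observer canonical form for the monic polynomial \<open>p\<close> of degree \<open>m\<close>: ones on
  the subdiagonal and the negated coefficients of \<open>p\<close> in the last column.
\<close>

definition observer_canonical_mat :: "nat \<Rightarrow> real poly \<Rightarrow> real Matrix.mat" where
  "observer_canonical_mat m p =
     Matrix.mat m m (\<lambda>(i, j). if j = m - 1 then - Polynomial.coeff p i else if i = j + 1 then 1 else 0)"

section \<open>Time signals\<close>

definition piecewise_continuous :: "(real \<Rightarrow> real) \<Rightarrow> bool" where
  "piecewise_continuous r \<longleftrightarrow>
     (\<forall>T. finite {t \<in> {0..T}. \<not> continuous (at t within {0..}) r}) \<and>
     (\<forall>t\<ge>0. \<exists>l. (r \<longlongrightarrow> l) (at_right t)) \<and>
     (\<forall>t>0. \<exists>l. (r \<longlongrightarrow> l) (at_left t))"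

definition continuity_times :: "(real \<Rightarrow> real) \<Rightarrow> real set" where
  "continuity_times r = {t. 0 \<le> t \<and> continuous (at t within {0..}) r}"

text \<open>
  \<open>x\<close> is a continuous solution on \<open>[0, \<infinity>)\<close>, in dimension \<open>N\<close>, of \<open>x' = g\<close>, where the differential
  equation is required at the times in \<open>R\<close>. Below, \<open>R\<close> consists of the continuity times of the
  piecewise continuous reference; at the remaining isolated times a solution need not be
  differentiable. The derivative at time \<open>0\<close> is one-sided.
\<close>

definition solves_ode ::
    "real set \<Rightarrow> nat \<Rightarrow> (real \<Rightarrow> real Matrix.vec) \<Rightarrow> (real \<Rightarrow> real Matrix.vec) \<Rightarrow> bool" where
  "solves_ode R N x g \<longleftrightarrow>
     (\<forall>t\<ge>0. x t \<in> carrier_vec N) \<and>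
     (\<forall>i<N. continuous_on {0..} (\<lambda>t. vec_index (x t) i)) \<and>
     (\<forall>i<N. \<forall>t\<in>R.
        ((\<lambda>t. vec_index (x t) i) has_real_derivative vec_index (g t) i) (at t within {0..}))"

text \<open>The operator equation \<open>z = G(s)[v]\<close> for the realization \<open>G\<close>, with internal state \<open>x\<close>.\<close>

definition lti_op ::
    "real set \<Rightarrow> state_space \<Rightarrow> (real \<Rightarrow> real) \<Rightarrow> (real \<Rightarrow> real Matrix.vec) \<Rightarrow> (real \<Rightarrow> real) \<Rightarrow> bool" where
  "lti_op R G v x z \<longleftrightarrow>
     solves_ode R (ss_dim G) x (\<lambda>t. mult_mat_vec (ss_A G) (x t) + v t \<cdot>\<^sub>v ss_b G) \<and>
     (\<forall>t\<ge>0. z t = scalar_prod (ss_c G) (x t) + ss_d G * v t)"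

definition bounded_signal :: "(real \<Rightarrow> real) \<Rightarrow> bool" where
  "bounded_signal v \<longleftrightarrow> bounded (v ` {0..})"

definition bounded_vec_signal :: "(real \<Rightarrow> real Matrix.vec) \<Rightarrow> bool" where
  "bounded_vec_signal x \<longleftrightarrow> (\<exists>B. \<forall>t\<ge>0. \<forall>i<dim_vec (x t). \<bar>vec_index (x t) i\<bar> \<le> B)"

section \<open>The adaptive closed loop\<close>

text \<open>
  \<open>sig_xF s t j\<close> is the state of the copy of \<open>F(s)\<close> acting on component \<open>j\<close> of \<open>\<omega>\<close>, and \<open>sig_xFu\<close>
  is the state of the copy acting on \<open>\<theta>\<^sup>T \<omega>\<close>; \<open>sig_Fu\<close> is the output of the latter. \<open>sig_xW\<close> and
  \<open>sig_Wout\<close> are the state and the output of \<open>W\<^sub>f'(s)\<close>.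
\<close>

record signals =
  sig_xp :: "real \<Rightarrow> real Matrix.vec"
  sig_omega1 :: "real \<Rightarrow> real Matrix.vec"
  sig_omega2 :: "real \<Rightarrow> real Matrix.vec"
  sig_xm :: "real \<Rightarrow> real Matrix.vec"
  sig_xF :: "real \<Rightarrow> nat \<Rightarrow> real Matrix.vec"
  sig_xFu :: "real \<Rightarrow> real Matrix.vec"
  sig_xW :: "real \<Rightarrow> real Matrix.vec"
  sig_theta :: "real \<Rightarrow> real Matrix.vec"
  sig_u :: "real \<Rightarrow> real"
  sig_y :: "real \<Rightarrow> real"
  sig_omega :: "real \<Rightarrow> real Matrix.vec"
  sig_ym :: "real \<Rightarrow> real"
  sig_ey :: "real \<Rightarrow> real"
  sig_zeta :: "real \<Rightarrow> real Matrix.vec"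
  sig_Fu :: "real \<Rightarrow> real"
  sig_echi :: "real \<Rightarrow> real"
  sig_Wout :: "real \<Rightarrow> real"
  sig_ea :: "real \<Rightarrow> real"

definition plant_eqs ::
    "real set \<Rightarrow> nat \<Rightarrow> real \<Rightarrow> real Matrix.mat \<Rightarrow> real Matrix.vec \<Rightarrow> real Matrix.vec \<Rightarrow> signals \<Rightarrow> bool" where
  "plant_eqs R n kp Ap bp cp s \<longleftrightarrow>
     solves_ode R n (sig_xp s) (\<lambda>t. mult_mat_vec Ap (sig_xp s t) + sig_u s t \<cdot>\<^sub>v bp) \<and>
     (\<forall>t\<ge>0. sig_y s t = kp * scalar_prod cp (sig_xp s t))"

definition reference_model_eqs ::
    "real set \<Rightarrow> nat \<Rightarrow> real Matrix.mat \<Rightarrow> real Matrix.vec \<Rightarrow> real Matrix.vec \<Rightarrow> real Matrix.vec \<Rightarrow>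
     (real \<Rightarrow> real) \<Rightarrow> signals \<Rightarrow> bool" where
  "reference_model_eqs R m Am bm cm l r s \<longleftrightarrow>
     solves_ode R m (sig_xm s)
       (\<lambda>t. mult_mat_vec Am (sig_xm s t) + r t \<cdot>\<^sub>v bm + (sig_y s t - sig_ym s t) \<cdot>\<^sub>v l) \<and>
     (\<forall>t\<ge>0. sig_ym s t = scalar_prod cm (sig_xm s t))"

definition controller_eqs ::
    "real set \<Rightarrow> nat \<Rightarrow> real Matrix.mat \<Rightarrow> real Matrix.vec \<Rightarrow> (real \<Rightarrow> real) \<Rightarrow> signals \<Rightarrow> bool" where
  "controller_eqs R n \<Lambda> bl r s \<longleftrightarrow>
     solves_ode R (n - 1) (sig_omega1 s)
       (\<lambda>t. mult_mat_vec \<Lambda> (sig_omega1 s t) + sig_u s t \<cdot>\<^sub>v bl) \<and>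
     solves_ode R (n - 1) (sig_omega2 s)
       (\<lambda>t. mult_mat_vec \<Lambda> (sig_omega2 s t) + sig_y s t \<cdot>\<^sub>v bl) \<and>
     (\<forall>t\<ge>0. sig_omega s t = sig_omega1 s t @\<^sub>v vCons (sig_y s t) (sig_omega2 s t)) \<and>
     (\<forall>t\<ge>0. sig_u s t = r t + scalar_prod (sig_theta s t) (sig_omega s t))"

definition error_eqs ::
    "real set \<Rightarrow> nat \<Rightarrow> state_space \<Rightarrow> state_space \<Rightarrow> signals \<Rightarrow> bool" where
  "error_eqs R n F Wf s \<longleftrightarrow>
     (\<forall>t\<ge>0. sig_ey s t = sig_y s t - sig_ym s t) \<and>
     (\<forall>t\<ge>0. sig_zeta s t \<in> carrier_vec (2 * n - 1)) \<and>
     (\<forall>j < 2 * n - 1.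
        lti_op R F (\<lambda>t. vec_index (sig_omega s t) j) (\<lambda>t. sig_xF s t j)
          (\<lambda>t. vec_index (sig_zeta s t) j)) \<and>
     lti_op R F (\<lambda>t. scalar_prod (sig_theta s t) (sig_omega s t)) (sig_xFu s) (sig_Fu s) \<and>
     (\<forall>t\<ge>0. sig_echi s t = scalar_prod (sig_theta s t) (sig_zeta s t) - sig_Fu s t) \<and>
     lti_op R Wf
       (\<lambda>t. sig_echi s t - sig_ea s t * scalar_prod (sig_zeta s t) (sig_zeta s t))
       (sig_xW s) (sig_Wout s) \<and>
     (\<forall>t\<ge>0. sig_ea s t = sig_ey s t + sig_Wout s t)"

definition update_law ::
    "real set \<Rightarrow> nat \<Rightarrow> real \<Rightarrow> signals \<Rightarrow> bool" where
  "update_law R n \<gamma> s \<longleftrightarrow>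
     solves_ode R (2 * n - 1) (sig_theta s) (\<lambda>t. (- \<gamma> * sig_ea s t) \<cdot>\<^sub>v sig_zeta s t)"

definition closed_loop ::
    "nat \<Rightarrow> nat \<Rightarrow> real \<Rightarrow> real Matrix.mat \<Rightarrow> real Matrix.vec \<Rightarrow> real Matrix.vec \<Rightarrow>
     real Matrix.mat \<Rightarrow> real Matrix.vec \<Rightarrow> real Matrix.vec \<Rightarrow> real Matrix.vec \<Rightarrow>
     real Matrix.mat \<Rightarrow> real Matrix.vec \<Rightarrow> state_space \<Rightarrow> state_space \<Rightarrow> real \<Rightarrow>
     (real \<Rightarrow> real) \<Rightarrow> signals \<Rightarrow> bool" where
  "closed_loop n m kp Ap bp cp Am bm cm l \<Lambda> bl F Wf \<gamma> r s \<longleftrightarrow>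
     (let R = continuity_times r in
        plant_eqs R n kp Ap bp cp s \<and>
        reference_model_eqs R m Am bm cm l r s \<and>
        controller_eqs R n \<Lambda> bl r s \<and>
        error_eqs R n F Wf s \<and>
        update_law R n \<gamma> s)"

definition all_signals_bounded :: "nat \<Rightarrow> signals \<Rightarrow> bool" where
  "all_signals_bounded n s \<longleftrightarrow>
     bounded_vec_signal (sig_xp s) \<and>
     bounded_vec_signal (sig_omega1 s) \<and> bounded_vec_signal (sig_omega2 s) \<and>
     bounded_vec_signal (sig_xm s) \<and>
     (\<forall>j < 2 * n - 1. bounded_vec_signal (\<lambda>t. sig_xF s t j)) \<and>
     bounded_vec_signal (sig_xFu s) \<and> bounded_vec_signal (sig_xW s) \<and>
     bounded_vec_signal (sig_theta s) \<and>
     bounded_signal (sig_u s) \<and> bounded_signal (sig_y s) \<and> bounded_signal (sig_ym s) \<and>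
     bounded_vec_signal (sig_zeta s) \<and>
     bounded_signal (sig_echi s) \<and> bounded_signal (sig_ea s)"

end

theory Submission
  imports Defs
begin

text \<open>
  The argument is the Lyapunov analysis of an augmented error. Every filter gives a linear differential
  relation with polynomial coefficients between its signals, so that block diagram algebra becomes polynomial
  algebra, and factors may be dropped when they are Hurwitz, at the price of exponentially decaying terms. With the matching
  parameter \<open>\<theta>\<^sup>*\<close>, the augmented error satisfies \<open>e\<^sub>a = W\<^sub>f' [(\<theta> - \<theta>\<^sup>*)\<^sup>T \<zeta> - e\<^sub>a \<zeta>\<^sup>T \<zeta>]\<close> up to such a
  term. Strict positive realness provides a quadratic form in the state of \<open>W\<^sub>f'\<close> which, added to
  \<open>|\<theta> - \<theta>\<^sup>*|\<^sup>2 / \<gamma>\<close>, decreases; hence \<open>\<theta>\<close> and \<open>e\<^sub>a\<close> are bounded, and \<open>e\<^sub>a\<close> and \<open>e\<^sub>a \<zeta>\<close> are square integrable.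

  Stability of the filters and of the zeros of the plant bounds every signal by the supremum of
  \<open>v = (\<theta> - \<theta>\<^sup>*)\<^sup>T \<omega>\<close>. The signal \<open>e\<^sub>y - e\<^sub>a\<close> is a filtered version of quantities containing the square integrable factor
  \<open>e\<^sub>a \<zeta>\<close>, which makes \<open>e\<^sub>y\<close> small relative to \<open>sup |v|\<close>. On the other hand \<open>v\<close> is recovered from \<open>e\<^sub>y\<close>: the lag
  \<open>(\<alpha> / (s + \<alpha>))\<close>, applied \<open>n\<^sup>*\<close> times to \<open>v\<close>, is a stable proper filter of \<open>e\<^sub>y\<close>, and it differs from \<open>v\<close> by \<open>O(1 / sqrt \<alpha>)\<close>
  relative to \<open>sup |v|\<close>. Together the two estimates bound \<open>v\<close> on every interval of existence, which gives global
  existence, and Barbalat's argument gives \<open>e\<^sub>y \<rightarrow> 0\<close>.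
\<close>

no_notation vec_nth (infixl "$" 90)
unbundle no fps_syntax
hide_const (open) module.smult

section \<open>Signals on a time interval\<close>

text \<open>The loop is polynomial in its state, so at the start only local solutions are available,
  and no estimate can presuppose \<open>[0, \<infinity>)\<close>. Every estimate is therefore proved
  on an arbitrary interval \<open>I\<close> that contains 0 and is closed downwards, with constants
  valid on all of \<open>I\<close>; applied to the interval of existence, the same estimates exclude
  blow-up. The set \<open>S\<close> holds the jump times of the reference.

  Square integrability of \<open>ea \<zeta>\<close> carries no smallness. Smallness comes from the
  tail: after some time the integral of the square increases by at most a chosen
  \<open>h\<^sup>2\<close>, and everything earlier goes into an additive constant. The order of
  choices is decisive: \<alpha> comes first, with an approximation constant independent of \<alpha>;
  the bound of the lagged signal by \<open>ey\<close> has a constant depending on \<alpha>;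
  \<open>h\<close> comes last, small against it.

  Decaying terms caused by initial conditions are never solved for. They are carried by quadratic
  Lyapunov functions that enter the main one with suitable weights.\<close>

locale time_domain =
  fixes I S :: "real set"
  assumes zero_mem: "0 \<in> I"
    and time_nonneg: "t \<in> I \<Longrightarrow> 0 \<le> t"
    and time_down: "t \<in> I \<Longrightarrow> 0 \<le> s \<Longrightarrow> s \<le> t \<Longrightarrow> s \<in> I"
    and fin_exc: "finite (S \<inter> {0..t})"
begin

text \<open>Derivatives are taken within \<open>I\<close>, hence one-sided at its ends, and only off
  \<open>S\<close>; continuity across \<open>S\<close> replaces the equation there, so that
  increments are still integrals of the right-hand side.\<close>

definition sol :: "(real \<Rightarrow> 'a::real_normed_vector) \<Rightarrow> (real \<Rightarrow> 'a) \<Rightarrow> bool" where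
  "sol x g \<longleftrightarrow> continuous_on I x \<and> (\<forall>t\<in>I - S. (x has_vector_derivative g t) (at t within I))"

lemma sub_I: "b \<in> I \<Longrightarrow> 0 \<le> a \<Longrightarrow> {a..b} \<subseteq> I"
  using time_down by auto

lemma sol_cont: "sol x g \<Longrightarrow> continuous_on I x"
  by (simp add: sol_def)

lemma sol_cong:
  assumes "sol x g" "\<And>t. t \<in> I \<Longrightarrow> x t = y t" "\<And>t. t \<in> I - S \<Longrightarrow> g t = h t"
  shows "sol y h"
proof -
  have "continuous_on I y" using assms(1,2) continuous_on_cong[of I I x y] by (auto simp: sol_def)
  moreover have "(y has_vector_derivative h t) (at t within I)" if "t \<in> I - S" for t
  proof (rule has_vector_derivative_transform[of t I y x])
    show "(x has_vector_derivative h t) (at t within I)" using assms(1,3) that by (auto simp: sol_def)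
  qed (use assms(2) that in auto)
  ultimately show ?thesis by (auto simp: sol_def)
qed

lemma sol_const: "sol (\<lambda>t. c) (\<lambda>t. 0)"
  by (auto simp: sol_def)

lemma sol_add: "sol x g \<Longrightarrow> sol y h \<Longrightarrow> sol (\<lambda>t. x t + y t) (\<lambda>t. g t + h t)"
  by (auto simp: sol_def intro!: continuous_on_add continuous_on_diff continuous_on_mult continuous_on_minus continuous_on_sum continuous_on_of_real continuous_on_const has_vector_derivative_add)

lemma sol_diff: "sol x g \<Longrightarrow> sol y h \<Longrightarrow> sol (\<lambda>t. x t - y t) (\<lambda>t. g t - h t)"
  by (auto simp: sol_def intro!: continuous_on_add continuous_on_diff continuous_on_mult continuous_on_minus continuous_on_sum continuous_on_of_real continuous_on_const has_vector_derivative_diff)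

lemma sol_mult:
  fixes x y :: "real \<Rightarrow> 'a::real_normed_algebra"
  shows "sol x g \<Longrightarrow> sol y h \<Longrightarrow> sol (\<lambda>t. x t * y t) (\<lambda>t. x t * h t + g t * y t)"
  by (auto simp: sol_def intro!: continuous_on_add continuous_on_diff continuous_on_mult continuous_on_minus continuous_on_sum continuous_on_of_real continuous_on_const has_vector_derivative_mult)

lemma sol_cmult:
  fixes x :: "real \<Rightarrow> 'a::real_normed_algebra"
  shows "sol x g \<Longrightarrow> sol (\<lambda>t. c * x t) (\<lambda>t. c * g t)"
  by (auto simp: sol_def intro!: continuous_on_add continuous_on_diff continuous_on_mult continuous_on_minus continuous_on_sum continuous_on_of_real continuous_on_const has_vector_derivative_mult_right)

lemma sol_minus:
  "sol x g \<Longrightarrow> sol (\<lambda>t. - x t) (\<lambda>t. - g t)"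
  by (auto simp: sol_def intro!: continuous_on_add continuous_on_diff continuous_on_mult continuous_on_minus continuous_on_sum continuous_on_of_real continuous_on_const has_vector_derivative_minus)

lemma sol_sum:
  "(\<And>i. i \<in> K \<Longrightarrow> sol (x i) (g i)) \<Longrightarrow> sol (\<lambda>t. \<Sum>i\<in>K. x i t) (\<lambda>t. \<Sum>i\<in>K. g i t)"
  by (auto simp: sol_def intro!: continuous_on_add continuous_on_diff continuous_on_mult continuous_on_minus continuous_on_sum continuous_on_of_real continuous_on_const has_vector_derivative_sum)

lemma sol_of_real: "sol x g \<Longrightarrow> sol (\<lambda>t. complex_of_real (x t)) (\<lambda>t. complex_of_real (g t))"
  by (auto simp: sol_def intro!: continuous_on_add continuous_on_diff continuous_on_mult continuous_on_minus continuous_on_sum continuous_on_of_real continuous_on_const has_vector_derivative_of_real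
      simp flip: has_real_derivative_iff_has_vector_derivative)

lemma sol_square:
  assumes "sol x g" shows "sol (\<lambda>t. (x t)\<^sup>2) (\<lambda>t. 2 * x t * (g t :: real))"
  using sol_mult[OF assms assms] by (auto intro: sol_cong simp: power2_eq_square algebra_simps)

lemma sol_cmod_square:
  assumes "sol z g"
  shows "sol (\<lambda>t. (cmod (z t))\<^sup>2) (\<lambda>t. 2 * Re (cnj (z t) * g t))"
proof -
  have re: "sol (\<lambda>t. Re (z t)) (\<lambda>t. Re (g t))" and im: "sol (\<lambda>t. Im (z t)) (\<lambda>t. Im (g t))"
    using assms by (auto simp: sol_def has_vector_derivative_complex_iff has_real_derivative_iff_has_vector_derivative
        intro!: continuous_on_Re continuous_on_Im)
  show ?thesis
    by (rule sol_cong[OF sol_add[OF sol_square[OF re] sol_square[OF im]]]) (auto simp: cmod_power2)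
qed

text \<open>The fundamental theorem tolerates finitely many exceptional points because
  \<open>x\<close> is continuous at them; this is where finiteness of \<open>S\<close> on bounded
  intervals enters.\<close>

lemma sol_has_integral:
  fixes x :: "real \<Rightarrow> 'a::banach"
  assumes x: "sol x g" and ab: "0 \<le> a" "a \<le> b" "b \<in> I"
  shows "(g has_integral x b - x a) {a..b}"
proof (rule fundamental_theorem_of_calculus_interior_strong[of "S \<inter> {0..b}"])
  show "finite (S \<inter> {0..b})" by (rule fin_exc)
  show "continuous_on {a..b} x" using x sub_I[OF ab(3,1)] by (auto simp: sol_def intro: continuous_on_subset)
  fix t assume t: "t \<in> {a<..<b} - S \<inter> {0..b}"
  then have tI: "t \<in> I - S" "{a<..<b} \<subseteq> I" using sub_I[OF ab(3,1)] ab by auto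
  then have "(x has_vector_derivative g t) (at t within I)" using x by (auto simp: sol_def)
  then have "(x has_vector_derivative g t) (at t within {a<..<b})"
    by (rule has_vector_derivative_within_subset[OF _ tI(2)])
  then show "(x has_vector_derivative g t) (at t)"
    using t by (simp add: at_within_open[of t "{a<..<b}"])
qed (use ab in auto)

lemma sol_decreasing:
  assumes x: "sol x g" and ab: "0 \<le> a" "a \<le> b" "b \<in> I"
    and le: "\<And>t. t \<in> {a..b} - S \<Longrightarrow> g t \<le> (0::real)"
  shows "x b \<le> x a"
proof -
  \<comment> \<open>The sign of \<open>g\<close> is known only off \<open>S\<close>; on
    \<open>S\<close> the derivative may be redefined, and 0 is a harmless value.\<close>
  define g' where "g' t = (if t \<in> S then 0 else g t)" for t
  have "sol x g'" by (rule sol_cong[OF x]) (auto simp: g'_def)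
  then have "(g' has_integral x b - x a) {a..b}" by (rule sol_has_integral[OF _ ab])
  then have "x b - x a \<le> 0" by (rule has_integral_le[OF _ has_integral_0]) (use le in \<open>auto simp: g'_def\<close>)
  then show ?thesis by simp
qed

lemma sol_exp: "sol (\<lambda>t. exp (k * (t - a))) (\<lambda>t. k * exp (k * (t - a)) :: real)"
  unfolding sol_def
  by (auto intro!: continuous_intros derivative_eq_intros simp flip: has_real_derivative_iff_has_vector_derivative)

text \<open>Integrating factor: with the equilibrium \<open>M / \<alpha>\<close> subtracted,
  multiplication by \<open>exp (\<alpha> * (t - a))\<close> gives a decreasing function. The sign of
  \<open>V\<close> is left free, since the estimate is also applied to a form not yet known to be
  nonnegative.\<close>

lemma sol_decay:
  assumes V: "sol V dV" and ab: "0 \<le> a" "a \<le> b" "b \<in> I" and al: "\<alpha> > 0"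
    and le: "\<And>t. t \<in> {a..b} - S \<Longrightarrow> dV t \<le> - \<alpha> * V t + (M::real)"
  shows "V b \<le> (V a - M / \<alpha>) * exp (- \<alpha> * (b - a)) + M / \<alpha>"
proof -
  have d: "sol (\<lambda>t. (V t - M / \<alpha>) * exp (\<alpha> * (t - a)))
     (\<lambda>t. (V t - M / \<alpha>) * (\<alpha> * exp (\<alpha> * (t - a))) + (dV t - 0) * exp (\<alpha> * (t - a)))"
    by (rule sol_mult[OF sol_diff[OF V sol_const] sol_exp])
  have "(V b - M / \<alpha>) * exp (\<alpha> * (b - a)) \<le> (V a - M / \<alpha>) * exp (\<alpha> * (a - a))"
  proof (rule sol_decreasing[OF d ab])
    fix t assume t: "t \<in> {a..b} - S"
    have "(V t - M / \<alpha>) * (\<alpha> * exp (\<alpha> * (t - a))) + (dV t - 0) * exp (\<alpha> * (t - a))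
       = (\<alpha> * V t - M + dV t) * exp (\<alpha> * (t - a))" using al by (simp add: field_simps)
    also have "\<dots> \<le> 0" using le[OF t] by (intro mult_nonpos_nonneg) auto
    finally show "(V t - M / \<alpha>) * (\<alpha> * exp (\<alpha> * (t - a))) + (dV t - 0) * exp (\<alpha> * (t - a)) \<le> 0" .
  qed
  then have "(V b - M / \<alpha>) * exp (\<alpha> * (b - a)) * exp (- \<alpha> * (b - a)) \<le> (V a - M / \<alpha>) * exp (- \<alpha> * (b - a))"
    by (intro mult_right_mono) auto
  moreover have "exp (\<alpha> * (b - a)) * exp (- \<alpha> * (b - a)) = 1" by (simp flip: exp_add)
  ultimately have "V b - M / \<alpha> \<le> (V a - M / \<alpha>) * exp (- \<alpha> * (b - a))"
    by (metis mult.assoc mult.right_neutral)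
  then show ?thesis by linarith
qed

lemma sol_decay_bound:
  assumes V: "sol V dV" and ab: "0 \<le> a" "a \<le> b" "b \<in> I" and al: "\<alpha> > 0" and M: "(M::real) \<ge> 0" and Va: "V a \<ge> 0"
    and le: "\<And>t. t \<in> {a..b} - S \<Longrightarrow> dV t \<le> - \<alpha> * V t + M"
  shows "V b \<le> V a + M / \<alpha>"
proof -
  have e: "exp (- \<alpha> * (b - a)) \<le> 1" using al ab by simp
  have "(V a - M / \<alpha>) * exp (- \<alpha> * (b - a)) \<le> V a * exp (- \<alpha> * (b - a))"
    using al M by (intro mult_right_mono) auto
  also have "\<dots> \<le> V a" using e Va by (simp add: mult_left_le)
  finally show ?thesis using sol_decay[OF V ab al le] by fastforce
qed

definition J :: "(real \<Rightarrow> real) \<Rightarrow> real \<Rightarrow> real" where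
  "J w t = integral {0..t} w"

lemma sol_J:
  assumes "continuous_on I w" shows "sol (J w) w"
proof -
  have d: "(J w has_vector_derivative w t) (at t within I)" if t: "t \<in> I" for t
  \<comment> \<open>Either \<open>I\<close> continues to the right of \<open>t\<close> and the
    derivative is localized to \<open>{..<b}\<close>, or \<open>t\<close> is the last point of
    \<open>I\<close> and \<open>I\<close> lies in \<open>{0..t}\<close>.\<close>
  proof (cases "\<exists>b\<in>I. t < b")
    case True
    then obtain b where b: "b \<in> I" "t < b" by auto
    have "(J w has_vector_derivative w t) (at t within {0..b})"
      unfolding J_def using t b time_nonneg sub_I[of b 0] assms
      by (intro integral_has_vector_derivative) (auto intro: continuous_on_subset)
    then have "(J w has_vector_derivative w t) (at t within I \<inter> {..<b})"
      by (rule has_vector_derivative_within_subset) (use time_nonneg in auto)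
    moreover have "at t within I \<inter> {..<b} = at t within I"
      using b by (intro at_within_nhd[of t "{..<b}"]) auto
    ultimately show ?thesis by simp
  next
    case False
    then have "I \<subseteq> {0..t}" using time_nonneg by force
    moreover have "(J w has_vector_derivative w t) (at t within {0..t})"
      unfolding J_def using t time_nonneg sub_I[of t 0] assms
      by (intro integral_has_vector_derivative) (auto intro: continuous_on_subset)
    ultimately show ?thesis by (rule has_vector_derivative_within_subset[rotated])
  qed
  then show ?thesis unfolding sol_def
    by (auto simp: continuous_on_eq_continuous_within intro: has_vector_derivative_continuous)
qed

lemma J_0 [simp]: "J w 0 = 0"
  by (simp add: J_def)

lemma J_nonneg: "t \<in> I \<Longrightarrow> (\<And>s. s \<in> {0..t} \<Longrightarrow> 0 \<le> w s) \<Longrightarrow> 0 \<le> J w t"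
  unfolding J_def by (cases "w integrable_on {0..t}") (auto intro: integral_nonneg simp: not_integrable_integral)

lemma J_mono:
  assumes w: "continuous_on I w" "\<And>s. s \<in> I \<Longrightarrow> 0 \<le> w s" and st: "0 \<le> s" "s \<le> t" "t \<in> I"
  shows "J w s \<le> J w t"
  using sol_decreasing[OF sol_minus[OF sol_J[OF w(1)]] st] w(2) sub_I[OF st(3,1)] by fastforce

lemma compact_bounded:
  assumes "continuous_on I w" "t \<in> I" shows "\<exists>B. \<forall>s\<in>{0..t}. \<bar>w s :: real\<bar> \<le> B"
proof -
  have "bounded (w ` {0..t})"
    using assms sub_I[of t 0] by (intro compact_imp_bounded compact_continuous_image) (auto intro: continuous_on_subset)
  then show ?thesis by (auto simp: bounded_iff)
qed

section \<open>Linear differential relations with polynomial coefficients\<close>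

text \<open>The signal multiplying \<open>D^j\<close> when \<open>\<Sum> p(D) z\<close> is ordered
  by powers of \<open>D\<close>.\<close>

definition lc :: "(real poly \<times> (real \<Rightarrow> real)) list \<Rightarrow> nat \<Rightarrow> real \<Rightarrow> real" where
  "lc xs j t = (\<Sum>(p, z)\<leftarrow>xs. coeff p j * z t)"

lemma lc_simps [simp]:
  "lc [] j t = 0" "lc ((p, z) # xs) j t = coeff p j * z t + lc xs j t"
  "lc (xs @ ys) j t = lc xs j t + lc ys j t"
  by (auto simp: lc_def)

text \<open>
  \<open>rel xs N\<close> states \<open>\<Sum> p(D) z = 0\<close>, the sum being over the pairs \<open>(p, z)\<close> in \<open>xs\<close>, for arbitrary initial
  conditions: integrated \<open>N\<close> times it holds up to a polynomial in \<open>t\<close> of degree below \<open>N\<close>. The chain \<open>X\<close> is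
  Horner's scheme for the integrated form; thus the \<open>z\<close> themselves need not be differentiable.
\<close>

definition rel :: "(real poly \<times> (real \<Rightarrow> real)) list \<Rightarrow> nat \<Rightarrow> bool" where
  "rel xs N \<longleftrightarrow> (\<forall>(p, z)\<in>set xs. degree p \<le> N) \<and>
     (\<exists>X. (\<forall>t\<in>I. lc xs N t + X 0 t = 0) \<and>
          (\<forall>k<N. sol (X k) (\<lambda>t. lc xs (N - Suc k) t + X (Suc k) t)) \<and> (\<forall>t\<in>I. X N t = 0))"

text \<open>A relation sees its list only through the coefficient signals \<open>lc\<close>. Signals
  may thus be merged, split or cancelled by comparing coefficients, which is how the block diagram
  identities below are verified.\<close>

lemma rel_cong:
  assumes "rel xs N" "\<And>p z. (p, z) \<in> set ys \<Longrightarrow> degree p \<le> N"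
    and eq: "\<And>j t. j \<le> N \<Longrightarrow> t \<in> I \<Longrightarrow> lc ys j t = lc xs j t"
  shows "rel ys N"
proof -
  obtain X where X: "\<forall>t\<in>I. lc xs N t + X 0 t = 0" "\<forall>k<N. sol (X k) (\<lambda>t. lc xs (N - Suc k) t + X (Suc k) t)"
    "\<forall>t\<in>I. X N t = 0" using assms(1) by (auto simp: rel_def)
  have "\<forall>k<N. sol (X k) (\<lambda>t. lc ys (N - Suc k) t + X (Suc k) t)"
    using X(2) by (auto intro: sol_cong simp: eq)
  then show ?thesis using X assms(2) by (auto simp: rel_def eq)
qed

lemma rel_append:
  assumes "rel xs N" "rel ys N" shows "rel (xs @ ys) N"
proof -
  obtain X where X: "\<forall>t\<in>I. lc xs N t + X 0 t = 0" "\<forall>k<N. sol (X k) (\<lambda>t. lc xs (N - Suc k) t + X (Suc k) t)"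
    "\<forall>t\<in>I. X N t = 0" using assms(1) by (auto simp: rel_def)
  obtain Y where Y: "\<forall>t\<in>I. lc ys N t + Y 0 t = 0" "\<forall>k<N. sol (Y k) (\<lambda>t. lc ys (N - Suc k) t + Y (Suc k) t)"
    "\<forall>t\<in>I. Y N t = 0" using assms(2) by (auto simp: rel_def)
  show ?thesis unfolding rel_def
  proof (intro conjI exI[of _ "\<lambda>k t. X k t + Y k t"] allI impI ballI)
    fix k assume k: "k < N"
    show "sol (\<lambda>t. X k t + Y k t) (\<lambda>t. lc (xs @ ys) (N - Suc k) t + (X (Suc k) t + Y (Suc k) t))"
      by (rule sol_cong[OF sol_add[OF X(2)[rule_format, OF k] Y(2)[rule_format, OF k]]]) auto
  next
    fix t assume t: "t \<in> I"
    show "lc (xs @ ys) N t + (X 0 t + Y 0 t) = 0" using X(1) Y(1) t by fastforce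
    show "X N t + Y N t = 0" using X(3) Y(3) t by simp
  qed (use assms in \<open>auto simp: rel_def\<close>)
qed

abbreviation pmul :: "real poly \<Rightarrow> (real poly \<times> (real \<Rightarrow> real)) list \<Rightarrow> (real poly \<times> (real \<Rightarrow> real)) list" where
  "pmul q xs \<equiv> map (\<lambda>(p, z). (q * p, z)) xs"

lemma lc_const_mult: "lc (pmul [:c:] xs) j t = c * lc xs j t"
  by (induction xs) (auto simp: algebra_simps)

lemma lc_shift: "lc (pmul [:0, 1:] xs) j t = (case j of 0 \<Rightarrow> 0 | Suc i \<Rightarrow> lc xs i t)"
  by (induction xs) (auto split: nat.splits simp: coeff_pCons)

lemma rel_const_mult:
  assumes "rel xs N" shows "rel (pmul [:c:] xs) N"
proof -
  obtain X where X: "\<forall>t\<in>I. lc xs N t + X 0 t = 0" "\<forall>k<N. sol (X k) (\<lambda>t. lc xs (N - Suc k) t + X (Suc k) t)"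
    "\<forall>t\<in>I. X N t = 0" using assms(1) by (auto simp: rel_def)
  show ?thesis unfolding rel_def
  proof (intro conjI exI[of _ "\<lambda>k t. c * X k t"] allI impI ballI)
    fix k assume k: "k < N"
    show "sol (\<lambda>t. c * X k t) (\<lambda>t. lc (pmul [:c:] xs) (N - Suc k) t + c * X (Suc k) t)"
      by (rule sol_cong[OF sol_cmult[OF X(2)[rule_format, OF k], of c]]) (simp_all only: lc_const_mult distrib_left)
  next
    fix t assume t: "t \<in> I"
    have "lc (pmul [:c:] xs) N t + c * X 0 t = c * (lc xs N t + X 0 t)"
      by (simp only: lc_const_mult distrib_left)
    then show "lc (pmul [:c:] xs) N t + c * X 0 t = 0" using X(1) t by simp
    show "c * X N t = 0" using X(3) t by simp
  next
    fix w assume "w \<in> set (pmul [:c:] xs)"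
    then show "case w of (p, z) \<Rightarrow> degree p \<le> N"
      using assms by (fastforce simp: rel_def intro: order_trans[OF degree_smult_le])
  qed
qed

text \<open>The chain gets a new head equal to 0, because the coefficient of degree
  \<open>Suc N\<close> vanishes. Relations of different orders are brought to a common order in this
  way.\<close>

lemma rel_lift:
  assumes "rel xs N" shows "rel xs (Suc N)"
proof -
  obtain X where X: "\<forall>t\<in>I. lc xs N t + X 0 t = 0" "\<forall>k<N. sol (X k) (\<lambda>t. lc xs (N - Suc k) t + X (Suc k) t)"
    "\<forall>t\<in>I. X N t = 0" using assms(1) by (auto simp: rel_def)
  have d: "(p, z) \<in> set xs \<Longrightarrow> degree p \<le> N" for p z using assms by (auto simp: rel_def)
  have z: "lc xs (Suc N) t = 0" for t using d
    by (induction xs) (fastforce simp: coeff_eq_0)+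
  show ?thesis unfolding rel_def
  proof (intro conjI exI[of _ "\<lambda>k. case k of 0 \<Rightarrow> (\<lambda>t. 0) | Suc j \<Rightarrow> X j"] allI impI ballI)
    fix k assume k: "k < Suc N"
    show "sol (case k of 0 \<Rightarrow> (\<lambda>t. 0) | Suc j \<Rightarrow> X j)
           (\<lambda>t. lc xs (Suc N - Suc k) t + (case Suc k of 0 \<Rightarrow> (\<lambda>t. 0) | Suc j \<Rightarrow> X j) t)"
    proof (cases k)
      case 0
      then show ?thesis using X(1) by (auto intro: sol_cong[OF sol_const])
    next
      case (Suc j)
      then show ?thesis using X(2) k by auto
    qed
  qed (use X d z in \<open>auto simp: le_SucI split: prod.split\<close>)
qed

lemma rel_lift_le: "rel xs N \<Longrightarrow> N \<le> M \<Longrightarrow> rel xs M"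
  by (induction M) (auto simp: le_Suc_eq intro: rel_lift)

text \<open>Differentiating a relation keeps its chain and prolongs it by a zero stage, as the
  shifted list has constant coefficient 0.\<close>

lemma rel_shift:
  assumes "rel xs N" shows "rel (pmul [:0, 1:] xs) (Suc N)"
proof -
  obtain X where X: "\<forall>t\<in>I. lc xs N t + X 0 t = 0" "\<forall>k<N. sol (X k) (\<lambda>t. lc xs (N - Suc k) t + X (Suc k) t)"
    "\<forall>t\<in>I. X N t = 0" using assms(1) by (auto simp: rel_def)
  show ?thesis unfolding rel_def
  proof (intro conjI exI[of _ "\<lambda>k. if k = Suc N then (\<lambda>t. 0) else X k"] allI impI ballI)
    fix k assume k: "k < Suc N"
    show "sol (if k = Suc N then \<lambda>t. 0 else X k)
           (\<lambda>t. lc (pmul [:0, 1:] xs) (Suc N - Suc k) t + (if Suc k = Suc N then \<lambda>t. 0 else X (Suc k)) t)"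
    proof (cases "k = N")
      case True
      then show ?thesis using X(3) unfolding lc_shift by (auto intro: sol_cong[OF sol_const])
    next
      case False
      then have "Suc N - Suc k = Suc (N - Suc k)" using k by simp
      then show ?thesis using X(2) k False unfolding lc_shift by auto
    qed
  next
    fix t assume "t \<in> I"
    then show "lc (pmul [:0, 1:] xs) (Suc N) t + (if 0 = Suc N then \<lambda>t. 0 else X 0) t = 0"
      using X(1) unfolding lc_shift by simp
  next
    fix w assume "w \<in> set (pmul [:0, 1:] xs)"
    then show "case w of (p, z) \<Rightarrow> degree p \<le> Suc N" using assms by (fastforce simp: rel_def degree_pCons_eq_if)
  qed auto
qed

text \<open>Horner induction on \<open>q\<close>. Multiplying by a polynomial is always sound;
  dropping a factor loses information about initial conditions and needs the stability estimates
  that follow.\<close>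

lemma rel_mult:
  assumes "rel xs N" "degree q \<le> M" shows "rel (pmul q xs) (M + N)"
  using assms(2)
proof (induction q arbitrary: M)
  case 0
  show ?case using rel_lift_le[OF rel_const_mult[OF assms(1), of 0], of "M + N"] by simp
next
  case (pCons a q)
  have 1: "rel (pmul [:a:] xs) (M + N)" by (rule rel_lift_le[OF rel_const_mult[OF assms(1)]]) simp
  have d: "\<And>p z. (p, z) \<in> set xs \<Longrightarrow> degree p \<le> N" using assms by (auto simp: rel_def)
  have lc: "lc (pmul (pCons a q) xs) j t = lc (pmul [:a:] xs) j t + lc (pmul [:0, 1:] (pmul q xs)) j t" for j t
    by (induction xs) (auto simp: algebra_simps)
  have deg: "degree p \<le> M + N" if pz: "(p, z) \<in> set (pmul (pCons a q) xs)" for p z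
  proof -
    obtain p' where "p = pCons a q * p'" "(p', z) \<in> set xs" using pz by (auto simp del: mult_pCons_left)
    then show ?thesis using d pCons.prems by (metis add_mono degree_mult_le order_trans)
  qed
  show ?case
  proof (cases "q = 0")
    case True
    then show ?thesis using 1 by simp
  next
    case False
    then obtain M' where M': "M = Suc M'" "degree q \<le> M'" using pCons.prems by (cases M) auto
    have 2: "rel (pmul [:0, 1:] (pmul q xs)) (M + N)" using rel_shift[OF pCons.IH[OF M'(2)]] M' by simp
    show ?thesis
      by (rule rel_cong[OF rel_append[OF 1 2] deg]) (simp_all only: lc lc_simps)
  qed
qed

end

section \<open>Stability\<close>

context time_domain
begin

lemma cmod_add_square_le: "(cmod (x + y))\<^sup>2 \<le> 2 * (cmod x)\<^sup>2 + 2 * (cmod y)\<^sup>2"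
proof -
  have "(cmod (x + y))\<^sup>2 \<le> (cmod x + cmod y)\<^sup>2" by (intro power_mono norm_triangle_ineq) auto
  also have "\<dots> \<le> 2 * (cmod x)\<^sup>2 + 2 * (cmod y)\<^sup>2"
    using sum_squares_bound[of "cmod x" "cmod y"] by (simp add: power2_sum)
  finally show ?thesis .
qed

lemma young_complex:
  assumes "\<delta> > 0"
  shows "2 * Re (cnj z * w) \<le> \<delta> * (cmod z)\<^sup>2 + (1 / \<delta>) * (cmod w)\<^sup>2"
proof -
  have "Re (cnj z * w) \<le> cmod z * cmod w" using complex_Re_le_cmod[of "cnj z * w"] by (simp add: norm_mult)
  moreover have "0 \<le> (\<delta> * cmod z - cmod w)\<^sup>2 / \<delta>" using assms by simp
  moreover have "(\<delta> * cmod z - cmod w)\<^sup>2 / \<delta> = \<delta> * (cmod z)\<^sup>2 + (1 / \<delta>) * (cmod w)\<^sup>2 - 2 * (cmod z * cmod w)"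
    using assms by (simp add: power2_diff power_mult_distrib diff_divide_distrib add_divide_distrib) (simp add: power2_eq_square)
  ultimately show ?thesis by linarith
qed

text \<open>Strict bounds on finitely many roots leave room for a better rate \<open>a'\<close>; the
  gap \<open>a' - a\<close> later pays for coupling terms.\<close>

lemma finite_strict_margin:
  assumes "finite A" "\<forall>x\<in>A. x < - (a::real)" shows "\<exists>a'>a. \<forall>x\<in>A. x < - a'"
proof (cases "A = {}")
  case False
  define M where "M = Max A"
  have "M < - a" "\<forall>x\<in>A. x \<le> M" using assms False by (auto simp: M_def)
  then show ?thesis by (intro exI[of _ "(a - M) / 2"] conjI ballI) (simp, force simp: field_simps)
qed (auto intro: exI[of _ "a + 1"])

text \<open>
  Deflation: with \<open>p = (s - \<mu>) p\<^sub>2\<close>, the combinations \<open>Z (k + 1) - c Z 0\<close>, \<open>c\<close> the coefficients of \<open>s p\<^sub>2\<close>, form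
  the chain of \<open>p\<^sub>2\<close>, and \<open>Z 0\<close> is a first order lag, with pole \<open>\<mu>\<close>, of the head of that chain.
\<close>

lemma chain_stable:
  fixes rs :: "complex list"
  assumes "\<forall>\<mu>\<in>set rs. 2 * Re \<mu> < - a"
    and "\<And>k. k < length rs \<Longrightarrow>
      sol (Z k) (\<lambda>t. - coeff (\<Prod>\<mu>\<leftarrow>rs. [:-\<mu>, 1:]) (length rs - Suc k) * Z 0 t + W k t + Z (Suc k) t)"
    and "\<forall>t\<in>I. Z (length rs) t = 0"
  shows "\<exists>V dV K. K \<ge> 0 \<and> sol V dV \<and>
      (\<forall>t\<in>I. (cmod (Z 0 t))\<^sup>2 \<le> V t \<and> (0 < length rs \<longrightarrow> (cmod (Z 1 t))\<^sup>2 \<le> K * V t)) \<and>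
      (\<forall>t\<in>I - S. dV t \<le> - a * V t + K * (\<Sum>k<length rs. (cmod (W k t))\<^sup>2))"
  using assms
proof (induction rs arbitrary: Z W a)
  case Nil
  then show ?case by (intro exI[of _ "\<lambda>t. 0"] exI[of _ 0]) (auto intro: sol_const)
next
  case (Cons \<mu> rs)
  define M where "M = length rs"
  define p2 where "p2 = (\<Prod>\<mu>\<leftarrow>rs. [:-\<mu>, 1:])"
  define q where "q = pCons 0 p2"
  have p2M: "coeff p2 M = 1"
  proof -
    have "monic p2" unfolding p2_def by (rule monic_prod_list) auto
    then show ?thesis by (simp add: p2_def M_def degree_linear_factors)
  qed
  have pc: "coeff (\<Prod>\<mu>\<leftarrow>\<mu> # rs. [:-\<mu>, 1:]) j = coeff q j - \<mu> * coeff p2 j" for j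
    by (simp add: q_def p2_def)
  have qS: "coeff q (Suc j) = coeff p2 j" "coeff q 0 = 0" for j by (auto simp: q_def)
  obtain a' where a': "a' > a" "\<forall>\<nu>\<in>set (\<mu> # rs). 2 * Re \<nu> < - a'"
    using finite_strict_margin[of "(\<lambda>\<nu>. 2 * Re \<nu>) ` set (\<mu> # rs)" a] Cons.prems(1) by auto
  define Zt where "Zt k t = Z (Suc k) t - coeff q (M - k) * Z 0 t" for k t
  define Wt where "Wt k t = W (Suc k) t - coeff q (M - k) * W 0 t" for k t
  have Z0: "sol (Z 0) (\<lambda>t. \<mu> * Z 0 t + (W 0 t + Zt 0 t))"
  proof -
    have "coeff q M - \<mu> * coeff p2 M = coeff q M - \<mu>" using p2M by simp
    then show ?thesis using Cons.prems(2)[of 0] unfolding pc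
      by (auto simp: Zt_def M_def algebra_simps elim!: sol_cong)
  qed
  have Zt: "sol (Zt k) (\<lambda>t. - coeff p2 (M - Suc k) * Zt 0 t + Wt k t + Zt (Suc k) t)" if k: "k < M" for k
  proof -
    have k': "M - k = Suc (M - Suc k)" using k by simp
    have "sol (\<lambda>t. Z (Suc k) t - coeff q (M - k) * Z 0 t)
      (\<lambda>t. (- (coeff q (M - Suc k) - \<mu> * coeff p2 (M - Suc k)) * Z 0 t + W (Suc k) t + Z (Suc (Suc k)) t)
          - coeff q (M - k) * (\<mu> * Z 0 t + (W 0 t + Zt 0 t)))"
      using Cons.prems(2)[of "Suc k"] k unfolding pc by (intro sol_diff sol_cmult Z0) (auto simp: M_def)
    then show ?thesis
      by (rule sol_cong) (auto simp: Zt_def Wt_def k' qS algebra_simps)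
  qed
  have ZtM: "\<forall>t\<in>I. Zt M t = 0" using Cons.prems(3) by (auto simp: Zt_def M_def qS)
  obtain V dV K where V: "K \<ge> 0" "sol V dV" "\<And>t. t \<in> I \<Longrightarrow> (cmod (Zt 0 t))\<^sup>2 \<le> V t"
      "\<And>t. t \<in> I - S \<Longrightarrow> dV t \<le> - a' * V t + K * (\<Sum>k<M. (cmod (Wt k t))\<^sup>2)"
    using Cons.IH[of a' Zt Wt] a' Zt ZtM unfolding M_def p2_def by auto
  \<comment> \<open>\<open>\<delta>\<close> is the surplus damping of the first order lag with pole
    \<open>\<mu>\<close>. The weight \<open>b\<close> makes the coupling term
    \<open>(2 / \<delta>) V\<close> from Young's inequality equal to \<open>(a' - a) b V\<close>,
    the damping that the shorter chain has to spare.\<close>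
  define \<delta> where "\<delta> = - a' - 2 * Re \<mu>"
  define b where "b = 2 / (\<delta> * (a' - a))"
  have pos: "\<delta> > 0" "a' - a > 0" "b > 0" using a' by (auto simp: \<delta>_def b_def)
  define Q where "Q = (\<Sum>k<M. 2 * (cmod (coeff q (M - k)))\<^sup>2)"
  define q0 where "q0 = 2 * (cmod (coeff q M))\<^sup>2"
  define K' where "K' = b * K * (2 + Q) + 2 / \<delta> + 2 / b + q0"
  have nn: "Q \<ge> 0" "q0 \<ge> 0" by (auto simp: Q_def q0_def intro: sum_nonneg)
  define U where "U t = b * V t + (cmod (Z 0 t))\<^sup>2" for t
  define dU where "dU t = b * dV t + 2 * Re (cnj (Z 0 t) * (\<mu> * Z 0 t + (W 0 t + Zt 0 t)))" for t
  have V0: "0 \<le> V t" if "t \<in> I" for t using V(3)[OF that] by (meson order_trans zero_le_power2)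
  have "sol U dU" unfolding U_def dU_def by (intro sol_add sol_cmult V sol_cmod_square Z0)
  moreover have "K' \<ge> 0" using V(1) pos nn by (auto simp: K'_def intro!: add_nonneg_nonneg)
  \<comment> \<open>The second stage \<open>Z 1\<close> is bounded as well because it appears in the
    derivative of the output in \<open>rel_stable\<close>.\<close>
  moreover have "(cmod (Z 0 t))\<^sup>2 \<le> U t \<and> (0 < length (\<mu> # rs) \<longrightarrow> (cmod (Z 1 t))\<^sup>2 \<le> K' * U t)" if t: "t \<in> I" for t
  proof -
    have U1: "(cmod (Z 0 t))\<^sup>2 \<le> U t" "b * V t \<le> U t" using V0[OF t] pos by (auto simp: U_def)
    have "Z 1 t = Zt 0 t + coeff q M * Z 0 t" by (simp add: Zt_def)
    then have "(cmod (Z 1 t))\<^sup>2 \<le> 2 * (cmod (Zt 0 t))\<^sup>2 + 2 * (cmod (coeff q M * Z 0 t))\<^sup>2"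
      by (simp add: cmod_add_square_le)
    also have "\<dots> \<le> 2 * V t + q0 * (cmod (Z 0 t))\<^sup>2" using V(3)[OF t] by (simp add: q0_def norm_mult power_mult_distrib)
    also have "\<dots> \<le> 2 / b * U t + q0 * U t"
    proof (intro add_mono mult_left_mono U1 nn)
      show "2 * V t \<le> 2 / b * U t" using U1(2) pos by (simp add: field_simps)
    qed
    also have "\<dots> \<le> K' * U t"
      using U1 V(1) pos nn order_trans[OF zero_le_power2 U1(1)]
      by (simp add: K'_def distrib_right)
    finally show ?thesis using U1 by simp
  qed
  moreover have "dU t \<le> - a * U t + K' * (\<Sum>k<length (\<mu> # rs). (cmod (W k t))\<^sup>2)" if t: "t \<in> I - S" for t
  proof -
    define SW where "SW = (\<Sum>k<length (\<mu> # rs). (cmod (W k t))\<^sup>2)"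
    have SW: "SW = (cmod (W 0 t))\<^sup>2 + (\<Sum>k<M. (cmod (W (Suc k) t))\<^sup>2)"
      unfolding SW_def M_def by (simp only: list.size add_Suc_right add_0_right sum.lessThan_Suc_shift)
    have sw: "(cmod (W 0 t))\<^sup>2 \<le> SW" "(\<Sum>k<M. (cmod (W (Suc k) t))\<^sup>2) \<le> SW" "0 \<le> SW"
      by (simp_all add: SW sum_nonneg)
    have "(\<Sum>k<M. (cmod (Wt k t))\<^sup>2) \<le> (\<Sum>k<M. 2 * (cmod (W (Suc k) t))\<^sup>2 + 2 * (cmod (coeff q (M - k)))\<^sup>2 * (cmod (W 0 t))\<^sup>2)"
    proof (rule sum_mono)
      fix k
      show "(cmod (Wt k t))\<^sup>2 \<le> 2 * (cmod (W (Suc k) t))\<^sup>2 + 2 * (cmod (coeff q (M - k)))\<^sup>2 * (cmod (W 0 t))\<^sup>2"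
        using cmod_add_square_le[of "W (Suc k) t" "- (coeff q (M - k) * W 0 t)"]
        by (simp add: Wt_def norm_mult power_mult_distrib)
    qed
    also have "\<dots> = 2 * (\<Sum>k<M. (cmod (W (Suc k) t))\<^sup>2) + Q * (cmod (W 0 t))\<^sup>2"
      by (simp add: sum.distrib Q_def sum_distrib_left sum_distrib_right)
    also have "\<dots> \<le> 2 * SW + Q * SW" using sw nn by (intro add_mono mult_left_mono) auto
    finally have Wt: "(\<Sum>k<M. (cmod (Wt k t))\<^sup>2) \<le> (2 + Q) * SW" by (simp add: algebra_simps)
    have "b * dV t \<le> b * (- a' * V t + K * ((2 + Q) * SW))"
      using V(4)[OF t] Wt V(1) pos by (intro mult_left_mono order_trans[OF V(4)[OF t]] add_left_mono) auto
    then have 1: "b * dV t \<le> - a' * (b * V t) + b * K * (2 + Q) * SW" by (simp add: algebra_simps)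
    have "2 * Re (cnj (Z 0 t) * (\<mu> * Z 0 t)) = 2 * Re \<mu> * (cmod (Z 0 t))\<^sup>2"
      unfolding cmod_power2 by (simp add: algebra_simps power2_eq_square)
    moreover have "2 * Re (cnj (Z 0 t) * (W 0 t + Zt 0 t)) \<le> \<delta> * (cmod (Z 0 t))\<^sup>2 + (1 / \<delta>) * (cmod (W 0 t + Zt 0 t))\<^sup>2"
      by (rule young_complex[OF pos(1)])
    moreover have "(1 / \<delta>) * (cmod (W 0 t + Zt 0 t))\<^sup>2 \<le> (1 / \<delta>) * (2 * SW + 2 * V t)"
      using sw V(3)[of t] t pos cmod_add_square_le[of "W 0 t" "Zt 0 t"] by (intro mult_left_mono) auto
    moreover have "(1 / \<delta>) * (2 * SW + 2 * V t) = 2 / \<delta> * SW + (a' - a) * (b * V t)"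
      using pos by (simp add: b_def field_simps)
    ultimately have 2: "2 * Re (cnj (Z 0 t) * (\<mu> * Z 0 t + (W 0 t + Zt 0 t))) \<le>
        - a' * (cmod (Z 0 t))\<^sup>2 + 2 / \<delta> * SW + (a' - a) * (b * V t)"
      by (simp add: \<delta>_def distrib_left) (simp add: algebra_simps)
    have 3: "a * (cmod (Z 0 t))\<^sup>2 \<le> a' * (cmod (Z 0 t))\<^sup>2" using a' by (intro mult_right_mono) auto
    have 4: "b * K * (2 + Q) * SW + 2 / \<delta> * SW \<le> K' * SW"
      unfolding K'_def distrib_right using pos nn sw by simp
    show ?thesis using 1 2 3 4 unfolding dU_def U_def SW_def[symmetric] by (simp add: algebra_simps)
  qed
  ultimately show ?case by blast
qed

abbreviation ssq :: "(real poly \<times> (real \<Rightarrow> real)) list \<Rightarrow> real \<Rightarrow> real" where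
  "ssq xs t \<equiv> (\<Sum>(q, w)\<leftarrow>xs. (w t)\<^sup>2)"

lemma sq_nonneg: "0 \<le> ssq xs t"
  by (rule sum_list_nonneg) auto

lemma real_square_add_le: "(x + y)\<^sup>2 \<le> 2 * x\<^sup>2 + 2 * (y::real)\<^sup>2"
  using sum_squares_bound[of x y] by (simp add: power2_sum)

lemma lc_square_bound: "\<exists>C\<ge>0. \<forall>t. (\<Sum>k<N. (lc xs k t)\<^sup>2) \<le> C * ssq xs t"
proof (induction xs)
  case Nil
  then show ?case by (auto intro: exI[of _ 0])
next
  case (Cons x xs)
  obtain q w where x: "x = (q, w)" by (cases x)
  obtain C where C: "C \<ge> 0" "\<And>t. (\<Sum>k<N. (lc xs k t)\<^sup>2) \<le> C * ssq xs t" using Cons by auto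
  define D where "D = (\<Sum>k<N. (coeff q k)\<^sup>2)"
  have D: "D \<ge> 0" by (auto simp: D_def intro: sum_nonneg)
  have "(\<Sum>k<N. (lc (x # xs) k t)\<^sup>2) \<le> (2 * D + 2 * C) * ssq (x # xs) t" for t
  proof -
    have "(\<Sum>k<N. (lc (x # xs) k t)\<^sup>2) \<le> (\<Sum>k<N. 2 * ((coeff q k)\<^sup>2 * (w t)\<^sup>2) + 2 * (lc xs k t)\<^sup>2)"
      unfolding x using real_square_add_le
      by (intro sum_mono) (metis lc_simps(2) mult.assoc power_mult_distrib)
    also have "\<dots> = 2 * D * (w t)\<^sup>2 + 2 * (\<Sum>k<N. (lc xs k t)\<^sup>2)"
      by (simp add: sum.distrib D_def sum_distrib_left sum_distrib_right mult.assoc)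
    also have "\<dots> \<le> 2 * D * (w t)\<^sup>2 + 2 * (C * ssq xs t)" using C(2)[of t] by simp
    also have "\<dots> \<le> 2 * D * ssq (x # xs) t + 2 * C * ssq (x # xs) t"
      unfolding x using D C sq_nonneg[of t xs] by (simp add: distrib_left)
    finally show ?thesis by (simp add: algebra_simps)
  qed
  then show ?case using C D by (intro exI[of _ "2 * D + 2 * C"]) auto
qed

text \<open>Over the complex numbers \<open>p\<close> splits into linear factors, and the integrated
  relation becomes a chain as in \<open>chain_stable\<close>. Strict properness,
  \<open>coeff q N = 0\<close>, makes \<open>z\<close> the negative of the head of the integrated
  chain, hence differentiable, and the next stage bounds its derivative. The factor 2 in the root
  condition appears because \<open>V\<close> is quadratic in \<open>z\<close>.\<close>

lemma rel_stable:
  assumes r: "rel ((p, z) # xs) N" and p: "monic p" "degree p = N"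
    and roots: "\<forall>s. poly (map_poly complex_of_real p) s = 0 \<longrightarrow> 2 * Re s < - a"
    and xs: "\<forall>(q, w)\<in>set xs. coeff q N = 0"
  shows "\<exists>K V dV dz. K \<ge> 0 \<and> sol V dV \<and> (\<forall>t\<in>I. (z t)\<^sup>2 \<le> V t) \<and>
    (\<forall>t\<in>I - S. dV t \<le> - a * V t + K * ssq xs t) \<and>
    sol z dz \<and> (\<forall>t\<in>I - S. (dz t)\<^sup>2 \<le> K * (V t + ssq xs t))"
proof -
  define pc where "pc = map_poly complex_of_real p"
  have pcN: "degree pc = N" "coeff pc k = complex_of_real (coeff p k)" for k
    using p by (auto simp: pc_def degree_map_poly coeff_map_poly)
  obtain rs where rs: "smult (coeff pc (degree pc)) (\<Prod>\<mu>\<leftarrow>rs. [:-\<mu>, 1:]) = pc" "length rs = N"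
    using fundamental_theorem_algebra_factorized[of pc] pcN by auto
  then have prs: "(\<Prod>\<mu>\<leftarrow>rs. [:-\<mu>, 1:]) = pc" using p pcN by simp
  have rt: "\<forall>\<mu>\<in>set rs. 2 * Re \<mu> < - a"
  proof
    fix \<mu> assume "\<mu> \<in> set rs"
    then have "poly pc \<mu> = 0" unfolding prs[symmetric] by (induction rs) auto
    then show "2 * Re \<mu> < - a" using roots by (simp add: pc_def)
  qed
  obtain X where X: "\<And>t. t \<in> I \<Longrightarrow> lc ((p, z) # xs) N t + X 0 t = 0"
    "\<And>k. k < N \<Longrightarrow> sol (X k) (\<lambda>t. lc ((p, z) # xs) (N - Suc k) t + X (Suc k) t)"
    "\<And>t. t \<in> I \<Longrightarrow> X N t = 0" using r unfolding rel_def by blast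
  have "lc xs N t = 0" for t using xs by (induction xs) fastforce+
  then have zX: "z t = - X 0 t" if "t \<in> I" for t using X(1)[OF that] p by simp
  define Z where "Z k t = complex_of_real (- X k t)" for k t
  define W where "W k t = complex_of_real (- lc xs (N - Suc k) t)" for k t
  have "\<exists>V dV K. K \<ge> 0 \<and> sol V dV \<and>
      (\<forall>t\<in>I. (cmod (Z 0 t))\<^sup>2 \<le> V t \<and> (0 < length rs \<longrightarrow> (cmod (Z 1 t))\<^sup>2 \<le> K * V t)) \<and>
      (\<forall>t\<in>I - S. dV t \<le> - a * V t + K * (\<Sum>k<length rs. (cmod (W k t))\<^sup>2))"
  proof (rule chain_stable[OF rt])
    fix k assume k: "k < length rs"
    have "sol (\<lambda>t. complex_of_real (- X k t)) (\<lambda>t. complex_of_real (- (lc ((p, z) # xs) (N - Suc k) t + X (Suc k) t)))"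
      using X(2)[of k] k rs by (intro sol_of_real sol_minus) auto
    then show "sol (Z k) (\<lambda>t. - coeff (\<Prod>\<mu>\<leftarrow>rs. [:-\<mu>, 1:]) (length rs - Suc k) * Z 0 t + W k t + Z (Suc k) t)"
      unfolding prs rs(2)
      by (rule sol_cong) (auto simp: Z_def W_def pcN zX)
  qed (use X rs in \<open>auto simp: Z_def\<close>)
  then obtain V dV K where V: "K \<ge> 0" "sol V dV" "\<And>t. t \<in> I \<Longrightarrow> (X 0 t)\<^sup>2 \<le> V t"
      "\<And>t. t \<in> I \<Longrightarrow> 0 < N \<Longrightarrow> (X 1 t)\<^sup>2 \<le> K * V t"
      "\<And>t. t \<in> I - S \<Longrightarrow> dV t \<le> - a * V t + K * (\<Sum>k<N. (lc xs (N - Suc k) t)\<^sup>2)"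
    using rs by (auto simp: Z_def W_def)
  obtain C where C: "C \<ge> 0" "\<And>t. (\<Sum>k<N. (lc xs k t)\<^sup>2) \<le> C * ssq xs t" using lc_square_bound by blast
  have dV: "dV t \<le> - a * V t + K * C * ssq xs t" if "t \<in> I - S" for t
  proof -
    have "K * (\<Sum>k<N. (lc xs (N - Suc k) t)\<^sup>2) \<le> K * (C * ssq xs t)"
      using C V(1) sum.nat_diff_reindex[of "\<lambda>k. (lc xs k t)\<^sup>2" N] by (intro mult_left_mono) auto
    then show ?thesis using V(5)[OF that] by (simp add: mult.assoc)
  qed
  have V0: "0 \<le> V t" if "t \<in> I" for t using V(3)[OF that] by (meson order_trans zero_le_power2)
  have "\<exists>dz L. L \<ge> 0 \<and> sol z dz \<and> (\<forall>t\<in>I - S. (dz t)\<^sup>2 \<le> L * (V t + ssq xs t))"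
  proof (cases N)
    case 0
    then have "sol z (\<lambda>t. 0)" using zX X(3) by (intro sol_cong[OF sol_const[of 0]]) auto
    then show ?thesis by (intro exI[of _ "\<lambda>t. 0"] exI[of _ 0]) auto
  next
    case (Suc M)
    define c where "c = coeff p M"
    define L where "L = 4 * c\<^sup>2 + 4 * C + 2 * K"
    define dz where "dz t = - (c * z t + lc xs M t + X 1 t)" for t
    have "sol z dz" using Suc X(2)[of 0] zX
      by (intro sol_cong[OF sol_minus[OF X(2)[of 0]]]) (auto simp: dz_def c_def)
    moreover have "(dz t)\<^sup>2 \<le> L * (V t + ssq xs t)" if t: "t \<in> I - S" for t
    proof -
      have "(dz t)\<^sup>2 \<le> 4 * (c * z t)\<^sup>2 + 4 * (lc xs M t)\<^sup>2 + 2 * (X 1 t)\<^sup>2"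
        using real_square_add_le[of "c * z t + lc xs M t" "X 1 t"] real_square_add_le[of "c * z t" "lc xs M t"]
        unfolding dz_def power2_minus by linarith
      moreover have "(c * z t)\<^sup>2 \<le> c\<^sup>2 * V t" using V(3)[of t] zX[of t] t by (auto simp: power_mult_distrib intro!: mult_left_mono)
      moreover have "(lc xs M t)\<^sup>2 \<le> C * ssq xs t"
        using C(2)[of t] member_le_sum[of M "{..<N}" "\<lambda>k. (lc xs k t)\<^sup>2"] Suc by auto
      moreover have "(X 1 t)\<^sup>2 \<le> K * V t" using V(4) t Suc by auto
      ultimately have "(dz t)\<^sup>2 \<le> 4 * (c\<^sup>2 * V t) + 4 * (C * ssq xs t) + 2 * (K * V t)" by linarith
      also have "\<dots> \<le> L * (V t + ssq xs t)"
        unfolding L_def using V(1) C(1) V0[of t] t sq_nonneg[of t xs] by (simp add: distrib_left distrib_right)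
      finally show ?thesis .
    qed
    ultimately show ?thesis using C V(1) by (intro exI[of _ dz] exI[of _ L]) (auto simp: L_def)
  qed
  then obtain dz L where L: "L \<ge> 0" "sol z dz" "\<And>t. t \<in> I - S \<Longrightarrow> (dz t)\<^sup>2 \<le> L * (V t + ssq xs t)" by blast
  have pos: "0 \<le> ssq xs t" "K * C \<ge> 0" for t using sq_nonneg V C by auto
  show ?thesis
  proof (rule exI[of _ "K * C + L"], rule exI[of _ V], rule exI[of _ dV], rule exI[of _ dz], intro conjI ballI)
    fix t assume t: "t \<in> I - S"
    show "dV t \<le> - a * V t + (K * C + L) * ssq xs t"
      using dV[OF t] pos(1)[of t] pos(2) L(1) by (simp add: distrib_right) (smt (verit) mult_nonneg_nonneg)
    have "L * (V t + ssq xs t) \<le> (K * C + L) * (V t + ssq xs t)"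
      using pos V0[of t] t L by (intro mult_right_mono) auto
    then show "(dz t)\<^sup>2 \<le> (K * C + L) * (V t + ssq xs t)" using L(3)[OF t] by linarith
  qed (use V zX L pos in auto)
qed

end

lemma hurwitz_margin:
  assumes "hurwitz_poly p" "p \<noteq> 0"
  obtains a where "a > 0" "\<forall>s. poly (map_poly complex_of_real p) s = 0 \<longrightarrow> 2 * Re s < - a"
proof -
  let ?R = "{s. poly (map_poly complex_of_real p) s = 0}"
  have "finite ?R" using assms(2) by (intro poly_roots_finite) (simp add: map_poly_eq_0_iff)
  \<comment> \<open>The margin lemma belongs to the locale, so a one-point time domain serves to
    instantiate it.\<close>
  then have "\<exists>a'>0. \<forall>x\<in>(\<lambda>s. 2 * Re s) ` ?R. x < - a'"
    using assms(1) by (intro time_domain.finite_strict_margin[of "{0}" "{}"])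
      (auto simp: hurwitz_poly_def time_domain_def)
  then show ?thesis using that by auto
qed

section \<open>Growth relative to a running supremum\<close>

context time_domain
begin

text \<open>\<open>z\<close> grows no faster than \<open>1 + sup |v|\<close> over the past.
  Quantifying over bounds \<open>B\<close> avoids the supremum itself, and one constant serves the
  whole of \<open>I\<close>, up to an unknown end of existence. The summand 1 absorbs initial
  conditions and bounded inputs.\<close>

definition sdom :: "(real \<Rightarrow> real) \<Rightarrow> (real \<Rightarrow> real) \<Rightarrow> bool" where
  "sdom z v \<longleftrightarrow> (\<exists>C\<ge>0. \<forall>t\<in>I. \<forall>B. (\<forall>s\<in>{0..t}. \<bar>v s\<bar> \<le> B) \<longrightarrow> \<bar>z t\<bar> \<le> C * (1 + B))"

lemma sdomI:
  assumes "\<And>t B. t \<in> I \<Longrightarrow> 0 \<le> B \<Longrightarrow> (\<And>s. 0 \<le> s \<Longrightarrow> s \<le> t \<Longrightarrow> \<bar>v s\<bar> \<le> B) \<Longrightarrow> \<bar>z t\<bar> \<le> C * (1 + B)"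
  shows "sdom z v"
  unfolding sdom_def
proof (intro exI[of _ "max C 0"] conjI ballI allI impI)
  fix t B assume t: "t \<in> I" and B: "\<forall>s\<in>{0..t}. \<bar>v s\<bar> \<le> B"
  have "0 \<le> B" using B time_nonneg[OF t] by force
  then have "\<bar>z t\<bar> \<le> C * (1 + B)" using B by (intro assms[OF t]) auto
  also have "\<dots> \<le> max C 0 * (1 + B)" using \<open>0 \<le> B\<close> by (intro mult_right_mono) auto
  finally show "\<bar>z t\<bar> \<le> max C 0 * (1 + B)" .
qed auto

lemma sdomE:
  assumes "sdom z v"
  obtains C where "C \<ge> 0" "\<And>t B. t \<in> I \<Longrightarrow> (\<And>s. 0 \<le> s \<Longrightarrow> s \<le> t \<Longrightarrow> \<bar>v s\<bar> \<le> B) \<Longrightarrow> \<bar>z t\<bar> \<le> C * (1 + B)"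
  using assms unfolding sdom_def by auto

lemma sdom_refl: "sdom v v"
  by (rule sdomI[of v v 1]) (use time_nonneg in force)

lemma sdom_cong: "sdom z v \<Longrightarrow> (\<And>t. t \<in> I \<Longrightarrow> y t = z t) \<Longrightarrow> sdom y v"
  by (auto simp: sdom_def)

lemma sdom_bounded:
  assumes "\<And>t. t \<in> I \<Longrightarrow> \<bar>z t\<bar> \<le> K" shows "sdom z v"
proof (rule sdomI[of v z K])
  fix t B assume "t \<in> I" "0 \<le> (B::real)"
  then show "\<bar>z t\<bar> \<le> K * (1 + B)"
    using assms[of t] mult_left_mono[of 1 "1 + B" K] by linarith
qed

lemma sdom_add:
  assumes "sdom y v" "sdom z v" shows "sdom (\<lambda>t. y t + z t) v"
proof -
  obtain C where C: "\<And>t B. t \<in> I \<Longrightarrow> (\<And>s. 0 \<le> s \<Longrightarrow> s \<le> t \<Longrightarrow> \<bar>v s\<bar> \<le> B) \<Longrightarrow> \<bar>y t\<bar> \<le> C * (1 + B)" using sdomE[OF assms(1)] by metis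
  obtain D where D: "\<And>t B. t \<in> I \<Longrightarrow> (\<And>s. 0 \<le> s \<Longrightarrow> s \<le> t \<Longrightarrow> \<bar>v s\<bar> \<le> B) \<Longrightarrow> \<bar>z t\<bar> \<le> D * (1 + B)" using sdomE[OF assms(2)] by metis
  show ?thesis
  proof (rule sdomI[of _ _ "C + D"])
    fix t B assume "t \<in> I" "\<And>s. 0 \<le> s \<Longrightarrow> s \<le> t \<Longrightarrow> \<bar>v s\<bar> \<le> B"
    then show "\<bar>y t + z t\<bar> \<le> (C + D) * (1 + B)" using C[of t B] D[of t B] by (auto simp: distrib_right)
  qed
qed

lemma sdom_bdd_mult:
  assumes "sdom z v" "\<And>t. t \<in> I \<Longrightarrow> \<bar>y t\<bar> \<le> K" shows "sdom (\<lambda>t. y t * z t) v"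
proof -
  obtain C where C: "C \<ge> 0" "\<And>t B. t \<in> I \<Longrightarrow> (\<And>s. 0 \<le> s \<Longrightarrow> s \<le> t \<Longrightarrow> \<bar>v s\<bar> \<le> B) \<Longrightarrow> \<bar>z t\<bar> \<le> C * (1 + B)" using sdomE[OF assms(1)] by metis
  show ?thesis
  proof (rule sdomI[of _ _ "K * C"])
    fix t B assume t: "t \<in> I" and B: "0 \<le> B" "\<And>s. 0 \<le> s \<Longrightarrow> s \<le> t \<Longrightarrow> \<bar>v s\<bar> \<le> B"
    have "\<bar>y t * z t\<bar> \<le> K * (C * (1 + B))"
      unfolding abs_mult using assms(2)[OF t] C(2)[OF t B(2)] order_trans[OF abs_ge_zero assms(2)[OF t]]
      by (intro mult_mono) auto
    then show "\<bar>y t * z t\<bar> \<le> K * C * (1 + B)" by (simp add: mult.assoc)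
  qed
qed

lemma sdom_cmult: "sdom z v \<Longrightarrow> sdom (\<lambda>t. c * z t) v"
  by (rule sdom_bdd_mult[of z v "\<lambda>t. c" "\<bar>c\<bar>"]) auto

lemma sdom_diff: "sdom y v \<Longrightarrow> sdom z v \<Longrightarrow> sdom (\<lambda>t. y t - z t) v"
  using sdom_add[of y v "\<lambda>t. (-1) * z t"] sdom_cmult[of z v "-1"] by simp

lemma sdom_zero: "sdom (\<lambda>t. 0) v"
  by (rule sdom_bounded[of _ 0]) auto

lemma sdom_sum: "(\<And>i. i \<in> K \<Longrightarrow> sdom (z i) v) \<Longrightarrow> sdom (\<lambda>t. \<Sum>i\<in>K. z i t) v"
  by (induction K rule: infinite_finite_induct) (auto intro: sdom_zero sdom_add)

lemma sdom_trans:
  assumes "sdom z y" "sdom y v" shows "sdom z v"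
proof -
  obtain C where C: "C \<ge> 0" "\<And>t B. t \<in> I \<Longrightarrow> (\<And>s. 0 \<le> s \<Longrightarrow> s \<le> t \<Longrightarrow> \<bar>y s\<bar> \<le> B) \<Longrightarrow> \<bar>z t\<bar> \<le> C * (1 + B)" using sdomE[OF assms(1)] by metis
  obtain D where D: "D \<ge> 0" "\<And>t B. t \<in> I \<Longrightarrow> (\<And>s. 0 \<le> s \<Longrightarrow> s \<le> t \<Longrightarrow> \<bar>v s\<bar> \<le> B) \<Longrightarrow> \<bar>y t\<bar> \<le> D * (1 + B)" using sdomE[OF assms(2)] by metis
  show ?thesis
  proof (rule sdomI[of _ _ "C * (1 + D)"])
    fix t B assume t: "t \<in> I" and B: "0 \<le> B" "\<And>s. 0 \<le> s \<Longrightarrow> s \<le> t \<Longrightarrow> \<bar>v s\<bar> \<le> B"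
    have "\<bar>y s\<bar> \<le> D * (1 + B)" if "0 \<le> s" "s \<le> t" for s
      using that B time_down[OF t that] by (intro D) auto
    then have "\<bar>z t\<bar> \<le> C * (1 + D * (1 + B))" by (rule C(2)[OF t])
    also have "\<dots> \<le> C * ((1 + D) * (1 + B))" using B C(1) D(1) by (intro mult_left_mono) (auto simp: algebra_simps)
    finally show "\<bar>z t\<bar> \<le> C * (1 + D) * (1 + B)" by (simp add: mult.assoc)
  qed
qed

lemma sdom_lc: "(\<And>q w. (q, w) \<in> set xs \<Longrightarrow> sdom w v) \<Longrightarrow> sdom (lc xs j) v"
proof (induction xs)
  case Nil
  then show ?case using sdom_zero by (simp add: sdom_def)
next
  case (Cons x xs)
  obtain q w where x: "x = (q, w)" by (cases x)
  have "sdom (\<lambda>t. coeff q j * w t + lc xs j t) v" using Cons x by (intro sdom_add sdom_cmult) auto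
  then show ?case by (rule sdom_cong) (simp add: x)
qed

lemma sdom_sq:
  assumes "\<And>q w. (q, w) \<in> set xs \<Longrightarrow> sdom w v"
  shows "\<exists>C\<ge>0. \<forall>t\<in>I. \<forall>B. (\<forall>s\<in>{0..t}. \<bar>v s\<bar> \<le> B) \<longrightarrow> ssq xs t \<le> C * (1 + B)\<^sup>2"
  using assms
proof (induction xs)
  case Nil
  then show ?case by (auto intro: exI[of _ 0])
next
  case (Cons x xs)
  obtain q w where x: "x = (q, w)" by (cases x)
  obtain C where C: "C \<ge> 0" "\<And>t B. t \<in> I \<Longrightarrow> (\<forall>s\<in>{0..t}. \<bar>v s\<bar> \<le> B) \<Longrightarrow> ssq xs t \<le> C * (1 + B)\<^sup>2"
    using Cons by fastforce
  obtain D where D: "\<And>t B. t \<in> I \<Longrightarrow> (\<And>s. 0 \<le> s \<Longrightarrow> s \<le> t \<Longrightarrow> \<bar>v s\<bar> \<le> B) \<Longrightarrow> \<bar>w t\<bar> \<le> D * (1 + B)"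
    using Cons.prems x sdomE[of w v] by (metis list.set_intros(1))
  have "ssq (x # xs) t \<le> (D\<^sup>2 + C) * (1 + B)\<^sup>2" if "t \<in> I" "\<forall>s\<in>{0..t}. \<bar>v s\<bar> \<le> B" for t B
  proof -
    have "\<bar>w t\<bar> \<le> D * (1 + B)" using that by (intro D) auto
    then have "(w t)\<^sup>2 \<le> (D * (1 + B))\<^sup>2" by (metis abs_ge_zero power2_abs power_mono)
    then show ?thesis using C(2)[OF that] by (simp add: x power_mult_distrib distrib_right)
  qed
  then show ?case using C(1) by (intro exI[of _ "D\<^sup>2 + C"]) auto
qed

text \<open>Removes the feedthrough: subtracting the multiple \<open>coeff q N\<close> of
  \<open>p\<close> makes every numerator strictly proper, and the direct terms move into the
  output.\<close>

lemma rel_proper: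
  assumes r: "rel ((p, z) # xs) N" and p: "monic p" "degree p = N"
  defines "ys \<equiv> map (\<lambda>(q, w). (q - smult (coeff q N) p, w)) xs"
  shows "rel ((p, \<lambda>t. z t + lc xs N t) # ys) N" "\<forall>(q, w)\<in>set ys. coeff q N = 0"
    "(q, w) \<in> set ys \<Longrightarrow> \<exists>q'. (q', w) \<in> set xs"
proof -
  have d: "degree q \<le> N" if "(q, w) \<in> set xs" for q w using r that by (auto simp: rel_def)
  have lc: "lc ys j t = lc xs j t - coeff p j * lc xs N t" for j t
    unfolding ys_def by (induction xs) (auto simp: algebra_simps)
  show "rel ((p, \<lambda>t. z t + lc xs N t) # ys) N"
  proof (rule rel_cong[OF r])
    fix q w assume "(q, w) \<in> set ((p, \<lambda>t. z t + lc xs N t) # ys)"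
    then consider "q = p" | q' where "q = q' - smult (coeff q' N) p" "(q', w) \<in> set xs" by (auto simp: ys_def)
    then show "degree q \<le> N"
    proof cases
      case 2
      then show ?thesis using d[OF 2(2)] p degree_smult_le[of "coeff q' N" p] by (auto intro: degree_diff_le)
    qed (use p in simp)
  qed (simp add: lc algebra_simps)
  show "\<forall>(q, w)\<in>set ys. coeff q N = 0" using p by (auto simp: ys_def)
  show "(q, w) \<in> set ys \<Longrightarrow> \<exists>q'. (q', w) \<in> set xs" by (auto simp: ys_def)
qed

text \<open>Input-output stability of proper filters with Hurwitz denominator, for every initial
  condition. After \<open>rel_proper\<close> the Lyapunov function of \<open>rel_stable\<close> is
  at most a multiple of \<open>(1 + B)\<^sup>2\<close>, and its square root gives linear
  growth.\<close>

lemma rel_sdom: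
  assumes r: "rel ((p, z) # xs) N" and p: "monic p" "degree p = N" "hurwitz_poly p"
    and xs: "\<And>q w. (q, w) \<in> set xs \<Longrightarrow> sdom w v"
  shows "sdom z v"
proof -
  define ys where "ys = map (\<lambda>(q, w). (q - smult (coeff q N) p, w)) xs"
  note ys = rel_proper[OF r p(1,2), folded ys_def]
  obtain a where a: "a > 0" "\<forall>s. poly (map_poly complex_of_real p) s = 0 \<longrightarrow> 2 * Re s < - a"
    using hurwitz_margin[OF p(3)] p(1) by (metis leading_coeff_0_iff zero_neq_one)
  obtain K V dV dz where V: "K \<ge> 0" "sol V dV" "\<forall>t\<in>I. (z t + lc xs N t)\<^sup>2 \<le> V t"
    "\<forall>t\<in>I - S. dV t \<le> - a * V t + K * ssq ys t"
    "sol (\<lambda>t. z t + lc xs N t) dz"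
    using rel_stable[OF ys(1) p(1,2) a(2) ys(2)] by blast
  have "sdom w v" if "(q, w) \<in> set ys" for q w using ys(3)[OF that] xs by blast
  then obtain C where C: "C \<ge> 0" "\<And>t B. t \<in> I \<Longrightarrow> (\<forall>s\<in>{0..t}. \<bar>v s\<bar> \<le> B) \<Longrightarrow> ssq ys t \<le> C * (1 + B)\<^sup>2"
    using sdom_sq[of ys v] by blast
  have V0: "0 \<le> V 0" using V(3) zero_mem by (meson order_trans zero_le_power2)
  have "sdom (\<lambda>t. z t + lc xs N t) v"
  proof (rule sdomI[of _ _ "sqrt (V 0 + K * C / a)"])
    fix t B assume t: "t \<in> I" and B: "0 \<le> B" "\<And>s. 0 \<le> s \<Longrightarrow> s \<le> t \<Longrightarrow> \<bar>v s\<bar> \<le> B"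
    have "V t \<le> V 0 + K * (C * (1 + B)\<^sup>2) / a"
    proof (rule sol_decay_bound[OF V(2) order_refl time_nonneg[OF t] t a(1) _ V0])
      fix s assume s: "s \<in> {0..t} - S"
      then have sI: "s \<in> I - S" using time_down[OF t] by auto
      have "ssq ys s \<le> C * (1 + B)\<^sup>2" using s sI B by (intro C) auto
      then show "dV s \<le> - a * V s + K * (C * (1 + B)\<^sup>2)"
        using V(4)[rule_format, OF sI] mult_left_mono[OF _ V(1)] by fastforce
    qed (use V C in auto)
    also have "\<dots> \<le> (V 0 + K * C / a) * (1 + B)\<^sup>2"
      using V0 B power_mono[of 1 "1 + B" 2] mult_left_mono[of 1 "(1 + B)\<^sup>2" "V 0"] by (simp add: distrib_right)
    finally have "(z t + lc xs N t)\<^sup>2 \<le> (V 0 + K * C / a) * (1 + B)\<^sup>2" using V(3) t by fastforce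
    then have "sqrt ((z t + lc xs N t)\<^sup>2) \<le> sqrt ((V 0 + K * C / a) * (1 + B)\<^sup>2)" by (rule real_sqrt_le_mono)
    then show "\<bar>z t + lc xs N t\<bar> \<le> sqrt (V 0 + K * C / a) * (1 + B)"
      using B by (simp add: real_sqrt_mult)
  qed
  then have "sdom (\<lambda>t. (z t + lc xs N t) - lc xs N t) v" using xs by (intro sdom_diff sdom_lc) auto
  then show ?thesis by simp
qed

end

section \<open>Resolvents\<close>

text \<open>\<open>res A c\<close> is the row \<open>c\<^sup>T adj (s I - A)\<close> and \<open>num A b c\<close> the numerator \<open>c\<^sup>T adj (s I - A) b\<close>.\<close>

definition res :: "real Matrix.mat \<Rightarrow> real Matrix.vec \<Rightarrow> nat \<Rightarrow> real poly" where
  "res A c i = (\<Sum>k<dim_row A. smult (vec_index c k) (adj_mat (char_poly_matrix A) $$ (k, i)))"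

definition num :: "real Matrix.mat \<Rightarrow> real Matrix.vec \<Rightarrow> real Matrix.vec \<Rightarrow> real poly" where
  "num A b c = (\<Sum>i<dim_row A. smult (vec_index b i) (res A c i))"

lemma transfer_fun_num:
  assumes "A \<in> carrier_mat N N" "b \<in> carrier_vec N" "c \<in> carrier_vec N"
  shows "transfer_fun A b c = Fraction_Field.Fract (num A b c) (char_poly A)"
proof -
  have adj: "adj_mat (char_poly_matrix A) \<in> carrier_mat N N" using adj_mat(1)[of "char_poly_matrix A" N] assms by simp
  have "scalar_prod (map_vec (\<lambda>a. [:a:]) c) (mult_mat_vec (adj_mat (char_poly_matrix A)) (map_vec (\<lambda>a. [:a:]) b))
     = (\<Sum>k<N. [:vec_index c k:] * (\<Sum>i<N. adj_mat (char_poly_matrix A) $$ (k, i) * [:vec_index b i:]))"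
    using assms adj by (auto simp: scalar_prod_def atLeast0LessThan intro!: sum.cong)
  also have "\<dots> = (\<Sum>k<N. \<Sum>i<N. smult (vec_index b i) (smult (vec_index c k) (adj_mat (char_poly_matrix A) $$ (k, i))))"
    by (simp add: smult_sum2 mult.commute)
  also have "\<dots> = num A b c"
    using assms by (subst sum.swap) (auto simp: num_def res_def smult_sum2)
  finally show ?thesis by (simp add: transfer_fun_def)
qed

lemma char_poly_matrix_index:
  assumes "A \<in> carrier_mat N N" "i < N" "j < N"
  shows "char_poly_matrix A $$ (i, j) = (if i = j then [:0, 1:] else 0) - [:A $$ (i, j):]"
  using assms by (auto simp: char_poly_matrix_def)

text \<open>Column \<open>j\<close> of \<open>c\<^sup>T adj (M) M = det (M) c\<^sup>T\<close> with
  \<open>M = s I - A\<close>.\<close>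

lemma res_identity:
  assumes A: "A \<in> carrier_mat N N" and j: "j < N"
  shows "[:0, 1:] * res A c j - (\<Sum>i<N. smult (A $$ (i, j)) (res A c i)) = smult (vec_index c j) (char_poly A)"
proof -
  let ?M = "char_poly_matrix A" and ?adj = "adj_mat (char_poly_matrix A)"
  have M: "?M \<in> carrier_mat N N" using A by simp
  note adj = adj_mat[OF M]
  have e: "(\<Sum>i<N. ?adj $$ (k, i) * ?M $$ (i, j)) = (if k = j then char_poly A else 0)" if k: "k < N" for k
  proof -
    have "(\<Sum>i<N. ?adj $$ (k, i) * ?M $$ (i, j)) = (?adj * ?M) $$ (k, j)"
      using M adj(1) k j by (simp add: scalar_prod_def atLeast0LessThan)
    also have "\<dots> = (if k = j then char_poly A else 0)"
      unfolding adj(3) using k j by (simp add: char_poly_def)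
    finally show ?thesis .
  qed
  have "[:0, 1:] * res A c j - (\<Sum>i<N. smult (A $$ (i, j)) (res A c i))
      = (\<Sum>i<N. res A c i * ?M $$ (i, j))"
  proof -
    have "(\<Sum>i<N. res A c i * ?M $$ (i, j)) = (\<Sum>i<N. (if i = j then [:0, 1:] * res A c i else 0) - smult (A $$ (i, j)) (res A c i))"
      using A j by (intro sum.cong) (auto simp: char_poly_matrix_index algebra_simps)
    then show ?thesis using j by (simp add: sum_subtractf sum.delta)
  qed
  also have "\<dots> = (\<Sum>k<N. smult (vec_index c k) (\<Sum>i<N. ?adj $$ (k, i) * ?M $$ (i, j)))"
    using A unfolding res_def by (subst sum_distrib_right, subst sum.swap) (simp add: smult_sum2)
  also have "\<dots> = (\<Sum>k<N. if k = j then smult (vec_index c k) (char_poly A) else 0)"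
    by (intro sum.cong) (auto simp: e)
  also have "\<dots> = smult (vec_index c j) (char_poly A)" using j by (simp add: sum.delta)
  finally show ?thesis .
qed

text \<open>Each coefficient is a combination of coefficients one degree higher, and the degrees are
  finite, so the induction descends from 0. It serves both for degree bounds and for uniqueness of
  solutions of recursions in \<open>s\<close>.\<close>

lemma coeffs_vanish:
  assumes "\<And>j k. j < N \<Longrightarrow> k \<ge> K \<Longrightarrow> coeff (w j) k = (\<Sum>i<N. A $$ (i, j) * coeff (w i :: real poly) (Suc k))"
    and "j < N" "k \<ge> K"
  shows "coeff (w j) k = 0"
proof -
  define D where "D = (\<Sum>i<N. degree (w i))"
  have D: "degree (w i) \<le> D" if "i < N" for i using that member_le_sum[of i "{..<N}" "\<lambda>i. degree (w i)"] by (simp add: D_def)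
  have "coeff (w j) k = 0" if "j < N" "k \<ge> K" "k + d > D" for d j k
    using that
  proof (induction d arbitrary: j k)
    case 0
    then show ?case using D[of j] by (intro coeff_eq_0) auto
  next
    case (Suc d)
    have "coeff (w i) (Suc k) = 0" if "i < N" for i using Suc.IH[of i "Suc k"] Suc.prems that by simp
    then show ?case using assms(1)[of j k] Suc.prems by simp
  qed
  from this[of j k "Suc D"] assms(2,3) show ?thesis by auto
qed

lemma coeff_res:
  assumes A: "A \<in> carrier_mat N N" and j: "j < N"
  shows "coeff (res A c j) k = (\<Sum>i<N. A $$ (i, j) * coeff (res A c i) (Suc k)) + vec_index c j * coeff (char_poly A) (Suc k)"
    "0 = (\<Sum>i<N. A $$ (i, j) * coeff (res A c i) 0) + vec_index c j * coeff (char_poly A) 0"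
proof -
  have "\<And>k. coeff ([:0, 1:] * res A c j - (\<Sum>i<N. smult (A $$ (i, j)) (res A c i))) k = vec_index c j * coeff (char_poly A) k"
    using res_identity[OF A j, of c] by simp
  from this[of "Suc k"] this[of 0]
  show "coeff (res A c j) k = (\<Sum>i<N. A $$ (i, j) * coeff (res A c i) (Suc k)) + vec_index c j * coeff (char_poly A) (Suc k)"
    "0 = (\<Sum>i<N. A $$ (i, j) * coeff (res A c i) 0) + vec_index c j * coeff (char_poly A) 0"
    by (auto simp: coeff_sum)
qed

lemma char_poly_monic:
  assumes "(A :: real Matrix.mat) \<in> carrier_mat N N" shows "monic (char_poly A)" "degree (char_poly A) = N" "char_poly A \<noteq> 0"
  using degree_monic_char_poly[OF assms] by auto

lemma coeff_res_ge:
  assumes A: "A \<in> carrier_mat N N" and "j < N" "k \<ge> N"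
  shows "coeff (res A c j) k = 0"
proof (rule coeffs_vanish[of N N "res A c" A])
  fix j k assume "j < N" "N \<le> k"
  then show "coeff (res A c j) k = (\<Sum>i<N. A $$ (i, j) * coeff (res A c i) (Suc k))"
    using coeff_res(1)[OF A, of j c k] char_poly_monic[OF A] by (simp add: coeff_eq_0)
qed (use assms in auto)

lemma degree_res:
  assumes "A \<in> carrier_mat N N" "j < N" shows "degree (res A c j) < N"
  using coeff_res_ge[OF assms, of "degree (res A c j)" c] assms(2) by (metis degree_0 gr_implies_not_zero leading_coeff_0_iff not_le zero_less_iff_neq_zero)

lemma num_coeff_ge:
  assumes "A \<in> carrier_mat N N" "k \<ge> N" shows "coeff (num A b c) k = 0"
  using assms coeff_res_ge[OF assms(1)] by (auto simp: num_def coeff_sum)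

lemma degree_num:
  assumes "A \<in> carrier_mat N N" "N > 0" shows "degree (num A b c) < N"
  using num_coeff_ge[OF assms(1), of "degree (num A b c)" b c] assms(2) by (metis degree_0 leading_coeff_0_iff not_le)

lemma num_add: "A \<in> carrier_mat N N \<Longrightarrow> g \<in> carrier_vec N \<Longrightarrow> h \<in> carrier_vec N \<Longrightarrow> num A (g + h) c = num A g c + num A h c"
  by (simp add: num_def smult_add_left sum.distrib)

lemma num_smult: "A \<in> carrier_mat N N \<Longrightarrow> g \<in> carrier_vec N \<Longrightarrow> num A (a \<cdot>\<^sub>v g) c = smult a (num A g c)"
  by (simp add: num_def smult_sum2)

lemma num_zero: "A \<in> carrier_mat N N \<Longrightarrow> num A (0\<^sub>v N) c = 0"
  by (simp add: num_def)

text \<open>Write \<open>A = s I - (s I - A)\<close>; the second part cancels against the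
  adjugate.\<close>

lemma num_mult_mat_vec:
  assumes A: "A \<in> carrier_mat N N" and g: "g \<in> carrier_vec N"
  shows "num A (A *\<^sub>v g) c = [:0, 1:] * num A g c - smult (\<Sum>j<N. vec_index c j * vec_index g j) (char_poly A)"
proof -
  have "num A (A *\<^sub>v g) c = (\<Sum>i<N. \<Sum>j<N. smult (vec_index g j) (smult (A $$ (i, j)) (res A c i)))"
    using A g by (auto simp: num_def scalar_prod_def atLeast0LessThan smult_sum mult.commute intro!: sum.cong)
  also have "\<dots> = (\<Sum>j<N. smult (vec_index g j) (\<Sum>i<N. smult (A $$ (i, j)) (res A c i)))"
    by (subst sum.swap) (simp add: smult_sum2)
  also have "\<dots> = (\<Sum>j<N. smult (vec_index g j) ([:0, 1:] * res A c j - smult (vec_index c j) (char_poly A)))"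
  proof (intro sum.cong refl arg_cong[of _ _ "smult _"])
    fix j assume "j \<in> {..<N}"
    then show "(\<Sum>i<N. smult (A $$ (i, j)) (res A c i)) = [:0, 1:] * res A c j - smult (vec_index c j) (char_poly A)"
      using res_identity[OF A, of j c] by (simp add: algebra_simps)
  qed
  also have "\<dots> = [:0, 1:] * num A g c - smult (\<Sum>j<N. vec_index c j * vec_index g j) (char_poly A)"
    using A by (simp add: num_def sum_distrib_left smult_diff_right sum_subtractf smult_sum mult.commute)
  finally show ?thesis .
qed

text \<open>The witness is \<open>g = h(A) b\<close>, built by Horner's scheme: applying
  \<open>A\<close> to a vector multiplies its numerator by \<open>s\<close> modulo the
  characteristic polynomial.\<close>

lemma num_span:
  assumes A: "A \<in> carrier_mat N N" and b: "b \<in> carrier_vec N"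
  shows "\<exists>g\<in>carrier_vec N. char_poly A dvd num A g c - h * num A b c"
proof (induction h)
  case 0
  show ?case using num_zero[OF A] by (intro bexI[of _ "0\<^sub>v N"]) auto
next
  case (pCons a h)
  then obtain g where "g \<in> carrier_vec N" "char_poly A dvd num A g c - h * num A b c" by blast
  then obtain k where g: "g \<in> carrier_vec N" "num A g c - h * num A b c = char_poly A * k" by (auto elim: dvdE)
  define s where "s = (\<Sum>j<N. vec_index c j * vec_index g j)"
  have Ag: "A *\<^sub>v g \<in> carrier_vec N" using A g by simp
  have "num A (a \<cdot>\<^sub>v b + A *\<^sub>v g) c - pCons a h * num A b c
      = [:0, 1:] * (num A g c - h * num A b c) - smult s (char_poly A)"
  proof -
    have "num A (a \<cdot>\<^sub>v b + A *\<^sub>v g) c = smult a (num A b c) + ([:0, 1:] * num A g c - smult s (char_poly A))"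
      unfolding s_def num_mult_mat_vec[OF A g(1), of c, symmetric] num_smult[OF A b, of a c, symmetric]
      by (rule num_add[OF A _ Ag]) (use b in simp)
    moreover have "pCons a h * num A b c = smult a (num A b c) + [:0, 1:] * (h * num A b c)" by simp
    ultimately show ?thesis by (simp only: right_diff_distrib)
  qed
  also have "\<dots> = char_poly A * (pCons 0 k - [:s:])" unfolding g(2) by (simp add: algebra_simps)
  finally have "char_poly A dvd num A (a \<cdot>\<^sub>v b + A *\<^sub>v g) c - pCons a h * num A b c" by (metis dvd_triv_left)
  then show ?case using Ag b by (intro bexI[of _ "a \<cdot>\<^sub>v b + A *\<^sub>v g"]) auto
qed

lemma dvd_degree_less_zero: "(p::real poly) dvd q \<Longrightarrow> degree q < degree p \<Longrightarrow> q = 0"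
  using dvd_imp_degree_le by (metis not_le)

text \<open>Polynomials of degree below \<open>N\<close> that are congruent modulo the
  characteristic polynomial coincide, so reaching a numerator reduces to a congruence.\<close>

lemma num_reachable:
  assumes A: "A \<in> carrier_mat N N" "N > 0" and b: "b \<in> carrier_vec N"
    and R: "degree R < N" "char_poly A dvd R - h * num A b c"
  shows "\<exists>g\<in>carrier_vec N. num A g c = R"
proof -
  obtain g where g: "g \<in> carrier_vec N" "char_poly A dvd num A g c - h * num A b c"
    using num_span[OF A(1) b] by blast
  have "char_poly A dvd (num A g c - h * num A b c) - (R - h * num A b c)" by (intro dvd_diff g R)
  then have "char_poly A dvd num A g c - R" by simp
  moreover have "degree (num A g c - R) < N" using degree_num[OF A, of g c] R by (intro degree_diff_less) auto
  ultimately have "num A g c - R = 0" using char_poly_monic[OF A(1)] by (intro dvd_degree_less_zero) auto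
  then show ?thesis using g by auto
qed

text \<open>Both bordered products below eliminate one off-diagonal block of \<open>[1, -c\<^sup>T; g, M]\<close>.\<close>

lemma det_rank_one:
  fixes M :: "real poly Matrix.mat"
  assumes M: "M \<in> carrier_mat N N" and g: "g \<in> carrier_mat N 1" and c: "c \<in> carrier_mat 1 N" and d: "det M \<noteq> 0"
  shows "det (g * c + M) = det M + (c * (adj_mat M * g)) $$ (0, 0)"
proof -
  define B where "B = four_block_mat (1\<^sub>m 1) (- c) g M"
  define U1 where "U1 = four_block_mat (1\<^sub>m 1) c (0\<^sub>m N 1) (1\<^sub>m N)"
  \<comment> \<open>Scaling by \<open>det M\<close> replaces the inverse of \<open>M\<close>, so
    that the elimination stays within polynomial matrices; the factor is cancelled at the
    end.\<close>
  define U2 where "U2 = four_block_mat (det M \<cdot>\<^sub>m 1\<^sub>m 1) (0\<^sub>m 1 N) (- (adj_mat M * g)) (1\<^sub>m N)"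
  note adj = adj_mat[OF M]
  have ag: "adj_mat M * g \<in> carrier_mat N 1" using adj g by auto
  have B: "B \<in> carrier_mat (1 + N) (1 + N)" "U1 \<in> carrier_mat (1 + N) (1 + N)" "U2 \<in> carrier_mat (1 + N) (1 + N)"
    using M g c ag unfolding B_def U1_def U2_def by (auto intro!: four_block_carrier_mat)
  have BU1: "B * U1 = four_block_mat (1\<^sub>m 1) (0\<^sub>m 1 N) g (g * c + M)"
  proof -
    have "B * U1 = four_block_mat (1\<^sub>m 1 * 1\<^sub>m 1 + (- c) * 0\<^sub>m N 1) (1\<^sub>m 1 * c + (- c) * 1\<^sub>m N)
        (g * 1\<^sub>m 1 + M * 0\<^sub>m N 1) (g * c + M * 1\<^sub>m N)"
      unfolding B_def U1_def using M g c by (intro mult_four_block_mat) auto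
    also have "\<dots> = four_block_mat (1\<^sub>m 1) (0\<^sub>m 1 N) g (g * c + M)"
    proof -
      have "- c * 0\<^sub>m N 1 = 0\<^sub>m 1 1" "M * 0\<^sub>m N 1 = 0\<^sub>m N 1" "1\<^sub>m 1 * c + (- c) * 1\<^sub>m N = 0\<^sub>m 1 N"
        using c M by auto
      then show ?thesis using g M by simp
    qed
    finally show ?thesis .
  qed
  have BU2: "B * U2 = four_block_mat (det M \<cdot>\<^sub>m 1\<^sub>m 1 + c * (adj_mat M * g)) (- c) (0\<^sub>m N 1) M"
  proof -
    have "B * U2 = four_block_mat (1\<^sub>m 1 * (det M \<cdot>\<^sub>m 1\<^sub>m 1) + (- c) * (- (adj_mat M * g))) (1\<^sub>m 1 * 0\<^sub>m 1 N + (- c) * 1\<^sub>m N)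
        (g * (det M \<cdot>\<^sub>m 1\<^sub>m 1) + M * (- (adj_mat M * g))) (g * 0\<^sub>m 1 N + M * 1\<^sub>m N)"
      unfolding B_def U2_def using M g c ag by (intro mult_four_block_mat) auto
    moreover have "(- c) * (- (adj_mat M * g)) = c * (adj_mat M * g)"
      using c ag by (intro eq_matI) (auto simp: scalar_prod_def)
    moreover have "g * (det M \<cdot>\<^sub>m 1\<^sub>m 1) + M * (- (adj_mat M * g)) = 0\<^sub>m N 1"
    proof -
      have "M * (- (adj_mat M * g)) = - ((M * adj_mat M) * g)" using M adj(1) g ag by (simp add: assoc_mult_mat[of M N N _ N _ 1])
      also have "\<dots> = - (det M \<cdot>\<^sub>m g)" unfolding adj(2) using g by (simp add: mult_smult_assoc_mat[of _ N N g 1])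
      moreover have "g * (det M \<cdot>\<^sub>m 1\<^sub>m 1) = det M \<cdot>\<^sub>m g" using g by (simp add: mult_smult_distrib[of g N 1 _ 1])
      ultimately show ?thesis using g by (intro eq_matI) auto
    qed
    ultimately show ?thesis using g c M ag by auto
  qed
  have "det U1 = 1" unfolding U1_def using c by (subst det_four_block_mat_lower_left_zero[of _ 1 _ N]) auto
  then have "det B = det (B * U1)" using det_mult[OF B(1,2)] by simp
  also have "\<dots> = det (g * c + M)" unfolding BU1 using g c M by (subst det_four_block_mat_upper_right_zero[of _ 1 _ N]) auto
  finally have 1: "det B = det (g * c + M)" .
  have "det U2 = det M" unfolding U2_def using ag by (subst det_four_block_mat_upper_right_zero[of _ 1 _ N]) (auto simp: det_single)
  then have "det B * det M = det (B * U2)" using det_mult[OF B(1,3)] by simp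
  also have "\<dots> = (det M + (c * (adj_mat M * g)) $$ (0, 0)) * det M"
    unfolding BU2 using g c M ag by (subst det_four_block_mat_lower_left_zero[of _ 1 _ N]) (auto simp: det_single)
  finally show ?thesis using d 1 by simp
qed

text \<open>\<open>s I - A + g c\<^sup>T\<close> is a rank one perturbation of
  \<open>s I - A\<close>, and the determinant changes by a numerator. Placing the poles of an
  observer therefore means reaching a prescribed numerator.\<close>

lemma char_poly_output_injection:
  assumes A: "A \<in> carrier_mat N N" and g: "g \<in> carrier_vec N" and c: "c \<in> carrier_vec N"
  defines "A' \<equiv> Matrix.mat N N (\<lambda>(i, j). A $$ (i, j) - vec_index g i * vec_index c j)"
  shows "char_poly A' = char_poly A + num A g c"
proof -
  let ?M = "char_poly_matrix A"
  define gm where "gm = Matrix.mat N 1 (\<lambda>(i, j). [:vec_index g i:])"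
  define cm where "cm = Matrix.mat 1 N (\<lambda>(i, j). [:vec_index c j:])"
  have A': "A' \<in> carrier_mat N N" by (simp add: A'_def)
  have M: "?M \<in> carrier_mat N N" using A by simp
  have adj: "adj_mat ?M \<in> carrier_mat N N" using adj_mat[OF M] by simp
  have gc: "gm \<in> carrier_mat N 1" "cm \<in> carrier_mat 1 N" by (auto simp: gm_def cm_def)
  have "char_poly_matrix A' = gm * cm + ?M"
  proof (rule eq_matI)
    fix i j assume ij: "i < dim_row (gm * cm + ?M)" "j < dim_col (gm * cm + ?M)"
    then have ij: "i < N" "j < N" using gc M by auto
    then show "char_poly_matrix A' $$ (i, j) = (gm * cm + ?M) $$ (i, j)"
      unfolding char_poly_matrix_index[OF A' ij]
      using char_poly_matrix_index[OF A ij] gc M ij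
      by (simp add: A'_def gm_def cm_def scalar_prod_def mult.commute)
  qed (use char_poly_matrix_closed[OF A'] gc M in auto)
  then have "char_poly A' = char_poly A + (cm * (adj_mat ?M * gm)) $$ (0, 0)"
    using det_rank_one[OF M gc] char_poly_monic(3)[OF A] by (simp add: char_poly_def)
  also have "(cm * (adj_mat ?M * gm)) $$ (0, 0) = (\<Sum>k<N. [:vec_index c k:] * (\<Sum>i<N. adj_mat ?M $$ (k, i) * [:vec_index g i:]))"
    using adj gc by (auto simp: scalar_prod_def gm_def cm_def atLeast0LessThan intro!: sum.cong)
  also have "\<dots> = num A g c"
    using A by (simp add: num_def res_def smult_sum2 mult.commute) (subst sum.swap, simp add: mult.commute)
  finally show ?thesis .
qed

text \<open>Dual of \<open>num_mult_mat_vec\<close>, from \<open>M adj (M) = det (M) I\<close>: here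
  \<open>A\<close> acts on the output vector. It drives the induction over \<open>A^k b\<close> in
  the controllability argument.\<close>

lemma num_transpose:
  assumes A: "A \<in> carrier_mat N N" and c: "c \<in> carrier_vec N"
  shows "num A b (transpose_mat A *\<^sub>v c) = [:0, 1:] * num A b c - smult (\<Sum>j<N. vec_index c j * vec_index b j) (char_poly A)"
proof -
  let ?M = "char_poly_matrix A" and ?adj = "adj_mat (char_poly_matrix A)"
  have M: "?M \<in> carrier_mat N N" using A by simp
  note adj = adj_mat[OF M]
  have e: "(\<Sum>k<N. smult (A $$ (j, k)) (?adj $$ (k, i))) = [:0, 1:] * ?adj $$ (j, i) - (if j = i then char_poly A else 0)" if ji: "j < N" "i < N" for j i
  proof -
    have "(\<Sum>k<N. ?M $$ (j, k) * ?adj $$ (k, i)) = (?M * ?adj) $$ (j, i)"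
      using M adj(1) ji by (simp add: scalar_prod_def atLeast0LessThan)
    also have "\<dots> = (if j = i then char_poly A else 0)" unfolding adj(2) using ji by (simp add: char_poly_def)
    finally have "(if j = i then char_poly A else 0) = (\<Sum>k<N. (if j = k then [:0, 1:] * ?adj $$ (k, i) else 0) - smult (A $$ (j, k)) (?adj $$ (k, i)))"
    proof (subst sum.cong[OF refl])
      fix k assume "k \<in> {..<N}"
      then show "(if j = k then [:0, 1:] * ?adj $$ (k, i) else 0) - smult (A $$ (j, k)) (?adj $$ (k, i)) = ?M $$ (j, k) * ?adj $$ (k, i)"
        using A ji by (auto simp: char_poly_matrix_index left_diff_distrib)
    qed simp
    then show ?thesis using ji by (simp add: sum_subtractf sum.delta)
  qed
  have "res A (transpose_mat A *\<^sub>v c) i = [:0, 1:] * res A c i - smult (vec_index c i) (char_poly A)" if i: "i < N" for i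
  proof -
    have "res A (transpose_mat A *\<^sub>v c) i = (\<Sum>k<N. \<Sum>j<N. smult (vec_index c j) (smult (A $$ (j, k)) (?adj $$ (k, i))))"
      using A c by (auto simp: res_def scalar_prod_def atLeast0LessThan smult_sum mult.commute intro!: sum.cong)
    also have "\<dots> = (\<Sum>j<N. smult (vec_index c j) (\<Sum>k<N. smult (A $$ (j, k)) (?adj $$ (k, i))))"
      by (subst sum.swap) (simp add: smult_sum2)
    also have "\<dots> = (\<Sum>j<N. [:0, 1:] * smult (vec_index c j) (?adj $$ (j, i)) - (if j = i then smult (vec_index c j) (char_poly A) else 0))"
      using i by (intro sum.cong) (auto simp: e smult_diff_right)
    also have "\<dots> = [:0, 1:] * res A c i - smult (vec_index c i) (char_poly A)"
      using i A by (simp add: sum_subtractf sum.delta res_def sum_distrib_left del: mult_pCons_left)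
    finally show ?thesis .
  qed
  then show ?thesis using A
    by (simp add: num_def smult_diff_right sum_subtractf sum_distrib_left smult_sum mult.commute del: mult_pCons_left)
qed

section \<open>Canonical forms and realizations\<close>

lemma observer_canonical_carrier [simp]: "observer_canonical_mat N p \<in> carrier_mat N N"
  by (simp add: observer_canonical_mat_def)

text \<open>The powers of \<open>s\<close> solve the recursion of \<open>res_identity\<close> with
  \<open>p\<close> in place of the characteristic polynomial.\<close>

lemma observer_canonical_powers:
  fixes p :: "real poly"
  assumes p: "monic p" "degree p = N" and j: "j < N"
  shows "[:0, 1:] * monom 1 j - (\<Sum>i<N. smult (observer_canonical_mat N p $$ (i, j)) (monom 1 i))
    = smult (vec_index (unit_vec N (N - 1)) j) p"
proof (cases "j = N - 1")
  case True
  have "[:0, 1:] * monom 1 j = (monom 1 N :: real poly)" using True j by (simp add: monom_Suc[symmetric] flip: monom_Suc)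
  moreover have "(\<Sum>i<N. smult (observer_canonical_mat N p $$ (i, j)) (monom 1 i)) = - (\<Sum>i<N. monom (coeff p i) i)"
    using True j by (simp add: observer_canonical_mat_def smult_monom minus_monom flip: sum_negf)
  moreover have "p = (\<Sum>i<N. monom (coeff p i) i) + monom 1 N"
    using poly_as_sum_of_monoms[of p] p by (simp add: lessThan_Suc_atMost[symmetric])
  ultimately show ?thesis using True j by simp
next
  case False
  have "(\<Sum>i<N. smult (observer_canonical_mat N p $$ (i, j)) (monom 1 i))
      = (\<Sum>i<N. if i = Suc j then monom 1 i else (0::real poly))"
    using False j by (intro sum.cong) (auto simp: observer_canonical_mat_def)
  also have "\<dots> = monom 1 (Suc j)" using False j by (simp add: sum.delta)
  finally show ?thesis using False j by (simp add: monom_Suc)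
qed

text \<open>No determinant is expanded. The cross differences \<open>w\<close> solve a homogeneous
  recursion, whose only polynomial solution is 0; degree and leading coefficient then identify the
  characteristic polynomial, and with it the row of the resolvent.\<close>

lemma observer_canonical:
  fixes p :: "real poly"
  assumes p: "monic p" "degree p = N"
  shows "char_poly (observer_canonical_mat N p) = p"
    and "i < N \<Longrightarrow> res (observer_canonical_mat N p) (unit_vec N (N - 1)) i = monom 1 i"
proof -
  let ?A = "observer_canonical_mat N p" and ?e = "unit_vec N (N - 1) :: real Matrix.vec"
  note A = observer_canonical_carrier[of N p]
  define w where "w i = p * res ?A ?e i - char_poly ?A * monom 1 i" for i
  have w: "w i = 0" if i: "i < N" for i
  proof (rule poly_eqI)
    fix k
    have rec: "[:0, 1:] * w j = (\<Sum>i<N. smult (?A $$ (i, j)) (w i))" if j: "j < N" for j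
    proof -
      have "[:0, 1:] * w j - (\<Sum>i<N. smult (?A $$ (i, j)) (w i))
        = p * ([:0, 1:] * res ?A ?e j - (\<Sum>i<N. smult (?A $$ (i, j)) (res ?A ?e i)))
          - char_poly ?A * ([:0, 1:] * monom 1 j - (\<Sum>i<N. smult (?A $$ (i, j)) (monom 1 i)))"
        by (simp add: w_def smult_diff_right sum_subtractf sum_distrib_left right_diff_distrib mult.commute
            del: mult_pCons_left mult_pCons_right)
      also have "\<dots> = 0" unfolding res_identity[OF A j] observer_canonical_powers[OF p j] by (simp add: mult.commute)
      finally show ?thesis by simp
    qed
    have *: "coeff (w j) k = (\<Sum>i<N. ?A $$ (i, j) * coeff (w i) (Suc k))" if "j < N" for j k
      using arg_cong[OF rec[OF that], of "\<lambda>q. coeff q (Suc k)"] by (simp add: coeff_sum)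
    have "coeff (w i) k = 0" by (rule coeffs_vanish[of N 0 w ?A, OF *]) (use i in auto)
    then show "coeff (w i) k = coeff 0 k" by simp
  qed
  show cp: "char_poly ?A = p"
  proof (cases "N = 0")
    case True
    then show ?thesis using p char_poly_monic[OF A] by (metis monic_degree_0)
  next
    case False
    then have e: "p * res ?A ?e 0 = char_poly ?A" using w[of 0] by (simp add: w_def)
    then have "degree p + degree (res ?A ?e 0) = N" using char_poly_monic[OF A] p
      by (metis degree_mult_eq mult_zero_left mult_zero_right)
    then obtain c where c: "res ?A ?e 0 = [:c:]" using p degree_eq_zeroE by (metis add_eq_self_zero)
    have "coeff (p * [:c:]) N = 1" using e char_poly_monic[OF A] unfolding c by simp
    then have "c = 1" using p by simp
    then show ?thesis using e c by (simp add: one_pCons[symmetric])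
  qed
  show "res ?A ?e i = monom 1 i" if "i < N"
    using w[OF that] p unfolding w_def cp by (metis leading_coeff_0_iff mult_cancel_left right_minus_eq zero_neq_one)
qed

lemma fract_eq_iff: "b \<noteq> 0 \<Longrightarrow> d \<noteq> 0 \<Longrightarrow> Fraction_Field.Fract a b = Fraction_Field.Fract c d \<longleftrightarrow> a * d = c * (b::real poly)"
  by (rule eq_fract(1))

lemma realizes_iff:
  assumes "ss_A G \<in> carrier_mat N N" "ss_b G \<in> carrier_vec N" "ss_c G \<in> carrier_vec N" "a \<noteq> 0"
  shows "realizes G (Fraction_Field.Fract b a) \<longleftrightarrow>
    (num (ss_A G) (ss_b G) (ss_c G) + smult (ss_d G) (char_poly (ss_A G))) * a = b * char_poly (ss_A G)"
proof -
  have "transfer_fun (ss_A G) (ss_b G) (ss_c G) + Fraction_Field.Fract [:ss_d G:] 1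
      = Fraction_Field.Fract (num (ss_A G) (ss_b G) (ss_c G) + smult (ss_d G) (char_poly (ss_A G))) (char_poly (ss_A G))"
    using assms char_poly_monic(3)[OF assms(1)] by (simp add: transfer_fun_num)
  then show ?thesis using assms char_poly_monic(3)[OF assms(1)]
    by (auto simp: realizes_def fract_eq_iff)
qed

text \<open>Bounds the dimension of a minimal realization from above. The feedthrough is the
  coefficient of degree \<open>N\<close>, and the remainder is the input vector of the observer
  form.\<close>

lemma realization_exists:
  fixes a b :: "real poly"
  assumes a: "monic a" "degree a = N" and b: "degree b \<le> N"
  shows "\<exists>G. realizes G (Fraction_Field.Fract b a) \<and> ss_dim G = N"
proof -
  define d where "d = coeff b N"
  define r where "r = b - smult d a"
  define G where "G = \<lparr>ss_A = observer_canonical_mat N a, ss_b = Matrix.vec N (coeff r), ss_c = unit_vec N (N - 1), ss_d = d\<rparr>"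
  have r: "coeff r k = 0" if "k \<ge> N" for k
    using that a b by (cases "k = N") (auto simp: r_def d_def coeff_eq_0)
  have "num (ss_A G) (ss_b G) (ss_c G) = (\<Sum>i<N. monom (coeff r i) i)"
  proof -
    have "smult (coeff r i) (res (observer_canonical_mat N a) (unit_vec N (N - 1)) i) = monom (coeff r i) i" if "i < N" for i
      unfolding observer_canonical(2)[OF a that] by (simp add: smult_monom)
    moreover have "dim_row (observer_canonical_mat N a) = N" by (simp add: observer_canonical_mat_def)
    ultimately show ?thesis by (simp add: num_def G_def)
  qed
  also have "\<dots> = r"
    by (rule poly_eqI) (use r in \<open>auto simp: coeff_sum not_less\<close>)
  finally have "num (ss_A G) (ss_b G) (ss_c G) + smult (ss_d G) (char_poly (ss_A G)) = b"
    by (simp add: r_def G_def observer_canonical[OF a])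
  moreover have "ss_dim G = N" by (simp add: G_def observer_canonical_mat_def)
  moreover have "realizes G (Fraction_Field.Fract b a)"
  proof (subst realizes_iff[of _ N])
    show "a \<noteq> 0" using a by auto
  qed (use calculation in \<open>auto simp: G_def observer_canonical[OF a]\<close>)
  ultimately show ?thesis by blast
qed

text \<open>Coprimality forces \<open>a\<close> to divide the characteristic polynomial, and the
  realization of dimension \<open>degree a\<close> leaves no room for a further factor.\<close>

lemma minimal_realization_poly:
  fixes a b :: "real poly"
  assumes G: "minimal_realization G (Fraction_Field.Fract b a)"
    and a: "monic a" and b: "degree b \<le> degree a" and cop: "coprime a b"
  shows "ss_dim G = degree a" "char_poly (ss_A G) = a"
    "num (ss_A G) (ss_b G) (ss_c G) + smult (ss_d G) a = b"
proof -
  have r: "realizes G (Fraction_Field.Fract b a)" using G by (simp add: minimal_realization_def)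
  then have c: "ss_A G \<in> carrier_mat (ss_dim G) (ss_dim G)" "ss_b G \<in> carrier_vec (ss_dim G)" "ss_c G \<in> carrier_vec (ss_dim G)"
    by (auto simp: realizes_def)
  have a0: "a \<noteq> 0" using a by auto
  note \<chi> = char_poly_monic[OF c(1)]
  have e: "(num (ss_A G) (ss_b G) (ss_c G) + smult (ss_d G) (char_poly (ss_A G))) * a = b * char_poly (ss_A G)"
    using r realizes_iff[OF c a0] by blast
  then have "a dvd b * char_poly (ss_A G)" by (metis dvd_triv_right)
  then have "a dvd char_poly (ss_A G)" using cop by (simp add: coprime_dvd_mult_right_iff)
  then obtain k where k: "char_poly (ss_A G) = a * k" by (elim dvdE)
  have "ss_dim G \<le> degree a" using realization_exists[OF a refl b] G by (metis minimal_realization_def)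
  moreover have "degree a + degree k = ss_dim G" using \<chi> k a0 by (metis degree_mult_eq mult_zero_right)
  ultimately have dk: "degree k = 0" "ss_dim G = degree a" by auto
  have "lead_coeff k = 1" using \<chi> k a lead_coeff_mult[of a k] by simp
  then have "k = 1" using dk by (metis monic_degree_0)
  then show "ss_dim G = degree a" "char_poly (ss_A G) = a" using dk k by auto
  then show "num (ss_A G) (ss_b G) (ss_c G) + smult (ss_d G) a = b" using e a0 by simp
qed

lemma hurwitz_char_poly:
  assumes "A \<in> carrier_mat N N" "hurwitz_mat A" shows "hurwitz_poly (char_poly A)"
proof -
  have "char_poly (map_mat complex_of_real A) = map_poly complex_of_real (char_poly A)"
    by (rule comm_ring_hom.char_poly_hom[OF _ assms(1)]) (unfold_locales, auto)
  then show ?thesis using assms eigenvalue_root_char_poly[of "map_mat complex_of_real A" N]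
    by (auto simp: hurwitz_poly_def hurwitz_mat_def)
qed

text \<open>If \<open>v\<^sup>T adj (s I - A) b\<close> vanishes, the degree bound applied to
  \<open>num_transpose\<close> gives \<open>v\<^sup>T b = 0\<close> and the same vanishing for
  \<open>A\<^sup>T v\<close>. Hence \<open>v\<close> is orthogonal to all
  \<open>A^k b\<close>.\<close>

lemma controllable_injective:
  assumes A: "A \<in> carrier_mat N N" and b: "b \<in> carrier_vec N" and ctr: "controllable N A b"
    and v: "v \<in> carrier_vec N" and z: "num A b v = 0"
  shows "v = 0\<^sub>v N"
proof (cases "N = 0")
  case False
  define K where "K = mat_of_cols N (map (\<lambda>k. (A ^\<^sub>m k) *\<^sub>v b) [0..<N])"
  have K: "K \<in> carrier_mat N N" by (auto simp: K_def)
  have "vec_space.rank N K = N" using ctr by (simp add: controllable_def K_def)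
  then have dK: "det K \<noteq> 0" using vec_space.det_rank_iff[OF K] by simp
  have step: "num A b (transpose_mat A *\<^sub>v w) = 0 \<and> (\<Sum>j<N. vec_index w j * vec_index b j) = 0"
    if w: "w \<in> carrier_vec N" "num A b w = 0" for w
  proof -
    define s where "s = (\<Sum>j<N. vec_index w j * vec_index b j)"
    have e: "num A b (transpose_mat A *\<^sub>v w) = - smult s (char_poly A)"
      using num_transpose[OF A w(1), of b] w(2) by (simp add: s_def)
    have "coeff (num A b (transpose_mat A *\<^sub>v w)) N = 0" by (rule num_coeff_ge[OF A]) simp
    then have "s = 0" using e char_poly_monic[OF A] by simp
    then show ?thesis using e by (simp add: s_def)
  qed
  have comm: "A * A ^\<^sub>m k = A ^\<^sub>m k * A" for k
    by (induction k) (use A in \<open>auto simp flip: assoc_mult_mat[of A N N _ N A N]\<close>)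
  have Ab: "(A ^\<^sub>m k) *\<^sub>v b \<in> carrier_vec N" for k using A b by (intro mult_mat_vec_carrier[of _ N N]) auto
  have zero: "scalar_prod w ((A ^\<^sub>m k) *\<^sub>v b) = 0" if "w \<in> carrier_vec N" "num A b w = 0" for w k
    using that
  proof (induction k arbitrary: w)
    case 0
    then show ?case using step[OF 0] A b by (simp add: scalar_prod_def atLeast0LessThan)
  next
    case (Suc k)
    have "(A ^\<^sub>m Suc k) *\<^sub>v b = A *\<^sub>v ((A ^\<^sub>m k) *\<^sub>v b)"
      using A b by (simp add: comm[symmetric] assoc_mult_mat_vec[of _ N N _ N])
    then have "scalar_prod w ((A ^\<^sub>m Suc k) *\<^sub>v b) = scalar_prod (transpose_mat A *\<^sub>v w) ((A ^\<^sub>m k) *\<^sub>v b)"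
      using transpose_vec_mult_scalar[OF A Ab Suc.prems(1), of k] by simp
    then show ?case using Suc.IH[of "transpose_mat A *\<^sub>v w"] step[OF Suc.prems] A Suc.prems by simp
  qed
  have "transpose_mat K *\<^sub>v v = 0\<^sub>v N"
  proof (rule eq_vecI)
    fix k assume "k < dim_vec (0\<^sub>v N)"
    then have k: "k < N" by simp
    have "vec_index (transpose_mat K *\<^sub>v v) k = scalar_prod ((A ^\<^sub>m k) *\<^sub>v b) v"
      using K k Ab v by (simp add: K_def)
    also have "\<dots> = scalar_prod v ((A ^\<^sub>m k) *\<^sub>v b)" using Ab v by (rule comm_scalar_prod)
    also have "\<dots> = 0" by (rule zero[OF v z])
    finally show "vec_index (transpose_mat K *\<^sub>v v) k = vec_index (0\<^sub>v N) k" using k by simp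
  qed (use K in auto)
  moreover have "det (transpose_mat K) \<noteq> 0" using dK det_transpose[OF K] by simp
  ultimately show ?thesis using det_0_iff_vec_prod_zero[of "transpose_mat K" N] K v by auto
qed (use v in auto)

lemma solve_linear_system:
  fixes M :: "real Matrix.mat"
  assumes M: "M \<in> carrier_mat N N" and inj: "\<And>v. v \<in> carrier_vec N \<Longrightarrow> M *\<^sub>v v = 0\<^sub>v N \<Longrightarrow> v = 0\<^sub>v N"
    and y: "y \<in> carrier_vec N"
  shows "\<exists>v\<in>carrier_vec N. M *\<^sub>v v = y"
proof -
  have d: "det M \<noteq> 0" using det_0_iff_vec_prod_zero[OF M] inj by auto
  note adj = adj_mat[OF M]
  have "M *\<^sub>v ((1 / det M) \<cdot>\<^sub>v (adj_mat M *\<^sub>v y)) = (1 / det M) \<cdot>\<^sub>v ((M * adj_mat M) *\<^sub>v y)"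
    using M adj(1) y by (simp add: mult_mat_vec[of _ N N] assoc_mult_mat_vec[of _ N N _ N])
  also have "\<dots> = y" unfolding adj(2) using d y by (auto simp: smult_smult_assoc)
  finally show ?thesis using adj(1) y by (intro bexI[of _ "(1 / det M) \<cdot>\<^sub>v (adj_mat M *\<^sub>v y)"]) auto
qed

text \<open>Numerators depend linearly on the output vector. This map between spaces of dimension
  \<open>N\<close> is injective by controllability, hence onto.\<close>

lemma controllable_assign:
  assumes A: "A \<in> carrier_mat N N" and b: "b \<in> carrier_vec N" and ctr: "controllable N A b"
    and R: "\<And>k. k \<ge> N \<Longrightarrow> coeff R k = 0"
  shows "\<exists>v. R = (\<Sum>j<N. smult (v j) (num A b (unit_vec N j)))"
proof -
  define M where "M = Matrix.mat N N (\<lambda>(k, j). coeff (num A b (unit_vec N j)) k)"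
  have M: "M \<in> carrier_mat N N" by (simp add: M_def)
  have lin: "num A b v = (\<Sum>j<N. smult (vec_index v j) (num A b (unit_vec N j)))" for v
  proof -
    have r: "res A (unit_vec N j) i = adj_mat (char_poly_matrix A) $$ (j, i)" if "j < N" for i j
      using A that by (simp add: res_def sum.delta if_distrib[of "\<lambda>c. smult c _"] cong: if_cong)
    have "num A b v = (\<Sum>i<N. \<Sum>j<N. smult (vec_index b i) (smult (vec_index v j) (adj_mat (char_poly_matrix A) $$ (j, i))))"
      using A by (simp add: num_def res_def smult_sum2)
    also have "\<dots> = (\<Sum>j<N. \<Sum>i<N. smult (vec_index b i) (smult (vec_index v j) (adj_mat (char_poly_matrix A) $$ (j, i))))"
      by (rule sum.swap)
    also have "\<dots> = (\<Sum>j<N. smult (vec_index v j) (num A b (unit_vec N j)))"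
      using A by (simp add: num_def r smult_sum2 mult.commute)
    finally show ?thesis .
  qed
  have Mv: "vec_index (M *\<^sub>v v) k = coeff (num A b v) k" if "v \<in> carrier_vec N" "k < N" for v k
    using that M by (subst lin) (simp add: M_def scalar_prod_def coeff_sum atLeast0LessThan mult.commute)
  have "\<exists>v\<in>carrier_vec N. M *\<^sub>v v = Matrix.vec N (coeff R)"
  proof (rule solve_linear_system[OF M])
    fix v :: "real Matrix.vec" assume v: "v \<in> carrier_vec N" "M *\<^sub>v v = 0\<^sub>v N"
    have "num A b v = 0"
    proof (rule poly_eqI)
      fix k show "coeff (num A b v) k = coeff 0 k"
        using Mv[OF v(1), of k] v(2) num_coeff_ge[OF A, of k b v] by (cases "k < N") auto
    qed
    then show "v = 0\<^sub>v N" by (rule controllable_injective[OF A b ctr v(1)])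
  qed simp
  then obtain v where v: "v \<in> carrier_vec N" "M *\<^sub>v v = Matrix.vec N (coeff R)" by blast
  have "R = num A b v"
  proof (rule poly_eqI)
    fix k show "coeff R k = coeff (num A b v) k"
      using Mv[OF v(1), of k] v(2) num_coeff_ge[OF A, of k b v] R[of k] by (cases "k < N") auto
  qed
  then show ?thesis using lin[of v] by (intro exI[of _ "vec_index v"]) simp
qed

section \<open>State space systems as differential relations\<close>

context time_domain
begin

lemma lc_map_upt: "lc (map (\<lambda>i. (p i, w i)) [0..<N]) j t = (\<Sum>i<N. coeff (p i) j * w i t)"
  by (induction N) (auto simp: algebra_simps)

text \<open>The stages of the chain are the coefficients of
  \<open>- c\<^sup>T adj (s I - A) x\<close>, from the highest degree down. Their derivatives match
  the definition of a relation by \<open>coeff_res\<close>, whose degree 0 case closes the last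
  stage.\<close>

lemma state_space_rel:
  assumes A: "A \<in> carrier_mat N N"
    and x: "\<And>i. i < N \<Longrightarrow> sol (x i) (\<lambda>t. (\<Sum>j<N. A $$ (i, j) * x j t) + w i t)"
  shows "rel ((char_poly A, \<lambda>t. \<Sum>i<N. vec_index c i * x i t) # map (\<lambda>i. (- res A c i, w i)) [0..<N]) N"
    (is "rel ?xs N")
proof -
  define X where "X k t = (if k < N then - (\<Sum>i<N. coeff (res A c i) (N - Suc k) * x i t) else 0)" for k t
  note cp = char_poly_monic[OF A]
  have lc: "lc ?xs j t = coeff (char_poly A) j * (\<Sum>i<N. vec_index c i * x i t) - (\<Sum>i<N. coeff (res A c i) j * w i t)" for j t
    by (simp add: lc_map_upt sum_negf)
  have swap: "(\<Sum>i<N. coeff (res A c i) (Suc k) * (\<Sum>j<N. A $$ (i, j) * x j t))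
      = (\<Sum>j<N. (\<Sum>i<N. A $$ (i, j) * coeff (res A c i) (Suc k)) * x j t)"
      "(\<Sum>i<N. coeff (res A c i) 0 * (\<Sum>j<N. A $$ (i, j) * x j t))
      = (\<Sum>j<N. (\<Sum>i<N. A $$ (i, j) * coeff (res A c i) 0) * x j t)" for k t
    unfolding sum_distrib_left sum_distrib_right by (subst sum.swap, simp add: mult_ac)+
  have top: "lc ?xs N t + X 0 t = 0" for t
  proof (cases N)
    case (Suc M)
    have "coeff (res A c i) N = 0" if "i < N" for i by (rule coeff_res_ge[OF A that]) simp
    moreover have "coeff (res A c i) M = vec_index c i" if "i < N" for i
      using coeff_res(1)[OF A that, of c M] coeff_res_ge[OF A, of _ N c] cp Suc by simp
    ultimately show ?thesis unfolding lc X_def using cp Suc by simp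
  qed (simp add: lc X_def)
  have der: "sol (X k) (\<lambda>t. lc ?xs (N - Suc k) t + X (Suc k) t)" if k: "k < N" for k
  proof -
    have "sol (\<lambda>t. - (\<Sum>i<N. coeff (res A c i) (N - Suc k) * x i t))
      (\<lambda>t. - (\<Sum>i<N. coeff (res A c i) (N - Suc k) * ((\<Sum>j<N. A $$ (i, j) * x j t) + w i t)))"
      by (intro sol_minus sol_sum sol_cmult x) auto
    then show ?thesis
    proof (rule sol_cong)
      fix t
      show "- (\<Sum>i<N. coeff (res A c i) (N - Suc k) * x i t) = X k t" using k by (simp add: X_def)
      show "- (\<Sum>i<N. coeff (res A c i) (N - Suc k) * ((\<Sum>j<N. A $$ (i, j) * x j t) + w i t)) = lc ?xs (N - Suc k) t + X (Suc k) t"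
      proof (cases "N - Suc k")
        case 0
        have "(\<Sum>j<N. (\<Sum>i<N. A $$ (i, j) * coeff (res A c i) 0) * x j t) = (\<Sum>j<N. - (vec_index c j * coeff (char_poly A) 0) * x j t)"
          by (intro sum.cong refl arg_cong[of _ _ "\<lambda>z. z * _"]) (use coeff_res(2)[OF A, of _ c] in force)
        then have "(\<Sum>i<N. coeff (res A c i) 0 * (\<Sum>j<N. A $$ (i, j) * x j t)) = - (coeff (char_poly A) 0 * (\<Sum>i<N. vec_index c i * x i t))"
          unfolding swap by (simp add: sum_negf sum_distrib_left mult_ac)
        then show ?thesis using 0 unfolding lc X_def by (simp add: distrib_left sum.distrib)
      next
        case (Suc m)
        have m: "N - Suc (Suc k) = m" "Suc k < N" using Suc by auto
        have "(\<Sum>j<N. (\<Sum>i<N. A $$ (i, j) * coeff (res A c i) (Suc m)) * x j t)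
          = (\<Sum>j<N. (coeff (res A c j) m - vec_index c j * coeff (char_poly A) (Suc m)) * x j t)"
          by (intro sum.cong refl arg_cong[of _ _ "\<lambda>z. z * _"]) (use coeff_res(1)[OF A, of _ c m] in force)
        then have "(\<Sum>i<N. coeff (res A c i) (Suc m) * (\<Sum>j<N. A $$ (i, j) * x j t))
            = (\<Sum>i<N. coeff (res A c i) m * x i t) - coeff (char_poly A) (Suc m) * (\<Sum>i<N. vec_index c i * x i t)"
          unfolding swap by (simp add: left_diff_distrib right_diff_distrib sum_subtractf sum_distrib_left mult_ac)
        then show ?thesis using Suc m unfolding lc X_def by (simp add: distrib_left sum.distrib)
      qed
    qed
  qed
  have deg: "degree p \<le> N" if "(p, z) \<in> set ?xs" for p z
    using that cp degree_res[OF A, of _ c] by (force simp: less_imp_le)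
  have "\<forall>(p, z)\<in>set ?xs. degree p \<le> N" "\<forall>t\<in>I. X N t = 0" using deg by (blast, simp add: X_def)
  then show ?thesis unfolding rel_def using top der by blast
qed

lemma state_sdom:
  assumes A: "A \<in> carrier_mat N N" "hurwitz_poly (char_poly A)"
    and x: "\<And>i. i < N \<Longrightarrow> sol (x i) (\<lambda>t. (\<Sum>j<N. A $$ (i, j) * x j t) + w i t)"
    and w: "\<And>i. i < N \<Longrightarrow> sdom (w i) v" and k: "k < N"
  shows "sdom (x k) v"
proof -
  have "sdom (\<lambda>t. \<Sum>i<N. vec_index (unit_vec N k) i * x i t) v"
    by (rule rel_sdom[OF state_space_rel[OF A(1) x] char_poly_monic(1,2)[OF A(1)] A(2)]) (use w in auto)
  then show ?thesis
    by (rule sdom_cong) (use k in \<open>simp add: sum.delta if_distrib[of "\<lambda>z. z * _"] cong: if_cong\<close>)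
qed

section \<open>Existence of solutions\<close>

lemma at_within_I:
  assumes t: "t \<in> I" obtains b where "b \<in> I" "t \<le> b" "at t within I = at t within {0..b}"
proof (cases "\<exists>b\<in>I. t < b")
  case True
  then obtain b where b: "b \<in> I" "t < b" by auto
  have "at t within I = at t within {0..b}"
  proof (rule at_within_nhd[of t "{..<b}"])
    show "I \<inter> {..<b} - {t} = {0..b} \<inter> {..<b} - {t}" using time_nonneg by (auto intro: time_down[OF b(1)])
  qed (use b in auto)
  then show ?thesis using b that by force
next
  case False
  then have "I = {0..t}" using time_nonneg time_down[OF t] by force
  then show ?thesis using t that by blast
qed

lemma continuous_on_I:
  assumes "\<And>T. T \<in> I \<Longrightarrow> continuous_on {0..T} f" shows "continuous_on I f"
  unfolding continuous_on_eq_continuous_within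
proof
  fix t assume t: "t \<in> I"
  obtain b where b: "b \<in> I" "t \<le> b" "at t within I = at t within {0..b}" using at_within_I[OF t] .
  have "continuous (at t within {0..b}) f"
    using assms[OF b(1)] b time_nonneg[OF t] by (auto simp: continuous_on_eq_continuous_within)
  then show "continuous (at t within I) f" by (simp only: b(3))
qed

lemma J_exp_bound:
  assumes w: "continuous_on I w" and t: "t \<in> I" and k: "k > 0" and A: "A \<ge> 0"
    and le: "\<And>s. s \<in> {0..t} \<Longrightarrow> \<bar>w s\<bar> \<le> A * exp (k * s)"
  shows "\<bar>J w t\<bar> \<le> A / k * exp (k * t)"
proof -
  have e: "sol (\<lambda>s. (A / k) * exp (k * (s - 0))) (\<lambda>s. (A / k) * (k * exp (k * (s - 0))))"
    by (intro sol_cmult sol_exp)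
  have pos: "0 \<le> A / k" using A k by simp
  have "J w t - A / k * exp (k * (t - 0)) \<le> J w 0 - A / k * exp (k * (0 - 0))"
    by (rule sol_decreasing[OF sol_diff[OF sol_J[OF w] e] order_refl time_nonneg[OF t] t])
      (use le k in \<open>force simp: abs_le_iff\<close>)
  moreover have "- J w t - A / k * exp (k * (t - 0)) \<le> - J w 0 - A / k * exp (k * (0 - 0))"
    by (rule sol_decreasing[OF sol_diff[OF sol_minus[OF sol_J[OF w]] e] order_refl time_nonneg[OF t] t])
      (use le k in \<open>force simp: abs_le_iff\<close>)
  ultimately show ?thesis using pos by simp
qed

lemma lipschitz_continuous:
  assumes K: "finite K" and Y: "\<And>j. j \<in> K \<Longrightarrow> continuous_on I (Y j)"
    and lip: "\<And>x y. \<bar>G x - G y\<bar> \<le> L * (\<Sum>j\<in>K. \<bar>x j - y j :: real\<bar>)"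
  shows "continuous_on I (\<lambda>s. G (\<lambda>j. Y j s) :: real)"
  unfolding continuous_on
proof
  fix t assume t: "t \<in> I"
  have "((\<lambda>s. L * (\<Sum>j\<in>K. \<bar>Y j s - Y j t\<bar>)) \<longlongrightarrow> L * (\<Sum>j\<in>K. \<bar>Y j t - Y j t\<bar>)) (at t within I)"
    using Y t by (intro tendsto_intros) (auto simp: continuous_on)
  then have "((\<lambda>s. L * (\<Sum>j\<in>K. \<bar>Y j s - Y j t\<bar>)) \<longlongrightarrow> 0) (at t within I)" by simp
  then have "((\<lambda>s. G (\<lambda>j. Y j s) - G (\<lambda>j. Y j t)) \<longlongrightarrow> 0) (at t within I)"
    by (rule Lim_null_comparison[rotated]) (auto intro: always_eventually lip)
  then show "((\<lambda>s. G (\<lambda>j. Y j s)) \<longlongrightarrow> G (\<lambda>j. Y j t)) (at t within I)" by (rule LIM_zero_cancel)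
qed

text \<open>With the weight \<open>exp (2 C s)\<close> one integration gains the factor 1/2 on
  intervals of any length, because the integral of the weight is at most the weight divided by
  \<open>2 C\<close>.\<close>

lemma picard_step:
  assumes K: "finite K" and g: "\<And>i x y. i \<in> K \<Longrightarrow> \<bar>g i x - g i y\<bar> \<le> L * (\<Sum>j\<in>K. \<bar>x j - y j :: real\<bar>)" "L \<ge> 0"
    and X: "\<And>j. j \<in> K \<Longrightarrow> continuous_on I (X j)" "\<And>j. j \<in> K \<Longrightarrow> continuous_on I (Y j)"
    and t: "t \<in> I" and M: "M \<ge> 0" and C: "C > 0" "real (card K) * L \<le> C"
    and le: "\<And>s. s \<in> {0..t} \<Longrightarrow> (\<Sum>j\<in>K. \<bar>X j s - Y j s\<bar>) \<le> M * exp (2 * C * s)"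
  shows "(\<Sum>i\<in>K. \<bar>J (\<lambda>s. g i (\<lambda>j. X j s)) t - J (\<lambda>s. g i (\<lambda>j. Y j s)) t\<bar>) \<le> M / 2 * exp (2 * C * t)"
proof -
  have "\<bar>J (\<lambda>s. g i (\<lambda>j. X j s)) t - J (\<lambda>s. g i (\<lambda>j. Y j s)) t\<bar> \<le> L * M / (2 * C) * exp (2 * C * t)" if i: "i \<in> K" for i
  proof -
    have c: "continuous_on I (\<lambda>s. g i (\<lambda>j. X j s))" "continuous_on I (\<lambda>s. g i (\<lambda>j. Y j s))"
      using lipschitz_continuous[OF K] X g(1)[OF i] by auto
    have int: "w integrable_on {0..t}" if "continuous_on I w" for w :: "real \<Rightarrow> real"
      using that sub_I[OF t, of 0] by (intro integrable_continuous_interval) (auto intro: continuous_on_subset)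
    have "J (\<lambda>s. g i (\<lambda>j. X j s)) t - J (\<lambda>s. g i (\<lambda>j. Y j s)) t = J (\<lambda>s. g i (\<lambda>j. X j s) - g i (\<lambda>j. Y j s)) t"
      unfolding J_def by (rule integral_diff[symmetric]) (intro int c)+
    also have "\<bar>\<dots>\<bar> \<le> L * M / (2 * C) * exp (2 * C * t)"
    proof (rule J_exp_bound[OF _ t])
      fix s assume s: "s \<in> {0..t}"
      have "\<bar>g i (\<lambda>j. X j s) - g i (\<lambda>j. Y j s)\<bar> \<le> L * (\<Sum>j\<in>K. \<bar>X j s - Y j s\<bar>)" by (rule g(1)[OF i])
      also have "\<dots> \<le> L * (M * exp (2 * C * s))" using le[OF s] g(2) by (rule mult_left_mono)
      finally show "\<bar>g i (\<lambda>j. X j s) - g i (\<lambda>j. Y j s)\<bar> \<le> L * M * exp (2 * C * s)" by (simp add: mult.assoc)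
    qed (use c C M g(2) in \<open>auto intro: continuous_intros\<close>)
    finally show ?thesis .
  qed
  then have "(\<Sum>i\<in>K. \<bar>J (\<lambda>s. g i (\<lambda>j. X j s)) t - J (\<lambda>s. g i (\<lambda>j. Y j s)) t\<bar>) \<le> real (card K) * (L * M / (2 * C) * exp (2 * C * t))"
    by (rule sum_bounded_above)
  also have "\<dots> = real (card K) * L / C * (M / 2 * exp (2 * C * t))" using C by (simp add: field_simps)
  also have "\<dots> \<le> 1 * (M / 2 * exp (2 * C * t))" using C M by (intro mult_right_mono) auto
  finally show ?thesis by simp
qed

text \<open>The distance of two solutions is at most half of itself in the weighted norm; iterating
  makes it arbitrarily small.\<close>

lemma picard_unique:
  assumes K: "finite K" and g: "\<And>i x y. i \<in> K \<Longrightarrow> \<bar>g i x - g i y\<bar> \<le> L * (\<Sum>j\<in>K. \<bar>x j - y j :: real\<bar>)" "L \<ge> 0"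
    and X: "\<And>j. j \<in> K \<Longrightarrow> continuous_on I (X j)" "\<And>j. j \<in> K \<Longrightarrow> continuous_on I (Y j)"
    and T: "T \<in> I"
    and eq: "\<And>i t. i \<in> K \<Longrightarrow> t \<in> {0..T} \<Longrightarrow> X i t = h i t + J (\<lambda>s. g i (\<lambda>j. X j s)) t"
      "\<And>i t. i \<in> K \<Longrightarrow> t \<in> {0..T} \<Longrightarrow> Y i t = h i t + J (\<lambda>s. g i (\<lambda>j. Y j s)) t"
    and i: "i \<in> K" and t: "t \<in> {0..T}"
  shows "X i t = Y i t"
proof -
  define C where "C = real (card K) * L + 1"
  have C: "C > 0" "real (card K) * L \<le> C" using g(2) by (auto simp: C_def add_nonneg_pos)
  define e where "e t = (\<Sum>j\<in>K. \<bar>X j t - Y j t\<bar>)" for t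
  have "continuous_on I e" unfolding e_def using X by (intro continuous_intros) auto
  then obtain M where M: "\<And>s. s \<in> {0..T} \<Longrightarrow> \<bar>e s\<bar> \<le> M" using compact_bounded[OF _ T] by blast
  have M0: "M \<ge> 0" using M[of 0] time_nonneg[OF T] by force
  have "e s \<le> M * (1 / 2) ^ n * exp (2 * C * s)" if "s \<in> {0..T}" for s n
    using that
  proof (induction n arbitrary: s)
    case 0
    have "e s \<le> M * 1" using M[OF 0] by simp
    also have "\<dots> \<le> M * exp (2 * C * s)" using M0 C 0 by (intro mult_left_mono) auto
    finally show ?case by simp
  next
    case (Suc n)
    have "e s = (\<Sum>i\<in>K. \<bar>J (\<lambda>s. g i (\<lambda>j. X j s)) s - J (\<lambda>s. g i (\<lambda>j. Y j s)) s\<bar>)"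
      unfolding e_def by (intro sum.cong) (use eq Suc.prems in auto)
    also have "\<dots> \<le> (M * (1 / 2) ^ n) / 2 * exp (2 * C * s)"
    proof (rule picard_step[OF K g X _ _ C])
      show "s \<in> I" using Suc.prems time_down[OF T] by auto
      show "(\<Sum>j\<in>K. \<bar>X j u - Y j u\<bar>) \<le> M * (1 / 2) ^ n * exp (2 * C * u)" if "u \<in> {0..s}" for u
        using Suc.IH[of u] Suc.prems that by (auto simp: e_def)
    qed (use M0 in auto)
    finally show ?case by simp
  qed
  then have "\<And>n. e t \<le> M * (1 / 2) ^ n * exp (2 * C * t)" using t by blast
  moreover have "(\<lambda>n. M * (1 / 2) ^ n * exp (2 * C * t)) \<longlonglongrightarrow> M * 0 * exp (2 * C * t)"
    by (intro tendsto_intros LIMSEQ_power_zero) auto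
  ultimately have "e t \<le> M * 0 * exp (2 * C * t)" using LIMSEQ_le_const by blast
  then have "e t \<le> 0" by simp
  then have "e t = 0" unfolding e_def by (meson abs_ge_zero antisym sum_nonneg)
  then show ?thesis using i K unfolding e_def by (simp add: sum_nonneg_eq_0_iff)
qed

text \<open>The weight makes differences of successive iterates geometric on every compact part of
  \<open>I\<close>, so that a global Lipschitz constant gives the solution on all of
  \<open>I\<close> at once.\<close>

lemma picard:
  assumes K: "finite K" and g: "\<And>i x y. i \<in> K \<Longrightarrow> \<bar>g i x - g i y\<bar> \<le> L * (\<Sum>j\<in>K. \<bar>x j - y j :: real\<bar>)" "L \<ge> 0"
    and h: "\<And>i. i \<in> K \<Longrightarrow> continuous_on I (h i)"
  shows "\<exists>x. \<forall>i\<in>K. continuous_on I (x i) \<and> (\<forall>t\<in>I. x i t = h i t + J (\<lambda>s. g i (\<lambda>j. x j s)) t)"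
proof -
  define C where "C = real (card K) * L + 1"
  have C: "C > 0" "real (card K) * L \<le> C" using g(2) by (auto simp: C_def add_nonneg_pos)
  define X where "X = rec_nat h (\<lambda>n Y i t. h i t + J (\<lambda>s. g i (\<lambda>j. Y j s)) t)"
  have X0: "X 0 = h" and XS: "X (Suc n) i t = h i t + J (\<lambda>s. g i (\<lambda>j. X n j s)) t" for n i t
    by (auto simp: X_def)
  have cont: "continuous_on I (X n i)" if "i \<in> K" for n i
    using that
  proof (induction n arbitrary: i)
    case (Suc n)
    have "continuous_on I (\<lambda>s. g i (\<lambda>j. X n j s))"
      by (rule lipschitz_continuous[OF K _ g(1)[OF Suc.prems]]) (rule Suc.IH)
    then have "continuous_on I (\<lambda>t. h i t + J (\<lambda>s. g i (\<lambda>j. X n j s)) t)"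
      using h[OF Suc.prems] by (intro continuous_on_add sol_cont[OF sol_J])
    then show ?case by (simp add: XS[abs_def])
  qed (simp add: X0 h)
  \<comment> \<open>The limit is written as a telescoping series to make the Weierstrass test
    applicable.\<close>
  define x where "x i t = h i t + (\<Sum>k. X (Suc k) i t - X k i t)" for i t
  have unif: "uniform_limit {0..T} (\<lambda>n. X n i) (x i) sequentially" if i: "i \<in> K" and T: "T \<in> I" for i T
  proof -
    define e where "e n t = (\<Sum>j\<in>K. \<bar>X (Suc n) j t - X n j t\<bar>)" for n t
    have "continuous_on I (e 0)" unfolding e_def using cont by (intro continuous_intros) auto
    then obtain M where M: "\<And>s. s \<in> {0..T} \<Longrightarrow> \<bar>e 0 s\<bar> \<le> M" using compact_bounded[OF _ T] by blast
    have M0: "M \<ge> 0" using M[of 0] time_nonneg[OF T] by force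
    have e: "e n s \<le> M * (1 / 2) ^ n * exp (2 * C * s)" if "s \<in> {0..T}" for s n
      using that
    proof (induction n arbitrary: s)
      case 0
      have "e 0 s \<le> M * 1" using M[OF 0] by simp
      also have "\<dots> \<le> M * exp (2 * C * s)" using M0 C 0 by (intro mult_left_mono) auto
      finally show ?case by simp
    next
      case (Suc n)
      have "X (Suc (Suc n)) j s - X (Suc n) j s = J (\<lambda>s. g j (\<lambda>j. X (Suc n) j s)) s - J (\<lambda>s. g j (\<lambda>j. X n j s)) s" for j
        using XS[of "Suc n" j s] XS[of n j s] by linarith
      then have "e (Suc n) s = (\<Sum>i\<in>K. \<bar>J (\<lambda>s. g i (\<lambda>j. X (Suc n) j s)) s - J (\<lambda>s. g i (\<lambda>j. X n j s)) s\<bar>)"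
        unfolding e_def by simp
      also have "\<dots> \<le> (M * (1 / 2) ^ n) / 2 * exp (2 * C * s)"
      proof (rule picard_step[OF K g cont cont _ _ C])
        show "s \<in> I" using Suc.prems time_down[OF T] by auto
        show "(\<Sum>j\<in>K. \<bar>X (Suc n) j u - X n j u\<bar>) \<le> M * (1 / 2) ^ n * exp (2 * C * u)" if "u \<in> {0..s}" for u
          using Suc.IH[of u] Suc.prems that by (auto simp: e_def)
      qed (use M0 in auto)
      finally show ?case by simp
    qed
    have "uniform_limit {0..T} (\<lambda>n t. \<Sum>k<n. X (Suc k) i t - X k i t) (\<lambda>t. \<Sum>k. X (Suc k) i t - X k i t) sequentially"
    proof (rule Weierstrass_m_test)
      fix n t assume t: "t \<in> {0..T}"
      have "norm (X (Suc n) i t - X n i t) \<le> e n t"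
        unfolding e_def real_norm_def using i K by (intro member_le_sum) auto
      also have "\<dots> \<le> M * (1 / 2) ^ n * exp (2 * C * t)" by (rule e[OF t])
      also have "\<dots> \<le> M * (1 / 2) ^ n * exp (2 * C * T)" using t C M0 by (intro mult_left_mono) auto
      finally show "norm (X (Suc n) i t - X n i t) \<le> M * (1 / 2) ^ n * exp (2 * C * T)" .
    next
      show "summable (\<lambda>n. M * (1 / 2) ^ n * exp (2 * C * T))"
        by (intro summable_mult summable_mult2 summable_geometric) auto
    qed
    then have "uniform_limit {0..T} (\<lambda>n t. h i t + (\<Sum>k<n. X (Suc k) i t - X k i t)) (x i) sequentially"
      unfolding x_def[abs_def] by (intro uniform_limit_add uniform_limit_const)
    then show ?thesis by (simp add: sum_lessThan_telescope[of "\<lambda>k. X k i _"] X0)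
  qed
  have xcont: "continuous_on I (x i)" if i: "i \<in> K" for i
  proof (rule continuous_on_I)
    fix T assume T: "T \<in> I"
    show "continuous_on {0..T} (x i)"
      by (rule uniform_limit_theorem[OF _ unif[OF i T]])
        (use cont[OF i] sub_I[OF T, of 0] in \<open>auto intro!: always_eventually intro: continuous_on_subset\<close>)
  qed
  have "x i t = h i t + J (\<lambda>s. g i (\<lambda>j. x j s)) t" if i: "i \<in> K" and t: "t \<in> I" for i t
  proof -
    have "uniform_limit {0..t} (\<lambda>n s. g i (\<lambda>j. X n j s)) (\<lambda>s. g i (\<lambda>j. x j s)) sequentially"
    proof (rule uniform_limitI)
      fix \<epsilon> :: real assume \<epsilon>: "\<epsilon> > 0"
      define \<delta> where "\<delta> = \<epsilon> / C"
      have \<delta>: "\<delta> > 0" using \<epsilon> C by (simp add: \<delta>_def)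
      have "\<forall>\<^sub>F n in sequentially. \<forall>j\<in>K. \<forall>s\<in>{0..t}. dist (X n j s) (x j s) < \<delta>"
        using K uniform_limitD[OF unif[OF _ t] \<delta>] by (simp add: eventually_ball_finite)
      then show "\<forall>\<^sub>F n in sequentially. \<forall>s\<in>{0..t}. dist (g i (\<lambda>j. X n j s)) (g i (\<lambda>j. x j s)) < \<epsilon>"
      proof (rule eventually_mono, intro ballI)
        fix n s assume n: "\<forall>j\<in>K. \<forall>s\<in>{0..t}. dist (X n j s) (x j s) < \<delta>" and s: "s \<in> {0..t}"
        have "\<bar>g i (\<lambda>j. X n j s) - g i (\<lambda>j. x j s)\<bar> \<le> L * (\<Sum>j\<in>K. \<bar>X n j s - x j s\<bar>)" by (rule g(1)[OF i])
        also have "\<dots> \<le> L * (real (card K) * \<delta>)"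
          using n s by (intro mult_left_mono g(2) sum_bounded_above) (auto simp: dist_real_def less_imp_le)
        also have "\<dots> < C * \<delta>" using \<delta> by (simp add: C_def algebra_simps)
        finally show "dist (g i (\<lambda>j. X n j s)) (g i (\<lambda>j. x j s)) < \<epsilon>" using C by (simp add: dist_real_def \<delta>_def)
      qed
    qed
    moreover have "continuous_on {0..t} (\<lambda>s. g i (\<lambda>j. X n j s))" for n
    proof -
      have "continuous_on I (\<lambda>s. g i (\<lambda>j. X n j s))" by (rule lipschitz_continuous[OF K _ g(1)[OF i]]) (rule cont)
      then show ?thesis using sub_I[OF t, of 0] by (auto intro: continuous_on_subset)
    qed
    ultimately obtain A B where AB: "\<And>n. ((\<lambda>s. g i (\<lambda>j. X n j s)) has_integral A n) {0..t}"
      "((\<lambda>s. g i (\<lambda>j. x j s)) has_integral B) {0..t}" "A \<longlonglongrightarrow> B"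
      by (rule uniform_limit_integral) auto
    have "A = (\<lambda>n. J (\<lambda>s. g i (\<lambda>j. X n j s)) t)" "B = J (\<lambda>s. g i (\<lambda>j. x j s)) t"
      by (simp_all add: J_def fun_eq_iff integral_unique[OF AB(1)] integral_unique[OF AB(2)])
    then have "(\<lambda>n. X (Suc n) i t) \<longlonglongrightarrow> h i t + J (\<lambda>s. g i (\<lambda>j. x j s)) t"
      unfolding XS using AB(3) by (auto intro: tendsto_add)
    moreover have "(\<lambda>n. X (Suc n) i t) \<longlonglongrightarrow> x i t"
      using tendsto_uniform_limitI[OF unif[OF i t], of t] time_nonneg[OF t] by (auto intro: LIMSEQ_Suc)
    ultimately show ?thesis using LIMSEQ_unique by blast
  qed
  then show ?thesis using xcont by blast
qed

lemma linear_exists: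
  fixes A :: "real Matrix.mat"
  assumes w: "\<And>i. i < N \<Longrightarrow> continuous_on I (w i)"
  shows "\<exists>x. \<forall>i<N. x i 0 = c i \<and> sol (x i) (\<lambda>t. (\<Sum>j<N. A $$ (i, j) * x j t) + w i t)"
proof -
  define L where "L = (\<Sum>i<N. \<Sum>j<N. \<bar>A $$ (i, j)\<bar>)"
  have L: "\<bar>A $$ (i, j)\<bar> \<le> L" if "i < N" "j < N" for i j
  proof -
    have "\<bar>A $$ (i, j)\<bar> \<le> (\<Sum>j<N. \<bar>A $$ (i, j)\<bar>)" using that by (intro member_le_sum) auto
    also have "\<dots> \<le> L" unfolding L_def using that member_le_sum[of i "{..<N}" "\<lambda>i. \<Sum>j<N. \<bar>A $$ (i, j)\<bar>"] by (auto intro: sum_nonneg)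
    finally show ?thesis .
  qed
  have "\<exists>x. \<forall>i\<in>{..<N}. continuous_on I (x i) \<and>
     (\<forall>t\<in>I. x i t = (c i + J (w i) t) + J (\<lambda>s. (\<lambda>i x. \<Sum>j<N. A $$ (i, j) * x j) i (\<lambda>j. x j s)) t)"
  proof (rule picard[where L = L])
    fix i and x y :: "nat \<Rightarrow> real" assume i: "i \<in> {..<N}"
    have "\<bar>(\<Sum>j<N. A $$ (i, j) * x j) - (\<Sum>j<N. A $$ (i, j) * y j)\<bar> = \<bar>\<Sum>j<N. A $$ (i, j) * (x j - y j)\<bar>"
      by (simp add: right_diff_distrib sum_subtractf)
    also have "\<dots> \<le> (\<Sum>j<N. \<bar>A $$ (i, j)\<bar> * \<bar>x j - y j\<bar>)" using sum_abs by (metis (mono_tags, lifting) abs_mult sum.cong)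
    also have "\<dots> \<le> (\<Sum>j<N. L * \<bar>x j - y j\<bar>)" using L i by (intro sum_mono mult_right_mono) auto
    finally show "\<bar>(\<Sum>j<N. A $$ (i, j) * x j) - (\<Sum>j<N. A $$ (i, j) * y j)\<bar> \<le> L * (\<Sum>j<N. \<bar>x j - y j\<bar>)"
      by (simp add: sum_distrib_left)
  next
    show "L \<ge> 0" by (auto simp: L_def intro: sum_nonneg)
  next
    fix i assume i: "i \<in> {..<N}"
    show "continuous_on I (\<lambda>t. c i + J (w i) t)" using w i by (intro continuous_intros sol_cont[OF sol_J]) auto
  qed simp
  then obtain x where "\<forall>i\<in>{..<N}. continuous_on I (x i) \<and>
     (\<forall>t\<in>I. x i t = (c i + J (w i) t) + J (\<lambda>s. (\<lambda>i x. \<Sum>j<N. A $$ (i, j) * x j) i (\<lambda>j. x j s)) t)" by blast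
  then have x: "\<And>i. i < N \<Longrightarrow> continuous_on I (x i)"
    "\<And>i t. i < N \<Longrightarrow> t \<in> I \<Longrightarrow> x i t = (c i + J (w i) t) + J (\<lambda>s. \<Sum>j<N. A $$ (i, j) * x j s) t"
    by (metis lessThan_iff, simp)
  have "x i 0 = c i \<and> sol (x i) (\<lambda>t. (\<Sum>j<N. A $$ (i, j) * x j t) + w i t)" if i: "i < N" for i
  proof
    show "x i 0 = c i" using x(2)[OF i zero_mem] by simp
    have "sol (\<lambda>t. (c i + J (w i) t) + J (\<lambda>s. \<Sum>j<N. A $$ (i, j) * x j s) t) (\<lambda>t. (0 + w i t) + (\<Sum>j<N. A $$ (i, j) * x j t))"
      using w i x by (intro sol_add sol_const sol_J continuous_intros) auto
    then show "sol (x i) (\<lambda>t. (\<Sum>j<N. A $$ (i, j) * x j t) + w i t)"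
      by (rule sol_cong) (use x(2)[OF i] in auto)
  qed
  then show ?thesis by blast
qed

lemma J_cong: "(\<And>s. s \<in> {0..t} \<Longrightarrow> v s = w s) \<Longrightarrow> J v t = J w t"
  unfolding J_def by (rule integral_cong) auto

end

section \<open>From local to global solutions\<close>

definition clamp_abs :: "real \<Rightarrow> real \<Rightarrow> real" where
  "clamp_abs R v = max (- R) (min R v)"

lemma clamp_abs_lipschitz: "\<bar>clamp_abs R a - clamp_abs R b\<bar> \<le> \<bar>a - b\<bar>"
  by (auto simp: clamp_abs_def max_def min_def)

lemma clamp_abs_bound: "0 \<le> R \<Longrightarrow> \<bar>clamp_abs R a\<bar> \<le> R"
  by (auto simp: clamp_abs_def)

lemma clamp_abs_id: "\<bar>a\<bar> \<le> R \<Longrightarrow> clamp_abs R a = a"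
  by (auto simp: clamp_abs_def)

text \<open>Clamping the coordinates turns local Lipschitz continuity into a global one, and the
  clamped solution is genuine as long as it stays inside the box. These pieces are glued to a
  solution on the interval \<open>I\<close> of all times reached, where \<open>apriori\<close>
  supplies a bound. A clamp level beyond that bound shows that \<open>I\<close> is
  unbounded.\<close>

lemma ode_global:
  fixes g :: "'i \<Rightarrow> ('i \<Rightarrow> real) \<Rightarrow> real"
  assumes K: "finite K" and h: "\<And>i. i \<in> K \<Longrightarrow> continuous_on {0..} (h i)"
    and lip: "\<And>R. 0 \<le> R \<Longrightarrow> \<exists>L\<ge>0. \<forall>i\<in>K. \<forall>x y. (\<forall>j\<in>K. \<bar>x j\<bar> \<le> R \<and> \<bar>y j\<bar> \<le> R) \<longrightarrow> \<bar>g i x - g i y\<bar> \<le> L * (\<Sum>j\<in>K. \<bar>x j - y j\<bar>)"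
    and apriori: "\<And>I x. time_domain I {} \<Longrightarrow>
       (\<And>i. i \<in> K \<Longrightarrow> continuous_on I (x i)) \<Longrightarrow>
       (\<And>i t. i \<in> K \<Longrightarrow> t \<in> I \<Longrightarrow> x i t = h i t + time_domain.J (\<lambda>s. g i (\<lambda>j. x j s)) t) \<Longrightarrow>
       \<exists>B. \<forall>i\<in>K. \<forall>t\<in>I. \<bar>x i t\<bar> \<le> B"
  shows "\<exists>x. \<forall>i\<in>K. continuous_on {0..} (x i) \<and> (\<forall>t\<ge>0. x i t = h i t + time_domain.J (\<lambda>s. g i (\<lambda>j. x j s)) t)"
proof -
  interpret T: time_domain "{0..}" "{}" by unfold_locales auto
  define gR where "gR R i x = g i (\<lambda>j. clamp_abs (real R) (x j))" for R i x
  have "\<exists>L\<ge>0. \<forall>i\<in>K. \<forall>x y. \<bar>gR R i x - gR R i y\<bar> \<le> L * (\<Sum>j\<in>K. \<bar>x j - y j\<bar>)" for R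
  proof -
    obtain L where L: "L \<ge> 0" "\<forall>i\<in>K. \<forall>x y. (\<forall>j\<in>K. \<bar>x j\<bar> \<le> real R \<and> \<bar>y j\<bar> \<le> real R) \<longrightarrow> \<bar>g i x - g i y\<bar> \<le> L * (\<Sum>j\<in>K. \<bar>x j - y j\<bar>)"
      using lip[of "real R"] by auto
    have "\<bar>gR R i x - gR R i y\<bar> \<le> L * (\<Sum>j\<in>K. \<bar>x j - y j\<bar>)" if i: "i \<in> K" for i x y
    proof -
      have "\<bar>gR R i x - gR R i y\<bar> \<le> L * (\<Sum>j\<in>K. \<bar>clamp_abs (real R) (x j) - clamp_abs (real R) (y j)\<bar>)"
        unfolding gR_def using L(2) i clamp_abs_bound by auto
      also have "\<dots> \<le> L * (\<Sum>j\<in>K. \<bar>x j - y j\<bar>)"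
        using L(1) clamp_abs_lipschitz by (intro mult_left_mono sum_mono) auto
      finally show ?thesis .
    qed
    then show ?thesis using L(1) by blast
  qed
  then obtain L where L: "\<And>R. L R \<ge> 0" "\<And>R i x y. i \<in> K \<Longrightarrow> \<bar>gR R i x - gR R i y\<bar> \<le> L R * (\<Sum>j\<in>K. \<bar>x j - y j\<bar>)"
    by metis
  have "\<exists>x. \<forall>i\<in>K. continuous_on {0..} (x i) \<and> (\<forall>t\<in>{0..}. x i t = h i t + T.J (\<lambda>s. gR R i (\<lambda>j. x j s)) t)" for R
    by (rule T.picard[OF K L(2)[of _ R] L(1)[of R] h])
  then obtain X where X: "\<And>R i. i \<in> K \<Longrightarrow> continuous_on {0..} (X R i)"
    "\<And>R i t. i \<in> K \<Longrightarrow> 0 \<le> t \<Longrightarrow> X R i t = h i t + T.J (\<lambda>s. gR R i (\<lambda>j. X R j s)) t"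
    by (metis atLeast_iff)
  \<comment> \<open>Up to time \<open>t\<close> clamping at level \<open>R\<close> has no effect on
    this solution.\<close>
  define good where "good R t \<longleftrightarrow> (\<forall>s\<in>{0..t}. \<forall>i\<in>K. \<bar>X R i s\<bar> \<le> real R)" for R t
  \<comment> \<open>The Lipschitz estimate at distance 0 shows that \<open>g i\<close> depends only
    on the coordinates in \<open>K\<close>.\<close>
  have g_cong: "g i x = g i y" if "i \<in> K" "\<And>j. j \<in> K \<Longrightarrow> x j = y j" for i x y
  proof -
    define B where "B = (\<Sum>j\<in>K. \<bar>x j\<bar>)"
    have B: "\<bar>x j\<bar> \<le> B" if "j \<in> K" for j using that K member_le_sum[of j K "\<lambda>j. \<bar>x j\<bar>"] by (auto simp: B_def)
    have "0 \<le> B" by (auto simp: B_def intro: sum_nonneg)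
    then obtain L where L: "\<forall>i\<in>K. \<forall>x y. (\<forall>j\<in>K. \<bar>x j\<bar> \<le> B \<and> \<bar>y j\<bar> \<le> B) \<longrightarrow> \<bar>g i x - g i y\<bar> \<le> L * (\<Sum>j\<in>K. \<bar>x j - y j\<bar>)"
      using lip[of B] by blast
    have "\<forall>j\<in>K. \<bar>x j\<bar> \<le> B \<and> \<bar>y j\<bar> \<le> B" using B that(2) by metis
    then have "\<bar>g i x - g i y\<bar> \<le> L * (\<Sum>j\<in>K. \<bar>x j - y j\<bar>)" using L that(1) by blast
    also have "\<dots> = 0" using that(2) by simp
    finally show ?thesis by simp
  qed
  have unclamp: "gR R i (\<lambda>j. X R' j s) = g i (\<lambda>j. X R' j s)" if "i \<in> K" "\<And>j. j \<in> K \<Longrightarrow> \<bar>X R' j s\<bar> \<le> real R" for R R' i s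
    unfolding gR_def using that by (intro g_cong) (auto simp: clamp_abs_id)
  have agree: "X R i s = X R' i s" if R: "good R t" "\<And>s i. s \<in> {0..t} \<Longrightarrow> i \<in> K \<Longrightarrow> \<bar>X R i s\<bar> \<le> real R'"
    and t: "0 \<le> t" "s \<in> {0..t}" "i \<in> K" for R R' s t i
  proof (rule T.picard_unique[OF K L(2)[of _ R'] L(1)[of R'], where X = "X R" and Y = "X R'" and T = t and h = h])
    fix j u assume j: "j \<in> K" and u: "u \<in> {0..t}"
    have "T.J (\<lambda>s. gR R j (\<lambda>j. X R j s)) u = T.J (\<lambda>s. gR R' j (\<lambda>j. X R j s)) u"
      using R u j unfolding good_def by (intro T.J_cong) (auto simp: unclamp)
    then show "X R j u = h j u + T.J (\<lambda>s. gR R' j (\<lambda>j. X R j s)) u" using X(2)[OF j, of u R] u by simp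
    show "X R' j u = h j u + T.J (\<lambda>s. gR R' j (\<lambda>j. X R' j s)) u" using X(2)[OF j, of u R'] u by simp
  qed (use t X in auto)
  define I where "I = {t. 0 \<le> t \<and> (\<exists>R. good R t)}"
  define x where "x i t = X (LEAST R. good R t) i t" for i t
  have good_down: "good R s" if "good R t" "s \<le> t" for R s t using that by (auto simp: good_def)
  have good_up: "good R' t" if "good R t" "R \<le> R'" "0 \<le> t" for R R' t
  proof -
    have "\<bar>X R i s\<bar> \<le> real R'" if "s \<in> {0..t}" "i \<in> K" for s i
      using \<open>good R t\<close> \<open>R \<le> R'\<close> that unfolding good_def by force
    then show ?thesis using agree[OF that(1), of R'] that(3) unfolding good_def by metis
  qed
  have xX: "x i s = X R i s" if "good R t" "s \<in> {0..t}" "i \<in> K" for R t s i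
  proof -
    have gs: "good R s" using that good_down by auto
    define R0 where "R0 = (LEAST R. good R s)"
    have "good R0 s" "R0 \<le> R" using gs by (auto simp: R0_def intro: LeastI Least_le)
    then have le: "\<bar>X R0 i u\<bar> \<le> real R" if "u \<in> {0..s}" "i \<in> K" for u i
      using that order_trans[of "\<bar>X R0 i u\<bar>" "real R0" "real R"] unfolding good_def by simp
    have "X R0 i s = X R i s" by (rule agree[OF \<open>good R0 s\<close> le]) (use that in auto)
    then show ?thesis by (simp add: x_def R0_def)
  qed
  obtain R00 where R00: "(\<Sum>i\<in>K. \<bar>h i 0\<bar>) \<le> real R00" using real_arch_simple by blast
  have "good R00 0" unfolding good_def
  proof (intro ballI)
    fix s i assume "s \<in> {0..0::real}" and i: "i \<in> K"
    then have "X R00 i s = h i 0" using X(2)[OF i, of 0 R00] by simp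
    then show "\<bar>X R00 i s\<bar> \<le> real R00" using R00 i K member_le_sum[of i K "\<lambda>i. \<bar>h i 0\<bar>"] by simp
  qed
  then interpret TI: time_domain I "{}" by unfold_locales (auto simp: I_def intro: good_down)
  have xcont: "continuous_on I (x i)" if i: "i \<in> K" for i
  proof (rule TI.continuous_on_I)
    fix t assume "t \<in> I"
    then obtain R where "good R t" by (auto simp: I_def)
    then have "continuous_on {0..t} (x i) \<longleftrightarrow> continuous_on {0..t} (X R i)"
      using xX i by (intro continuous_on_cong) auto
    then show "continuous_on {0..t} (x i)" using X(1)[OF i, of R] by (auto intro: continuous_on_subset)
  qed
  have xeq: "x i t = h i t + T.J (\<lambda>s. g i (\<lambda>j. x j s)) t" if i: "i \<in> K" and t: "t \<in> I" for i t
  proof -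
    obtain R where R: "good R t" using t by (auto simp: I_def)
    have "T.J (\<lambda>s. g i (\<lambda>j. x j s)) t = T.J (\<lambda>s. gR R i (\<lambda>j. X R j s)) t"
    proof (rule T.J_cong)
      fix s assume s: "s \<in> {0..t}"
      have "g i (\<lambda>j. x j s) = g i (\<lambda>j. X R j s)" using xX[OF R s] i by (intro g_cong) auto
      also have "\<dots> = gR R i (\<lambda>j. X R j s)" using R s i by (intro unclamp[symmetric]) (auto simp: good_def)
      finally show "g i (\<lambda>j. x j s) = gR R i (\<lambda>j. X R j s)" .
    qed
    then show ?thesis using xX[OF R, of t i] X(2)[OF i, of t R] t i by (auto simp: I_def)
  qed
  obtain B where B: "\<And>i t. i \<in> K \<Longrightarrow> t \<in> I \<Longrightarrow> \<bar>x i t\<bar> \<le> B"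
    using apriori[OF TI.time_domain_axioms xcont xeq] by blast
  \<comment> \<open>\<open>B\<close> bounds single coordinates, \<open>B'\<close> their sum
    \<open>F\<close>. The level \<open>R\<close> exceeds \<open>B'\<close> by at least 1, which
    leaves room for a crossing at \<open>B' + 1 / 2\<close>.\<close>
  define B' where "B' = real (card K) * \<bar>B\<bar>"
  obtain R where R: "B' + 1 \<le> real R" using real_arch_simple by blast
  have xR: "x i s = X R i s" if t: "t \<in> I" "s \<in> {0..t}" "i \<in> K" for t s i
  proof -
    obtain R0 where R0: "good R0 t" using t by (auto simp: I_def)
    have sub: "u \<in> I" if "u \<in> {0..t}" for u using t that TI.time_down by auto
    have "\<bar>X R0 j u\<bar> \<le> real R" if "u \<in> {0..t}" "j \<in> K" for u j
    proof -
      have "0 < card K" using K that(2) card_gt_0_iff by blast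
      then have "\<bar>B\<bar> \<le> B'" unfolding B'_def using mult_right_mono[of 1 "real (card K)" "\<bar>B\<bar>"] by simp
      then show ?thesis using xX[OF R0 that] B[OF that(2) sub[OF that(1)]] R by linarith
    qed
    then have "X R0 i s = X R i s" by (rule agree[OF R0]) (use t in \<open>auto simp: I_def\<close>)
    then show ?thesis using xX[OF R0 t(2,3)] by simp
  qed
  define F where "F t = (\<Sum>i\<in>K. \<bar>X R i t\<bar>)" for t
  have Fc: "continuous_on {0..} F" unfolding F_def using X(1) by (intro continuous_intros) auto
  have FI: "F t \<le> B'" if t: "t \<in> I" for t
  proof -
    have "F t \<le> (\<Sum>i\<in>K. \<bar>B\<bar>)" unfolding F_def
    proof (rule sum_mono)
      fix i assume i: "i \<in> K"
      have "x i t = X R i t" using t i by (intro xR[OF t]) (auto simp: I_def)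
      then show "\<bar>X R i t\<bar> \<le> \<bar>B\<bar>" using B[OF i t] by simp
    qed
    then show ?thesis by (simp add: B'_def)
  qed
  \<comment> \<open>Otherwise \<open>F\<close> reaches \<open>B' + 1 / 2\<close> for a first time
    \<open>c\<close>. Up to \<open>c\<close> the clamp at \<open>R\<close> is inactive, so
    \<open>c\<close> lies in \<open>I\<close>, where \<open>F\<close> is at most
    \<open>B'\<close>.\<close>
  have all: "t1 \<in> I" if t1: "0 \<le> t1" for t1
  proof (rule ccontr)
    assume "t1 \<notin> I"
    then have "\<not> good R t1" using t1 by (auto simp: I_def)
    then obtain s1 i where s1: "s1 \<in> {0..t1}" "i \<in> K" "real R < \<bar>X R i s1\<bar>" by (auto simp: good_def not_le)
    have "\<bar>X R i s1\<bar> \<le> F s1" unfolding F_def using s1(2) K by (intro member_le_sum[of i K "\<lambda>i. \<bar>X R i s1\<bar>"]) auto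
    then have Fs1: "B' + 1 / 2 \<le> F s1" using s1 R by linarith
    define A where "A = {s \<in> {0..s1}. B' + 1 / 2 \<le> F s}"
    have "compact A"
    proof -
      have "closed ({0..s1} \<inter> F -` {B' + 1 / 2..})"
        using Fc by (intro continuous_closed_preimage) (auto intro: continuous_on_subset)
      moreover have "A = {0..s1} \<inter> ({0..s1} \<inter> F -` {B' + 1 / 2..})" by (auto simp: A_def)
      ultimately show ?thesis using compact_Int_closed[OF compact_Icc] by metis
    qed
    moreover have "A \<noteq> {}" using Fs1 s1 by (auto simp: A_def)
    ultimately obtain c where c: "c \<in> A" "\<And>s. s \<in> A \<Longrightarrow> c \<le> s" using compact_attains_inf by metis
    have c0: "0 \<le> c" "c \<le> s1" "B' + 1 / 2 \<le> F c" using c(1) by (auto simp: A_def)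
    have "F 0 \<le> B'" by (rule FI[OF TI.zero_mem])
    moreover have "continuous_on {0..c} F" using Fc by (rule continuous_on_subset) auto
    ultimately obtain c' where c': "0 \<le> c'" "c' \<le> c" "F c' = B' + 1 / 2"
      using IVT'[of F 0 "B' + 1 / 2" c] c0 by auto
    then have "c' \<in> A" using c0 by (auto simp: A_def)
    then have Fcc: "F c = B' + 1 / 2" using c(2)[of c'] c' by auto
    have F1: "F s \<le> B' + 1 / 2" if "s \<in> {0..c}" for s
    proof (cases "s = c")
      case False
      then have "s \<notin> A" using c(2) that by force
      then show ?thesis using that c0 by (auto simp: A_def)
    qed (simp add: Fcc)
    have F2: "\<bar>X R j s\<bar> \<le> F s" if "j \<in> K" for j s
      unfolding F_def using that K by (intro member_le_sum[of j K "\<lambda>i. \<bar>X R i s\<bar>"]) auto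
    have "\<bar>X R j s\<bar> \<le> real R" if "s \<in> {0..c}" "j \<in> K" for j s using F1[OF that(1)] F2[OF that(2), of s] R by linarith
    then have "good R c" unfolding good_def by blast
    then have "c \<in> I" using c0 by (auto simp: I_def)
    then show False using FI[of c] Fcc by simp
  qed
  then have "I = {0..}" by (auto simp: I_def)
  then show ?thesis using xcont xeq by auto
qed

section \<open>A Kalman-Yakubovich-Popov lemma for polynomials\<close>

lemma right_limit_nonneg:
  assumes "isCont f (a::real)" "\<And>x. x > a \<Longrightarrow> 0 \<le> (f x :: real)" shows "0 \<le> f a"
proof (rule tendsto_lowerbound[of f "f a" "at_right a"])
  show "(f \<longlongrightarrow> f a) (at_right a)" using assms(1) by (simp add: isCont_def filterlim_at_split)
  show "\<forall>\<^sub>F x in at_right a. 0 \<le> f x" using assms(2) by (auto simp: eventually_at_right_field intro: exI[of _ "a + 1"])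
qed auto

lemma left_limit_nonneg:
  assumes "isCont f (a::real)" "\<And>x. x < a \<Longrightarrow> 0 \<le> (f x :: real)" shows "0 \<le> f a"
proof (rule tendsto_lowerbound[of f "f a" "at_left a"])
  show "(f \<longlongrightarrow> f a) (at_left a)" using assms(1) by (simp add: isCont_def filterlim_at_split)
  show "\<forall>\<^sub>F x in at_left a. 0 \<le> f x" using assms(2) by (auto simp: eventually_at_left_field intro: exI[of _ "a - 1"])
qed auto

lemma poly_map_cnj: "poly (map_poly cnj p) z = cnj (poly p (cnj z))"
  by (induction p) (auto simp: map_poly_pCons)

lemma poly_of_real_cnj: "poly (map_poly complex_of_real p) (cnj z) = cnj (poly (map_poly complex_of_real p) z)"
  by (induction p) (auto simp: map_poly_pCons)

lemma map_poly_of_real_ring: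
  "map_poly complex_of_real (p + q) = map_poly complex_of_real p + map_poly complex_of_real q"
  "map_poly complex_of_real (p - q) = map_poly complex_of_real p - map_poly complex_of_real q"
  "map_poly complex_of_real (p * q) = map_poly complex_of_real p * map_poly complex_of_real q"
  by (intro poly_eqI; simp add: coeff_map_poly coeff_mult)+

lemma poly_zero_on_line:
  fixes p :: "complex poly"
  assumes "\<And>x::real. poly p (f x) = 0" "inj f" shows "p = 0"
proof (rule ccontr)
  assume "p \<noteq> 0"
  then have "finite {z. poly p z = 0}" by (rule poly_roots_finite)
  then have "finite (range f)" by (rule finite_subset[rotated]) (use assms in auto)
  then show False using assms(2) finite_imageD infinite_UNIV_char_0 by blast
qed

lemma isCont_poly_of_real: "isCont (\<lambda>x. poly p (complex_of_real x)) a"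
  by (intro continuous_intros)

text \<open>Nonreal roots of a polynomial that is real on the real axis come in conjugate pairs, and
  real roots of a nonnegative one are at least double. Splitting off two roots contributes
  \<open>|x - z|\<^sup>2\<close>, and induction on the degree finishes.\<close>

lemma nonneg_poly_cmod_square:
  fixes H :: "complex poly"
  assumes "\<And>x::real. Im (poly H (of_real x)) = 0 \<and> 0 \<le> Re (poly H (of_real x))"
  shows "\<exists>h. degree H = 2 * degree h \<and> (\<forall>x::real. Re (poly H (of_real x)) = (cmod (poly h (of_real x)))\<^sup>2)"
  using assms
proof (induction "degree H" arbitrary: H rule: less_induct)
  case less
  show ?case
  proof (cases "degree H = 0")
    case True
    then obtain c where c: "H = [:c:]" by (metis degree_eq_zeroE)
    then have "0 \<le> Re c" using less.prems[of 0] by simp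
    then show ?thesis by (intro exI[of _ "[:complex_of_real (sqrt (Re c)):]"]) (simp add: c)
  next
    case False
    then obtain z where z: "poly H z = 0"
      using fundamental_theorem_of_algebra[of H] by (auto simp: constant_degree)
    then obtain H1 where H1: "H = [:-z, 1:] * H1" by (metis dvdE poly_eq_0_iff_dvd)
    have H0: "H \<noteq> 0" using False by auto
    have "\<exists>H2. H = [:-z, 1:] * ([:- cnj z, 1:] * H2) \<and>
      (\<forall>x::real. Im (poly H2 (of_real x)) = 0 \<and> 0 \<le> Re (poly H2 (of_real x)))"
    proof (cases "Im z = 0")
      case False
      have "map_poly cnj H - H = 0"
      proof (rule poly_zero_on_line[of _ complex_of_real])
        fix x :: real
        show "poly (map_poly cnj H - H) (complex_of_real x) = 0"
          using less.prems[of x] by (simp add: poly_map_cnj complex_eq_iff)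
      qed (simp add: inj_def)
      then have "poly H (cnj z) = 0" using z poly_map_cnj[of H "cnj z"] by simp
      moreover have "cnj z \<noteq> z" using False by (auto simp: complex_eq_iff)
      ultimately have "poly H1 (cnj z) = 0" unfolding H1 by simp
      then obtain H2 where H2: "H1 = [:- cnj z, 1:] * H2" by (metis dvdE poly_eq_0_iff_dvd)
      have "Im (poly H2 (of_real x)) = 0 \<and> 0 \<le> Re (poly H2 (of_real x))" for x :: real
      proof -
        have e: "poly H (of_real x) = of_real ((cmod (of_real x - z))\<^sup>2) * poly H2 (of_real x)"
          unfolding H1 H2 complex_norm_square by (simp add: algebra_simps)
        have "(cmod (of_real x - z))\<^sup>2 > 0" using False by (auto simp: complex_eq_iff)
        then show ?thesis using less.prems[of x] unfolding e by (simp add: zero_le_mult_iff)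
      qed
      then show ?thesis using H1 H2 by blast
    next
      case True
      then obtain a where a: "z = complex_of_real a" by (metis complex_is_Real_iff Reals_cases)
      have e1: "poly H (of_real x) = of_real (x - a) * poly H1 (of_real x)" for x
        unfolding H1 a by (simp add: algebra_simps)
      have c1: "isCont (\<lambda>x. Re (poly H1 (complex_of_real x))) a" "isCont (\<lambda>x. Im (poly H1 (complex_of_real x))) a"
        by - (rule isCont_Re isCont_Im, rule isCont_poly_of_real)+
      have s1: "Im (poly H1 (of_real x)) = 0" if "x \<noteq> a" for x using less.prems[of x] that unfolding e1 by simp
      have s2: "0 \<le> Re (poly H1 (of_real x))" if "x > a" for x
        using less.prems[of x] that unfolding e1 by (simp add: zero_le_mult_iff)
      have s3: "0 \<le> - Re (poly H1 (of_real x))" if "x < a" for x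
        using less.prems[of x] that unfolding e1 by (simp add: zero_le_mult_iff)
      \<comment> \<open>The quotient of a nonnegative function by \<open>x - a\<close> is
        nonnegative on the right of \<open>a\<close> and nonpositive on the left, so by continuity
        it vanishes at \<open>a\<close>: the root is double.\<close>
      have "0 \<le> Re (poly H1 (of_real a))" "0 \<le> - Re (poly H1 (of_real a))"
        using right_limit_nonneg[OF c1(1) s2] left_limit_nonneg[of a "\<lambda>x. - Re (poly H1 (complex_of_real x))"] s3 c1(1)
        by (auto intro: continuous_intros)
      moreover have "0 \<le> Im (poly H1 (of_real a))" "0 \<le> - Im (poly H1 (of_real a))"
        using right_limit_nonneg[OF c1(2)] right_limit_nonneg[of a "\<lambda>x. - Im (poly H1 (complex_of_real x))"] s1 c1(2)
        by (auto intro: continuous_intros)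
      ultimately have "poly H1 z = 0" unfolding a by (simp add: complex_eq_iff)
      then obtain H2 where H2: "H1 = [:- z, 1:] * H2" by (metis dvdE poly_eq_0_iff_dvd)
      have e2: "poly H (of_real x) = of_real ((x - a)\<^sup>2) * poly H2 (of_real x)" for x
        unfolding e1 H2 a by (simp add: algebra_simps power2_eq_square)
      have c2: "isCont (\<lambda>x. Re (poly H2 (complex_of_real x))) a" "isCont (\<lambda>x. Im (poly H2 (complex_of_real x))) a"
        by - (rule isCont_Re isCont_Im, rule isCont_poly_of_real)+
      have t: "Im (poly H2 (of_real x)) = 0 \<and> 0 \<le> Re (poly H2 (of_real x))" if "x \<noteq> a" for x
        using less.prems[of x] that unfolding e2 by (simp add: zero_le_mult_iff)
      have "0 \<le> Re (poly H2 (of_real a))" "0 \<le> Im (poly H2 (of_real a))" "0 \<le> - Im (poly H2 (of_real a))"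
        using right_limit_nonneg[OF c2(1)] right_limit_nonneg[OF c2(2)]
          right_limit_nonneg[of a "\<lambda>x. - Im (poly H2 (complex_of_real x))"] t c2
        by (auto intro: continuous_intros)
      then have "Im (poly H2 (of_real x)) = 0 \<and> 0 \<le> Re (poly H2 (of_real x))" for x :: real
        using t[of x] by (cases "x = a") auto
      moreover have "cnj z = z" by (simp add: a)
      ultimately show ?thesis using H1 H2 by auto
    qed
    then obtain H2 where H2: "H = [:-z, 1:] * ([:- cnj z, 1:] * H2)"
      "\<And>x::real. Im (poly H2 (of_real x)) = 0 \<and> 0 \<le> Re (poly H2 (of_real x))" by blast
    have H20: "H2 \<noteq> 0" using H0 H2(1) by auto
    have d: "degree H = 2 + degree H2" unfolding H2(1)
      using H20 degree_mult_eq[of "[:- cnj z, 1:]" H2] degree_mult_eq[of "[:- z, 1:]" "[:- cnj z, 1:] * H2"]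
      by (simp del: mult_pCons_left)
    then obtain h where h: "degree H2 = 2 * degree h" "\<And>x::real. Re (poly H2 (of_real x)) = (cmod (poly h (of_real x)))\<^sup>2"
      using less.hyps[of H2] H2(2) by auto
    show ?thesis
    proof (cases "h = 0")
      case True
      then have "poly H2 (of_real x) = 0" for x using h(2)[of x] H2(2)[of x] by (simp add: complex_eq_iff)
      then have "H2 = 0" by (intro poly_zero_on_line[of _ complex_of_real]) (auto simp: inj_def)
      then show ?thesis using H20 by simp
    next
      case False
      have "Re (poly H (of_real x)) = (cmod (poly ([:-z, 1:] * h) (of_real x)))\<^sup>2" for x
      proof -
        have "poly H (of_real x) = of_real ((cmod (of_real x - z))\<^sup>2) * poly H2 (of_real x)"
          unfolding H2 complex_norm_square by (simp add: algebra_simps)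
        moreover have "poly ([:-z, 1:] * h) (of_real x) = (of_real x - z) * poly h (of_real x)" by (simp add: algebra_simps)
        ultimately show ?thesis using h(2)[of x] by (simp add: norm_mult power_mult_distrib del: mult_pCons_left)
      qed
      moreover have "degree ([:-z, 1:] * h) = 1 + degree h" using False by (subst degree_mult_eq) auto
      ultimately show ?thesis using d h(1) by (intro exI[of _ "[:-z, 1:] * h"]) simp
    qed
  qed
qed

text \<open>On the line \<open>s = - \<kappa> + i w\<close> the left side is a nonnegative
  polynomial in \<open>w\<close>, hence a square modulus. A single real factor would require a
  selection of roots; two real polynomials, the real and imaginary parts of the coefficients,
  suffice for the quadratic form.\<close>

lemma spectral_factor:
  fixes p q :: "real poly"
  assumes pos: "\<And>w::real. 0 \<le> Re (poly (map_poly complex_of_real q) (Complex (- \<kappa>) w) * cnj (poly (map_poly complex_of_real p) (Complex (- \<kappa>) w)))"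
    and deg: "degree p \<le> N" "degree q < N"
  shows "\<exists>d1 d2. degree d1 < N \<and> degree d2 < N \<and> (\<forall>w.
    2 * Re (poly (map_poly complex_of_real q) (Complex (- \<kappa>) w) * cnj (poly (map_poly complex_of_real p) (Complex (- \<kappa>) w)))
    = (cmod (poly (map_poly complex_of_real d1) (Complex (- \<kappa>) w)))\<^sup>2 + (cmod (poly (map_poly complex_of_real d2) (Complex (- \<kappa>) w)))\<^sup>2)"
proof -
  define pc where "pc = map_poly complex_of_real p"
  define qc where "qc = map_poly complex_of_real q"
  have pqdeg: "degree pc \<le> N" "degree qc < N" using deg by (auto simp: pc_def qc_def degree_map_poly)
  define sub where "sub = [:- complex_of_real \<kappa>, \<i>:]"
  have sub: "poly sub (of_real w) = Complex (- \<kappa>) w" for w by (simp add: sub_def complex_eq_iff)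
  define ps where "ps = pcompose pc sub"
  define qs where "qs = pcompose qc sub"
  define G where "G w = 2 * Re (poly qc (Complex (- \<kappa>) w) * cnj (poly pc (Complex (- \<kappa>) w)))" for w
  define H where "H = qs * map_poly cnj ps + map_poly cnj qs * ps"
  have Hx: "poly H (of_real w) = of_real (G w)" for w
    by (simp add: H_def ps_def qs_def G_def poly_map_cnj poly_pcompose sub complex_eq_iff)
  have dcnj: "degree (map_poly cnj r) = degree r" for r by (rule degree_map_poly) auto
  have ds: "degree ps \<le> N" "degree qs < N"
    using pqdeg by (auto simp: ps_def qs_def degree_pcompose sub_def)
  have "degree H < 2 * N" unfolding H_def
    using ds degree_mult_le[of qs "map_poly cnj ps"] degree_mult_le[of "map_poly cnj qs" ps]
    by (intro degree_add_less) (auto simp: dcnj)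
  moreover have Gpos: "0 \<le> G w" for w using pos[of w] unfolding G_def pc_def qc_def by (rule mult_nonneg_nonneg[rotated]) simp
  have "\<exists>h. degree H = 2 * degree h \<and> (\<forall>x::real. Re (poly H (of_real x)) = (cmod (poly h (of_real x)))\<^sup>2)"
    by (rule nonneg_poly_cmod_square) (simp add: Hx Gpos)
  then obtain h where h: "degree H = 2 * degree h" "\<And>x::real. Re (poly H (of_real x)) = (cmod (poly h (of_real x)))\<^sup>2"
    by blast
  ultimately have dh: "degree h < N" by simp
  \<comment> \<open>Transports the factor back from \<open>w\<close> to \<open>s\<close> by
    \<open>w = - i (s + \<kappa>)\<close>.\<close>
  define d where "d = pcompose h [:- (\<i> * complex_of_real \<kappa>), - \<i>:]"
  have dd: "degree d < N" using dh by (simp add: d_def degree_pcompose)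
  have dx: "poly d (Complex (- \<kappa>) w) = poly h (of_real w)" for w
  proof -
    have "- (\<i> * complex_of_real \<kappa>) + Complex (- \<kappa>) w * - \<i> = of_real w" by (simp add: complex_eq_iff)
    then show ?thesis by (simp add: d_def poly_pcompose)
  qed
  define d1 where "d1 = map_poly Re d"
  define d2 where "d2 = map_poly Im d"
  have "degree d1 \<le> degree d" "degree d2 \<le> degree d" by (auto simp: d1_def d2_def intro: map_poly_degree_leq)
  then have dg: "degree d1 < N" "degree d2 < N" using dd by auto
  have split: "d = map_poly complex_of_real d1 + smult \<i> (map_poly complex_of_real d2)"
    by (rule poly_eqI) (simp add: d1_def d2_def coeff_map_poly complex_eq_iff)
  have "G w = (cmod (poly (map_poly complex_of_real d1) (Complex (- \<kappa>) w)))\<^sup>2 + (cmod (poly (map_poly complex_of_real d2) (Complex (- \<kappa>) w)))\<^sup>2" for w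
  proof -
    define s where "s = Complex (- \<kappa>) w"
    define a where "a = poly (map_poly complex_of_real d1) s"
    define b where "b = poly (map_poly complex_of_real d2) s"
    have cs: "Complex (- \<kappa>) (- w) = cnj s" by (simp add: s_def complex_eq_iff)
    have G: "G w = (cmod (poly d (Complex (- \<kappa>) w)))\<^sup>2" for w using h(2)[of w] by (simp add: Hx dx)
    have 1: "G w = (cmod (a + \<i> * b))\<^sup>2" unfolding G by (simp add: split a_def b_def s_def)
    have 2: "G (- w) = (cmod (cnj a + \<i> * cnj b))\<^sup>2" unfolding G cs by (simp add: split a_def b_def poly_of_real_cnj)
    \<comment> \<open>\<open>G\<close> is even since \<open>p\<close> and \<open>q\<close> are real.
      Adding the two expressions at \<open>w\<close> and \<open>- w\<close> removes the mixed terms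
      of \<open>a\<close> and \<open>b\<close>.\<close>
    have "G (- w) = G w" unfolding G_def cs pc_def qc_def poly_of_real_cnj s_def by simp
    then show ?thesis using 1 2 unfolding a_def[symmetric] b_def[symmetric] s_def[symmetric] cmod_power2
      by (simp add: power2_eq_square algebra_simps)
  qed
  then show ?thesis using dg unfolding G_def pc_def qc_def by blast
qed

lemma pcompose_as_poly: "poly (map_poly (\<lambda>a. [:a:]) p) x = pcompose p (x :: real poly)"
  by (induction p) (auto simp: map_poly_pCons pcompose_pCons)

text \<open>Regard \<open>\<pi>\<close> as the coefficients of a polynomial in two variables. The
  identity on the line says that it vanishes when the second variable is
  \<open>- 2 \<kappa> - s\<close>, so it is divisible by the sum of the variables plus
  \<open>2 \<kappa>\<close>. The quotient \<open>b\<close> is the future Lyapunov matrix.\<close>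

lemma bivariate_division:
  fixes p q d1 d2 :: "real poly"
  defines "\<pi> \<equiv> \<lambda>i j. coeff q i * coeff p j + coeff p i * coeff q j - coeff d1 i * coeff d1 j - coeff d2 i * coeff d2 j"
  assumes line: "\<And>w. 2 * Re (poly (map_poly complex_of_real q) (Complex (- \<kappa>) w) * cnj (poly (map_poly complex_of_real p) (Complex (- \<kappa>) w)))
    = (cmod (poly (map_poly complex_of_real d1) (Complex (- \<kappa>) w)))\<^sup>2 + (cmod (poly (map_poly complex_of_real d2) (Complex (- \<kappa>) w)))\<^sup>2"
  shows "\<exists>b D. (\<forall>i j. D < i \<or> D < j \<longrightarrow> b i j = 0) \<and>
    (\<forall>i j. \<pi> i j = 2 * \<kappa> * b i j + (case i of 0 \<Rightarrow> 0 | Suc k \<Rightarrow> b k j) + (case j of 0 \<Rightarrow> 0 | Suc k \<Rightarrow> b i k))"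
proof -
  \<comment> \<open>On the line with real part \<open>- \<kappa>\<close> the substitution
    \<open>- 2 \<kappa> - s\<close> is complex conjugation.\<close>
  define \<sigma> where "\<sigma> = [:- 2 * \<kappa>, - 1:]"
  define E where "E = q * pcompose p \<sigma> + p * pcompose q \<sigma> - d1 * pcompose d1 \<sigma> - d2 * pcompose d2 \<sigma>"
  have "map_poly complex_of_real E = 0"
  proof (rule poly_zero_on_line[of _ "\<lambda>w. Complex (- \<kappa>) w"])
    fix w
    let ?s = "Complex (- \<kappa>) w"
    have "poly (map_poly complex_of_real \<sigma>) ?s = cnj ?s" by (simp add: \<sigma>_def map_poly_pCons complex_eq_iff)
    then have pc: "poly (map_poly complex_of_real (pcompose r \<sigma>)) ?s = cnj (poly (map_poly complex_of_real r) ?s)" for r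
      by (simp add: of_real_hom.map_poly_pcompose poly_pcompose poly_of_real_cnj)
    have "poly (map_poly complex_of_real E) ?s = 2 * Re (poly (map_poly complex_of_real q) ?s * cnj (poly (map_poly complex_of_real p) ?s))
      - (cmod (poly (map_poly complex_of_real d1) ?s))\<^sup>2 - (cmod (poly (map_poly complex_of_real d2) ?s))\<^sup>2"
      unfolding E_def of_real_diff complex_norm_square
      by (simp add: map_poly_of_real_ring pc) (simp add: complex_eq_iff)
    then show "poly (map_poly complex_of_real E) ?s = 0" using line[of w] by (simp flip: of_real_diff of_real_power)
  qed (simp add: inj_def)
  then have E0: "E = 0" by simp
  define L where "L = map_poly (\<lambda>a::real. [:a:])"
  define PP where "PP = smult q (L p) + smult p (L q) - smult d1 (L d1) - smult d2 (L d2)"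
  have cL: "coeff (L r) j = [:coeff r j:]" for r j by (simp add: L_def coeff_map_poly)
  have cPP: "coeff (coeff PP j) i = \<pi> i j" for i j by (simp add: PP_def cL \<pi>_def mult.commute)
  have "poly PP \<sigma> = E" by (simp add: PP_def E_def L_def pcompose_as_poly)
  then obtain QQ where QQ: "PP = [:- \<sigma>, 1:] * QQ" using E0 by (metis dvdE poly_eq_0_iff_dvd)
  define b where "b i j = coeff (coeff QQ j) i" for i j
  have "\<pi> i j = 2 * \<kappa> * b i j + (case i of 0 \<Rightarrow> 0 | Suc k \<Rightarrow> b k j) + (case j of 0 \<Rightarrow> 0 | Suc k \<Rightarrow> b i k)" for i j
    unfolding cPP[symmetric] QQ \<sigma>_def b_def by (simp add: coeff_pCons split: nat.splits)
  moreover define D where "D = degree QQ + (\<Sum>j\<le>degree QQ. degree (coeff QQ j))"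
  have "b i j = 0" if "D < i \<or> D < j" for i j
  proof (cases "j \<le> degree QQ")
    case True
    then have "degree (coeff QQ j) \<le> (\<Sum>j\<le>degree QQ. degree (coeff QQ j))"
      using member_le_sum[of j "{..degree QQ}" "\<lambda>j. degree (coeff QQ j)"] by simp
    then have "degree (coeff QQ j) < i" using that True by (auto simp: D_def)
    then show ?thesis by (simp add: b_def coeff_eq_0)
  qed (simp add: b_def coeff_eq_0)
  ultimately show ?thesis by blast
qed

text \<open>The quotient has degree below \<open>N\<close> in its first variable; its top
  coefficients vanish one after another from the degree bound downwards.\<close>

lemma division_vanish:
  fixes b \<pi> :: "nat \<Rightarrow> nat \<Rightarrow> real"
  assumes "\<And>i j. D < i \<Longrightarrow> b i j = 0"
    and "\<And>i j. \<pi> i j = c * b i j + (case i of 0 \<Rightarrow> 0 | Suc k \<Rightarrow> b k j) + (case j of 0 \<Rightarrow> 0 | Suc k \<Rightarrow> b i k)"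
    and "\<And>i j. N < i \<Longrightarrow> \<pi> i j = 0" and "N \<le> i"
  shows "b i j = 0"
proof -
  have "b i j = 0" if "N \<le> i" "D < i + d" for i j d
    using that
  proof (induction d arbitrary: i j)
    case (Suc d)
    then have "b (Suc i) j = 0" for j by auto
    then show ?case using assms(2)[of "Suc i" j] assms(3)[of "Suc i" j] Suc.prems by (simp split: nat.splits)
  qed (use assms(1) in auto)
  from this[of i "Suc D" j] assms(4) show ?thesis by simp
qed

lemma sum_case_shift:
  fixes f :: "nat \<Rightarrow> nat \<Rightarrow> real"
  shows "(\<Sum>i\<le>N. (case i of 0 \<Rightarrow> 0 | Suc k \<Rightarrow> f k i)) = (\<Sum>k<N. f k (Suc k))"
  by (simp only: lessThan_Suc_atMost[symmetric] sum.lessThan_Suc_shift) simp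

definition qf :: "nat \<Rightarrow> (nat \<Rightarrow> nat \<Rightarrow> real) \<Rightarrow> (nat \<Rightarrow> real) \<Rightarrow> real" where
  "qf N B x = (\<Sum>i<N. \<Sum>j<N. B i j * x i * x j)"

text \<open>Read a monomial of bidegree \<open>(i, j)\<close> as \<open>x i * x j\<close>.
  Multiplying by a variable shifts an index, which is differentiation along a chain of derivatives,
  so the division becomes an identity for the derivative of the form. The inequality results from
  dropping the squares of \<open>d1\<close> and \<open>d2\<close>; comparing coefficients of degree
  \<open>N\<close> gives the last column of \<open>B\<close>.\<close>

lemma kyp_identity:
  fixes p q :: "real poly"
  assumes pos: "\<And>w::real. 0 \<le> Re (poly (map_poly complex_of_real q) (Complex (- \<kappa>) w) * cnj (poly (map_poly complex_of_real p) (Complex (- \<kappa>) w)))"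
    and deg: "degree p = N" "degree q < N" and p: "monic p"
  shows "\<exists>B. (\<forall>i j. B i j = B j i) \<and> (\<forall>i<N. B i (N - 1) = coeff q i) \<and>
    (\<forall>x. 2 * (\<Sum>i<N. \<Sum>j<N. B i j * x i * x (Suc j))
       \<le> 2 * (\<Sum>i\<le>N. coeff q i * x i) * (\<Sum>i\<le>N. coeff p i * x i) - 2 * \<kappa> * qf N B x)"
proof -
  obtain d1 d2 where d: "degree d1 < N" "degree d2 < N" and line: "\<And>w.
    2 * Re (poly (map_poly complex_of_real q) (Complex (- \<kappa>) w) * cnj (poly (map_poly complex_of_real p) (Complex (- \<kappa>) w)))
    = (cmod (poly (map_poly complex_of_real d1) (Complex (- \<kappa>) w)))\<^sup>2 + (cmod (poly (map_poly complex_of_real d2) (Complex (- \<kappa>) w)))\<^sup>2"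
    using spectral_factor[OF pos, of N] deg by auto
  define \<pi> where "\<pi> i j = coeff q i * coeff p j + coeff p i * coeff q j - coeff d1 i * coeff d1 j - coeff d2 i * coeff d2 j" for i j
  obtain b D where b: "\<And>i j. D < i \<or> D < j \<Longrightarrow> b i j = 0"
    "\<And>i j. \<pi> i j = 2 * \<kappa> * b i j + (case i of 0 \<Rightarrow> 0 | Suc k \<Rightarrow> b k j) + (case j of 0 \<Rightarrow> 0 | Suc k \<Rightarrow> b i k)"
    using bivariate_division[OF line] unfolding \<pi>_def by blast
  have sym: "\<pi> i j = \<pi> j i" for i j by (simp add: \<pi>_def mult.commute)
  have big: "\<pi> i j = 0" if "N < i" for i j using that deg d by (simp add: \<pi>_def coeff_eq_0)
  have z1: "b i j = 0" if "N \<le> i" for i j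
    by (rule division_vanish[of D b \<pi> "2 * \<kappa>" N, OF _ b(2)]) (use b(1) big that in auto)
  have b': "\<pi> i j = 2 * \<kappa> * b j i + (case i of 0 \<Rightarrow> 0 | Suc k \<Rightarrow> b j k) + (case j of 0 \<Rightarrow> 0 | Suc k \<Rightarrow> b k i)" for i j
    using b(2)[of j i] sym[of i j] by simp
  have z2: "b i j = 0" if "N \<le> j" for i j
    by (rule division_vanish[of D "\<lambda>i j. b j i" \<pi> "2 * \<kappa>" N j i, OF _ b']) (use b(1) big that in auto)
  \<comment> \<open>\<open>\<pi>\<close> is symmetric, so the quotient may be symmetrized without
    changing the identity.\<close>
  define B where "B i j = (b i j + b j i) / 2" for i j
  have B: "\<pi> i j = 2 * \<kappa> * B i j + (case i of 0 \<Rightarrow> 0 | Suc k \<Rightarrow> B k j) + (case j of 0 \<Rightarrow> 0 | Suc k \<Rightarrow> B i k)" for i j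
    using b(2)[of i j] b(2)[of j i] sym[of i j] by (cases i; cases j) (auto simp: B_def field_simps)
  have Bz: "B i j = 0" "B j i = 0" if "N \<le> i" for i j using z1[OF that] z2[OF that] by (auto simp: B_def)
  have Bs: "B i j = B j i" for i j by (simp add: B_def)
  have last: "B i (N - 1) = coeff q i" if i: "i < N" for i
  proof -
    obtain M where M: "N = Suc M" using i by (cases N) auto
    have "\<pi> i N = coeff q i" using deg d p i by (simp add: \<pi>_def coeff_eq_0)
    moreover have "\<pi> i N = B i M" using B[of i N] Bz(2)[of N] unfolding M by (simp split: nat.splits)
    ultimately show ?thesis by (simp add: M)
  qed
  have "2 * (\<Sum>i<N. \<Sum>j<N. B i j * x i * x (Suc j))
       \<le> 2 * (\<Sum>i\<le>N. coeff q i * x i) * (\<Sum>i\<le>N. coeff p i * x i) - 2 * \<kappa> * qf N B x" for x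
  proof -
    have cut: "(\<Sum>j\<le>N. B i j * f j) = (\<Sum>j<N. B i j * f j)" for i and f :: "nat \<Rightarrow> real"
      using Bz(2)[of N i] by (simp add: lessThan_Suc_atMost[symmetric])
    have prod: "(\<Sum>i\<le>N. \<Sum>j\<le>N. (f i * g j) * x i * x j) = (\<Sum>i\<le>N. f i * x i) * (\<Sum>j\<le>N. g j * x j)" for f g
      unfolding sum_product by (intro sum.cong refl) simp
    have "(\<Sum>i\<le>N. \<Sum>j\<le>N. \<pi> i j * x i * x j) = 2 * (\<Sum>i\<le>N. coeff q i * x i) * (\<Sum>i\<le>N. coeff p i * x i)
        - (\<Sum>i\<le>N. coeff d1 i * x i)\<^sup>2 - (\<Sum>i\<le>N. coeff d2 i * x i)\<^sup>2"
      unfolding \<pi>_def left_diff_distrib distrib_right sum_subtractf sum.distrib prod by (simp add: power2_eq_square)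
    moreover have "(\<Sum>i\<le>N. \<Sum>j\<le>N. \<pi> i j * x i * x j) = 2 * \<kappa> * qf N B x + 2 * (\<Sum>i<N. \<Sum>j<N. B i j * x i * x (Suc j))"
    proof -
      have t1: "(\<Sum>i\<le>N. \<Sum>j\<le>N. 2 * \<kappa> * B i j * x i * x j) = 2 * \<kappa> * qf N B x"
      proof -
        have "(\<Sum>i\<le>N. \<Sum>j\<le>N. 2 * \<kappa> * B i j * x i * x j) = (\<Sum>i\<le>N. \<Sum>j<N. B i j * (2 * \<kappa> * x i * x j))"
        proof (rule sum.cong[OF refl])
          fix i
          show "(\<Sum>j\<le>N. 2 * \<kappa> * B i j * x i * x j) = (\<Sum>j<N. B i j * (2 * \<kappa> * x i * x j))"
            unfolding cut[symmetric] by (intro sum.cong refl) (simp add: mult_ac)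
        qed
        also have "\<dots> = (\<Sum>i<N. \<Sum>j<N. B i j * (2 * \<kappa> * x i * x j))"
          using Bz(1)[of N] by (simp add: lessThan_Suc_atMost[symmetric])
        finally show ?thesis by (simp add: qf_def sum_distrib_left mult_ac)
      qed
      have t3: "(\<Sum>i\<le>N. \<Sum>j\<le>N. (case j of 0 \<Rightarrow> 0 | Suc k \<Rightarrow> B i k) * x i * x j) = (\<Sum>i<N. \<Sum>j<N. B i j * x i * x (Suc j))"
      proof -
        have "(\<Sum>i\<le>N. \<Sum>j\<le>N. (case j of 0 \<Rightarrow> 0 | Suc k \<Rightarrow> B i k) * x i * x j)
          = (\<Sum>i\<le>N. \<Sum>j\<le>N. (case j of 0 \<Rightarrow> 0 | Suc k \<Rightarrow> B i k * x i * x j))"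
          by (intro sum.cong refl) (simp split: nat.splits)
        also have "\<dots> = (\<Sum>i\<le>N. \<Sum>k<N. B i k * x i * x (Suc k))" by (simp only: sum_case_shift)
        also have "\<dots> = (\<Sum>i<N. \<Sum>j<N. B i j * x i * x (Suc j))"
          using Bz(1)[of N] by (simp add: lessThan_Suc_atMost[symmetric])
        finally show ?thesis .
      qed
      have t2: "(\<Sum>i\<le>N. \<Sum>j\<le>N. (case i of 0 \<Rightarrow> 0 | Suc k \<Rightarrow> B k j) * x i * x j) = (\<Sum>i<N. \<Sum>j<N. B i j * x i * x (Suc j))"
        unfolding t3[symmetric] by (subst sum.swap) (simp add: Bs mult_ac cong: nat.case_cong)
      show ?thesis unfolding B distrib_right sum.distrib t1 t2 t3 by simp
    qed
    ultimately show ?thesis using zero_le_power2[of "\<Sum>i\<le>N. coeff d1 i * x i"] zero_le_power2[of "\<Sum>i\<le>N. coeff d2 i * x i"] by linarith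
  qed
  then show ?thesis using Bs last by blast
qed

text \<open>Transposed, so that the states are successive derivatives and the index shift of
  \<open>kyp_identity\<close> is the dynamics.\<close>

definition companion :: "nat \<Rightarrow> real poly \<Rightarrow> real Matrix.mat" where
  "companion N p = transpose_mat (observer_canonical_mat N p)"

lemma companion_carrier [simp]: "companion N p \<in> carrier_mat N N"
  by (simp add: companion_def)

lemma char_poly_companion: "monic p \<Longrightarrow> degree p = N \<Longrightarrow> char_poly (companion N p) = p"
  using observer_canonical(1)[of p N] char_poly_transpose_mat[OF observer_canonical_carrier[of N p]]
  by (simp add: companion_def)

lemma companion_row:
  assumes "i < N"
  shows "(\<Sum>j<N. companion N p $$ (i, j) * x j) = (if Suc i < N then x (Suc i) else - (\<Sum>j<N. coeff p j * x j))"
proof (cases "Suc i < N")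
  case True
  have "(\<Sum>j<N. companion N p $$ (i, j) * x j) = (\<Sum>j<N. if j = Suc i then x j else 0)"
    using assms True by (intro sum.cong) (auto simp: companion_def observer_canonical_mat_def)
  then show ?thesis using True by (simp add: sum.delta)
next
  case False
  then have "i = N - 1" using assms by simp
  then have "(\<Sum>j<N. companion N p $$ (i, j) * x j) = (\<Sum>j<N. - (coeff p j * x j))"
    using assms by (intro sum.cong) (auto simp: companion_def observer_canonical_mat_def)
  then show ?thesis using False by (simp add: sum_negf)
qed

lemma qf_symmetric_deriv:
  fixes B :: "nat \<Rightarrow> nat \<Rightarrow> real"
  assumes "\<And>i j. B i j = B j i"
  shows "(\<Sum>i<N. \<Sum>j<N. B i j * dx i * x j + B i j * x i * dx j) = 2 * (\<Sum>i<N. \<Sum>j<N. B i j * x i * dx j)"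
proof -
  have "(\<Sum>i<N. \<Sum>j<N. B i j * dx i * x j) = (\<Sum>i<N. \<Sum>j<N. B i j * x i * dx j)"
  proof -
    have s: "B i j * dx i * x j = B j i * x j * dx i" for i j using assms[of i j] by (simp add: mult_ac)
    have "(\<Sum>i<N. \<Sum>j<N. B i j * dx i * x j) = (\<Sum>i<N. \<Sum>j<N. B j i * x j * dx i)" by (intro sum.cong refl s)
    also have "\<dots> = (\<Sum>i<N. \<Sum>j<N. B i j * x i * dx j)" by (rule sum.swap)
    finally show ?thesis .
  qed
  then show ?thesis by (simp add: sum.distrib)
qed

context time_domain
begin

lemma sol_qf:
  assumes "\<And>i j. B i j = B j i" "\<And>i. i < N \<Longrightarrow> sol (x i) (dx i)"
  shows "sol (\<lambda>t. qf N B (\<lambda>i. x i t)) (\<lambda>t. 2 * (\<Sum>i<N. \<Sum>j<N. B i j * x i t * dx j t))"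
proof -
  have "sol (\<lambda>t. \<Sum>i<N. \<Sum>j<N. B i j * (x i t * x j t)) (\<lambda>t. \<Sum>i<N. \<Sum>j<N. B i j * (x i t * dx j t + dx i t * x j t))"
    using assms(2) by (intro sol_sum sol_cmult sol_mult) auto
  then show ?thesis
  proof (rule sol_cong)
    fix t
    show "(\<Sum>i<N. \<Sum>j<N. B i j * (x i t * dx j t + dx i t * x j t)) = 2 * (\<Sum>i<N. \<Sum>j<N. B i j * x i t * dx j t)"
      unfolding qf_symmetric_deriv[where dx = "\<lambda>i. dx i t", OF assms(1), symmetric]
      by (intro sum.cong refl) (simp add: algebra_simps)
  qed (simp add: qf_def mult.assoc)
qed

end

text \<open>Along the free companion system started at \<open>x0\<close> the form satisfies
  \<open>W' \<le> - 2 \<kappa> W\<close>. A negative start would force \<open>W\<close> below a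
  negative multiple of \<open>exp (- 2 \<kappa> t)\<close>, whereas the roots allow
  \<open>|W|\<close> only the faster decay \<open>exp (- 3 \<kappa> t)\<close>.\<close>

lemma qf_nonneg:
  fixes p q :: "real poly"
  assumes p: "monic p" "degree p = N" and q: "degree q < N" and \<kappa>: "\<kappa> > 0"
    and roots: "\<forall>s. poly (map_poly complex_of_real p) s = 0 \<longrightarrow> 2 * Re s < - (3 * \<kappa>)"
    and B: "\<And>i j. B i j = B j i"
    "\<And>x. 2 * (\<Sum>i<N. \<Sum>j<N. B i j * x i * x (Suc j))
       \<le> 2 * (\<Sum>i\<le>N. coeff q i * x i) * (\<Sum>i\<le>N. coeff p i * x i) - 2 * \<kappa> * qf N B x"
  shows "0 \<le> qf N B x0"
proof (rule ccontr)
  assume neg: "\<not> 0 \<le> qf N B x0"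
  interpret T: time_domain "{0..}" "{}" by unfold_locales auto
  let ?A = "companion N p"
  obtain x where x: "\<And>i. i < N \<Longrightarrow> x i 0 = x0 i" "\<And>i. i < N \<Longrightarrow> T.sol (x i) (\<lambda>t. (\<Sum>j<N. ?A $$ (i, j) * x j t) + 0)"
    using T.linear_exists[of N "\<lambda>i t. 0" x0 ?A] by auto
  have "\<exists>c. \<forall>t\<ge>0. (x k t)\<^sup>2 \<le> c * exp (- (3 * \<kappa>) * t)" if k: "k < N" for k
  proof -
    have "T.rel ((char_poly ?A, \<lambda>t. \<Sum>i<N. vec_index (unit_vec N k) i * x i t) # map (\<lambda>i. (- res ?A (unit_vec N k) i, \<lambda>t. 0)) [0..<N]) N"
      by (rule T.state_space_rel[OF companion_carrier]) (rule x(2))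
    moreover have "(\<lambda>t. \<Sum>i<N. vec_index (unit_vec N k) i * x i t) = x k"
      using k by (auto simp: sum.delta if_distrib[of "\<lambda>z. z * _"] cong: if_cong)
    ultimately have r: "T.rel ((p, x k) # map (\<lambda>i. (- res ?A (unit_vec N k) i, \<lambda>t. 0)) [0..<N]) N"
      by (simp add: char_poly_companion[OF p])
    have c0: "\<forall>(q, w)\<in>set (map (\<lambda>i. (- res ?A (unit_vec N k) i, \<lambda>t. 0::real)) [0..<N]). coeff q N = 0"
      using coeff_res_ge[OF companion_carrier] by auto
    have ss: "T.ssq (map (\<lambda>i. (- res ?A (unit_vec N k) i, \<lambda>t. 0)) [0..<N]) t = 0" for t
      by (simp add: o_def case_prod_beta)
    obtain K V dV where V: "T.sol V dV" "\<forall>t\<in>{0..}. (x k t)\<^sup>2 \<le> V t" "\<forall>t\<in>{0..} - {}. dV t \<le> - (3 * \<kappa>) * V t + 0"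
      using T.rel_stable[OF r p roots c0] unfolding ss by auto
    have "(x k t)\<^sup>2 \<le> V 0 * exp (- (3 * \<kappa>) * t)" if "0 \<le> t" for t
      using T.sol_decay[OF V(1) order_refl that, of "3 * \<kappa>" 0] V(2,3) \<kappa> that by force
    then show ?thesis by blast
  qed
  then obtain c where c: "\<And>k t. k < N \<Longrightarrow> 0 \<le> t \<Longrightarrow> (x k t)\<^sup>2 \<le> c k * exp (- (3 * \<kappa>) * t)" by metis
  define C where "C = (\<Sum>i<N. \<Sum>j<N. \<bar>B i j\<bar> * (c i + c j))"
  define W where "W t = qf N B (\<lambda>i. x i t)" for t
  \<comment> \<open>Entry \<open>N\<close> is the derivative of the last state under zero input, so
    that \<open>\<Sum> coeff p i * y t i\<close> up to \<open>N\<close> vanishes and the input term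
    of the inequality drops out.\<close>
  define y where "y t i = (if i < N then x i t else - (\<Sum>j<N. coeff p j * x j t))" for i t
  have solW: "T.sol W (\<lambda>t. 2 * (\<Sum>i<N. \<Sum>j<N. B i j * x i t * ((\<Sum>l<N. ?A $$ (j, l) * x l t) + 0)))"
    unfolding W_def by (rule T.sol_qf[OF B(1) x(2)])
  have dW: "2 * (\<Sum>i<N. \<Sum>j<N. B i j * x i t * ((\<Sum>l<N. ?A $$ (j, l) * x l t) + 0)) \<le> - (2 * \<kappa>) * W t + 0" for t
  proof -
    have "2 * (\<Sum>i<N. \<Sum>j<N. B i j * x i t * ((\<Sum>l<N. ?A $$ (j, l) * x l t) + 0)) = 2 * (\<Sum>i<N. \<Sum>j<N. B i j * y t i * y t (Suc j))"
      by (intro arg_cong[of _ _ "\<lambda>z. 2 * z"] sum.cong refl) (auto simp: companion_row y_def)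
    also have "\<dots> \<le> 2 * (\<Sum>i\<le>N. coeff q i * y t i) * (\<Sum>i\<le>N. coeff p i * y t i) - 2 * \<kappa> * qf N B (y t)" by (rule B(2))
    also have "(\<Sum>i\<le>N. coeff p i * y t i) = 0"
      using p by (simp add: lessThan_Suc_atMost[symmetric] y_def)
    also have "qf N B (y t) = W t" by (simp add: qf_def y_def W_def)
    finally show ?thesis by simp
  qed
  have up: "W t \<le> W 0 * exp (- (2 * \<kappa>) * t)" if "0 \<le> t" for t
    using T.sol_decay[OF solW order_refl that, of "2 * \<kappa>" 0] dW \<kappa> that by force
  have low: "- C * exp (- (3 * \<kappa>) * t) \<le> W t" if t: "0 \<le> t" for t
  proof -
    have "- W t \<le> (\<Sum>i<N. \<Sum>j<N. \<bar>B i j\<bar> * (c i + c j) * exp (- (3 * \<kappa>) * t))"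
      unfolding W_def qf_def sum_negf[symmetric]
    proof (intro sum_mono)
      fix i j assume ij: "i \<in> {..<N}" "j \<in> {..<N}"
      have "\<bar>x i t * x j t\<bar> \<le> (x i t)\<^sup>2 + (x j t)\<^sup>2"
      proof -
        have "2 * (\<bar>x i t\<bar> * \<bar>x j t\<bar>) \<le> (x i t)\<^sup>2 + (x j t)\<^sup>2"
          using sum_squares_bound[of "\<bar>x i t\<bar>" "\<bar>x j t\<bar>"] by (simp add: mult.assoc)
        moreover have "0 \<le> \<bar>x i t\<bar> * \<bar>x j t\<bar>" by simp
        ultimately show ?thesis unfolding abs_mult by linarith
      qed
      also have "\<dots> \<le> (c i + c j) * exp (- (3 * \<kappa>) * t)" using c[of i t] c[of j t] ij t by (simp add: distrib_right)
      finally have "\<bar>B i j\<bar> * \<bar>x i t * x j t\<bar> \<le> \<bar>B i j\<bar> * ((c i + c j) * exp (- (3 * \<kappa>) * t))" by (intro mult_left_mono) auto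
      moreover have "- (B i j * x i t * x j t) \<le> \<bar>B i j\<bar> * \<bar>x i t * x j t\<bar>"
        by (metis abs_ge_minus_self abs_mult mult.assoc)
      ultimately show "- (B i j * x i t * x j t) \<le> \<bar>B i j\<bar> * (c i + c j) * exp (- (3 * \<kappa>) * t)" by (simp add: mult.assoc)
    qed
    then show ?thesis by (simp add: C_def sum_distrib_right)
  qed
  have W0: "W 0 < 0" using neg x(1) by (simp add: W_def qf_def)
  have C0: "C > 0" using low[of 0] W0 by simp
  \<comment> \<open>With this time \<open>W 0 * (\<kappa> * t) = - C\<close>, and
    \<open>exp (\<kappa> t)\<close> is strictly larger than \<open>\<kappa> t\<close>.\<close>
  define t where "t = C / (- W 0) / \<kappa>"
  have t0: "0 \<le> t" unfolding t_def using C0 W0 \<kappa> by (intro divide_nonneg_pos) auto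
  have "- C * exp (- (3 * \<kappa>) * t) * exp (3 * \<kappa> * t) \<le> W 0 * exp (- (2 * \<kappa>) * t) * exp (3 * \<kappa> * t)"
    using low[OF t0] up[OF t0] by (intro mult_right_mono) auto
  then have "- C \<le> W 0 * exp (\<kappa> * t)" by (simp add: mult.assoc flip: exp_add)
  also have "W 0 * exp (\<kappa> * t) < W 0 * (\<kappa> * t)"
  proof (rule mult_strict_left_mono_neg[OF _ W0])
    show "\<kappa> * t < exp (\<kappa> * t)" using exp_ge_add_one_self[of "\<kappa> * t"] by linarith
  qed
  also have "W 0 * (\<kappa> * t) = - C" using W0 \<kappa> by (simp add: t_def)
  finally show False by simp
qed

text \<open>The bound of the output by the form is Cauchy-Schwarz for a semidefinite
  \<open>B\<close>: its last column is \<open>q\<close>, and its last diagonal entry is 1 because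
  \<open>q\<close> is monic.\<close>

lemma kyp:
  fixes p q :: "real poly"
  assumes p: "monic p" "degree p = N" and q: "monic q" "degree q + 1 = N" and \<kappa>: "\<kappa> > 0"
    and roots: "\<forall>s. poly (map_poly complex_of_real p) s = 0 \<longrightarrow> 2 * Re s < - (3 * \<kappa>)"
    and pos: "\<And>w::real. 0 \<le> Re (poly (map_poly complex_of_real q) (Complex (- \<kappa>) w) * cnj (poly (map_poly complex_of_real p) (Complex (- \<kappa>) w)))"
  shows "\<exists>B. (\<forall>i j. B i j = B j i) \<and> (\<forall>x. 0 \<le> qf N B x) \<and> (\<forall>x. (\<Sum>i<N. coeff q i * x i)\<^sup>2 \<le> qf N B x) \<and>
    (\<forall>x. 2 * (\<Sum>i<N. \<Sum>j<N. B i j * x i * x (Suc j))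
       \<le> 2 * (\<Sum>i<N. coeff q i * x i) * (\<Sum>i\<le>N. coeff p i * x i) - 2 * \<kappa> * qf N B x)"
proof -
  have qN: "degree q < N" using q by simp
  obtain B where B: "\<forall>i j. B i j = B j i" "\<forall>i<N. B i (N - 1) = coeff q i"
    "\<forall>x. 2 * (\<Sum>i<N. \<Sum>j<N. B i j * x i * x (Suc j))
       \<le> 2 * (\<Sum>i\<le>N. coeff q i * x i) * (\<Sum>i\<le>N. coeff p i * x i) - 2 * \<kappa> * qf N B x"
    using kyp_identity[OF pos p(2) qN p(1)] by blast
  have qsum: "(\<Sum>i\<le>N. coeff q i * x i) = (\<Sum>i<N. coeff q i * x i)" for x
    using qN by (simp add: lessThan_Suc_atMost[symmetric] coeff_eq_0)
  have nn: "0 \<le> qf N B x" for x by (rule qf_nonneg[OF p qN \<kappa> roots]) (use B in auto)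
  have cs: "(\<Sum>i<N. coeff q i * x i)\<^sup>2 \<le> qf N B x" for x
  proof -
    define c where "c = (\<Sum>i<N. coeff q i * x i)"
    \<comment> \<open>With this last unit vector, \<open>c\<close> is the value of the bilinear form
      at \<open>x\<close> and \<open>e\<close>, so nonnegativity at \<open>x - c e\<close> is the
      required inequality.\<close>
    define e where "e i = (if i = N - 1 then 1 else 0 :: real)" for i
    have N: "N - 1 < N" using q by simp
    have e1: "(\<Sum>j<N. B i j * e j) = B i (N - 1)" for i
      using N by (simp add: e_def sum.delta if_distrib[of "\<lambda>z. _ * z"] cong: if_cong)
    have e2: "(\<Sum>i<N. f i * e i) = f (N - 1)" for f :: "nat \<Rightarrow> real"
      using N by (simp add: e_def sum.delta if_distrib[of "\<lambda>z. _ * z"] cong: if_cong)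
    have "B (N - 1) (N - 1) = 1" using B(2) N q by (metis add_diff_cancel_right')
    have xe: "(\<Sum>i<N. \<Sum>j<N. B i j * x i * e j) = c"
    proof -
      have "(\<Sum>i<N. \<Sum>j<N. B i j * x i * e j) = (\<Sum>i<N. B i (N - 1) * x i)"
        by (intro sum.cong refl e2)
      then show ?thesis using B(2) by (simp add: c_def)
    qed
    have ex: "(\<Sum>i<N. \<Sum>j<N. B i j * e i * x j) = c"
    proof -
      have s: "B i j * e i * x j = B j i * x j * e i" for i j using B(1) by (metis mult.assoc mult.commute)
      have "(\<Sum>i<N. \<Sum>j<N. B i j * e i * x j) = (\<Sum>i<N. \<Sum>j<N. B j i * x j * e i)" by (intro sum.cong refl s)
      also have "\<dots> = c" unfolding xe[symmetric] by (rule sum.swap)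
      finally show ?thesis .
    qed
    have ee: "(\<Sum>i<N. \<Sum>j<N. B i j * e i * e j) = 1"
    proof -
      have "(\<Sum>i<N. \<Sum>j<N. B i j * e i * e j) = (\<Sum>i<N. B i (N - 1) * e i)" by (intro sum.cong refl e2)
      also have "\<dots> = B (N - 1) (N - 1)" by (rule e2)
      finally show ?thesis using \<open>B (N - 1) (N - 1) = 1\<close> by simp
    qed
    have "qf N B (\<lambda>i. x i - c * e i) = (\<Sum>i<N. \<Sum>j<N. B i j * x i * x j - c * (B i j * x i * e j) - c * (B i j * e i * x j) + c\<^sup>2 * (B i j * e i * e j))"
      unfolding qf_def by (intro sum.cong refl) (simp add: algebra_simps power2_eq_square)
    also have "\<dots> = qf N B x - c * c - c * c + c\<^sup>2 * 1"
      unfolding sum.distrib sum_subtractf sum_distrib_left[symmetric] xe ex ee by (simp add: qf_def)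
    also have "\<dots> = qf N B x - c\<^sup>2" by (simp add: power2_eq_square)
    finally show ?thesis using nn[of "\<lambda>i. x i - c * e i"] by (simp add: c_def)
  qed
  show ?thesis using B nn cs unfolding qsum by blast
qed

section \<open>Strict positive realness\<close>

text \<open>Positive realness of the shifted function is analytic information about a quotient; in
  lowest terms it excludes poles to the right of \<open>- \<epsilon>\<close>. Multiplying by the
  squared modulus of the denominator turns it into a polynomial inequality on a vertical
  line.\<close>

lemma positive_real_reduced:
  fixes H :: "real poly fract"
  assumes H: "strictly_positive_real H" and ab: "quot_of_fract H = (a, b)"
  obtains \<kappa> where "\<kappa> > 0" "\<forall>s. poly (map_poly complex_of_real b) s = 0 \<longrightarrow> 2 * Re s < - (3 * \<kappa>)"
    "\<And>w::real. 0 \<le> Re (poly (map_poly complex_of_real a) (Complex (- \<kappa>) w) * cnj (poly (map_poly complex_of_real b) (Complex (- \<kappa>) w)))"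
proof -
  define ac where "ac = map_poly complex_of_real a"
  define bc where "bc = map_poly complex_of_real b"
  have cop: "coprime a b" using coprime_quot_of_fract[of H] ab by simp
  have b0: "b \<noteq> 0" using snd_quot_of_fract_nonzero[of H] ab by simp
  obtain \<epsilon> where \<epsilon>: "\<epsilon> > 0" and an: "(\<lambda>s. rat_eval H (s - complex_of_real \<epsilon>)) analytic_on {s. 0 < Re s}"
    and re: "\<And>s. 0 < Re s \<Longrightarrow> 0 \<le> Re (rat_eval H (s - complex_of_real \<epsilon>))"
    using H unfolding strictly_positive_real_def positive_real_def by auto
  have ev: "rat_eval H s = poly ac s / poly bc s" for s by (simp add: rat_eval_def ab ac_def bc_def)
  \<comment> \<open>At a root of the denominator \<open>rat_eval\<close> has the default value 0 of
    division by zero. Continuity would make the quotient tend to 0 there, hence also the numerator,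
    against coprimality.\<close>
  have noroot: "poly bc s \<noteq> 0" if s: "- \<epsilon> < Re s" for s
  proof
    assume r: "poly bc s = 0"
    define u v where "u = fst (bezout_coefficients a b)" and "v = snd (bezout_coefficients a b)"
    have "u * a + v * b = 1" unfolding u_def v_def bezout_coefficients_fst_snd using cop by simp
    then have "map_poly complex_of_real (u * a + v * b) = 1" by simp
    then have "poly (map_poly complex_of_real (u * a + v * b)) s = 1" by simp
    then have nz: "poly ac s \<noteq> 0" using r by (auto simp: map_poly_of_real_ring ac_def bc_def)
    have c: "isCont (\<lambda>z. rat_eval H (z - complex_of_real \<epsilon>)) (s + complex_of_real \<epsilon>)"
      using an s by (intro analytic_at_imp_isCont) (auto elim: analytic_on_subset)
    have "isCont (\<lambda>z. z + complex_of_real \<epsilon>) s" by (intro continuous_intros)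
    from isCont_o2[OF this c]
    have "isCont (\<lambda>z. rat_eval H ((z + complex_of_real \<epsilon>) - complex_of_real \<epsilon>)) s" .
    then have "isCont (\<lambda>z. poly ac z / poly bc z) s" by (simp add: ev)
    then have l1: "((\<lambda>z. poly ac z / poly bc z) \<longlongrightarrow> 0) (at s)" using r by (simp add: isCont_def)
    have l2: "((\<lambda>z. poly bc z) \<longlongrightarrow> 0) (at s)" using poly_isCont[of s bc] r by (simp add: isCont_def)
    have l3: "((\<lambda>z. poly ac z / poly bc z * poly bc z) \<longlongrightarrow> 0 * 0) (at s)" by (rule tendsto_mult[OF l1 l2])
    have "bc \<noteq> 0" using b0 by (simp add: bc_def map_poly_eq_0_iff)
    then have "finite {z. poly bc z = 0}" by (rule poly_roots_finite)
    then have "\<forall>\<^sub>F z in at s. z \<notin> {z. poly bc z = 0} - {s}"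
      using islimpt_finite[of "{z. poly bc z = 0}" s] unfolding islimpt_iff_eventually by (auto elim: eventually_mono)
    then have "\<forall>\<^sub>F z in at s. poly ac z / poly bc z * poly bc z = poly ac z"
      by (rule eventually_rev_mp) (use r in \<open>auto simp: eventually_at_filter\<close>)
    then have "((\<lambda>z. poly ac z) \<longlongrightarrow> 0) (at s)" using l3 by (simp add: tendsto_cong)
    moreover have "((\<lambda>z. poly ac z) \<longlongrightarrow> poly ac s) (at s)" using poly_isCont[of s ac] by (simp add: isCont_def)
    ultimately show False using nz tendsto_unique[OF trivial_limit_at] by blast
  qed
  \<comment> \<open>Half of the margin serves as the line for the inequality; the poles, at
    \<open>- \<epsilon> = - 2 \<kappa>\<close> or further left, satisfy
    \<open>2 Re s \<le> - 4 \<kappa>\<close>, faster than the rate \<open>3 \<kappa>\<close> used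
    for \<open>qf_nonneg\<close>.\<close>
  define \<kappa> where "\<kappa> = \<epsilon> / 2"
  show ?thesis
  proof (rule that[of \<kappa>])
    show "\<kappa> > 0" using \<epsilon> by (simp add: \<kappa>_def)
    show "\<forall>s. poly (map_poly complex_of_real b) s = 0 \<longrightarrow> 2 * Re s < - (3 * \<kappa>)"
    proof (intro allI impI)
      fix s assume "poly (map_poly complex_of_real b) s = 0"
      then have "Re s \<le> - \<epsilon>" using noroot[of s] unfolding bc_def by (cases "- \<epsilon> < Re s") auto
      then show "2 * Re s < - (3 * \<kappa>)" using \<epsilon> by (simp add: \<kappa>_def)
    qed
    fix w :: real
    define s where "s = Complex (- \<kappa>) w"
    have "0 \<le> Re (rat_eval H ((s + complex_of_real \<epsilon>) - complex_of_real \<epsilon>))"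
      using \<epsilon> by (intro re) (simp add: s_def \<kappa>_def)
    then have "0 \<le> Re (poly ac s / poly bc s) * (cmod (poly bc s))\<^sup>2" by (simp add: ev)
    also have "\<dots> = Re (poly ac s / poly bc s * complex_of_real ((cmod (poly bc s))\<^sup>2))"
      by (simp only: times_complex.sel Re_complex_of_real Im_complex_of_real)
    also have "poly ac s / poly bc s * complex_of_real ((cmod (poly bc s))\<^sup>2) = poly ac s * cnj (poly bc s)"
      using noroot[of s] \<epsilon> unfolding complex_norm_square by (simp add: s_def \<kappa>_def)
    finally show "0 \<le> Re (poly (map_poly complex_of_real a) (Complex (- \<kappa>) w) * cnj (poly (map_poly complex_of_real b) (Complex (- \<kappa>) w)))"
      by (simp add: s_def ac_def bc_def)
  qed
qed

text \<open>The vector \<open>v\<close> of powers of \<open>s\<close> satisfies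
  \<open>(s I - A) v = p e\<close> with \<open>e\<close> the last unit vector. Evaluating
  \<open>c\<^sup>T adj (s I - A) (s I - A) v\<close> in two ways gives \<open>p\<close> times the
  last entry of the row and \<open>p q\<close>.\<close>

lemma num_companion:
  fixes p :: "real poly"
  assumes p: "monic p" "degree p = N" and q: "degree q < N"
  shows "num (companion N p) (unit_vec N (N - 1)) (Matrix.vec N (coeff q)) = q"
proof -
  let ?A = "companion N p" and ?c = "Matrix.vec N (coeff q)"
  have N: "N - 1 < N" using q by simp
  define v where "v i = (monom 1 i :: real poly)" for i
  have row: "[:0, 1:] * v i - (\<Sum>j<N. smult (?A $$ (i, j)) (v j)) = (if i = N - 1 then p else 0)" if i: "i < N" for i
  proof (cases "i = N - 1")
    case True
    have "(\<Sum>j<N. smult (?A $$ (i, j)) (v j)) = - (\<Sum>j<N. monom (coeff p j) j)"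
      using True i by (simp add: companion_def observer_canonical_mat_def v_def smult_monom minus_monom flip: sum_negf)
    moreover have "[:0, 1:] * v i = monom 1 N" using True i by (simp add: v_def flip: monom_Suc)
    moreover have "p = (\<Sum>i<N. monom (coeff p i) i) + monom 1 N"
      using poly_as_sum_of_monoms[of p] p by (simp add: lessThan_Suc_atMost[symmetric])
    ultimately show ?thesis using True by simp
  next
    case False
    have "(\<Sum>j<N. smult (?A $$ (i, j)) (v j)) = (\<Sum>j<N. if j = Suc i then v j else 0)"
      using False i by (intro sum.cong) (auto simp: companion_def observer_canonical_mat_def)
    also have "\<dots> = v (Suc i)" using False i by (simp add: sum.delta)
    finally show ?thesis using False by (simp add: v_def monom_Suc)
  qed
  have "p * res ?A ?c (N - 1) = (\<Sum>i<N. res ?A ?c i * ([:0, 1:] * v i - (\<Sum>j<N. smult (?A $$ (i, j)) (v j))))"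
  proof -
    have "(\<Sum>i<N. res ?A ?c i * ([:0, 1:] * v i - (\<Sum>j<N. smult (?A $$ (i, j)) (v j)))) = (\<Sum>i<N. if i = N - 1 then res ?A ?c i * p else 0)"
      by (intro sum.cong refl) (simp only: row lessThan_iff, simp)
    then show ?thesis using N by (simp add: sum.delta mult.commute)
  qed
  also have "\<dots> = (\<Sum>i<N. res ?A ?c i * ([:0, 1:] * v i)) - (\<Sum>i<N. \<Sum>j<N. res ?A ?c i * smult (?A $$ (i, j)) (v j))"
    by (simp only: right_diff_distrib sum_subtractf sum_distrib_left)
  also have "(\<Sum>i<N. \<Sum>j<N. res ?A ?c i * smult (?A $$ (i, j)) (v j)) = (\<Sum>j<N. \<Sum>i<N. res ?A ?c i * smult (?A $$ (i, j)) (v j))"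
    by (rule sum.swap)
  also have "(\<Sum>i<N. res ?A ?c i * ([:0, 1:] * v i)) - (\<Sum>j<N. \<Sum>i<N. res ?A ?c i * smult (?A $$ (i, j)) (v j))
      = (\<Sum>j<N. v j * ([:0, 1:] * res ?A ?c j - (\<Sum>i<N. smult (?A $$ (i, j)) (res ?A ?c i))))"
    by (simp add: right_diff_distrib sum_subtractf sum_distrib_left mult_ac)
  also have "\<dots> = (\<Sum>j<N. v j * smult (coeff q j) p)"
  proof -
    have "[:0, 1:] * res ?A ?c j - (\<Sum>i<N. smult (?A $$ (i, j)) (res ?A ?c i)) = smult (coeff q j) p" if "j < N" for j
      using res_identity[OF companion_carrier that, of p ?c] char_poly_companion[OF p] that by simp
    then show ?thesis by (intro sum.cong refl) (simp only: lessThan_iff)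
  qed
  also have "\<dots> = p * (\<Sum>j<N. monom (coeff q j) j)"
  proof -
    have "v j * smult (coeff q j) p = p * monom (coeff q j) j" for j
    proof -
      have "monom (coeff q j) j = smult (coeff q j) (monom 1 j)" by (simp add: smult_monom)
      then show ?thesis by (simp add: v_def mult.commute)
    qed
    then show ?thesis by (simp add: sum_distrib_left)
  qed
  also have "(\<Sum>j<N. monom (coeff q j) j) = q"
    by (rule poly_eqI) (use q in \<open>auto simp: coeff_sum coeff_eq_0\<close>)
  finally have "res ?A ?c (N - 1) = q" using p by (metis leading_coeff_0_iff mult_cancel_left zero_neq_one)
  moreover have "dim_row ?A = N" using companion_carrier[of N p] by blast
  ultimately show ?thesis using N by (simp add: num_def sum.delta if_distrib[of "\<lambda>c. smult c _"] cong: if_cong)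
qed

section \<open>Filters with one or two inputs as relations\<close>

context time_domain
begin

lemma ss_rel:
  assumes A: "A \<in> carrier_mat N N" "char_poly A = \<rho>" "num A b c = \<nu>" "num A b' c = \<nu>'"
    and x: "\<And>i. i < N \<Longrightarrow> sol (x i) (\<lambda>t. (\<Sum>j<N. A $$ (i, j) * x j t) + (vec_index b i * w t + vec_index b' i * w' t))"
    and y: "\<And>t. t \<in> I \<Longrightarrow> y t = (\<Sum>i<N. vec_index c i * x i t)"
  shows "rel [(\<rho>, y), (- \<nu>, w), (- \<nu>', w')] N"
proof -
  have c: "coeff (num A b'' c) j = (\<Sum>i<N. vec_index b'' i * coeff (res A c i) j)" for b'' j
    using A(1) by (simp add: num_def coeff_sum)
  have deg: "degree (num A b'' c) \<le> N" for b''
    using num_coeff_ge[OF A(1)] by (intro degree_le) (meson less_imp_le)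
  show ?thesis
  proof (rule rel_cong[OF state_space_rel[OF A(1) x, of c]])
    fix j t assume "t \<in> I"
    then show "lc [(\<rho>, y), (- \<nu>, w), (- \<nu>', w')] j t = lc ((char_poly A, \<lambda>t. \<Sum>i<N. vec_index c i * x i t) #
         map (\<lambda>i. (- res A c i, \<lambda>t. vec_index b i * w t + vec_index b' i * w' t)) [0..<N]) j t"
      using y A(2)
      by (simp add: lc_map_upt A(3,4)[symmetric] c sum_distrib_left sum_distrib_right sum_negf sum_subtractf distrib_left sum.distrib mult_ac)
  next
    fix p z assume "(p, z) \<in> set [(\<rho>, y), (- \<nu>, w), (- \<nu>', w')]"
    then show "degree p \<le> N" using deg char_poly_monic(2)[OF A(1)] A by auto
  qed auto
qed

lemma ss_rel1:
  assumes A: "A \<in> carrier_mat N N" "char_poly A = \<rho>" "num A b c = \<nu>"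
    and x: "\<And>i. i < N \<Longrightarrow> sol (x i) (\<lambda>t. (\<Sum>j<N. A $$ (i, j) * x j t) + vec_index b i * w t)"
    and y: "\<And>t. t \<in> I \<Longrightarrow> y t = (\<Sum>i<N. vec_index c i * x i t)"
  shows "rel [(\<rho>, y), (- \<nu>, w)] N"
proof -
  have "rel [(\<rho>, y), (- \<nu>, w), (- 0, \<lambda>t. 0)] N"
    by (rule ss_rel[OF A num_zero[OF A(1)] _ y]) (use x in auto)
  then show ?thesis by (rule rel_cong) (use \<open>rel _ _\<close> in \<open>auto simp: rel_def\<close>)
qed

lemma ss_rel_feedthrough:
  assumes A: "A \<in> carrier_mat N N" "char_poly A = \<rho>" "num A b c + smult d \<rho> = \<nu>"
    and x: "\<And>i. i < N \<Longrightarrow> sol (x i) (\<lambda>t. (\<Sum>j<N. A $$ (i, j) * x j t) + vec_index b i * w t)"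
    and y: "\<And>t. t \<in> I \<Longrightarrow> y t = (\<Sum>i<N. vec_index c i * x i t) + d * w t"
  shows "rel [(\<rho>, y), (- \<nu>, w)] N"
proof -
  have r: "rel [(\<rho>, \<lambda>t. \<Sum>i<N. vec_index c i * x i t), (- num A b c, w)] N"
    by (rule ss_rel1[OF A(1,2) refl x]) auto
  have "degree \<nu> \<le> N" unfolding A(3)[symmetric]
    using r by (intro degree_add_le) (auto simp: rel_def intro: order_trans[OF degree_smult_le])
  then have "(q, z) \<in> set [(\<rho>, y), (- \<nu>, w)] \<Longrightarrow> degree q \<le> N" for q z
    using char_poly_monic[OF A(1)] A(2) by auto
  then show ?thesis
    by (rule rel_cong[OF r]) (simp_all add: y A(3)[symmetric] algebra_simps)
qed

lemma rel_sum_list: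
  "(\<And>j. j < k \<Longrightarrow> rel (xs j) N) \<Longrightarrow> rel (concat (map xs [0..<k])) N"
proof (induction k)
  case 0
  have "sol (\<lambda>t. 0::real) (\<lambda>t. 0)" by (rule sol_const)
  then show ?case by (auto simp: rel_def intro!: exI[of _ "\<lambda>k t. 0"])
qed (auto intro: rel_append)

lemma lc_concat: "lc (concat (map xs [0..<k])) j t = (\<Sum>i<k. lc (xs i) j t)"
  by (induction k) auto

end

lemma monic_mult: "monic a \<Longrightarrow> monic b \<Longrightarrow> monic (a * b) \<and> degree (a * b) = degree a + degree (b :: real poly)"
  using lead_coeff_mult[of a b] by (metis degree_mult_eq leading_coeff_0_iff mult_1 zero_neq_one)

lemma hurwitz_mult: "hurwitz_poly a \<Longrightarrow> hurwitz_poly b \<Longrightarrow> hurwitz_poly (a * b)"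
  by (auto simp: hurwitz_poly_def map_poly_of_real_ring)

lemma hurwitz_factor: "hurwitz_poly (a * b) \<Longrightarrow> hurwitz_poly a"
  by (auto simp: hurwitz_poly_def map_poly_of_real_ring)

lemma linear_power:
  assumes "\<alpha> > 0" shows "monic ([:\<alpha>, 1:] ^ k) \<and> degree ([:\<alpha>, 1:] ^ k) = k \<and> hurwitz_poly ([:\<alpha>, 1:] ^ k)"
proof (induction k)
  case 0
  then show ?case by (simp add: hurwitz_poly_def)
next
  case (Suc k)
  let ?a = "[:\<alpha>, 1:]"
  have "monic (?a * ?a ^ k) \<and> degree (?a * ?a ^ k) = degree ?a + degree (?a ^ k)" by (rule monic_mult[OF _ Suc[THEN conjunct1]]) simp
  moreover have "hurwitz_poly (?a * ?a ^ k)"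
    by (rule hurwitz_mult) (use Suc assms in \<open>auto simp: hurwitz_poly_def map_poly_pCons add_eq_0_iff\<close>)
  moreover have "degree ?a = 1" by simp
  ultimately show ?case unfolding power_Suc using Suc by (auto simp only: plus_1_eq_Suc)
qed

text \<open>
  The data of the adaptive system. \<open>\<theta>s\<close> is the parameter for which the closed loop matches the
  reference model, \<open>lam1 Pm = Q P + R\<close> is the division behind the matching identity, \<open>q / p\<close> is the reduced
  form of the strictly positive real error transfer function, \<open>gg\<close> the cancelled factor, \<open>B\<close> and \<open>\<kappa>\<close> come
  from the positive real lemma, and \<open>go\<close> is an output injection that makes the plant an observer with stable dynamics.
\<close>

locale design =
  fixes n m ns NW :: nat
    and Z P Zm Pm L f lam lam1 Q R p q gg :: "real poly"
    and Ap Am Lam AF AW :: "real Matrix.mat"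
    and bp cp bm cm l bl bF cF bW cW go :: "real Matrix.vec"
    and dF gam \<kappa> :: real and \<theta>s :: "nat \<Rightarrow> real" and B :: "nat \<Rightarrow> nat \<Rightarrow> real"
  assumes ns: "ns \<ge> 1"
    and Z: "monic Z" "degree Z + ns = n" "hurwitz_poly Z"
    and P: "monic P" "degree P = n"
    and plant: "Ap \<in> carrier_mat n n" "char_poly Ap = P" "num Ap bp cp = Z"
    and inj: "hurwitz_poly (char_poly (Matrix.mat n n (\<lambda>(i, j). Ap $$ (i, j) - vec_index go i * vec_index cp j)))"
    and Pm: "monic Pm" "degree Pm = m" "hurwitz_poly Pm"
    and Zm: "monic Zm" "degree Zm + ns = m"
    and model: "Am \<in> carrier_mat m m" "char_poly Am = Pm" "num Am bm cm = Zm" "num Am l cm = L"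
    and f: "monic f" "degree f + 1 = ns" "hurwitz_poly f"
    and filter: "AF \<in> carrier_mat (ns - 1) (ns - 1)" "char_poly AF = f" "num AF bF cF + smult dF f = 1"
    and ctrl: "Lam \<in> carrier_mat (n - 1) (n - 1)" "char_poly Lam = lam" "hurwitz_poly lam" "lam = lam1 * Zm"
    and pq: "monic p" "degree p = NW" "monic q" "degree q + 1 = NW" "hurwitz_poly p" "hurwitz_poly (Pm + L)"
      "Zm * f = q * gg" "Pm + L = p * gg"
    and errf: "AW \<in> carrier_mat NW NW" "char_poly AW = p" "num AW bW cW = q"
    and match: "lam1 * Pm = Q * P + R" "degree Q + 1 = ns" "degree R < n"
      "lam - (\<Sum>j<n - 1. smult (\<theta>s j) (num Lam bl (unit_vec (n - 1) j))) = Z * Q"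
      "smult (\<theta>s (n - 1)) lam + (\<Sum>j<n - 1. smult (\<theta>s (n + j)) (num Lam bl (unit_vec (n - 1) j))) = - R"
    and gam: "gam > 0" and \<kappa>: "\<kappa> > 0"
    and KYP: "\<And>i j. B i j = B j i" "\<And>x. 0 \<le> qf NW B x" "\<And>x. (\<Sum>i<NW. coeff q i * x i)\<^sup>2 \<le> qf NW B x"
      "\<And>x. 2 * (\<Sum>i<NW. \<Sum>j<NW. B i j * x i * x (Suc j))
       \<le> 2 * (\<Sum>i<NW. coeff q i * x i) * (\<Sum>i\<le>NW. coeff p i * x i) - 2 * \<kappa> * qf NW B x"
begin

text \<open>Denominator of the map from the control error to \<open>ey\<close>. The factor
  \<open>lam1\<close> stays, since cancelling it changes signals by decaying terms.\<close>

abbreviation \<sigma> :: "real poly" where "\<sigma> \<equiv> lam1 * (Pm + L)"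

lemma n_pos: "n \<ge> 1" using Z ns by simp
lemma m_pos: "m \<ge> 1" using Zm ns by simp

lemma degree_L: "degree L < m"
  using degree_num[OF model(1), of l cm] model(4) m_pos by simp

lemma PmL: "monic (Pm + L)" "degree (Pm + L) = m"
  using degree_L Pm by (auto simp: coeff_eq_0 degree_add_eq_left)

lemma lam: "monic lam" "degree lam = n - 1"
  using char_poly_monic[OF ctrl(1)] ctrl(2) by auto

lemma lam1: "monic lam1" "degree lam1 + (m - ns) = n - 1"
proof -
  show "monic lam1" using lam ctrl(4) Zm lead_coeff_mult[of lam1 Zm] by auto
  then have "degree lam = degree lam1 + degree Zm" unfolding ctrl(4) using Zm by (intro degree_mult_eq) auto
  then show "degree lam1 + (m - ns) = n - 1" using lam Zm by simp
qed

lemma hurwitz_lam1: "hurwitz_poly lam1"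
  using ctrl hurwitz_factor by auto

lemma level: "degree lam1 + m = n - 1 + ns"
  using lam1(2) Zm n_pos by simp

lemma \<sigma>_props: "monic \<sigma>" "degree \<sigma> = n - 1 + ns" "hurwitz_poly \<sigma>"
  using monic_mult[OF lam1(1) PmL(1)] PmL level hurwitz_mult[OF hurwitz_lam1 pq(6)] by auto

lemma lam1Pm_props: "monic (lam1 * Pm)" "degree (lam1 * Pm) = n - 1 + ns" "hurwitz_poly (lam1 * Pm)"
  using monic_mult[OF lam1(1) Pm(1)] Pm level hurwitz_mult[OF hurwitz_lam1 Pm(3)] by auto

lemma index_cases:
  assumes "j < 2 * n - 1"
  obtains "j < n - 1" | "j = n - 1" | i where "j = n + i" "i < n - 1"
proof (cases "j < n")
  case True
  then show ?thesis using that by force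
next
  case False
  then have "j = n + (j - n)" "j - n < n - 1" using assms by auto
  then show ?thesis using that(3) by blast
qed

lemma sum_split_omega: "(\<Sum>j<2 * n - 1. g j) = (\<Sum>j<n - 1. g j) + g (n - 1) + (\<Sum>j<n - 1. g (n + j) :: real)"
proof -
  obtain k where k: "n = Suc k" using n_pos by (cases n) auto
  have "(\<Sum>j<Suc k + i. g j) = (\<Sum>j<Suc k. g j) + (\<Sum>j<i. g (Suc k + j))" for i
    by (induction i) auto
  from this[of k] have "(\<Sum>j<Suc k + k. g j) = (\<Sum>j<k. g j) + g k + (\<Sum>j<k. g (Suc k + j))" by simp
  then show ?thesis by (simp add: k mult_2)
qed

end

section \<open>The closed loop\<close>

text \<open>
  \<open>om\<close>, \<open>th\<close> and \<open>ze\<close> are indexed like the regressor \<open>(\<omega>\<^sub>1, y, \<omega>\<^sub>2)\<close>: the indices below \<open>n - 1\<close> belong to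
  \<open>\<omega>\<^sub>1\<close>, \<open>n - 1\<close> to \<open>y\<close>, and \<open>n + j\<close> to the component \<open>j\<close> of \<open>\<omega>\<^sub>2\<close>.
\<close>

locale loop = time_domain I S + design
  for I S +
  fixes xp xm xFu xW om th ze :: "nat \<Rightarrow> real \<Rightarrow> real" and xF :: "nat \<Rightarrow> nat \<Rightarrow> real \<Rightarrow> real"
    and r u y ym ey Fu echi Wout ea :: "real \<Rightarrow> real" and rb :: real
  assumes r_bound: "\<And>t. t \<in> I \<Longrightarrow> \<bar>r t\<bar> \<le> rb"
    and xp: "\<And>i. i < n \<Longrightarrow> sol (xp i) (\<lambda>t. (\<Sum>j<n. Ap $$ (i, j) * xp j t) + vec_index bp i * u t)"
    and y: "\<And>t. t \<in> I \<Longrightarrow> y t = (\<Sum>i<n. vec_index cp i * xp i t)"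
    and om1: "\<And>i. i < n - 1 \<Longrightarrow> sol (om i) (\<lambda>t. (\<Sum>j<n - 1. Lam $$ (i, j) * om j t) + vec_index bl i * u t)"
    and omy: "\<And>t. t \<in> I \<Longrightarrow> om (n - 1) t = y t"
    and om2: "\<And>i. i < n - 1 \<Longrightarrow> sol (om (n + i)) (\<lambda>t. (\<Sum>j<n - 1. Lam $$ (i, j) * om (n + j) t) + vec_index bl i * y t)"
    and u: "\<And>t. t \<in> I \<Longrightarrow> u t = r t + (\<Sum>j<2 * n - 1. th j t * om j t)"
    and xm: "\<And>i. i < m \<Longrightarrow> sol (xm i) (\<lambda>t. (\<Sum>j<m. Am $$ (i, j) * xm j t) + (vec_index bm i * r t + vec_index l i * ey t))"
    and ym: "\<And>t. t \<in> I \<Longrightarrow> ym t = (\<Sum>i<m. vec_index cm i * xm i t)"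
    and ey: "\<And>t. t \<in> I \<Longrightarrow> ey t = y t - ym t"
    and xF: "\<And>j i. j < 2 * n - 1 \<Longrightarrow> i < ns - 1 \<Longrightarrow>
      sol (xF j i) (\<lambda>t. (\<Sum>k<ns - 1. AF $$ (i, k) * xF j k t) + vec_index bF i * om j t)"
    and ze: "\<And>j t. j < 2 * n - 1 \<Longrightarrow> t \<in> I \<Longrightarrow> ze j t = (\<Sum>i<ns - 1. vec_index cF i * xF j i t) + dF * om j t"
    and xFu: "\<And>i. i < ns - 1 \<Longrightarrow>
      sol (xFu i) (\<lambda>t. (\<Sum>k<ns - 1. AF $$ (i, k) * xFu k t) + vec_index bF i * (\<Sum>j<2 * n - 1. th j t * om j t))"
    and Fu: "\<And>t. t \<in> I \<Longrightarrow> Fu t = (\<Sum>i<ns - 1. vec_index cF i * xFu i t) + dF * (\<Sum>j<2 * n - 1. th j t * om j t)"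
    and echi: "\<And>t. t \<in> I \<Longrightarrow> echi t = (\<Sum>j<2 * n - 1. th j t * ze j t) - Fu t"
    and xW: "\<And>i. i < NW \<Longrightarrow>
      sol (xW i) (\<lambda>t. (\<Sum>k<NW. AW $$ (i, k) * xW k t) + vec_index bW i * (echi t - ea t * (\<Sum>j<2 * n - 1. (ze j t)\<^sup>2)))"
    and Wout: "\<And>t. t \<in> I \<Longrightarrow> Wout t = (\<Sum>i<NW. vec_index cW i * xW i t)"
    and ea: "\<And>t. t \<in> I \<Longrightarrow> ea t = ey t + Wout t"
    and th: "\<And>j. j < 2 * n - 1 \<Longrightarrow> sol (th j) (\<lambda>t. - gam * ea t * ze j t)"
begin

definition v1 :: "real \<Rightarrow> real" where
  "v1 t = (\<Sum>j<2 * n - 1. (th j t - \<theta>s j) * om j t)"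

text \<open>The filtered control error: \<open>rel_eta\<close> identifies it with \<open>F\<close>
  applied to \<open>v1\<close>, although it is assembled from separately initialized
  filters.\<close>

definition eta :: "real \<Rightarrow> real" where
  "eta t = Fu t - (\<Sum>j<2 * n - 1. \<theta>s j * ze j t)"

definition ze2 :: "real \<Rightarrow> real" where
  "ze2 t = (\<Sum>j<2 * n - 1. (ze j t)\<^sup>2)"

definition phi :: "real \<Rightarrow> real" where
  "phi t = (\<Sum>j<2 * n - 1. (th j t - \<theta>s j) * ze j t) - ea t * ze2 t"

lemma u_v1: "t \<in> I \<Longrightarrow> u t = r t + v1 t + (\<Sum>j<2 * n - 1. \<theta>s j * om j t)"
  by (simp add: u v1_def left_diff_distrib sum_subtractf)

text \<open>Splits the auxiliary error so that \<open>eta\<close> can cancel the filtered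
  \<open>v1\<close> contained in \<open>ey\<close>; what remains is linear in the parameter
  error.\<close>

lemma echi_eta: "t \<in> I \<Longrightarrow> echi t = (\<Sum>j<2 * n - 1. (th j t - \<theta>s j) * ze j t) - eta t"
  by (simp add: echi eta_def left_diff_distrib sum_subtractf)

abbreviation Nj :: "nat \<Rightarrow> real poly" where
  "Nj j \<equiv> num Lam bl (unit_vec (n - 1) j)"

lemma sum_unit: "k < N \<Longrightarrow> (\<Sum>i<N. vec_index (unit_vec N k) i * g i) = (g k :: real)"
  by (simp add: sum.delta if_distrib[of "\<lambda>z. z * _"] cong: if_cong)

lemma rel_plant: "rel [(P, y), (- Z, u)] n"
  by (rule ss_rel1[OF plant xp y])

lemma rel_om1: "j < n - 1 \<Longrightarrow> rel [(lam, om j), (- Nj j, u)] (n - 1)"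
  by (rule ss_rel1[OF ctrl(1,2) refl, where x = om]) (simp_all only: om1 sum_unit)

lemma rel_om2: "j < n - 1 \<Longrightarrow> rel [(lam, om (n + j)), (- Nj j, y)] (n - 1)"
  by (rule ss_rel1[OF ctrl(1,2) refl, where x = "\<lambda>j. om (n + j)"]) (simp_all only: om2 sum_unit)

text \<open>Multiply the control law by \<open>lam\<close> and eliminate the filter states. By the
  matching equations the coefficients collected at \<open>u\<close> and \<open>y\<close> are
  \<open>Z Q\<close> and \<open>R\<close>.\<close>

lemma rel_control: "rel [(Z * Q, u), (R, y), (- lam, \<lambda>t. r t + v1 t)] (n - 1)"
proof -
  have 1: "rel (concat (map (\<lambda>j. pmul [:\<theta>s j:] [(lam, om j), (- Nj j, u)]) [0..<n - 1])) (n - 1)"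
    by (rule rel_sum_list, rule rel_const_mult, rule rel_om1)
  have 2: "rel (concat (map (\<lambda>j. pmul [:\<theta>s (n + j):] [(lam, om (n + j)), (- Nj j, y)]) [0..<n - 1])) (n - 1)"
    by (rule rel_sum_list, rule rel_const_mult, rule rel_om2)
  show ?thesis
  proof (rule rel_cong[OF rel_append[OF 1 2]])
    fix k t assume t: "t \<in> I"
    have ZQ: "coeff (Z * Q) k = coeff lam k - (\<Sum>j<n - 1. \<theta>s j * coeff (Nj j) k)"
      by (simp add: match(4)[symmetric] coeff_sum)
    have R: "coeff R k = - (\<theta>s (n - 1) * coeff lam k + (\<Sum>j<n - 1. \<theta>s (n + j) * coeff (Nj j) k))"
    proof -
      have "R = - (smult (\<theta>s (n - 1)) lam + (\<Sum>j<n - 1. smult (\<theta>s (n + j)) (Nj j)))" using match(5) by simp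
      then show ?thesis by (simp add: coeff_sum)
    qed
    have rv: "r t + v1 t = u t - ((\<Sum>j<n - 1. \<theta>s j * om j t) + \<theta>s (n - 1) * y t + (\<Sum>j<n - 1. \<theta>s (n + j) * om (n + j) t))"
      using u_v1[OF t] sum_split_omega[of "\<lambda>j. \<theta>s j * om j t"] omy[OF t] by simp
    show "lc [(Z * Q, u), (R, y), (- lam, \<lambda>t. r t + v1 t)] k t
      = lc (concat (map (\<lambda>j. pmul [:\<theta>s j:] [(lam, om j), (- Nj j, u)]) [0..<n - 1]) @
         concat (map (\<lambda>j. pmul [:\<theta>s (n + j):] [(lam, om (n + j)), (- Nj j, y)]) [0..<n - 1])) k t"
      unfolding lc_simps lc_concat
      by (simp add: ZQ R rv) (simp add: algebra_simps sum.distrib sum_subtractf sum_distrib_left sum_distrib_right)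
  next
    fix p z assume "(p, z) \<in> set [(Z * Q, u), (R, y), (- lam, \<lambda>t. r t + v1 t)]"
    then consider "p = Z * Q" | "p = R" | "p = - lam" by auto
    then show "degree p \<le> n - 1"
      by cases (use match(2,3) Z(2) lam degree_mult_le[of Z Q] in auto)
  qed
qed

text \<open>Adding \<open>Q\<close> times the plant equation cancels \<open>Z Q u\<close>, and
  \<open>Q P + R\<close> is \<open>lam1 Pm\<close>. The zeros of the plant are not cancelled
  here.\<close>

lemma rel_output: "rel [(lam1 * Pm, y), (- lam, \<lambda>t. r t + v1 t)] (n - 1 + ns)"
proof -
  have 1: "rel (pmul Q [(P, y), (- Z, u)]) (ns - 1 + n)" by (rule rel_mult[OF rel_plant]) (use match(2) in simp)
  have 2: "rel [(Z * Q, u), (R, y), (- lam, \<lambda>t. r t + v1 t)] (ns - 1 + n)"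
    by (rule rel_lift_le[OF rel_control]) simp
  have e: "n - 1 + ns = ns - 1 + n" using n_pos ns by simp
  show ?thesis unfolding e
  proof (rule rel_cong[OF rel_append[OF 1 2]])
    fix k t
    show "lc [(lam1 * Pm, y), (- lam, \<lambda>t. r t + v1 t)] k t = lc (pmul Q [(P, y), (- Z, u)] @ [(Z * Q, u), (R, y), (- lam, \<lambda>t. r t + v1 t)]) k t"
      unfolding match(1) by (simp add: algebra_simps)
  qed (use lam1Pm_props(2) lam(2) e in auto)
qed

text \<open>Eliminates \<open>y\<close> in place of \<open>u\<close>. The factor \<open>Z\<close>
  remains in front of \<open>u\<close>, which is where the minimum phase property will be
  used.\<close>

lemma rel_input: "rel [(Z * (lam1 * Pm), u), (- (P * lam), \<lambda>t. r t + v1 t)] (2 * n - 1)"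
proof -
  have 1: "rel (pmul P [(Z * Q, u), (R, y), (- lam, \<lambda>t. r t + v1 t)]) (n + (n - 1))" by (rule rel_mult[OF rel_control]) (use P in simp)
  have 2: "rel (pmul (- R) [(P, y), (- Z, u)]) ((n - 1) + n)" by (rule rel_mult[OF rel_plant]) (use match(3) in simp)
  have e: "2 * n - 1 = n + (n - 1)" "n - 1 + n = n + (n - 1)" using n_pos by auto
  show ?thesis unfolding e(1)
  proof (rule rel_cong[OF rel_append[OF 1 2[unfolded e(2)]]])
    fix k t
    show "lc [(Z * (lam1 * Pm), u), (- (P * lam), \<lambda>t. r t + v1 t)] k t
      = lc (pmul P [(Z * Q, u), (R, y), (- lam, \<lambda>t. r t + v1 t)] @ pmul (- R) [(P, y), (- Z, u)]) k t"
      unfolding match(1) by (simp add: algebra_simps)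
  qed (use lam1Pm_props(2) lam(2) Z(2) P(2) degree_mult_le[of Z "lam1 * Pm"] degree_mult_le[of P lam] in auto)
qed

lemma rel_model: "rel [(Pm, ym), (- Zm, r), (- L, ey)] m"
  by (rule ss_rel[OF model xm ym])

text \<open>Subtracting \<open>lam1\<close> times the reference model removes \<open>r\<close>, as
  \<open>lam = lam1 Zm\<close>; the error feedback through \<open>l\<close> turns \<open>Pm\<close>
  into \<open>Pm + L\<close>.\<close>

lemma rel_error: "rel [(\<sigma>, ey), (- lam, v1)] (n - 1 + ns)"
proof -
  have 1: "rel (pmul (- lam1) [(Pm, ym), (- Zm, r), (- L, ey)]) (degree lam1 + m)" by (rule rel_mult[OF rel_model]) simp
  show ?thesis
  proof (rule rel_cong[OF rel_append[OF rel_output 1[unfolded level]]])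
    fix k t assume t: "t \<in> I"
    have yy: "y t = ey t + ym t" using ey[OF t] by simp
    show "lc [(\<sigma>, ey), (- lam, v1)] k t = lc ([(lam1 * Pm, y), (- lam, \<lambda>t. r t + v1 t)] @ pmul (- lam1) [(Pm, ym), (- Zm, r), (- L, ey)]) k t"
      by (simp add: yy) (simp add: ctrl(4) algebra_simps)
  qed (use \<sigma>_props(2) lam(2) in auto)
qed

lemma rel_ze: "j < 2 * n - 1 \<Longrightarrow> rel [(f, ze j), (- 1, om j)] (ns - 1)"
  by (rule ss_rel_feedthrough[OF filter xF ze])

lemma rel_Fu: "rel [(f, Fu), (- 1, \<lambda>t. \<Sum>j<2 * n - 1. th j t * om j t)] (ns - 1)"
  by (rule ss_rel_feedthrough[OF filter xFu Fu])

lemma rel_eta: "rel [(f, eta), (- 1, v1)] (ns - 1)"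
proof -
  have 1: "rel (concat (map (\<lambda>j. pmul [:- \<theta>s j:] [(f, ze j), (- 1, om j)]) [0..<2 * n - 1])) (ns - 1)"
    by (rule rel_sum_list, rule rel_const_mult, rule rel_ze)
  show ?thesis
  proof (rule rel_cong[OF rel_append[OF rel_Fu 1]])
    fix k t assume t: "t \<in> I"
    show "lc [(f, eta), (- 1, v1)] k t = lc ([(f, Fu), (- 1, \<lambda>t. \<Sum>j<2 * n - 1. th j t * om j t)] @
          concat (map (\<lambda>j. pmul [:- \<theta>s j:] [(f, ze j), (- 1, om j)]) [0..<2 * n - 1])) k t"
      unfolding lc_simps lc_concat
      by (cases k) (simp_all add: eta_def v1_def algebra_simps sum.distrib sum_subtractf sum_distrib_left sum_distrib_right sum_negf)
  qed (use f in auto)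
qed

lemma rel_Wout: "rel [(p, Wout), (- q, \<lambda>t. phi t - eta t)] NW"
proof -
  have "rel [(p, Wout), (- q, \<lambda>t. echi t - ea t * ze2 t)] NW"
    by (rule ss_rel1[OF errf _ Wout]) (use xW in \<open>simp add: ze2_def\<close>)
  then show ?thesis
    by (rule rel_cong) (use pq in \<open>auto simp: phi_def echi_eta algebra_simps\<close>)
qed

lemma cont_om: assumes j: "j < 2 * n - 1" shows "continuous_on I (om j)"
proof -
  have cy: "continuous_on I y"
  proof -
    have "continuous_on I (\<lambda>t. \<Sum>i<n. vec_index cp i * xp i t)"
      using sol_cont[OF xp] by (intro continuous_intros) auto
    then show ?thesis using y by (simp cong: continuous_on_cong)
  qed
  show ?thesis
    by (rule index_cases[OF j]) (use sol_cont[OF om1] sol_cont[OF om2] cy omy in \<open>auto cong: continuous_on_cong\<close>)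
qed

lemma cont_th: "j < 2 * n - 1 \<Longrightarrow> continuous_on I (th j)"
  using sol_cont[OF th] .

lemma cont_ze: "j < 2 * n - 1 \<Longrightarrow> continuous_on I (ze j)"
proof -
  assume j: "j < 2 * n - 1"
  have "continuous_on I (\<lambda>t. (\<Sum>i<ns - 1. vec_index cF i * xF j i t) + dF * om j t)"
    using sol_cont[OF xF[OF j]] cont_om[OF j] by (intro continuous_intros) auto
  then show ?thesis using ze[OF j] by (simp cong: continuous_on_cong)
qed

lemma cont_y: "continuous_on I y"
  using cont_om[of "n - 1"] n_pos omy by (simp cong: continuous_on_cong)

lemma cont_ym: "continuous_on I ym"
proof -
  have "continuous_on I (\<lambda>t. \<Sum>i<m. vec_index cm i * xm i t)" using sol_cont[OF xm] by (intro continuous_intros) auto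
  then show ?thesis using ym by (simp cong: continuous_on_cong)
qed

lemma cont_ey: "continuous_on I ey"
proof -
  have "continuous_on I (\<lambda>t. y t - ym t)" by (intro continuous_intros cont_y cont_ym)
  then show ?thesis using ey by (simp cong: continuous_on_cong)
qed

lemma cont_Wout: "continuous_on I Wout"
proof -
  have "continuous_on I (\<lambda>t. \<Sum>i<NW. vec_index cW i * xW i t)" using sol_cont[OF xW] by (intro continuous_intros) auto
  then show ?thesis using Wout by (simp cong: continuous_on_cong)
qed

lemma cont_ea: "continuous_on I ea"
proof -
  have "continuous_on I (\<lambda>t. ey t + Wout t)" by (intro continuous_intros cont_ey cont_Wout)
  then show ?thesis using ea by (simp cong: continuous_on_cong)
qed

lemma cont_ze2: "continuous_on I ze2"
  unfolding ze2_def using cont_ze by (intro continuous_intros) auto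

lemma cont_v1: "continuous_on I v1"
  unfolding v1_def using cont_th cont_om by (intro continuous_intros) auto

lemma cont_phi: "continuous_on I phi"
  unfolding phi_def using cont_th cont_ze cont_ea cont_ze2 by (intro continuous_intros) auto

text \<open>
  The augmented error \<open>ea\<close> equals the response of \<open>q / p\<close> to \<open>phi\<close> up to the exponentially decaying term \<open>d\<close>,
  because \<open>\<sigma> q = p lam f\<close> up to the factor \<open>lam1\<close>.
\<close>

lemma augmented_error_chain:
  "\<exists>\<xi> d V dV dd K a. (\<forall>i<NW. sol (\<xi> i) (\<lambda>t. if Suc i < NW then \<xi> (Suc i) t else - (\<Sum>j<NW. coeff p j * \<xi> j t) + phi t)) \<and>
    (\<forall>t\<in>I. ea t = (\<Sum>i<NW. coeff q i * \<xi> i t) + d t) \<and> a > 0 \<and> K \<ge> 0 \<and> sol V dV \<and> sol d dd \<and>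
    (\<forall>t\<in>I. (d t)\<^sup>2 \<le> V t) \<and> (\<forall>t\<in>I - S. dV t \<le> - a * V t \<and> (dd t)\<^sup>2 \<le> K * V t)"
proof -
  let ?A = "companion NW p"
  have NW: "NW - 1 < NW" using pq by simp
  \<comment> \<open>The response to \<open>phi\<close> is realized in companion coordinates, in
    which the form of the positive real lemma is given, instead of the given realization of the
    error filter.\<close>
  have "\<exists>\<xi>. \<forall>i<NW. \<xi> i 0 = 0 \<and> sol (\<xi> i) (\<lambda>t. (\<Sum>j<NW. ?A $$ (i, j) * \<xi> j t) + vec_index (unit_vec NW (NW - 1)) i * phi t)"
    by (rule linear_exists) (intro continuous_intros cont_phi)
  then obtain \<xi> where \<xi>: "\<And>i. i < NW \<Longrightarrow> sol (\<xi> i) (\<lambda>t. (\<Sum>j<NW. ?A $$ (i, j) * \<xi> j t) + vec_index (unit_vec NW (NW - 1)) i * phi t)"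
    by blast
  define Y where "Y t = (\<Sum>i<NW. coeff q i * \<xi> i t)" for t
  have rY: "rel [(p, Y), (- q, phi)] NW"
  proof (rule ss_rel1[OF companion_carrier char_poly_companion[OF pq(1,2)] num_companion[OF pq(1,2)] \<xi>])
    show "degree q < NW" using pq by simp
  qed (auto simp: Y_def)
  define d where "d t = ea t - Y t" for t
  have 1: "rel (pmul p [(\<sigma>, ey), (- lam, v1)]) (NW + (n - 1 + ns))" by (rule rel_mult[OF rel_error]) (use pq in simp)
  have 2: "rel (pmul \<sigma> [(p, Wout), (- q, \<lambda>t. phi t - eta t)]) (NW + (n - 1 + ns))"
    using rel_mult[OF rel_Wout, of \<sigma> "n - 1 + ns"] \<sigma>_props(2) by (simp add: add.commute)
  have 3: "rel (pmul (- \<sigma>) [(p, Y), (- q, phi)]) (NW + (n - 1 + ns))"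
    using rel_mult[OF rY, of "- \<sigma>" "n - 1 + ns"] \<sigma>_props(2) by (simp add: add.commute)
  have 4: "rel (pmul (- (p * lam)) [(f, eta), (- 1, v1)]) (NW + (n - 1 + ns))"
  proof (rule rel_lift_le[OF rel_mult[OF rel_eta]])
    show "degree (- (p * lam)) \<le> NW + (n - 1)" using degree_mult_le[of p lam] pq lam by simp
  qed simp
  \<comment> \<open>The cancelled factor \<open>gg\<close> makes the reduced fraction
    \<open>q / p\<close> compatible with \<open>Zm\<close>, \<open>f\<close> and
    \<open>Pm + L\<close>.\<close>
  have gg: "\<sigma> * q = p * lam * f"
  proof -
    have "\<sigma> * q = lam1 * p * (q * gg)" by (simp only: pq(8) mult_ac)
    also have "\<dots> = p * lam * f" unfolding pq(7)[symmetric] ctrl(4) by (simp only: mult_ac)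
    finally show ?thesis .
  qed
  \<comment> \<open>In \<open>ey + Wout - Y\<close> the signals \<open>v1\<close>,
    \<open>eta\<close> and \<open>phi\<close> drop out, so \<open>d\<close> satisfies a homogeneous
    relation with Hurwitz polynomial.\<close>
  have rd: "rel [(\<sigma> * p, d)] (NW + (n - 1 + ns))"
  proof (rule rel_cong[OF rel_append[OF rel_append[OF 1 2] rel_append[OF 3 4]]])
    fix k t assume t: "t \<in> I"
    have e: "d t = ey t + Wout t - Y t" using ea[OF t] by (simp add: d_def)
    have cg: "coeff (\<sigma> * q) k = coeff (p * lam * f) k" by (simp only: gg)
    have c: "lc (pmul p [(\<sigma>, ey), (- lam, v1)]) k t = coeff (\<sigma> * p) k * ey t - coeff (p * lam) k * v1 t"
      "lc (pmul \<sigma> [(p, Wout), (- q, \<lambda>t. phi t - eta t)]) k t = coeff (\<sigma> * p) k * Wout t - coeff (\<sigma> * q) k * (phi t - eta t)"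
      "lc (pmul (- \<sigma>) [(p, Y), (- q, phi)]) k t = - coeff (\<sigma> * p) k * Y t + coeff (\<sigma> * q) k * phi t"
      "lc (pmul (- (p * lam)) [(f, eta), (- 1, v1)]) k t = - coeff (p * lam * f) k * eta t + coeff (p * lam) k * v1 t"
      by (simp_all add: mult_ac)
    show "lc [(\<sigma> * p, d)] k t = lc ((pmul p [(\<sigma>, ey), (- lam, v1)] @ pmul \<sigma> [(p, Wout), (- q, \<lambda>t. phi t - eta t)]) @
        (pmul (- \<sigma>) [(p, Y), (- q, phi)] @ pmul (- (p * lam)) [(f, eta), (- 1, v1)])) k t"
      unfolding lc_simps(3) c cg by (simp add: e algebra_simps)
  qed (use degree_mult_le[of \<sigma> p] \<sigma>_props(2) pq in auto)
  have \<sigma>p: "monic (\<sigma> * p)" "degree (\<sigma> * p) = NW + (n - 1 + ns)" "hurwitz_poly (\<sigma> * p)"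
    using monic_mult[OF \<sigma>_props(1) pq(1)] \<sigma>_props pq hurwitz_mult by auto
  obtain a where a: "a > 0" "\<forall>s. poly (map_poly complex_of_real (\<sigma> * p)) s = 0 \<longrightarrow> 2 * Re s < - a"
    using hurwitz_margin[OF \<sigma>p(3)] \<sigma>p(1) by (metis leading_coeff_0_iff zero_neq_one)
  obtain K V dV dd where "K \<ge> 0" "sol V dV" "\<forall>t\<in>I. (d t)\<^sup>2 \<le> V t"
    "\<forall>t\<in>I - S. dV t \<le> - a * V t + K * ssq [] t" "sol d dd" "\<forall>t\<in>I - S. (dd t)\<^sup>2 \<le> K * (V t + ssq [] t)"
    using rel_stable[OF rd \<sigma>p(1,2) a(2)] by auto
  moreover have "sol (\<xi> i) (\<lambda>t. if Suc i < NW then \<xi> (Suc i) t else - (\<Sum>j<NW. coeff p j * \<xi> j t) + phi t)" if "i < NW" for i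
    by (rule sol_cong[OF \<xi>[OF that]]) (use that in \<open>auto simp: companion_row\<close>)
  moreover have "\<forall>t\<in>I. ea t = (\<Sum>i<NW. coeff q i * \<xi> i t) + d t" by (simp add: d_def Y_def)
  ultimately show ?thesis using a(1) by (intro exI[of _ \<xi>] exI[of _ d] exI) auto
qed

end

section \<open>Lyapunov analysis\<close>

lemma qf_cross_bound:
  assumes sym: "\<And>i j. B i j = B j i" and nn: "\<And>x. 0 \<le> qf N B x" and k: "\<kappa> > 0"
  shows "2 * (\<Sum>i<N. \<Sum>j<N. B i j * x i * e j) \<le> \<kappa> * qf N B x + qf N B e / \<kappa>"
proof -
  define c where "c = (\<Sum>i<N. \<Sum>j<N. B i j * x i * e j)"
  have s: "(\<Sum>i<N. \<Sum>j<N. B i j * e i * x j) = c"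
  proof -
    have s: "B i j * e i * x j = B j i * x j * e i" for i j using sym[of i j] by simp
    have "(\<Sum>i<N. \<Sum>j<N. B i j * e i * x j) = (\<Sum>i<N. \<Sum>j<N. B j i * x j * e i)" by (intro sum.cong refl s)
    also have "\<dots> = c" unfolding c_def by (rule sum.swap)
    finally show ?thesis .
  qed
  have "qf N B (\<lambda>i. \<kappa> * x i - e i) = (\<Sum>i<N. \<Sum>j<N. \<kappa>\<^sup>2 * (B i j * x i * x j) - \<kappa> * (B i j * x i * e j) - \<kappa> * (B i j * e i * x j) + B i j * e i * e j)"
    unfolding qf_def by (intro sum.cong refl) (simp add: algebra_simps power2_eq_square)
  also have "\<dots> = \<kappa>\<^sup>2 * qf N B x - \<kappa> * c - \<kappa> * c + qf N B e"
    unfolding sum.distrib sum_subtractf sum_distrib_left[symmetric] s by (simp add: qf_def c_def)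
  finally have "2 * c * \<kappa> \<le> \<kappa>\<^sup>2 * qf N B x + qf N B e"
    using nn[of "\<lambda>i. \<kappa> * x i - e i"] by (simp add: algebra_simps)
  then have "2 * c \<le> (\<kappa>\<^sup>2 * qf N B x + qf N B e) / \<kappa>" using k by (simp add: pos_le_divide_eq)
  also have "\<dots> = \<kappa> * qf N B x + qf N B e / \<kappa>" using k by (simp add: add_divide_distrib power2_eq_square)
  finally show ?thesis by (simp add: c_def)
qed

lemma qf_upper_bound:
  assumes "\<And>i. i < N \<Longrightarrow> (e i)\<^sup>2 \<le> M"
  shows "qf N B e \<le> (\<Sum>i<N. \<Sum>j<N. \<bar>B i j\<bar>) * M"
proof -
  have "B i j * e i * e j \<le> \<bar>B i j\<bar> * M" if "i < N" "j < N" for i j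
  proof -
    have "2 * (\<bar>e i\<bar> * \<bar>e j\<bar>) \<le> (e i)\<^sup>2 + (e j)\<^sup>2" using sum_squares_bound[of "\<bar>e i\<bar>" "\<bar>e j\<bar>"] by (simp add: mult.assoc)
    then have "\<bar>e i * e j\<bar> \<le> M" using assms[OF that(1)] assms[OF that(2)] by (simp add: abs_mult)
    then have "\<bar>B i j\<bar> * \<bar>e i * e j\<bar> \<le> \<bar>B i j\<bar> * M" by (rule mult_left_mono) simp
    then show ?thesis using abs_ge_self[of "B i j * (e i * e j)"] by (simp add: abs_mult mult.assoc)
  qed
  then have "qf N B e \<le> (\<Sum>i<N. \<Sum>j<N. \<bar>B i j\<bar> * M)" unfolding qf_def by (intro sum_mono) auto
  then show ?thesis by (simp add: sum_distrib_right)
qed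

context loop
begin

text \<open>The squared norm of \<open>ea \<zeta>\<close>, which is \<open>1 / gam\<^sup>2\<close>
  times the squared speed of the parameters.\<close>

definition G :: "real \<Rightarrow> real" where
  "G t = (ea t)\<^sup>2 * ze2 t"

lemma ze2_nonneg: "0 \<le> ze2 t"
  by (auto simp: ze2_def intro: sum_nonneg)

lemma G_nonneg: "0 \<le> G t"
  by (simp add: G_def ze2_nonneg)

lemma cont_G: "continuous_on I G"
  unfolding G_def by (intro continuous_intros cont_ea cont_ze2)

text \<open>The identity behind positive realness needs \<open>ea\<close> to be exactly the output
  of the companion system. The decaying term \<open>d\<close> is therefore shifted into the state,
  and the resulting disturbance is paid for by its own Lyapunov function \<open>V\<close>.\<close>

lemma lyapunov:
  "\<exists>C\<ge>0. \<forall>t\<in>I. (\<forall>j<2 * n - 1. \<bar>th j t\<bar> \<le> C) \<and> \<bar>ea t\<bar> \<le> C \<and> J (\<lambda>s. (ea s)\<^sup>2) t \<le> C \<and> J G t \<le> C"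
proof -
  obtain \<xi> d V dV dd K a where H: "\<forall>i<NW. sol (\<xi> i) (\<lambda>t. if Suc i < NW then \<xi> (Suc i) t else - (\<Sum>j<NW. coeff p j * \<xi> j t) + phi t)"
    "\<forall>t\<in>I. ea t = (\<Sum>i<NW. coeff q i * \<xi> i t) + d t" "a > 0" "K \<ge> 0" "sol V dV" "sol d dd"
    "\<forall>t\<in>I. (d t)\<^sup>2 \<le> V t" "\<forall>t\<in>I - S. dV t \<le> - a * V t \<and> (dd t)\<^sup>2 \<le> K * V t"
    using augmented_error_chain by blast
  have \<xi>: "sol (\<xi> i) (\<lambda>t. if Suc i < NW then \<xi> (Suc i) t else - (\<Sum>j<NW. coeff p j * \<xi> j t) + phi t)" if "i < NW" for i
    using H(1) that by blast
  have ea_\<xi>: "ea t = (\<Sum>i<NW. coeff q i * \<xi> i t) + d t" if "t \<in> I" for t using H(2) that by blast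
  have V: "a > 0" "K \<ge> 0" "sol V dV" "sol d dd" "\<And>t. t \<in> I \<Longrightarrow> (d t)\<^sup>2 \<le> V t"
      "\<And>t. t \<in> I - S \<Longrightarrow> dV t \<le> - a * V t" "\<And>t. t \<in> I - S \<Longrightarrow> (dd t)\<^sup>2 \<le> K * V t"
    using H(3-) by blast+
  have NW: "NW - 1 < NW" using pq by simp
  \<comment> \<open>\<open>q\<close> is monic of degree \<open>NW - 1\<close>, so adding
    \<open>d\<close> to the last coordinate raises the output by exactly \<open>d\<close>.\<close>
  define x where "x i t = \<xi> i t + (if i = NW - 1 then d t else 0)" for i t
  define X where "X t i = (if i < NW then x i t else - (\<Sum>j<NW. coeff p j * x j t) + phi t)" for i t
  \<comment> \<open>The shift disturbs the two equations in which the last coordinate occurs: that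
    of its predecessor and its own.\<close>
  define e where "e i t = (if Suc i = NW - 1 then - d t else if i = NW - 1 then coeff p (NW - 1) * d t + dd t else 0)" for i t
  have solx: "sol (x i) (\<lambda>t. X t (Suc i) + e i t)" if i: "i < NW" for i
  proof (cases "i = NW - 1")
    case True
    have "sol (x i) (\<lambda>t. (- (\<Sum>j<NW. coeff p j * \<xi> j t) + phi t) + dd t)"
      using sol_add[OF \<xi>[OF i] V(4)] True NW unfolding x_def by simp
    moreover have "(\<Sum>j<NW. coeff p j * x j t) = (\<Sum>j<NW. coeff p j * \<xi> j t) + coeff p (NW - 1) * d t" for t
      using NW by (simp add: x_def distrib_left sum.distrib sum.delta if_distrib[of "\<lambda>z. _ * z"] cong: if_cong)
    ultimately show ?thesis
      by (elim sol_cong) (use True NW in \<open>auto simp: X_def e_def\<close>)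
  next
    case False
    then have Si: "Suc i < NW" using i by simp
    then have "sol (x i) (\<lambda>t. \<xi> (Suc i) t)" using \<xi>[OF i] False unfolding x_def by simp
    then show ?thesis by (rule sol_cong) (use False i in \<open>auto simp: X_def e_def x_def\<close>)
  qed
  have eaX: "ea t = (\<Sum>i<NW. coeff q i * X t i)" if "t \<in> I" for t
  proof -
    have "coeff q (NW - 1) = 1" using pq by (metis add_diff_cancel_right')
    then have "(\<Sum>i<NW. coeff q i * x i t) = (\<Sum>i<NW. coeff q i * \<xi> i t) + d t"
      using NW by (simp add: x_def distrib_left sum.distrib sum.delta if_distrib[of "\<lambda>z. _ * z"] cong: if_cong)
    then show ?thesis using ea_\<xi>[OF that] by (simp add: X_def)
  qed
  have phiX: "(\<Sum>i\<le>NW. coeff p i * X t i) = phi t" for t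
    using pq by (simp add: lessThan_Suc_atMost[symmetric] X_def)
  define E where "E = 2 * (coeff p (NW - 1))\<^sup>2 + 2 * K + 1"
  have e_bound: "(e i t)\<^sup>2 \<le> E * V t" if t: "t \<in> I - S" for i t
  proof -
    have v: "0 \<le> V t" using V(5)[of t] t by (metis Diff_iff order_trans zero_le_power2)
    have "(d t)\<^sup>2 \<le> E * V t"
    proof -
      have "1 * V t \<le> E * V t" using V(2) v by (intro mult_right_mono) (auto simp: E_def)
      then show ?thesis using V(5)[of t] t by simp
    qed
    moreover have "(coeff p (NW - 1) * d t + dd t)\<^sup>2 \<le> E * V t"
    proof -
      have "(coeff p (NW - 1) * d t + dd t)\<^sup>2 \<le> 2 * ((coeff p (NW - 1))\<^sup>2 * (d t)\<^sup>2) + 2 * (dd t)\<^sup>2"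
        using real_square_add_le[of "coeff p (NW - 1) * d t" "dd t"] by (simp add: power_mult_distrib)
      also have "\<dots> \<le> 2 * ((coeff p (NW - 1))\<^sup>2 * V t) + 2 * (K * V t)"
        using V(5)[of t] V(7)[OF t] t by (intro add_mono mult_left_mono) auto
      also have "\<dots> \<le> E * V t" using v by (simp add: E_def distrib_right)
      finally show ?thesis .
    qed
    ultimately show ?thesis using V(2) v by (auto simp: e_def E_def)
  qed
  define Bs where "Bs = (\<Sum>i<NW. \<Sum>j<NW. \<bar>B i j\<bar>)"
  define D where "D = Bs * E / \<kappa>"
  have Bs: "0 \<le> Bs" by (auto simp: Bs_def intro: sum_nonneg)
  define W where "W t = qf NW B (\<lambda>i. x i t)" for t
  define dW where "dW t = 2 * (\<Sum>i<NW. \<Sum>j<NW. B i j * x i t * (X t (Suc j) + e j t))" for t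
  have solW: "sol W dW" unfolding W_def dW_def by (rule sol_qf[OF KYP(1) solx])
  have WX: "W t = qf NW B (X t)" for t by (simp add: W_def qf_def X_def)
  have dW: "dW t \<le> 2 * ea t * phi t - \<kappa> * W t + D * V t" if t: "t \<in> I - S" for t
  proof -
    have "dW t = 2 * (\<Sum>i<NW. \<Sum>j<NW. B i j * X t i * X t (Suc j)) + 2 * (\<Sum>i<NW. \<Sum>j<NW. B i j * X t i * e j t)"
      by (simp add: dW_def X_def distrib_left sum.distrib)
    also have "\<dots> \<le> (2 * ea t * phi t - 2 * \<kappa> * W t) + (\<kappa> * W t + qf NW B (\<lambda>j. e j t) / \<kappa>)"
      using KYP(4)[of "X t"] eaX[of t] t qf_cross_bound[OF KYP(1,2) \<kappa>, of "X t" "\<lambda>j. e j t"]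
      unfolding phiX WX by (intro add_mono) auto
    also have "qf NW B (\<lambda>j. e j t) / \<kappa> \<le> Bs * (E * V t) / \<kappa>"
      unfolding Bs_def using e_bound[OF t] \<kappa> by (intro divide_right_mono qf_upper_bound) auto
    also have "Bs * (E * V t) / \<kappa> = D * V t" by (simp add: D_def)
    finally show ?thesis by simp
  qed
  define \<Theta> where "\<Theta> t = (\<Sum>j<2 * n - 1. (th j t - \<theta>s j)\<^sup>2) / gam" for t
  define dT where "dT t = (\<Sum>j<2 * n - 1. 2 * (th j t - \<theta>s j) * (- gam * ea t * ze j t - 0)) * (1 / gam)" for t
  have solT: "sol \<Theta> dT"
  proof -
    have "sol (\<lambda>t. (1 / gam) * (\<Sum>j<2 * n - 1. (th j t - \<theta>s j)\<^sup>2)) (\<lambda>t. (1 / gam) * (\<Sum>j<2 * n - 1. 2 * (th j t - \<theta>s j) * (- gam * ea t * ze j t - 0)))"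
      by (intro sol_cmult sol_sum sol_square sol_diff sol_const th) auto
    then show ?thesis by (rule sol_cong) (simp_all add: \<Theta>_def dT_def)
  qed
  have dT: "dT t = - 2 * ea t * (\<Sum>j<2 * n - 1. (th j t - \<theta>s j) * ze j t)" for t
    using gam by (simp add: dT_def sum_distrib_left sum_distrib_right field_simps flip: sum_negf)
  \<comment> \<open>The weight \<open>D / a\<close> makes the decay of \<open>V\<close> compensate
    the disturbance \<open>D V\<close> in the derivative of \<open>W\<close>.\<close>
  define U where "U t = (W t + \<Theta> t) + D / a * V t" for t
  define dU where "dU t = (dW t + dT t) + D / a * dV t" for t
  have solU: "sol U dU" unfolding U_def dU_def by (intro sol_add sol_cmult solW solT V)
  have D0: "0 \<le> D" using Bs \<kappa> V(2) by (simp add: D_def E_def)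
  have V0: "0 \<le> V t" if "t \<in> I" for t using V(5)[OF that] by (meson order_trans zero_le_power2)
  have \<Theta>0: "0 \<le> \<Theta> t" for t using gam by (auto simp: \<Theta>_def intro!: divide_nonneg_pos sum_nonneg)
  have W_ea: "(ea t)\<^sup>2 \<le> W t" if "t \<in> I" for t using KYP(3)[of "X t"] unfolding eaX[OF that] WX .
  have dU: "dU t \<le> - (2 * G t + \<kappa> * (ea t)\<^sup>2)" if t: "t \<in> I - S" for t
  proof -
    have "D / a * dV t \<le> D / a * (- a * V t)" using V(6)[OF t] D0 V(1) by (intro mult_left_mono) auto
    also have "\<dots> = - D * V t" using V(1) by simp
    finally have "D / a * dV t \<le> - D * V t" .
    \<comment> \<open>The update law is designed for this: the indefinite term in the parameter
      error cancels, and the damping \<open>- ea \<zeta>\<^sup>T \<zeta>\<close> in the error filter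
      leaves \<open>- 2 G\<close>.\<close>
    moreover have "2 * ea t * phi t + dT t = - 2 * G t"
      by (simp add: dT phi_def G_def right_diff_distrib power2_eq_square)
    moreover have "\<kappa> * (ea t)\<^sup>2 \<le> \<kappa> * W t" using W_ea[of t] t \<kappa> by (intro mult_left_mono) auto
    ultimately show ?thesis using dW[OF t] unfolding dU_def by linarith
  qed
  have int: "U t + (2 * J G t + \<kappa> * J (\<lambda>s. (ea s)\<^sup>2) t) \<le> U 0" if t: "t \<in> I" for t
  proof -
    have c: "continuous_on I (\<lambda>s. (ea s)\<^sup>2)" by (intro continuous_intros cont_ea)
    have "U t + (2 * J G t + \<kappa> * J (\<lambda>s. (ea s)\<^sup>2) t) \<le> U 0 + (2 * J G 0 + \<kappa> * J (\<lambda>s. (ea s)\<^sup>2) 0)"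
      by (rule sol_decreasing[OF sol_add[OF solU sol_add[OF sol_cmult[OF sol_J[OF cont_G]] sol_cmult[OF sol_J[OF c]]]] order_refl time_nonneg[OF t] t])
        (use dU sub_I[OF t, of 0] in fastforce)
    then show ?thesis by simp
  qed
  have Jn: "0 \<le> J G t" "0 \<le> J (\<lambda>s. (ea s)\<^sup>2) t" if "t \<in> I" for t
    using J_nonneg[OF that] G_nonneg by auto
  define U0 where "U0 = U 0"
  have U0n: "0 \<le> U0" and Wb: "W t \<le> U0" and Tb: "\<Theta> t \<le> U0" and Gb: "J G t \<le> U0" and Eb: "\<kappa> * J (\<lambda>s. (ea s)\<^sup>2) t \<le> U0" if t: "t \<in> I" for t
  proof -
    have W0: "0 \<le> W t" using W_ea[OF t] by (meson order_trans zero_le_power2)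
    have v: "0 \<le> D / a * V t" using D0 V(1) V0[OF t] by simp
    have "0 \<le> \<kappa> * J (\<lambda>s. (ea s)\<^sup>2) t" using Jn(2)[OF t] \<kappa> by simp
    then show "0 \<le> U0" "W t \<le> U0" "\<Theta> t \<le> U0" "J G t \<le> U0" "\<kappa> * J (\<lambda>s. (ea s)\<^sup>2) t \<le> U0"
      using int[OF t] W0 \<Theta>0[of t] v Jn(1)[OF t] unfolding U0_def U_def[of t] by linarith+
  qed
  note U0n = U0n[OF zero_mem]
  define S where "S = (\<Sum>j<2 * n - 1. \<bar>\<theta>s j\<bar>)"
  define C where "C = U0 + U0 / \<kappa> + sqrt U0 + (S + sqrt (gam * U0))"
  have S0: "0 \<le> S" by (auto simp: S_def intro: sum_nonneg)
  have parts: "0 \<le> U0 / \<kappa>" "0 \<le> sqrt U0" "0 \<le> sqrt (gam * U0)" using U0n \<kappa> gam by auto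
  have "\<bar>th j t\<bar> \<le> C" if t: "t \<in> I" and j: "j < 2 * n - 1" for j t
  proof -
    have "(th j t - \<theta>s j)\<^sup>2 \<le> (\<Sum>j<2 * n - 1. (th j t - \<theta>s j)\<^sup>2)" using j by (intro member_le_sum) auto
    also have "\<dots> = gam * \<Theta> t" using gam by (simp add: \<Theta>_def)
    also have "\<dots> \<le> gam * U0" using Tb[OF t] gam by (intro mult_left_mono) auto
    finally have "\<bar>th j t - \<theta>s j\<bar> \<le> sqrt (gam * U0)" using real_le_rsqrt[of "\<bar>th j t - \<theta>s j\<bar>"] by simp
    moreover have "\<bar>\<theta>s j\<bar> \<le> S" unfolding S_def using j by (intro member_le_sum) auto
    ultimately show ?thesis using parts U0n unfolding C_def by linarith
  qed
  moreover have "\<bar>ea t\<bar> \<le> C" if t: "t \<in> I" for t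
  proof -
    have "\<bar>ea t\<bar> \<le> sqrt U0" using W_ea[OF t] Wb[OF t] real_le_rsqrt[of "\<bar>ea t\<bar>"] by simp
    then show ?thesis using parts U0n S0 unfolding C_def by linarith
  qed
  moreover have "J (\<lambda>s. (ea s)\<^sup>2) t \<le> C" if t: "t \<in> I" for t
  proof -
    have "J (\<lambda>s. (ea s)\<^sup>2) t \<le> U0 / \<kappa>" using Eb[OF t] \<kappa> by (simp add: field_simps)
    then show ?thesis using parts U0n S0 unfolding C_def by linarith
  qed
  moreover have "J G t \<le> C" if t: "t \<in> I" for t using Gb[OF t] parts S0 unfolding C_def by linarith
  moreover have "0 \<le> C" using parts U0n S0 unfolding C_def by linarith
  ultimately show ?thesis by blast
qed

section \<open>Growth relative to the control error\<close>

lemma th_bounded: "j < 2 * n - 1 \<Longrightarrow> \<exists>C. \<forall>t\<in>I. \<bar>th j t\<bar> \<le> C"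
  using lyapunov by blast

lemma ea_bounded: "\<exists>C. \<forall>t\<in>I. \<bar>ea t\<bar> \<le> C"
  using lyapunov by blast

lemma sdom_r: "sdom r w"
  by (rule sdom_bounded[OF r_bound])

lemma sdom_rv: "sdom (\<lambda>t. r t + v1 t) v1"
  by (intro sdom_add sdom_r sdom_refl)

lemma sdom_y: "sdom y v1"
  by (rule rel_sdom[OF rel_output lam1Pm_props]) (use sdom_rv in auto)

lemma sdom_u: "sdom u v1"
proof -
  have "monic (Z * (lam1 * Pm))" "degree (Z * (lam1 * Pm)) = 2 * n - 1" "hurwitz_poly (Z * (lam1 * Pm))"
    using monic_mult[OF Z(1) lam1Pm_props(1)] lam1Pm_props Z n_pos hurwitz_mult by auto
  then show ?thesis by (rule rel_sdom[OF rel_input]) (use sdom_rv in auto)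
qed

lemma sdom_om: assumes j: "j < 2 * n - 1" shows "sdom (om j) v1"
proof (rule index_cases[OF j])
  assume "j < n - 1"
  then show ?thesis by (intro rel_sdom[OF rel_om1 lam ctrl(3)]) (use sdom_u in auto)
next
  assume "j = n - 1"
  then show ?thesis using sdom_cong[OF sdom_y] omy by simp
next
  fix i assume "j = n + i" "i < n - 1"
  then show ?thesis using rel_sdom[OF rel_om2[of i] lam ctrl(3)] sdom_y by auto
qed

lemma sdom_ze: "j < 2 * n - 1 \<Longrightarrow> sdom (ze j) v1"
  by (rule rel_sdom[OF rel_ze f(1) _ f(3)]) (use f sdom_om in auto)

lemma sdom_th_om: "sdom (\<lambda>t. \<Sum>j<2 * n - 1. th j t * om j t) v1"
proof (rule sdom_sum)
  fix j assume "j \<in> {..<2 * n - 1}"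
  then show "sdom (\<lambda>t. th j t * om j t) v1" using th_bounded[of j] sdom_om[of j] by (auto intro: sdom_bdd_mult)
qed

lemma sdom_ey: "sdom ey v1"
  by (rule rel_sdom[OF rel_error \<sigma>_props]) (use sdom_refl in auto)

text \<open>The plant may be unstable, so its state is not controlled by \<open>u\<close> alone.
  Adding and subtracting \<open>go y\<close> rewrites it as a Hurwitz system driven by
  \<open>y\<close> and \<open>u\<close>.\<close>

lemma sdom_xp: assumes i: "i < n" shows "sdom (xp i) v1"
proof -
  define Ag where "Ag = Matrix.mat n n (\<lambda>(i, j). Ap $$ (i, j) - vec_index go i * vec_index cp j)"
  show ?thesis
  proof (rule state_sdom[of Ag n xp "\<lambda>i t. vec_index go i * y t + vec_index bp i * u t"])
    show "hurwitz_poly (char_poly Ag)" using inj by (simp add: Ag_def)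
    fix k assume k: "k < n"
    show "sol (xp k) (\<lambda>t. (\<Sum>j<n. Ag $$ (k, j) * xp j t) + (vec_index go k * y t + vec_index bp k * u t))"
      by (rule sol_cong[OF xp[OF k]])
        (use k y in \<open>auto simp: Ag_def left_diff_distrib sum_subtractf sum_distrib_left mult.assoc\<close>)
    show "sdom (\<lambda>t. vec_index go k * y t + vec_index bp k * u t) v1" by (intro sdom_add sdom_cmult sdom_y sdom_u)
  qed (use i in \<open>auto simp: Ag_def\<close>)
qed

lemma sdom_xF: "j < 2 * n - 1 \<Longrightarrow> i < ns - 1 \<Longrightarrow> sdom (xF j i) v1"
  by (rule state_sdom[OF filter(1) _ xF]) (use filter(2) f sdom_om in \<open>auto intro: sdom_cmult\<close>)

lemma sdom_xFu: "i < ns - 1 \<Longrightarrow> sdom (xFu i) v1"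
  by (rule state_sdom[OF filter(1) _ xFu]) (use filter(2) f sdom_th_om in \<open>auto intro: sdom_cmult\<close>)

lemma sdom_xm: "i < m \<Longrightarrow> sdom (xm i) v1"
  by (rule state_sdom[OF model(1) _ xm]) (use model(2) Pm sdom_r sdom_ey in \<open>auto intro!: sdom_add sdom_cmult\<close>)

lemma sol_y: "sol y (\<lambda>t. \<Sum>i<n. vec_index cp i * ((\<Sum>j<n. Ap $$ (i, j) * xp j t) + vec_index bp i * u t))"
proof -
  have "sol (\<lambda>t. \<Sum>i<n. vec_index cp i * xp i t) (\<lambda>t. \<Sum>i<n. vec_index cp i * ((\<Sum>j<n. Ap $$ (i, j) * xp j t) + vec_index bp i * u t))"
    by (intro sol_sum sol_cmult xp) auto
  then show ?thesis by (rule sol_cong) (simp_all add: y)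
qed

lemma sol_om: assumes j: "j < 2 * n - 1" shows "\<exists>dom. sol (om j) dom \<and> sdom dom v1"
proof (rule index_cases[OF j])
  assume j': "j < n - 1"
  have "sdom (\<lambda>t. (\<Sum>k<n - 1. Lam $$ (j, k) * om k t) + vec_index bl j * u t) v1"
    by (intro sdom_add sdom_sum sdom_cmult sdom_om sdom_u) auto
  then show ?thesis using om1[OF j'] by blast
next
  assume j: "j = n - 1"
  have "sol (om j) (\<lambda>t. \<Sum>i<n. vec_index cp i * ((\<Sum>j<n. Ap $$ (i, j) * xp j t) + vec_index bp i * u t))"
    by (rule sol_cong[OF sol_y]) (use j omy in auto)
  moreover have "sdom (\<lambda>t. \<Sum>i<n. vec_index cp i * ((\<Sum>j<n. Ap $$ (i, j) * xp j t) + vec_index bp i * u t)) v1"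
    by (intro sdom_sum sdom_cmult sdom_add sdom_xp sdom_u) auto
  ultimately show ?thesis by blast
next
  fix i assume i: "j = n + i" "i < n - 1"
  have "sdom (\<lambda>t. (\<Sum>k<n - 1. Lam $$ (i, k) * om (n + k) t) + vec_index bl i * y t) v1"
    by (intro sdom_add sdom_sum sdom_cmult sdom_om sdom_y) auto
  then show ?thesis using om2[OF i(2)] unfolding i(1) by blast
qed

text \<open>The derivative of the control error splits into a part driven by the parameter update, bounded by the
  integrable \<open>G\<close>, and a part that grows no faster than \<open>v1\<close>.\<close>

lemma sol_v1:
  "\<exists>d1 d2 C. C \<ge> 0 \<and> sol v1 (\<lambda>t. d1 t + d2 t) \<and>
     (\<forall>t\<in>I. \<forall>B. (\<forall>s\<in>{0..t}. \<bar>v1 s\<bar> \<le> B) \<longrightarrow> (d1 t)\<^sup>2 \<le> C * (1 + B)\<^sup>2 * G t \<and> (d2 t)\<^sup>2 \<le> C * (1 + B)\<^sup>2)"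
proof -
  obtain dom where dom: "\<And>j. j < 2 * n - 1 \<Longrightarrow> sol (om j) (dom j)" "\<And>j. j < 2 * n - 1 \<Longrightarrow> sdom (dom j) v1"
    using sol_om by metis
  define d1 where "d1 t = (\<Sum>j<2 * n - 1. (- gam * ea t * ze j t) * om j t)" for t
  define d2 where "d2 t = (\<Sum>j<2 * n - 1. (th j t - \<theta>s j) * dom j t)" for t
  have s: "sol v1 (\<lambda>t. d1 t + d2 t)"
  proof -
    have "sol (\<lambda>t. \<Sum>j<2 * n - 1. (th j t - \<theta>s j) * om j t) (\<lambda>t. \<Sum>j<2 * n - 1. (th j t - \<theta>s j) * dom j t + (- gam * ea t * ze j t - 0) * om j t)"
      by (intro sol_sum sol_mult sol_diff sol_const th dom) auto
    then show ?thesis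
    proof (rule sol_cong)
      show "(\<Sum>j<2 * n - 1. (th j t - \<theta>s j) * dom j t + (- gam * ea t * ze j t - 0) * om j t) = d1 t + d2 t" for t
        unfolding d1_def d2_def sum.distrib[symmetric] by (intro sum.cong refl) simp
    qed (simp add: v1_def)
  qed
  have "sdom d2 v1" unfolding d2_def
  proof (rule sdom_sum)
    fix j assume j: "j \<in> {..<2 * n - 1}"
    then obtain C where "\<And>t. t \<in> I \<Longrightarrow> \<bar>th j t\<bar> \<le> C" using th_bounded[of j] by auto
    then have "\<And>t. t \<in> I \<Longrightarrow> \<bar>th j t - \<theta>s j\<bar> \<le> C + \<bar>\<theta>s j\<bar>" by fastforce
    then show "sdom (\<lambda>t. (th j t - \<theta>s j) * dom j t) v1" using dom(2) j by (intro sdom_bdd_mult[where K = "C + \<bar>\<theta>s j\<bar>"]) auto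
  qed
  then obtain C2 where C2: "C2 \<ge> 0" "\<And>t B. t \<in> I \<Longrightarrow> (\<forall>s\<in>{0..t}. \<bar>v1 s\<bar> \<le> B) \<Longrightarrow> \<bar>d2 t\<bar> \<le> C2 * (1 + B)"
    unfolding sdom_def by blast
  define xs where "xs = map (\<lambda>j. (0 :: real poly, om j)) [0..<2 * n - 1]"
  have ssq: "ssq xs t = (\<Sum>j<2 * n - 1. (om j t)\<^sup>2)" for t
    by (simp add: xs_def o_def case_prod_beta interv_sum_list_conv_sum_set_nat atLeast0LessThan)
  have "\<exists>C\<ge>0. \<forall>t\<in>I. \<forall>B. (\<forall>s\<in>{0..t}. \<bar>v1 s\<bar> \<le> B) \<longrightarrow> ssq xs t \<le> C * (1 + B)\<^sup>2"
    by (rule sdom_sq) (auto simp: xs_def intro: sdom_om)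
  then obtain C1 where C1: "C1 \<ge> 0" "\<And>t B. t \<in> I \<Longrightarrow> (\<forall>s\<in>{0..t}. \<bar>v1 s\<bar> \<le> B) \<Longrightarrow> (\<Sum>j<2 * n - 1. (om j t)\<^sup>2) \<le> C1 * (1 + B)\<^sup>2"
    unfolding ssq by blast
  define C where "C = gam\<^sup>2 * C1 + C2\<^sup>2"
  have "(d1 t)\<^sup>2 \<le> C * (1 + B)\<^sup>2 * G t \<and> (d2 t)\<^sup>2 \<le> C * (1 + B)\<^sup>2" if t: "t \<in> I" and B: "\<forall>s\<in>{0..t}. \<bar>v1 s\<bar> \<le> B" for t B
  proof
    have "d1 t = - gam * ea t * (\<Sum>j<2 * n - 1. ze j t * om j t)" by (simp add: d1_def sum_distrib_left mult.assoc)
    then have "(d1 t)\<^sup>2 = gam\<^sup>2 * (ea t)\<^sup>2 * (\<Sum>j<2 * n - 1. ze j t * om j t)\<^sup>2" by (simp add: power_mult_distrib)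
    also have "\<dots> \<le> gam\<^sup>2 * (ea t)\<^sup>2 * (ze2 t * (\<Sum>j<2 * n - 1. (om j t)\<^sup>2))"
      unfolding ze2_def by (intro mult_left_mono Cauchy_Schwarz_ineq_sum) auto
    also have "\<dots> = gam\<^sup>2 * G t * (\<Sum>j<2 * n - 1. (om j t)\<^sup>2)" by (simp add: G_def)
    also have "\<dots> \<le> gam\<^sup>2 * G t * (C1 * (1 + B)\<^sup>2)" using C1(2)[OF t B] G_nonneg by (intro mult_left_mono) auto
    also have "\<dots> \<le> C * (1 + B)\<^sup>2 * G t" using G_nonneg[of t] by (simp add: C_def distrib_right)
    finally show "(d1 t)\<^sup>2 \<le> C * (1 + B)\<^sup>2 * G t" .
    have "(d2 t)\<^sup>2 \<le> (C2 * (1 + B))\<^sup>2" using C2(2)[OF t B] by (metis abs_ge_zero power2_abs power_mono)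
    also have "\<dots> \<le> C * (1 + B)\<^sup>2" using C1(1) by (simp add: C_def power_mult_distrib distrib_right)
    finally show "(d2 t)\<^sup>2 \<le> C * (1 + B)\<^sup>2" .
  qed
  moreover have "C \<ge> 0" using C1 by (simp add: C_def)
  ultimately show ?thesis using s by blast
qed

end

section \<open>First order lags\<close>

context time_domain
begin

text \<open>A first order lag with unit gain cannot leave the interval that contains its initial
  value and its input.\<close>

lemma lag_bound:
  assumes x: "sol x (\<lambda>t. \<alpha> * (w t - x t))" and \<alpha>: "\<alpha> > 0" and t: "t \<in> I" and x0: "\<bar>x 0\<bar> \<le> M"
    and w: "\<And>s. s \<in> {0..t} \<Longrightarrow> \<bar>w s\<bar> \<le> M"
  shows "\<bar>x t\<bar> \<le> (M :: real)"
proof -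
  have one: "z t \<le> M" if z: "sol z (\<lambda>t. \<alpha> * (v t - z t))" "z 0 \<le> M" "\<And>s. s \<in> {0..t} \<Longrightarrow> v s \<le> M" for z v
  proof -
    have "z t \<le> (z 0 - \<alpha> * M / \<alpha>) * exp (- \<alpha> * (t - 0)) + \<alpha> * M / \<alpha>"
    proof (rule sol_decay[OF z(1) order_refl time_nonneg[OF t] t \<alpha>])
      fix s assume "s \<in> {0..t} - S"
      then have "\<alpha> * v s \<le> \<alpha> * M" using z(3)[of s] \<alpha> by (intro mult_left_mono) auto
      then show "\<alpha> * (v s - z s) \<le> - \<alpha> * z s + \<alpha> * M" by (simp add: algebra_simps)
    qed
    moreover have "(z 0 - \<alpha> * M / \<alpha>) * exp (- \<alpha> * (t - 0)) \<le> 0" using z(2) \<alpha> by (intro mult_nonpos_nonneg) auto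
    ultimately show ?thesis using \<alpha> by simp
  qed
  have "sol (\<lambda>t. - x t) (\<lambda>t. \<alpha> * (- w t - (- x t)))" by (rule sol_cong[OF sol_minus[OF x]]) (auto simp: algebra_simps)
  then have "- x t \<le> M" by (rule one[of "\<lambda>t. - x t" "\<lambda>t. - w t"]) (use x0 w in \<open>force simp: abs_le_iff\<close>)+
  moreover have "x t \<le> M" by (rule one[OF x]) (use x0 w in \<open>force simp: abs_le_iff\<close>)+
  ultimately show ?thesis by (simp add: abs_le_iff)
qed

lemma lag_exists:
  fixes w :: "real \<Rightarrow> real"
  assumes w: "continuous_on I w" shows "\<exists>x. x 0 = 0 \<and> sol x (\<lambda>t. \<alpha> * (w t - x t))"
proof -
  have "\<exists>x. \<forall>i<(1::nat). x i 0 = 0 \<and> sol (x i) (\<lambda>t. (\<Sum>j<1. Matrix.mat 1 1 (\<lambda>_. - \<alpha>) $$ (i, j) * x j t) + \<alpha> * w t)"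
    by (rule linear_exists[where c = "\<lambda>_. 0" and w = "\<lambda>_ t. \<alpha> * w t"]) (intro continuous_intros w)
  then obtain x where "x (0::nat) 0 = 0" "sol (x 0) (\<lambda>t. (\<Sum>j<1. Matrix.mat 1 1 (\<lambda>_. - \<alpha>) $$ (0, j) * x j t) + \<alpha> * w t)" by auto
  then show ?thesis by (intro exI[of _ "x 0"] conjI) (auto elim!: sol_cong simp: algebra_simps)
qed

lemma lags_exist:
  fixes w :: "real \<Rightarrow> real"
  assumes w: "continuous_on I w"
  shows "\<exists>\<kappa>. \<kappa> 0 = w \<and> (\<forall>k. \<kappa> (Suc k) 0 = 0 \<and> sol (\<kappa> (Suc k)) (\<lambda>t. \<alpha> * (\<kappa> k t - \<kappa> (Suc k) t)))"
proof -
  define L where "L v = (SOME x. x 0 = 0 \<and> sol x (\<lambda>t. \<alpha> * (v t - x t)))" for v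
  have L: "L v 0 = 0 \<and> sol (L v) (\<lambda>t. \<alpha> * (v t - L v t))" if "continuous_on I v" for v
    unfolding L_def by (rule someI_ex[OF lag_exists[OF that]])
  have c: "continuous_on I ((L ^^ k) w)" for k
    by (induction k) (use w L sol_cont in auto)
  show ?thesis by (intro exI[of _ "\<lambda>k. (L ^^ k) w"]) (use L[OF c] in auto)
qed

lemma rel_lags:
  assumes \<kappa>: "\<kappa> 0 = w" "\<And>k. sol (\<kappa> (Suc k)) (\<lambda>t. \<alpha> * (\<kappa> k t - \<kappa> (Suc k) t))"
  shows "rel [([:\<alpha>, 1:] ^ k, \<kappa> k), (- [:\<alpha> ^ k:], w)] k"
proof (induction k)
  case 0
  show ?case unfolding rel_def
    by (intro conjI exI[of _ "\<lambda>k t. 0"]) (auto simp: \<kappa>(1))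
next
  case (Suc k)
  have "rel [([:\<alpha>, 1:], \<kappa> (Suc k)), (- [:\<alpha>:], \<kappa> k)] 1" unfolding rel_def
  proof (intro conjI exI[of _ "\<lambda>j t. if j = 0 then - \<kappa> (Suc k) t else 0"] allI impI ballI)
    fix j :: nat assume j: "j < 1"
    then have j0: "j = 0" by simp
    show "sol (\<lambda>t. if j = 0 then - \<kappa> (Suc k) t else 0)
         (\<lambda>t. lc [([:\<alpha>, 1:], \<kappa> (Suc k)), (- [:\<alpha>:], \<kappa> k)] (1 - Suc j) t + (if Suc j = 0 then - \<kappa> (Suc k) t else 0))"
      unfolding j0 by (rule sol_cong[OF sol_minus[OF \<kappa>(2)[of k]]]) (auto simp: algebra_simps)
  qed auto
  from rel_mult[OF this, of "[:\<alpha>, 1:] ^ k" k]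
  have 1: "rel (pmul ([:\<alpha>, 1:] ^ k) [([:\<alpha>, 1:], \<kappa> (Suc k)), (- [:\<alpha>:], \<kappa> k)]) (Suc k)"
    using degree_power_le[of "[:\<alpha>, 1:]" k] by simp
  have 2: "rel (pmul [:\<alpha>:] [([:\<alpha>, 1:] ^ k, \<kappa> k), (- [:\<alpha> ^ k:], w)]) (Suc k)"
    by (rule rel_lift[OF rel_const_mult[OF Suc.IH]])
  show ?case
  proof (rule rel_cong[OF rel_append[OF 1 2]])
    fix j t
    have e: "[:\<alpha>, 1:] ^ Suc k = [:\<alpha>, 1:] ^ k * [:\<alpha>, 1:]" "[:\<alpha>, 1:] ^ k * - [:\<alpha>:] = - ([:\<alpha>:] * [:\<alpha>, 1:] ^ k)"
      "[:\<alpha>:] * - [:\<alpha> ^ k:] = - [:\<alpha> ^ Suc k:]"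
      by (simp_all only: power_Suc2 mult_minus_right mult.commute) simp
    show "lc [([:\<alpha>, 1:] ^ Suc k, \<kappa> (Suc k)), (- [:\<alpha> ^ Suc k:], w)] j t
      = lc (pmul ([:\<alpha>, 1:] ^ k) [([:\<alpha>, 1:], \<kappa> (Suc k)), (- [:\<alpha>:], \<kappa> k)] @ pmul [:\<alpha>:] [([:\<alpha>, 1:] ^ k, \<kappa> k), (- [:\<alpha> ^ k:], w)]) j t"
      by (simp only: list.map prod.case lc_simps append.simps e coeff_minus)
  next
    fix p z assume "(p, z) \<in> set [([:\<alpha>, 1:] ^ Suc k, \<kappa> (Suc k)), (- [:\<alpha> ^ Suc k:], w)]"
    then show "degree p \<le> Suc k" using degree_power_le[of "[:\<alpha>, 1:]" "Suc k"] by auto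
  qed
qed

lemma sdom_sum_squares:
  fixes k :: nat
  assumes "\<And>j. j < k \<Longrightarrow> sdom (z j) v"
  shows "\<exists>C\<ge>0. \<forall>t\<in>I. \<forall>B. (\<forall>s\<in>{0..t}. \<bar>v s\<bar> \<le> B) \<longrightarrow> (\<Sum>j<k. (z j t)\<^sup>2) \<le> C * (1 + B)\<^sup>2"
proof -
  define xs where "xs = map (\<lambda>j. (0 :: real poly, z j)) [0..<k]"
  have ssq: "ssq xs t = (\<Sum>j<k. (z j t)\<^sup>2)" for t
    by (simp add: xs_def o_def case_prod_beta interv_sum_list_conv_sum_set_nat atLeast0LessThan)
  have "\<exists>C\<ge>0. \<forall>t\<in>I. \<forall>B. (\<forall>s\<in>{0..t}. \<bar>v s\<bar> \<le> B) \<longrightarrow> ssq xs t \<le> C * (1 + B)\<^sup>2"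
    by (rule sdom_sq) (auto simp: xs_def intro: assms)
  then show ?thesis unfolding ssq .
qed

end

section \<open>Lags of the control error and energy of the error filter\<close>

context loop
begin

text \<open>\<open>v1\<close> is \<open>\<sigma> / lam\<close> applied to \<open>ey\<close>,
  improper by \<open>ns\<close> degrees. The \<open>ns\<close> lags supply exactly the missing
  degree, and the denominator \<open>lam\<close> times \<open>(s + \<alpha>)^ns\<close> is
  Hurwitz.\<close>

lemma lag_of_v1_sdom_ey:
  assumes \<alpha>: "\<alpha> > 0" and \<kappa>: "k 0 = v1" "\<And>i. sol (k (Suc i)) (\<lambda>t. \<alpha> * (k i t - k (Suc i) t))"
  shows "sdom (k ns) ey"
proof -
  define ph where "ph = [:\<alpha>, 1:] ^ ns"
  have ph: "monic ph" "degree ph = ns" "hurwitz_poly ph" unfolding ph_def using linear_power[OF \<alpha>, of ns] by auto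
  have 1: "rel (pmul lam [(ph, k ns), (- [:\<alpha> ^ ns:], v1)]) (n - 1 + ns)"
    by (rule rel_mult[OF rel_lags[OF \<kappa>, of ns, folded ph_def]]) (use lam in simp)
  have 2: "rel (pmul [:- (\<alpha> ^ ns):] [(\<sigma>, ey), (- lam, v1)]) (n - 1 + ns)" by (rule rel_const_mult[OF rel_error])
  have lp: "monic (lam * ph)" "degree (lam * ph) = n - 1 + ns" "hurwitz_poly (lam * ph)"
    using monic_mult[OF lam(1) ph(1)] lam ph hurwitz_mult[OF ctrl(3) ph(3)] by auto
  have "rel [(lam * ph, k ns), (- smult (\<alpha> ^ ns) \<sigma>, ey)] (n - 1 + ns)"
    by (rule rel_cong[OF rel_append[OF 1 2]]) (use lp(2) \<sigma>_props(2) \<alpha> in auto)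
  then show ?thesis by (rule rel_sdom[OF _ lp]) (auto intro: sdom_refl)
qed

text \<open>\<open>D\<close> is fixed before \<alpha>, while the constant hidden in
  \<open>sdom k ey\<close> depends on \<alpha>. The error of the first lag is driven by the
  derivative of \<open>v1\<close>, whose parts are square integrable or bounded relative to
  \<open>1 + B\<close>; an energy estimate with damping \<alpha> gains the factor
  \<open>1 / sqrt \<alpha>\<close>.\<close>

lemma v1_lag_approximation:
  "\<exists>D\<ge>0. \<forall>\<alpha>\<ge>1. \<exists>k. sdom k ey \<and> (\<forall>t\<in>I. \<forall>B. (\<forall>s\<in>{0..t}. \<bar>v1 s\<bar> \<le> B) \<longrightarrow> \<bar>v1 t - k t\<bar> \<le> D + D * (1 + B) / sqrt \<alpha>)"
proof -
  obtain d1 d2 C where v1: "C \<ge> 0" "sol v1 (\<lambda>t. d1 t + d2 t)" and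
    d12: "\<forall>t\<in>I. \<forall>B. (\<forall>s\<in>{0..t}. \<bar>v1 s\<bar> \<le> B) \<longrightarrow> (d1 t)\<^sup>2 \<le> C * (1 + B)\<^sup>2 * G t \<and> (d2 t)\<^sup>2 \<le> C * (1 + B)\<^sup>2"
    using sol_v1 by blast
  obtain Cl where Cl: "Cl \<ge> 0" "\<And>t. t \<in> I \<Longrightarrow> J G t \<le> Cl" using lyapunov by blast
  define E where "E = sqrt (2 * C * (Cl + 1))"
  have E0: "0 \<le> E" and E2: "E\<^sup>2 = 2 * C * (Cl + 1)" using v1(1) Cl(1) by (auto simp: E_def)
  define D where "D = real ns * (\<bar>v1 0\<bar> + E)"
  have D0: "0 \<le> D" using E0 by (simp add: D_def)
  have "\<exists>k. sdom k ey \<and> (\<forall>t\<in>I. \<forall>B. (\<forall>s\<in>{0..t}. \<bar>v1 s\<bar> \<le> B) \<longrightarrow> \<bar>v1 t - k t\<bar> \<le> D + D * (1 + B) / sqrt \<alpha>)"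
    if \<alpha>: "\<alpha> \<ge> 1" for \<alpha>
  proof -
    have \<alpha>0: "\<alpha> > 0" using \<alpha> by simp
    obtain k where k: "k 0 = v1" "\<And>i. k (Suc i) 0 = 0" "\<And>i. sol (k (Suc i)) (\<lambda>t. \<alpha> * (k i t - k (Suc i) t))"
      using lags_exist[OF cont_v1, of \<alpha>] by blast
    have first: "\<bar>v1 t - k 1 t\<bar> \<le> \<bar>v1 0\<bar> + E * (1 + B) / sqrt \<alpha>"
      if t: "t \<in> I" and B: "\<forall>s\<in>{0..t}. \<bar>v1 s\<bar> \<le> B" for t B
    proof -
      have B0: "0 \<le> B" using B time_nonneg[OF t] by force
      \<comment> \<open>Young's inequality spends \<open>\<alpha> / 2\<close> of damping on each of
        \<open>d1\<close> and \<open>d2\<close>; \<open>c\<close> is the resulting coefficient, and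
        half of the damping \<open>2 \<alpha>\<close> remains.\<close>
      define c where "c = 2 * C * (1 + B)\<^sup>2 / \<alpha>"
      have c0: "0 \<le> c" using v1(1) \<alpha>0 by (simp add: c_def)
      define d where "d t = v1 t - k 1 t" for t
      have sd: "sol d (\<lambda>t. d1 t + d2 t - \<alpha> * d t)"
        using sol_diff[OF v1(2) k(3)[of 0]] by (simp add: d_def[abs_def] k(1))
      \<comment> \<open>Subtracting \<open>c * J G\<close> takes the contribution of
        \<open>d1\<close> out of the differential inequality; it is returned as a constant because
        \<open>J G\<close> is bounded.\<close>
      define V where "V t = (d t)\<^sup>2 - c * J G t" for t
      have sV: "sol V (\<lambda>t. 2 * d t * (d1 t + d2 t - \<alpha> * d t) - c * G t)"
        unfolding V_def by (intro sol_diff sol_square sd sol_cmult sol_J cont_G)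
      have V0: "V 0 = (v1 0)\<^sup>2" using k(2)[of 0] by (simp add: V_def d_def)
      have "V t \<le> V 0 + c / \<alpha>"
      proof (rule sol_decay_bound[OF sV order_refl time_nonneg[OF t] t \<alpha>0 c0])
        show "0 \<le> V 0" by (simp add: V0)
        fix s assume s: "s \<in> {0..t} - S"
        then have sI: "s \<in> I" using time_down[OF t] by auto
        have B': "\<forall>r\<in>{0..s}. \<bar>v1 r\<bar> \<le> B" using B s by auto
        have young: "2 * d s * x \<le> \<alpha> / 2 * (d s)\<^sup>2 + 2 / \<alpha> * x\<^sup>2" for x
        proof -
          have "0 \<le> (\<alpha> * d s - 2 * x)\<^sup>2 / (2 * \<alpha>)" using \<alpha>0 by simp
          also have "\<dots> = \<alpha> / 2 * (d s)\<^sup>2 + 2 / \<alpha> * x\<^sup>2 - 2 * d s * x"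
            using \<alpha>0 by (simp add: power2_diff power_mult_distrib add_divide_distrib diff_divide_distrib) (simp add: power2_eq_square)
          finally show ?thesis by simp
        qed
        have "2 / \<alpha> * (d1 s)\<^sup>2 \<le> 2 / \<alpha> * (C * (1 + B)\<^sup>2 * G s)" "2 / \<alpha> * (d2 s)\<^sup>2 \<le> 2 / \<alpha> * (C * (1 + B)\<^sup>2)"
          using d12 sI B' \<alpha>0 by (intro mult_left_mono; simp)+
        moreover have "2 / \<alpha> * (C * (1 + B)\<^sup>2 * G s) = c * G s" "2 / \<alpha> * (C * (1 + B)\<^sup>2) = c" by (simp_all add: c_def)
        ultimately have "2 * d s * (d1 s + d2 s - \<alpha> * d s) - c * G s \<le> - \<alpha> * (d s)\<^sup>2 + c"
          using young[of "d1 s"] young[of "d2 s"] by (simp add: algebra_simps power2_eq_square)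
        also have "\<dots> \<le> - \<alpha> * V s + c"
        proof -
          have "0 \<le> \<alpha> * (c * J G s)" using \<alpha>0 c0 J_nonneg[OF sI] G_nonneg by simp
          then show ?thesis by (simp add: V_def right_diff_distrib)
        qed
        finally show "2 * d s * (d1 s + d2 s - \<alpha> * d s) - c * G s \<le> - \<alpha> * V s + c" .
      qed
      also have "c / \<alpha> \<le> c" using c0 \<alpha> by (simp add: divide_le_eq mult_le_cancel_left1)
      finally have "V t \<le> (v1 0)\<^sup>2 + c" by (simp only: V0)
      then have "(d t)\<^sup>2 \<le> (v1 0)\<^sup>2 + c + c * J G t" by (simp add: V_def)
      also have "\<dots> \<le> (v1 0)\<^sup>2 + c + c * Cl" using mult_left_mono[OF Cl(2)[OF t] c0] by simp
      also have "\<dots> = (v1 0)\<^sup>2 + (E * (1 + B) / sqrt \<alpha>)\<^sup>2"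
      proof -
        have "(E * (1 + B) / sqrt \<alpha>)\<^sup>2 = 2 * C * (Cl + 1) * (1 + B)\<^sup>2 / \<alpha>"
          using \<alpha>0 by (simp only: power_divide power_mult_distrib E2) simp
        also have "\<dots> = c + c * Cl" by (simp add: c_def add_divide_distrib distrib_left distrib_right)
        finally show ?thesis by simp
      qed
      also have "\<dots> \<le> (\<bar>v1 0\<bar> + E * (1 + B) / sqrt \<alpha>)\<^sup>2"
        using E0 B0 \<alpha>0 by (simp add: power2_sum)
      finally have "\<bar>d t\<bar>\<^sup>2 \<le> (\<bar>v1 0\<bar> + E * (1 + B) / sqrt \<alpha>)\<^sup>2" by simp
      moreover have "0 \<le> \<bar>v1 0\<bar> + E * (1 + B) / sqrt \<alpha>" using E0 B0 \<alpha>0 by simp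
      ultimately have "\<bar>d t\<bar> \<le> \<bar>v1 0\<bar> + E * (1 + B) / sqrt \<alpha>" by (rule power2_le_imp_le)
      then show ?thesis by (simp add: d_def)
    qed
    \<comment> \<open>The difference of consecutive lags is itself a lag of the preceding
      difference, so \<open>lag_bound\<close> carries the estimate of the first lag along.\<close>
    have step: "\<bar>k i t - k (Suc i) t\<bar> \<le> \<bar>v1 0\<bar> + E * (1 + B) / sqrt \<alpha>"
      if "t \<in> I" "\<forall>s\<in>{0..t}. \<bar>v1 s\<bar> \<le> B" for t B i
      using that
    proof (induction i arbitrary: t)
      case 0
      then show ?case using first[of t B] by (simp add: k(1))
    next
      case (Suc i)
      have B0: "0 \<le> B" using Suc.prems(2) time_nonneg[OF Suc.prems(1)] by force
      show ?case
      proof (rule lag_bound[OF _ \<alpha>0 Suc.prems(1)])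
        show "sol (\<lambda>t. k (Suc i) t - k (Suc (Suc i)) t) (\<lambda>t. \<alpha> * ((k i t - k (Suc i) t) - (k (Suc i) t - k (Suc (Suc i)) t)))"
          by (rule sol_cong[OF sol_diff[OF k(3)[of i] k(3)[of "Suc i"]]]) (auto simp: algebra_simps)
        show "\<bar>k (Suc i) 0 - k (Suc (Suc i)) 0\<bar> \<le> \<bar>v1 0\<bar> + E * (1 + B) / sqrt \<alpha>" using k(2) E0 B0 \<alpha>0 by simp
        fix s assume s: "s \<in> {0..t}"
        show "\<bar>k i s - k (Suc i) s\<bar> \<le> \<bar>v1 0\<bar> + E * (1 + B) / sqrt \<alpha>"
          by (rule Suc.IH) (use s Suc.prems time_down in auto)
      qed
    qed
    have "\<bar>v1 t - k ns t\<bar> \<le> D + D * (1 + B) / sqrt \<alpha>" if t: "t \<in> I" "\<forall>s\<in>{0..t}. \<bar>v1 s\<bar> \<le> B" for t B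
    proof -
      have B0: "0 \<le> B" using t(2) time_nonneg[OF t(1)] by force
      have "\<bar>v1 t - k i t\<bar> \<le> real i * (\<bar>v1 0\<bar> + E * (1 + B) / sqrt \<alpha>)" for i
      proof (induction i)
        case (Suc i)
        have "\<bar>v1 t - k (Suc i) t\<bar> \<le> \<bar>v1 t - k i t\<bar> + \<bar>k i t - k (Suc i) t\<bar>" by linarith
        then show ?case using Suc step[OF t, of i] by (simp add: distrib_right)
      qed (simp add: k(1))
      from this[of ns] have "\<bar>v1 t - k ns t\<bar> \<le> real ns * \<bar>v1 0\<bar> + real ns * E * (1 + B) / sqrt \<alpha>" by (simp add: distrib_left mult.assoc)
      also have "\<dots> \<le> D + D * (1 + B) / sqrt \<alpha>"
        using E0 B0 \<alpha>0 by (intro add_mono divide_right_mono mult_right_mono) (auto simp: D_def distrib_left)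
      finally show ?thesis .
    qed
    then show ?thesis using lag_of_v1_sdom_ey[OF \<alpha>0, of k, OF k(1,3)] by blast
  qed
  then show ?thesis using D0 by blast
qed

text \<open>Swapping: \<open>\<Sum>j th j xF j - xFu\<close> is the state of a copy of the filter driven only by the parameter update.\<close>

lemma Wout_lyapunov:
  "\<exists>V dV a C. a > 0 \<and> C \<ge> 0 \<and> sol V dV \<and> (\<forall>t\<in>I. (Wout t)\<^sup>2 \<le> V t) \<and>
     (\<forall>t\<in>I - S. \<forall>B. (\<forall>s\<in>{0..t}. \<bar>v1 s\<bar> \<le> B) \<longrightarrow> dV t \<le> - a * (Wout t)\<^sup>2 + C * (1 + B)\<^sup>2 * G t)"
proof -
  define c where "c i t = (\<Sum>j<2 * n - 1. th j t * xF j i t) - xFu i t" for i t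
  define w where "w i t = (\<Sum>j<2 * n - 1. (- gam * ea t * ze j t) * xF j i t)" for i t
  have sc: "sol (c i) (\<lambda>t. (\<Sum>k<ns - 1. AF $$ (i, k) * c k t) + w i t)" if i: "i < ns - 1" for i
  proof -
    have "sol (\<lambda>t. (\<Sum>j<2 * n - 1. th j t * xF j i t) - xFu i t)
      (\<lambda>t. (\<Sum>j<2 * n - 1. th j t * ((\<Sum>k<ns - 1. AF $$ (i, k) * xF j k t) + vec_index bF i * om j t) + (- gam * ea t * ze j t) * xF j i t)
        - ((\<Sum>k<ns - 1. AF $$ (i, k) * xFu k t) + vec_index bF i * (\<Sum>j<2 * n - 1. th j t * om j t)))"
      using i by (intro sol_diff sol_sum sol_mult th xF xFu) auto
    then show ?thesis
    proof (rule sol_cong)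
      fix t
      have s: "(\<Sum>j<2 * n - 1. th j t * (\<Sum>k<ns - 1. AF $$ (i, k) * xF j k t)) = (\<Sum>k<ns - 1. AF $$ (i, k) * (\<Sum>j<2 * n - 1. th j t * xF j k t))"
        unfolding sum_distrib_left by (subst sum.swap) (simp add: mult_ac)
      have s2: "(\<Sum>j<2 * n - 1. th j t * (vec_index bF i * om j t)) = vec_index bF i * (\<Sum>j<2 * n - 1. th j t * om j t)"
        by (simp add: sum_distrib_left mult_ac)
      show "(\<Sum>j<2 * n - 1. th j t * ((\<Sum>k<ns - 1. AF $$ (i, k) * xF j k t) + vec_index bF i * om j t) + (- gam * ea t * ze j t) * xF j i t)
        - ((\<Sum>k<ns - 1. AF $$ (i, k) * xFu k t) + vec_index bF i * (\<Sum>j<2 * n - 1. th j t * om j t))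
        = (\<Sum>k<ns - 1. AF $$ (i, k) * c k t) + w i t"
        unfolding sum.distrib distrib_left s s2 by (simp add: c_def w_def right_diff_distrib sum_subtractf)
    qed (simp add: c_def)
  qed
  have echi_c: "echi t = (\<Sum>i<ns - 1. vec_index cF i * c i t)" if t: "t \<in> I" for t
  proof -
    have "(\<Sum>j<2 * n - 1. th j t * ze j t) = (\<Sum>j<2 * n - 1. th j t * (\<Sum>i<ns - 1. vec_index cF i * xF j i t)) + dF * (\<Sum>j<2 * n - 1. th j t * om j t)"
      using ze t by (simp add: distrib_left sum.distrib sum_distrib_left mult_ac)
    also have "(\<Sum>j<2 * n - 1. th j t * (\<Sum>i<ns - 1. vec_index cF i * xF j i t)) = (\<Sum>i<ns - 1. vec_index cF i * (\<Sum>j<2 * n - 1. th j t * xF j i t))"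
      unfolding sum_distrib_left by (subst sum.swap) (simp add: mult_ac)
    finally show ?thesis by (simp add: echi[OF t] Fu[OF t] c_def right_diff_distrib sum_subtractf)
  qed
  define xs where "xs = map (\<lambda>i. (- res AF cF i, w i)) [0..<ns - 1]"
  have r1: "rel ((f, \<lambda>t. \<Sum>i<ns - 1. vec_index cF i * c i t) # xs) (ns - 1)"
    using state_space_rel[OF filter(1) sc, of cF] filter(2) by (simp add: xs_def)
  have fd: "degree f = ns - 1" using f by simp
  obtain a1 where a1: "a1 > 0" "\<forall>s. poly (map_poly complex_of_real f) s = 0 \<longrightarrow> 2 * Re s < - a1"
    using hurwitz_margin[OF f(3)] f(1) by (metis leading_coeff_0_iff zero_neq_one)
  have x0: "\<forall>(q, w)\<in>set xs. coeff q (ns - 1) = 0" using coeff_res_ge[OF filter(1)] by (auto simp: xs_def)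
  obtain K1 V1 dV1 where V1: "K1 \<ge> 0" "sol V1 dV1" "\<forall>t\<in>I. (\<Sum>i<ns - 1. vec_index cF i * c i t)\<^sup>2 \<le> V1 t"
    "\<forall>t\<in>I - S. dV1 t \<le> - a1 * V1 t + K1 * ssq xs t"
    using rel_stable[OF r1 f(1) fd a1(2) x0] by blast
  obtain a2 where a2: "a2 > 0" "\<forall>s. poly (map_poly complex_of_real p) s = 0 \<longrightarrow> 2 * Re s < - a2"
    using hurwitz_margin[OF pq(5)] pq(1) by (metis leading_coeff_0_iff zero_neq_one)
  have q0: "\<forall>(r, w)\<in>set [(- q, \<lambda>t. phi t - eta t)]. coeff r NW = 0" using pq by (simp add: coeff_eq_0)
  obtain K2 V2 dV2 where V2: "K2 \<ge> 0" "sol V2 dV2" "\<forall>t\<in>I. (Wout t)\<^sup>2 \<le> V2 t"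
    "\<forall>t\<in>I - S. dV2 t \<le> - a2 * V2 t + K2 * ssq [(- q, \<lambda>t. phi t - eta t)] t"
    using rel_stable[OF rel_Wout pq(1,2) a2(2) q0] by blast
  obtain Cz where Cz: "Cz \<ge> 0" "\<forall>t\<in>I. \<forall>B. (\<forall>s\<in>{0..t}. \<bar>v1 s\<bar> \<le> B) \<longrightarrow> ze2 t \<le> Cz * (1 + B)\<^sup>2"
    using sdom_sum_squares[of "2 * n - 1" ze v1] sdom_ze unfolding ze2_def by auto
  have "\<exists>C\<ge>0. \<forall>t\<in>I. \<forall>B. (\<forall>s\<in>{0..t}. \<bar>v1 s\<bar> \<le> B) \<longrightarrow> (w i t)\<^sup>2 \<le> C * (1 + B)\<^sup>2 * G t" if i: "i < ns - 1" for i
  proof -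
    obtain C where C: "C \<ge> 0" "\<forall>t\<in>I. \<forall>B. (\<forall>s\<in>{0..t}. \<bar>v1 s\<bar> \<le> B) \<longrightarrow> (\<Sum>j<2 * n - 1. (xF j i t)\<^sup>2) \<le> C * (1 + B)\<^sup>2"
      using sdom_sum_squares[of "2 * n - 1" "\<lambda>j. xF j i" v1] sdom_xF i by auto
    have "(w i t)\<^sup>2 \<le> gam\<^sup>2 * C * (1 + B)\<^sup>2 * G t" if t: "t \<in> I" "\<forall>s\<in>{0..t}. \<bar>v1 s\<bar> \<le> B" for t B
    proof -
      have "w i t = - gam * ea t * (\<Sum>j<2 * n - 1. ze j t * xF j i t)" by (simp add: w_def sum_distrib_left mult.assoc)
      then have "(w i t)\<^sup>2 = gam\<^sup>2 * (ea t)\<^sup>2 * (\<Sum>j<2 * n - 1. ze j t * xF j i t)\<^sup>2" by (simp add: power_mult_distrib)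
      also have "\<dots> \<le> gam\<^sup>2 * (ea t)\<^sup>2 * (ze2 t * (\<Sum>j<2 * n - 1. (xF j i t)\<^sup>2))"
        unfolding ze2_def by (intro mult_left_mono Cauchy_Schwarz_ineq_sum) auto
      also have "\<dots> = gam\<^sup>2 * G t * (\<Sum>j<2 * n - 1. (xF j i t)\<^sup>2)" by (simp add: G_def)
      also have "\<dots> \<le> gam\<^sup>2 * G t * (C * (1 + B)\<^sup>2)" using C(2) t G_nonneg by (intro mult_left_mono) auto
      finally show ?thesis by (simp add: mult_ac)
    qed
    then show ?thesis using C(1) by (intro exI[of _ "gam\<^sup>2 * C"]) auto
  qed
  then obtain Cw where Cw: "\<And>i. i < ns - 1 \<Longrightarrow> Cw i \<ge> 0"
    "\<And>i t B. i < ns - 1 \<Longrightarrow> t \<in> I \<Longrightarrow> (\<forall>s\<in>{0..t}. \<bar>v1 s\<bar> \<le> B) \<Longrightarrow> (w i t)\<^sup>2 \<le> Cw i * (1 + B)\<^sup>2 * G t" by metis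
  define Cx where "Cx = (\<Sum>i<ns - 1. Cw i)"
  have Cx0: "0 \<le> Cx" using Cw(1) by (auto simp: Cx_def intro: sum_nonneg)
  have Cx: "ssq xs t \<le> Cx * (1 + B)\<^sup>2 * G t" if t: "t \<in> I" "\<forall>s\<in>{0..t}. \<bar>v1 s\<bar> \<le> B" for t B
  proof -
    have "ssq xs t = (\<Sum>i<ns - 1. (w i t)\<^sup>2)"
      by (simp add: xs_def o_def case_prod_beta interv_sum_list_conv_sum_set_nat atLeast0LessThan)
    also have "\<dots> \<le> (\<Sum>i<ns - 1. Cw i * (1 + B)\<^sup>2 * G t)" using Cw(2) t by (intro sum_mono) auto
    finally show ?thesis by (simp add: Cx_def sum_distrib_right)
  qed
  \<comment> \<open>With this weight the decay of \<open>M V1\<close> cancels the term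
    \<open>2 K2 V1\<close> with which \<open>echi\<close> enters the error filter.\<close>
  define M where "M = 2 * K2 / a1"
  have M0: "0 \<le> M" using V2(1) a1(1) by (simp add: M_def)
  define C where "C = 2 * K2 * Cz + M * K1 * Cx"
  have C0: "0 \<le> C" using V1(1) V2(1) Cz(1) M0 Cx0 by (simp add: C_def)
  have "dV2 t + M * dV1 t \<le> - a2 * (Wout t)\<^sup>2 + C * (1 + B)\<^sup>2 * G t"
    if t: "t \<in> I - S" and B: "\<forall>s\<in>{0..t}. \<bar>v1 s\<bar> \<le> B" for t B
  proof -
    have tI: "t \<in> I" using t by simp
    have "(phi t - eta t)\<^sup>2 = (echi t - ea t * ze2 t)\<^sup>2" by (simp add: phi_def echi_eta[OF tI] algebra_simps)
    also have "\<dots> \<le> 2 * (echi t)\<^sup>2 + 2 * (ea t * ze2 t)\<^sup>2"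
      using real_square_add_le[of "echi t" "- (ea t * ze2 t)"] by simp
    \<comment> \<open>One factor is integrable, the other is bounded by the square of the growth;
      this keeps the estimate linear in \<open>G\<close>.\<close>
    also have "(ea t * ze2 t)\<^sup>2 = G t * ze2 t" by (simp add: G_def power2_eq_square)
    also have "\<dots> \<le> G t * (Cz * (1 + B)\<^sup>2)" using Cz(2) tI B G_nonneg by (intro mult_left_mono) auto
    also have "(echi t)\<^sup>2 \<le> V1 t" using V1(3) tI echi_c[OF tI] by simp
    finally have "(phi t - eta t)\<^sup>2 \<le> 2 * V1 t + 2 * (G t * (Cz * (1 + B)\<^sup>2))" by simp
    then have "K2 * (phi t - eta t)\<^sup>2 \<le> K2 * (2 * V1 t + 2 * (G t * (Cz * (1 + B)\<^sup>2)))" using V2(1) by (rule mult_left_mono)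
    moreover have "dV2 t \<le> - a2 * V2 t + K2 * (phi t - eta t)\<^sup>2" using V2(4) t by simp
    moreover have "- a2 * V2 t \<le> - a2 * (Wout t)\<^sup>2" using V2(3) tI a2(1) by simp
    moreover have "M * dV1 t \<le> M * (- a1 * V1 t + K1 * (Cx * (1 + B)\<^sup>2 * G t))"
    proof (rule mult_left_mono[OF _ M0])
      have "K1 * ssq xs t \<le> K1 * (Cx * (1 + B)\<^sup>2 * G t)" using Cx[OF tI B] V1(1) by (rule mult_left_mono)
      moreover have "dV1 t \<le> - a1 * V1 t + K1 * ssq xs t" using V1(4) t by blast
      ultimately show "dV1 t \<le> - a1 * V1 t + K1 * (Cx * (1 + B)\<^sup>2 * G t)" by linarith
    qed
    moreover have "M * (- a1 * V1 t) = - (2 * K2 * V1 t)" using a1(1) by (simp add: M_def)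
    moreover have "K2 * (2 * V1 t + 2 * (G t * (Cz * (1 + B)\<^sup>2))) + M * (- a1 * V1 t + K1 * (Cx * (1 + B)\<^sup>2 * G t))
       = C * (1 + B)\<^sup>2 * G t + (2 * K2 * V1 t + M * (- a1 * V1 t))" by (simp add: C_def algebra_simps)
    ultimately show ?thesis by linarith
  qed
  moreover have "(Wout t)\<^sup>2 \<le> V2 t + M * V1 t" if t: "t \<in> I" for t
  proof -
    have "0 \<le> V1 t" using V1(3) t by (meson order_trans zero_le_power2)
    then show ?thesis using V2(3) t M0 by (simp add: add_increasing2)
  qed
  moreover have "sol (\<lambda>t. V2 t + M * V1 t) (\<lambda>t. dV2 t + M * dV1 t)" by (intro sol_add sol_cmult V1 V2)
  ultimately show ?thesis using a2(1) C0 by blast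
qed

end

section \<open>Boundedness and convergence\<close>

context time_domain
begin

definition bdd :: "(real \<Rightarrow> real) \<Rightarrow> bool" where
  "bdd z \<longleftrightarrow> (\<exists>M. \<forall>t\<in>I. \<bar>z t\<bar> \<le> M)"

text \<open>Boundedness is growth relative to the zero signal, so the calculus of
  \<open>sdom\<close> carries over.\<close>

lemma bdd_iff_sdom: "bdd z \<longleftrightarrow> sdom z (\<lambda>t. 0)"
proof
  assume "bdd z"
  then show "sdom z (\<lambda>t. 0)" unfolding bdd_def using sdom_bounded by blast
next
  assume "sdom z (\<lambda>t. 0)"
  then obtain C where "\<And>t B. t \<in> I \<Longrightarrow> (\<And>s. 0 \<le> s \<Longrightarrow> s \<le> t \<Longrightarrow> \<bar>0\<bar> \<le> B) \<Longrightarrow> \<bar>z t\<bar> \<le> C * (1 + B)" using sdomE by metis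
  from this[of _ 0] have "\<forall>t\<in>I. \<bar>z t\<bar> \<le> C * (1 + 0)" by simp
  then show "bdd z" unfolding bdd_def by blast
qed

lemma bdd_sdom: "sdom z v \<Longrightarrow> bdd v \<Longrightarrow> bdd z"
  unfolding bdd_iff_sdom by (rule sdom_trans)

lemma bdd_add: "bdd y \<Longrightarrow> bdd z \<Longrightarrow> bdd (\<lambda>t. y t + z t)"
  unfolding bdd_iff_sdom by (rule sdom_add)

lemma bdd_diff: "bdd y \<Longrightarrow> bdd z \<Longrightarrow> bdd (\<lambda>t. y t - z t)"
  unfolding bdd_iff_sdom by (rule sdom_diff)

lemma bdd_sum: "(\<And>i. i \<in> K \<Longrightarrow> bdd (z i)) \<Longrightarrow> bdd (\<lambda>t. \<Sum>i\<in>K. z i t)"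
  unfolding bdd_iff_sdom by (rule sdom_sum)

lemma bdd_mult:
  assumes "bdd y" "bdd z" shows "bdd (\<lambda>t. y t * z t)"
proof -
  obtain M where "\<And>t. t \<in> I \<Longrightarrow> \<bar>y t\<bar> \<le> M" using assms(1) unfolding bdd_def by blast
  then show ?thesis using assms(2) unfolding bdd_iff_sdom by (intro sdom_bdd_mult)
qed

lemma bdd_cmult: "bdd z \<Longrightarrow> bdd (\<lambda>t. c * z t)"
  unfolding bdd_iff_sdom by (rule sdom_cmult)

lemma bdd_cong: "bdd z \<Longrightarrow> (\<And>t. t \<in> I \<Longrightarrow> y t = z t) \<Longrightarrow> bdd y"
  by (auto simp: bdd_def)

end

context loop
begin

text \<open>\<open>D\<close> does not depend on \<open>h\<close>. From a time \<open>T\<close> at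
  which \<open>J G\<close> is within \<open>h\<^sup>2\<close> of its supremum, the Lyapunov function
  of \<open>Wout\<close> increases by at most \<open>C (1 + B)\<^sup>2 h\<^sup>2\<close>; values
  before \<open>T\<close> go into \<open>K\<close>.\<close>

lemma ey_small:
  "\<exists>D\<ge>0. \<forall>h>0. \<exists>K\<ge>0. \<forall>t\<in>I. \<forall>B. (\<forall>s\<in>{0..t}. \<bar>v1 s\<bar> \<le> B) \<longrightarrow> \<bar>ey t\<bar> \<le> K + D * h * (1 + B)"
proof -
  obtain V dV a C where V: "a > 0" "C \<ge> 0" "sol V dV" "\<forall>t\<in>I. (Wout t)\<^sup>2 \<le> V t"
    "\<forall>t\<in>I - S. \<forall>B. (\<forall>s\<in>{0..t}. \<bar>v1 s\<bar> \<le> B) \<longrightarrow> dV t \<le> - a * (Wout t)\<^sup>2 + C * (1 + B)\<^sup>2 * G t"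
    using Wout_lyapunov by blast
  obtain Cl where Cl: "Cl \<ge> 0" "\<And>t. t \<in> I \<Longrightarrow> J G t \<le> Cl" "\<And>t. t \<in> I \<Longrightarrow> \<bar>ea t\<bar> \<le> Cl" using lyapunov by blast
  have "\<exists>K\<ge>0. \<forall>t\<in>I. \<forall>B. (\<forall>s\<in>{0..t}. \<bar>v1 s\<bar> \<le> B) \<longrightarrow> \<bar>ey t\<bar> \<le> K + sqrt C * h * (1 + B)" if h: "h > 0" for h
  proof -
    define Js where "Js = Sup (J G ` I)"
    have bd: "bdd_above (J G ` I)" by (rule bdd_aboveI[of _ Cl]) (use Cl(2) in blast)
    have ne: "J G ` I \<noteq> {}" using zero_mem by blast
    \<comment> \<open>The supremum over \<open>I\<close> replaces a limit, since \<open>I\<close>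
      may be bounded.\<close>
    have "\<exists>y\<in>J G ` I. Js - h\<^sup>2 < y" by (rule less_cSupD[OF ne]) (use h in \<open>simp add: Js_def\<close>)
    then obtain T where T: "T \<in> I" "Js - h\<^sup>2 < J G T" by blast
    have tail: "J G t - J G T \<le> h\<^sup>2" if "t \<in> I" for t using cSup_upper[OF imageI[OF that] bd] T(2) by (simp add: Js_def)
    obtain K1 where K1: "\<forall>s\<in>{0..T}. \<bar>Wout s\<bar> \<le> K1" using compact_bounded[OF cont_Wout T(1)] by blast
    have VT: "0 \<le> V T" using V(4) T(1) by (meson order_trans zero_le_power2)
    define K where "K = Cl + \<bar>K1\<bar> + sqrt (V T)"
    have "\<bar>ey t\<bar> \<le> K + sqrt C * h * (1 + B)" if t: "t \<in> I" and B: "\<forall>s\<in>{0..t}. \<bar>v1 s\<bar> \<le> B" for t B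
    proof -
      have B0: "0 \<le> B" using B time_nonneg[OF t] by force
      have nn: "0 \<le> sqrt C * h * (1 + B)" using V(2) h B0 by simp
      have "\<bar>Wout t\<bar> \<le> \<bar>K1\<bar> + sqrt (V T) + sqrt C * h * (1 + B)"
      proof (cases "t \<le> T")
        case True
        then have "\<bar>Wout t\<bar> \<le> \<bar>K1\<bar>" using K1 time_nonneg[OF t] by (metis abs_ge_self atLeastAtMost_iff order_trans)
        then show ?thesis using nn real_sqrt_ge_zero[OF VT] by linarith
      next
        case False
        define c where "c = C * (1 + B)\<^sup>2"
        have c0: "0 \<le> c" using V(2) by (simp add: c_def)
        have "V t - c * J G t \<le> V T - c * J G T"
        proof (rule sol_decreasing[OF sol_diff[OF V(3) sol_cmult[OF sol_J[OF cont_G]]] time_nonneg[OF T(1)] _ t])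
          fix s assume s: "s \<in> {T..t} - S"
          then have sI: "s \<in> I - S" using time_down[OF t] time_nonneg[OF T(1)] by auto
          have "\<forall>r\<in>{0..s}. \<bar>v1 r\<bar> \<le> B" using B s by auto
          then have "dV s \<le> - a * (Wout s)\<^sup>2 + c * G s" using V(5) sI by (simp add: c_def)
          moreover have "0 \<le> a * (Wout s)\<^sup>2" using V(1) by simp
          ultimately show "dV s - c * G s \<le> 0" by linarith
        qed (use False in simp)
        moreover have "c * (J G t - J G T) \<le> c * h\<^sup>2" using tail[OF t] c0 by (rule mult_left_mono)
        ultimately have "V t \<le> V T + c * h\<^sup>2" by (simp add: right_diff_distrib)
        then have "(Wout t)\<^sup>2 \<le> V T + c * h\<^sup>2" using V(4) t by fastforce
        also have "\<dots> = (sqrt (V T))\<^sup>2 + (sqrt C * h * (1 + B))\<^sup>2" using VT V(2) by (simp add: c_def power_mult_distrib)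
        also have "\<dots> \<le> (sqrt (V T) + sqrt C * h * (1 + B))\<^sup>2" using nn real_sqrt_ge_zero[OF VT] by (simp add: power2_sum)
        finally have "\<bar>Wout t\<bar>\<^sup>2 \<le> (sqrt (V T) + sqrt C * h * (1 + B))\<^sup>2" by simp
        then have "\<bar>Wout t\<bar> \<le> sqrt (V T) + sqrt C * h * (1 + B)"
          by (rule power2_le_imp_le) (use nn real_sqrt_ge_zero[OF VT] in linarith)
        then show ?thesis by linarith
      qed
      then show ?thesis using ea[OF t] Cl(3)[OF t] unfolding K_def by linarith
    qed
    moreover have "0 \<le> K" using Cl(1) VT by (simp add: K_def)
    ultimately show ?thesis by blast
  qed
  then show ?thesis using V(2) by (intro exI[of _ "sqrt C"]) auto
qed

text \<open>A small gain argument: the approximation of \<open>v1\<close> by its lag and the bound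
  of that lag by \<open>ey\<close> each contribute at most a quarter of the running bound, so half
  of it is absorbed.\<close>

lemma v1_bounded: "bdd v1"
proof -
  obtain D where D: "D \<ge> 0" "\<forall>\<alpha>\<ge>1. \<exists>k. sdom k ey \<and> (\<forall>t\<in>I. \<forall>B. (\<forall>s\<in>{0..t}. \<bar>v1 s\<bar> \<le> B) \<longrightarrow> \<bar>v1 t - k t\<bar> \<le> D + D * (1 + B) / sqrt \<alpha>)"
    using v1_lag_approximation by blast
  \<comment> \<open>Chosen for \<open>4 D \<le> sqrt \<alpha>\<close>; only then does
    \<open>C\<close>, the gain from \<open>ey\<close> to the lag, become a fixed number.\<close>
  define \<alpha> where "\<alpha> = 1 + 16 * D\<^sup>2"
  have \<alpha>: "\<alpha> \<ge> 1" by (simp add: \<alpha>_def)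
  have D4: "D / sqrt \<alpha> \<le> 1 / 4"
  proof -
    have "4 * D \<le> sqrt \<alpha>" by (rule real_le_rsqrt) (simp add: \<alpha>_def power_mult_distrib)
    then show ?thesis using \<alpha> by (simp add: field_simps)
  qed
  obtain k where k: "sdom k ey" "\<And>t B. t \<in> I \<Longrightarrow> (\<forall>s\<in>{0..t}. \<bar>v1 s\<bar> \<le> B) \<Longrightarrow> \<bar>v1 t - k t\<bar> \<le> D + D * (1 + B) / sqrt \<alpha>"
    using D(2) \<alpha> by blast
  obtain C where C: "C \<ge> 0" "\<And>t B. t \<in> I \<Longrightarrow> (\<And>s. 0 \<le> s \<Longrightarrow> s \<le> t \<Longrightarrow> \<bar>ey s\<bar> \<le> B) \<Longrightarrow> \<bar>k t\<bar> \<le> C * (1 + B)"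
    using sdomE[OF k(1)] by metis
  obtain E where E: "E \<ge> 0" "\<forall>h>0. \<exists>K\<ge>0. \<forall>t\<in>I. \<forall>B. (\<forall>s\<in>{0..t}. \<bar>v1 s\<bar> \<le> B) \<longrightarrow> \<bar>ey t\<bar> \<le> K + E * h * (1 + B)"
    using ey_small by blast
  \<comment> \<open>Makes \<open>C E h \<le> 1 / 4\<close>; the summand 1 keeps the denominator
    positive when \<open>C E = 0\<close>.\<close>
  define h where "h = 1 / (4 * (C * E + 1))"
  have CE: "0 \<le> C * E" using C(1) E(1) by simp
  then have h: "h > 0" by (simp add: h_def)
  have CEh: "C * E * h \<le> 1 / 4" using CE by (simp add: h_def field_simps)
  obtain K where K: "K \<ge> 0" "\<And>t B. t \<in> I \<Longrightarrow> (\<forall>s\<in>{0..t}. \<bar>v1 s\<bar> \<le> B) \<Longrightarrow> \<bar>ey t\<bar> \<le> K + E * h * (1 + B)"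
    using E(2)[THEN spec, THEN mp, OF h] by blast
  define M where "M = D + C * (1 + K) + 1"
  have step: "\<bar>v1 t\<bar> \<le> M + B / 2" if t: "t \<in> I" and B: "\<forall>s\<in>{0..t}. \<bar>v1 s\<bar> \<le> B" for t B
  proof -
    have B0: "0 \<le> B" using B time_nonneg[OF t] by force
    have "\<bar>k t\<bar> \<le> C * (1 + (K + E * h * (1 + B)))"
    proof (rule C(2)[OF t])
      fix s assume s: "0 \<le> s" "s \<le> t"
      show "\<bar>ey s\<bar> \<le> K + E * h * (1 + B)" by (rule K(2)[OF time_down[OF t s]]) (use B s in auto)
    qed
    also have "\<dots> = C * (1 + K) + C * E * h * (1 + B)" by (simp add: algebra_simps)
    also have "\<dots> \<le> C * (1 + K) + 1 / 4 * (1 + B)" using CEh B0 by (intro add_left_mono mult_right_mono) auto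
    finally have 1: "\<bar>k t\<bar> \<le> C * (1 + K) + 1 / 4 * (1 + B)" .
    have "\<bar>v1 t - k t\<bar> \<le> D + D / sqrt \<alpha> * (1 + B)" using k(2)[OF t B] by simp
    also have "\<dots> \<le> D + 1 / 4 * (1 + B)" using D4 B0 by (intro add_left_mono mult_right_mono) auto
    finally have 2: "\<bar>v1 t - k t\<bar> \<le> D + 1 / 4 * (1 + B)" .
    have "\<bar>v1 t\<bar> \<le> \<bar>v1 t - k t\<bar> + \<bar>k t\<bar>" by linarith
    then have "\<bar>v1 t\<bar> \<le> (D + 1 / 4 * (1 + B)) + (C * (1 + K) + 1 / 4 * (1 + B))" using 1 2 by linarith
    then show ?thesis unfolding M_def by (simp add: field_simps)
  qed
  have "\<bar>v1 t\<bar> \<le> 2 * M" if t: "t \<in> I" for t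
  proof -
    \<comment> \<open>At a maximum \<open>s\<close> of \<open>|v1|\<close> on \<open>{0..t}\<close>
      the estimate applies with \<open>B = |v1 s|\<close>.\<close>
    have "continuous_on {0..t} (\<lambda>s. \<bar>v1 s\<bar>)"
      using cont_v1 sub_I[OF t, of 0] by (intro continuous_intros) (auto intro: continuous_on_subset)
    then obtain s where s: "s \<in> {0..t}" "\<And>r. r \<in> {0..t} \<Longrightarrow> \<bar>v1 r\<bar> \<le> \<bar>v1 s\<bar>"
      using continuous_attains_sup[of "{0..t}" "\<lambda>s. \<bar>v1 s\<bar>"] time_nonneg[OF t] by auto
    have "\<bar>v1 s\<bar> \<le> M + \<bar>v1 s\<bar> / 2" by (rule step) (use s time_down[OF t] in auto)
    then show ?thesis using s(2)[of t] time_nonneg[OF t] by auto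
  qed
  then show ?thesis unfolding bdd_def by blast
qed

lemma bdd_v1_sdom: "sdom z v1 \<Longrightarrow> bdd z"
  using bdd_sdom v1_bounded by blast

lemma signals_bounded:
  shows "i < n \<Longrightarrow> bdd (xp i)" "j < 2 * n - 1 \<Longrightarrow> bdd (om j)" "i < m \<Longrightarrow> bdd (xm i)"
    "j < 2 * n - 1 \<Longrightarrow> k < ns - 1 \<Longrightarrow> bdd (xF j k)" "k < ns - 1 \<Longrightarrow> bdd (xFu k)"
    "j < 2 * n - 1 \<Longrightarrow> bdd (th j)" "bdd u" "bdd y" "bdd ey" "j < 2 * n - 1 \<Longrightarrow> bdd (ze j)" "bdd ea"
  using bdd_v1_sdom sdom_xp sdom_om sdom_xm sdom_xF sdom_xFu sdom_u sdom_y sdom_ey sdom_ze th_bounded ea_bounded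
  unfolding bdd_def[of "th j"] bdd_def[of ea] by blast+

lemma bdd_ym: "bdd ym"
  by (rule bdd_cong[OF bdd_diff[OF signals_bounded(8,9)]]) (simp add: ey)

lemma bdd_ze2: "bdd ze2"
  unfolding ze2_def power2_eq_square by (intro bdd_sum bdd_mult signals_bounded) auto

lemma bdd_echi: "bdd echi"
proof (rule bdd_cong)
  show "bdd (\<lambda>t. (\<Sum>j<2 * n - 1. th j t * ze j t) - ((\<Sum>i<ns - 1. vec_index cF i * xFu i t) + dF * (\<Sum>j<2 * n - 1. th j t * om j t)))"
    by (intro bdd_diff bdd_add bdd_sum bdd_mult[of "th _"] bdd_cmult signals_bounded) auto
qed (simp add: echi Fu)

lemma bdd_xW: assumes i: "i < NW" shows "bdd (xW i)"
  unfolding bdd_iff_sdom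
proof (rule state_sdom[OF errf(1) _ xW _ i])
  show "hurwitz_poly (char_poly AW)" using errf pq by simp
  show "sdom (\<lambda>t. vec_index bW k * (echi t - ea t * (\<Sum>j<2 * n - 1. (ze j t)\<^sup>2))) (\<lambda>t. 0)" for k
    unfolding bdd_iff_sdom[symmetric]
    by (intro bdd_cmult bdd_diff bdd_mult[of ea] bdd_echi signals_bounded bdd_ze2[unfolded ze2_def[abs_def]])
qed auto

lemma sol_ey: "\<exists>dey. sol ey dey \<and> bdd dey"
proof -
  let ?dy = "\<lambda>t. \<Sum>i<n. vec_index cp i * ((\<Sum>j<n. Ap $$ (i, j) * xp j t) + vec_index bp i * u t)"
  let ?dm = "\<lambda>t. \<Sum>i<m. vec_index cm i * ((\<Sum>j<m. Am $$ (i, j) * xm j t) + (vec_index bm i * r t + vec_index l i * ey t))"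
  have r: "bdd r" using r_bound by (auto simp: bdd_def)
  have "sol (\<lambda>t. y t - (\<Sum>i<m. vec_index cm i * xm i t)) (\<lambda>t. ?dy t - ?dm t)"
    by (intro sol_diff sol_y sol_sum sol_cmult xm) auto
  then have "sol ey (\<lambda>t. ?dy t - ?dm t)" by (rule sol_cong) (simp_all add: ey ym)
  moreover have "bdd (\<lambda>t. ?dy t - ?dm t)" by (intro bdd_diff bdd_sum bdd_cmult bdd_add signals_bounded r) auto
  ultimately show ?thesis by blast
qed

lemma cont_ey2: "continuous_on I (\<lambda>t. (ey t)\<^sup>2)"
  by (intro continuous_intros cont_ey)

text \<open>\<open>ey = ea - Wout\<close>. The square of \<open>ea\<close> is integrable by
  \<open>lyapunov\<close>; that of \<open>Wout\<close> follows by integrating the damping in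
  \<open>Wout_lyapunov\<close>, now that \<open>B\<close> can be a fixed bound of
  \<open>v1\<close>.\<close>

lemma J_ey2_bounded: "\<exists>C. \<forall>t\<in>I. J (\<lambda>s. (ey s)\<^sup>2) t \<le> C"
proof -
  obtain V dV a C where V: "a > 0" "C \<ge> 0" "sol V dV" "\<forall>t\<in>I. (Wout t)\<^sup>2 \<le> V t"
    "\<forall>t\<in>I - S. \<forall>B. (\<forall>s\<in>{0..t}. \<bar>v1 s\<bar> \<le> B) \<longrightarrow> dV t \<le> - a * (Wout t)\<^sup>2 + C * (1 + B)\<^sup>2 * G t"
    using Wout_lyapunov by blast
  obtain Cl where Cl: "Cl \<ge> 0" "\<And>t. t \<in> I \<Longrightarrow> J G t \<le> Cl" "\<And>t. t \<in> I \<Longrightarrow> J (\<lambda>s. (ea s)\<^sup>2) t \<le> Cl" using lyapunov by blast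
  obtain B where B: "\<And>t. t \<in> I \<Longrightarrow> \<bar>v1 t\<bar> \<le> B" using v1_bounded unfolding bdd_def by blast
  define c where "c = C * (1 + B)\<^sup>2"
  have c0: "0 \<le> c" using V(2) by (simp add: c_def)
  define E where "E t = (2 * J (\<lambda>s. (ea s)\<^sup>2) t + 2 / a * (c * J G t - V t))" for t
  have cw: "continuous_on I (\<lambda>s. (ea s)\<^sup>2)" by (intro continuous_intros cont_ea)
  have "J (\<lambda>s. (ey s)\<^sup>2) t \<le> 2 * Cl + 2 / a * (c * Cl + V 0)" if t: "t \<in> I" for t
  proof -
    have "J (\<lambda>s. (ey s)\<^sup>2) t - E t \<le> J (\<lambda>s. (ey s)\<^sup>2) 0 - E 0"
      unfolding E_def
    proof (rule sol_decreasing[OF sol_diff[OF sol_J[OF cont_ey2] sol_add[OF sol_cmult[OF sol_J[OF cw]] sol_cmult[OF sol_diff[OF sol_cmult[OF sol_J[OF cont_G]] V(3)]]]] order_refl time_nonneg[OF t] t])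
      fix s assume s: "s \<in> {0..t} - S"
      then have sI: "s \<in> I - S" using time_down[OF t] by auto
      have "\<forall>r\<in>{0..s}. \<bar>v1 r\<bar> \<le> B" using B sI time_down by auto
      then have "dV s \<le> - a * (Wout s)\<^sup>2 + c * G s" using V(5) sI by (simp add: c_def)
      then have "2 / a * (a * (Wout s)\<^sup>2) \<le> 2 / a * (c * G s - dV s)" using V(1) by (intro mult_left_mono) auto
      then have "2 * (Wout s)\<^sup>2 \<le> 2 / a * (c * G s - dV s)" using V(1) by simp
      moreover have "(ey s)\<^sup>2 \<le> 2 * (ea s)\<^sup>2 + 2 * (Wout s)\<^sup>2"
        using real_square_add_le[of "ea s" "- Wout s"] ea[of s] sI by simp
      ultimately show "(ey s)\<^sup>2 - (2 * (ea s)\<^sup>2 + 2 / a * (c * G s - dV s)) \<le> 0" by linarith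
    qed
    then have "J (\<lambda>s. (ey s)\<^sup>2) t \<le> E t + 2 / a * V 0" by (simp add: E_def right_diff_distrib)
    also have "E t \<le> 2 * Cl + 2 / a * (c * Cl)"
    proof -
      have "0 \<le> V t" using V(4) t by (meson order_trans zero_le_power2)
      then have "c * J G t - V t \<le> c * Cl" using mult_left_mono[OF Cl(2)[OF t] c0] by linarith
      then have "2 / a * (c * J G t - V t) \<le> 2 / a * (c * Cl)" using V(1) by (intro mult_left_mono) auto
      then show ?thesis unfolding E_def using Cl(3)[OF t] by linarith
    qed
    finally show ?thesis by (simp add: distrib_left)
  qed
  then show ?thesis by blast
qed

text \<open>Barbalat's argument: \<open>ey\<^sup>3\<close> has derivative bounded by a multiple of the integrable \<open>ey\<^sup>2\<close>.\<close>

lemma ey_tendsto_0: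
  assumes I: "I = {0..}" shows "(ey \<longlongrightarrow> 0) at_top"
proof -
  obtain dey where dey: "sol ey dey" "bdd dey" using sol_ey by blast
  obtain D where D: "\<And>t. t \<in> I \<Longrightarrow> \<bar>dey t\<bar> \<le> D" using dey(2) unfolding bdd_def by blast
  obtain C where C: "\<And>t. t \<in> I \<Longrightarrow> J (\<lambda>s. (ey s)\<^sup>2) t \<le> C" using J_ey2_bounded by blast
  define Q where "Q = J (\<lambda>s. (ey s)\<^sup>2)"
  define Qs where "Qs = Sup (Q ` I)"
  have bd: "bdd_above (Q ` I)" unfolding Q_def by (rule bdd_aboveI[of _ C]) (use C in blast)
  have ne: "Q ` I \<noteq> {}" using zero_mem by blast
  have Qle: "Q t \<le> Qs" if "t \<in> I" for t using cSup_upper[OF imageI[OF that] bd] by (simp add: Qs_def)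
  have D0: "0 \<le> D" using D[OF zero_mem] by linarith
  have solQ: "sol Q (\<lambda>t. (ey t)\<^sup>2)" unfolding Q_def by (rule sol_J[OF cont_ey2])
  have cube: "sol (\<lambda>t. (ey t)\<^sup>2 * ey t) (\<lambda>t. (ey t)\<^sup>2 * dey t + (2 * ey t * dey t) * ey t)"
    by (rule sol_mult[OF sol_square[OF dey(1)] dey(1)])
  have diff: "\<bar>(ey t)\<^sup>2 * ey t - (ey s)\<^sup>2 * ey s\<bar> \<le> 3 * D * (Q t - Q s)" if st: "0 \<le> s" "s \<le> t" for s t
  proof -
    have tI: "t \<in> I" using st I by simp
    have der: "(ey r)\<^sup>2 * dey r + (2 * ey r * dey r) * ey r = 3 * ((ey r)\<^sup>2 * dey r)" for r
      by (simp add: power2_eq_square)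
    have b: "\<bar>3 * ((ey r)\<^sup>2 * dey r)\<bar> \<le> 3 * D * (ey r)\<^sup>2" if "r \<in> {s..t} - S" for r
    proof -
      have "r \<in> I" using that sub_I[OF tI st(1)] by blast
      then show ?thesis using mult_left_mono[OF D, of r "(ey r)\<^sup>2"] by (simp add: abs_mult mult.commute)
    qed
    have "(ey t)\<^sup>2 * ey t - 3 * D * Q t \<le> (ey s)\<^sup>2 * ey s - 3 * D * Q s"
    proof (rule sol_decreasing[OF sol_diff[OF cube sol_cmult[OF solQ]] st tI])
      fix r assume "r \<in> {s..t} - S"
      then show "(ey r)\<^sup>2 * dey r + 2 * ey r * dey r * ey r - 3 * D * (ey r)\<^sup>2 \<le> 0"
        using b[of r] unfolding der by linarith
    qed
    moreover have "- ((ey t)\<^sup>2 * ey t) - 3 * D * Q t \<le> - ((ey s)\<^sup>2 * ey s) - 3 * D * Q s"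
    proof (rule sol_decreasing[OF sol_diff[OF sol_minus[OF cube] sol_cmult[OF solQ]] st tI])
      fix r assume "r \<in> {s..t} - S"
      then show "- ((ey r)\<^sup>2 * dey r + 2 * ey r * dey r * ey r) - 3 * D * (ey r)\<^sup>2 \<le> 0"
        using b[of r] unfolding der by linarith
    qed
    ultimately show ?thesis by (simp add: abs_le_iff right_diff_distrib)
  qed
  \<comment> \<open>\<open>Qs - Q s\<close> is the integral still to come. If this failed, the cube
    of \<open>ey\<close> could not change enough after \<open>s\<close> to come near 0,
    \<open>ey\<^sup>2\<close> would stay above a positive constant, and the integral would pass
    \<open>Qs\<close>.\<close>
  have small: "\<bar>ey s\<bar> ^ 3 \<le> 3 * D * (Qs - Q s)" if s: "0 \<le> s" for s
  proof (rule ccontr)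
    assume neg: "\<not> ?thesis"
    define e where "e = \<bar>ey s\<bar> ^ 3 - 3 * D * (Qs - Q s)"
    have e: "e > 0" using neg by (simp add: e_def)
    have low: "e \<le> \<bar>ey t\<bar> ^ 3" if "s \<le> t" for t
    proof -
      have "3 * D * (Q t - Q s) \<le> 3 * D * (Qs - Q s)" using Qle[of t] that s I D0 by (intro mult_left_mono) auto
      then have "\<bar>(ey t)\<^sup>2 * ey t - (ey s)\<^sup>2 * ey s\<bar> \<le> 3 * D * (Qs - Q s)" using diff[OF s that] by linarith
      then have "\<bar>(ey s)\<^sup>2 * ey s\<bar> - 3 * D * (Qs - Q s) \<le> \<bar>(ey t)\<^sup>2 * ey t\<bar>" by linarith
      moreover have "\<bar>(ey r)\<^sup>2 * ey r\<bar> = \<bar>ey r\<bar> ^ 3" for r by (simp add: abs_mult power3_eq_cube power2_eq_square)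
      ultimately show ?thesis by (simp add: e_def)
    qed
    \<comment> \<open>A cube of at least \<open>e\<close> means a square of at least
      \<open>e\<close> where \<open>|ey| \<le> 1\<close>, and of at least 1 elsewhere.\<close>
    define c where "c = min 1 e"
    have c: "c > 0" using e by (simp add: c_def)
    have low2: "c \<le> (ey t)\<^sup>2" if "s \<le> t" for t
    proof (cases "\<bar>ey t\<bar> \<le> 1")
      case True
      then have "\<bar>ey t\<bar> ^ 3 \<le> \<bar>ey t\<bar>\<^sup>2" by (intro power_decreasing) auto
      then show ?thesis using low[OF that] by (simp add: c_def)
    next
      case False
      then have "1 \<le> \<bar>ey t\<bar>\<^sup>2" by (intro one_le_power) auto
      then show ?thesis by (simp add: c_def)
    qed
    define T where "T = s + (Qs - Q s + 1) / c"
    have T: "s \<le> T" using Qle[of s] s I c by (simp add: T_def)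
    have "c * (T - s) - Q T \<le> c * (s - s) - Q s"
    proof (rule sol_decreasing[OF sol_diff[OF _ solQ] s T])
      show "sol (\<lambda>t. c * (t - s)) (\<lambda>t. c * (1 - 0))"
        unfolding sol_def by (auto intro!: continuous_intros derivative_eq_intros simp flip: has_real_derivative_iff_has_vector_derivative)
    qed (use low2 T s I in auto)
    then have "Qs - Q s + 1 \<le> Q T - Q s" using c by (simp add: T_def)
    then show False using Qle[of T] T s I by simp
  qed
  show ?thesis
  proof (rule tendstoI)
    fix \<epsilon> :: real assume \<epsilon>: "\<epsilon> > 0"
    \<comment> \<open>The summand 1 gives \<open>3 D h < \<epsilon>^3\<close> strictly, including
      the case \<open>D = 0\<close>.\<close>
    define h where "h = \<epsilon> ^ 3 / (3 * D + 1)"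
    have h: "h > 0" using \<epsilon> D0 by (simp add: h_def)
    have "\<exists>y\<in>Q ` I. Qs - h < y" by (rule less_cSupD[OF ne]) (use h in \<open>simp add: Qs_def\<close>)
    then obtain T where T: "T \<in> I" "Qs - h < Q T" by blast
    have "dist (ey t) 0 < \<epsilon>" if t: "t \<ge> T" for t
    proof -
      have T0: "0 \<le> T" using time_nonneg[OF T(1)] .
      have "Q T \<le> Q t" unfolding Q_def using t T0 I by (intro J_mono cont_ey2) auto
      then have "Qs - Q t \<le> h" using T(2) by linarith
      then have "3 * D * (Qs - Q t) \<le> 3 * D * h" using D0 by (intro mult_left_mono) auto
      also have "3 * D * h < (3 * D + 1) * h" using h by (simp add: distrib_right)
      also have "\<dots> = \<epsilon> ^ 3" using D0 by (simp add: h_def)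
      finally have "\<bar>ey t\<bar> ^ 3 < \<epsilon> ^ 3" using small[of t] T0 t by linarith
      then have "\<bar>ey t\<bar> < \<epsilon>" by (rule power_less_imp_less_base) (use \<epsilon> in simp)
      then show ?thesis by simp
    qed
    then show "\<forall>\<^sub>F t in at_top. dist (ey t) 0 < \<epsilon>" unfolding eventually_at_top_linorder by blast
  qed
qed

end

section \<open>Existence of solutions of the adaptive system\<close>

text \<open>Off the finitely many jumps \<open>r\<close> is continuous, hence measurable, and
  boundedness makes it integrable; a finite set is negligible.\<close>

lemma integrable_on_piecewise_continuous:
  fixes r :: "real \<Rightarrow> real"
  assumes fin: "finite {t \<in> {0..T}. \<not> continuous (at t within {0..}) r}" and bd: "\<And>t. 0 \<le> t \<Longrightarrow> \<bar>r t\<bar> \<le> rb"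
  shows "r integrable_on {0..T}"
proof -
  define D where "D = {0..T} - {t \<in> {0..T}. \<not> continuous (at t within {0..}) r}"
  have c: "continuous_on D r" unfolding continuous_on_eq_continuous_within
    by (auto simp: D_def intro: continuous_within_subset)
  have D: "D \<in> lmeasurable" unfolding D_def
    by (intro fmeasurable_Diff lmeasurable_interval(1)[of 0 T, unfolded cbox_interval] negligible_imp_sets negligible_finite fin)
  have "r \<in> borel_measurable (lebesgue_on D)" using c D by (intro continuous_imp_measurable_on_sets_lebesgue) auto
  then have "r integrable_on D"
    by (rule measurable_bounded_by_integrable_imp_integrable[where g = "\<lambda>_. rb"])
      (use D bd in \<open>auto simp: D_def integrable_on_const\<close>)
  then show ?thesis
  proof (rule integrable_spike_set)
    have "{t \<in> D - {0..T}. r t \<noteq> 0} = {}" unfolding D_def by blast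
    then show "negligible {t \<in> D - {0..T}. r t \<noteq> 0}" by (simp only: negligible_empty)
    show "negligible {t \<in> {0..T} - D. r t \<noteq> 0}"
      by (rule negligible_subset[OF negligible_finite[OF fin]]) (simp add: D_def subset_iff)
  qed
qed

text \<open>The reference is integrated beforehand, so that the fixed point argument sees only a
  continuous forcing term.\<close>

lemma primitive_piecewise_continuous:
  fixes r :: "real \<Rightarrow> real"
  assumes fin: "\<And>T. finite {t \<in> {0..T}. \<not> continuous (at t within {0..}) r}" and bd: "\<And>t. 0 \<le> t \<Longrightarrow> \<bar>r t\<bar> \<le> rb"
  shows "continuous_on {0..} (\<lambda>t. integral {0..t} r)"
    and "0 \<le> t \<Longrightarrow> continuous (at t within {0..}) r \<Longrightarrow> ((\<lambda>t. integral {0..t} r) has_vector_derivative r t) (at t within {0..})"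
proof -
  note int = integrable_on_piecewise_continuous[OF fin bd]
  have nhd: "at t within {0..} = at t within {0..t + 1}" for t :: real
    by (rule at_within_nhd[of _ "{..<t + 1}"]) auto
  have "continuous (at t within {0..}) (\<lambda>t. integral {0..t} r)" if "0 \<le> t" for t
    using indefinite_integral_continuous_1[OF int[of "t + 1"]] that
    unfolding continuous_on_eq_continuous_within nhd by auto
  then show "continuous_on {0..} (\<lambda>t. integral {0..t} r)" by (auto simp: continuous_on_eq_continuous_within)
  assume "0 \<le> t" "continuous (at t within {0..}) r"
  then show "((\<lambda>t. integral {0..t} r) has_vector_derivative r t) (at t within {0..})"
    using integral_has_vector_derivative_continuous_at[OF int[of "t + 1"], of t "{}"] unfolding nhd by auto
qed

text \<open>Boxes in the coordinates of \<open>K\<close> take the place of bounded sets in a normed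
  space. The class is closed under products because its members are bounded on boxes.\<close>

definition loclip :: "'i set \<Rightarrow> (('i \<Rightarrow> real) \<Rightarrow> real) \<Rightarrow> bool" where
  "loclip K g \<longleftrightarrow> (\<forall>R\<ge>0. \<exists>L\<ge>0. \<forall>x y. (\<forall>j\<in>K. \<bar>x j\<bar> \<le> R \<and> \<bar>y j\<bar> \<le> R) \<longrightarrow> \<bar>g x - g y\<bar> \<le> L * (\<Sum>j\<in>K. \<bar>x j - y j\<bar>))"

lemma loclip_const: "loclip K (\<lambda>x. c)"
  by (auto simp: loclip_def)

lemma loclip_coord: "finite K \<Longrightarrow> i \<in> K \<Longrightarrow> loclip K (\<lambda>x. x i)"
  unfolding loclip_def by (intro allI impI exI[of _ 1] conjI) (auto intro: member_le_sum)

lemma loclip_add: assumes "loclip K g" "loclip K h" shows "loclip K (\<lambda>x. g x + h x)"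
  unfolding loclip_def
proof (intro allI impI)
  fix R :: real assume R: "0 \<le> R"
  obtain L where L: "L \<ge> 0" "\<And>x y. (\<forall>j\<in>K. \<bar>x j\<bar> \<le> R \<and> \<bar>y j\<bar> \<le> R) \<Longrightarrow> \<bar>g x - g y\<bar> \<le> L * (\<Sum>j\<in>K. \<bar>x j - y j\<bar>)"
    using assms(1) R unfolding loclip_def by blast
  obtain M where M: "M \<ge> 0" "\<And>x y. (\<forall>j\<in>K. \<bar>x j\<bar> \<le> R \<and> \<bar>y j\<bar> \<le> R) \<Longrightarrow> \<bar>h x - h y\<bar> \<le> M * (\<Sum>j\<in>K. \<bar>x j - y j\<bar>)"
    using assms(2) R unfolding loclip_def by blast
  have "\<bar>g x + h x - (g y + h y)\<bar> \<le> (L + M) * (\<Sum>j\<in>K. \<bar>x j - y j\<bar>)" if "\<forall>j\<in>K. \<bar>x j\<bar> \<le> R \<and> \<bar>y j\<bar> \<le> R" for x y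
    using L(2)[OF that] M(2)[OF that] unfolding distrib_right by linarith
  then show "\<exists>L\<ge>0. \<forall>x y. (\<forall>j\<in>K. \<bar>x j\<bar> \<le> R \<and> \<bar>y j\<bar> \<le> R) \<longrightarrow> \<bar>g x + h x - (g y + h y)\<bar> \<le> L * (\<Sum>j\<in>K. \<bar>x j - y j\<bar>)"
    using L(1) M(1) by (intro exI[of _ "L + M"]) auto
qed

lemma loclip_bounded:
  assumes K: "finite K" and g: "loclip K g" and R: "0 \<le> R"
  shows "\<exists>M\<ge>0. \<forall>x. (\<forall>j\<in>K. \<bar>x j\<bar> \<le> R) \<longrightarrow> \<bar>g x\<bar> \<le> M"
proof -
  obtain L where L: "L \<ge> 0" "\<And>x y. (\<forall>j\<in>K. \<bar>x j\<bar> \<le> R \<and> \<bar>y j\<bar> \<le> R) \<Longrightarrow> \<bar>g x - g y\<bar> \<le> L * (\<Sum>j\<in>K. \<bar>x j - y j\<bar>)"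
    using g R unfolding loclip_def by blast
  have "\<bar>g x\<bar> \<le> \<bar>g (\<lambda>_. 0)\<bar> + L * (\<Sum>j\<in>K. R)" if x: "\<forall>j\<in>K. \<bar>x j\<bar> \<le> R" for x
  proof -
    have "\<bar>g x - g (\<lambda>_. 0)\<bar> \<le> L * (\<Sum>j\<in>K. \<bar>x j - 0\<bar>)" using L(2)[of x "\<lambda>_. 0"] x R by simp
    also have "\<dots> \<le> L * (\<Sum>j\<in>K. R)" using x L(1) by (intro mult_left_mono sum_mono) auto
    finally show ?thesis by linarith
  qed
  moreover have "0 \<le> \<bar>g (\<lambda>_. 0)\<bar> + L * (\<Sum>j\<in>K. R)" using L(1) R by simp
  ultimately show ?thesis by blast
qed

lemma loclip_mult: assumes K: "finite K" and gh: "loclip K g" "loclip K h" shows "loclip K (\<lambda>x. g x * h x)"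
  unfolding loclip_def
proof (intro allI impI)
  fix R :: real assume R: "0 \<le> R"
  obtain L where L: "L \<ge> 0" "\<And>x y. (\<forall>j\<in>K. \<bar>x j\<bar> \<le> R \<and> \<bar>y j\<bar> \<le> R) \<Longrightarrow> \<bar>g x - g y\<bar> \<le> L * (\<Sum>j\<in>K. \<bar>x j - y j\<bar>)"
    using gh(1) R unfolding loclip_def by blast
  obtain M where M: "M \<ge> 0" "\<And>x y. (\<forall>j\<in>K. \<bar>x j\<bar> \<le> R \<and> \<bar>y j\<bar> \<le> R) \<Longrightarrow> \<bar>h x - h y\<bar> \<le> M * (\<Sum>j\<in>K. \<bar>x j - y j\<bar>)"
    using gh(2) R unfolding loclip_def by blast
  obtain A where A: "A \<ge> 0" "\<And>x. (\<forall>j\<in>K. \<bar>x j\<bar> \<le> R) \<Longrightarrow> \<bar>g x\<bar> \<le> A" using loclip_bounded[OF K gh(1) R] by blast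
  obtain C where C: "C \<ge> 0" "\<And>x. (\<forall>j\<in>K. \<bar>x j\<bar> \<le> R) \<Longrightarrow> \<bar>h x\<bar> \<le> C" using loclip_bounded[OF K gh(2) R] by blast
  have "\<bar>g x * h x - g y * h y\<bar> \<le> (A * M + C * L) * (\<Sum>j\<in>K. \<bar>x j - y j\<bar>)" if xy: "\<forall>j\<in>K. \<bar>x j\<bar> \<le> R \<and> \<bar>y j\<bar> \<le> R" for x y
  proof -
    have "g x * h x - g y * h y = g x * (h x - h y) + h y * (g x - g y)" by (simp add: algebra_simps)
    then have "\<bar>g x * h x - g y * h y\<bar> \<le> \<bar>g x\<bar> * \<bar>h x - h y\<bar> + \<bar>h y\<bar> * \<bar>g x - g y\<bar>"
      using abs_triangle_ineq[of "g x * (h x - h y)" "h y * (g x - g y)"] by (simp add: abs_mult)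
    also have "\<dots> \<le> A * (M * (\<Sum>j\<in>K. \<bar>x j - y j\<bar>)) + C * (L * (\<Sum>j\<in>K. \<bar>x j - y j\<bar>))"
      using A C L(2)[OF xy] M(2)[OF xy] xy by (intro add_mono mult_mono) auto
    finally show ?thesis by (simp add: algebra_simps)
  qed
  then show "\<exists>L\<ge>0. \<forall>x y. (\<forall>j\<in>K. \<bar>x j\<bar> \<le> R \<and> \<bar>y j\<bar> \<le> R) \<longrightarrow> \<bar>g x * h x - g y * h y\<bar> \<le> L * (\<Sum>j\<in>K. \<bar>x j - y j\<bar>)"
    using A(1) C(1) L(1) M(1) by (intro exI[of _ "A * M + C * L"]) auto
qed

lemma loclip_uniform:
  assumes K: "finite K" and g: "\<And>i. i \<in> K \<Longrightarrow> loclip K (g i)" and R: "0 \<le> R"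
  shows "\<exists>L\<ge>0. \<forall>i\<in>K. \<forall>x y. (\<forall>j\<in>K. \<bar>x j\<bar> \<le> R \<and> \<bar>y j\<bar> \<le> R) \<longrightarrow> \<bar>g i x - g i y\<bar> \<le> L * (\<Sum>j\<in>K. \<bar>x j - y j\<bar>)"
proof -
  have "\<forall>i\<in>K. \<exists>L\<ge>0. \<forall>x y. (\<forall>j\<in>K. \<bar>x j\<bar> \<le> R \<and> \<bar>y j\<bar> \<le> R) \<longrightarrow> \<bar>g i x - g i y\<bar> \<le> L * (\<Sum>j\<in>K. \<bar>x j - y j\<bar>)"
    using g R unfolding loclip_def by blast
  then obtain L where L: "\<forall>i\<in>K. 0 \<le> L i \<and> (\<forall>x y. (\<forall>j\<in>K. \<bar>x j\<bar> \<le> R \<and> \<bar>y j\<bar> \<le> R) \<longrightarrow> \<bar>g i x - g i y\<bar> \<le> L i * (\<Sum>j\<in>K. \<bar>x j - y j\<bar>))"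
    by metis
  have "\<bar>g i x - g i y\<bar> \<le> sum L K * (\<Sum>j\<in>K. \<bar>x j - y j\<bar>)" if i: "i \<in> K" and xy: "\<forall>j\<in>K. \<bar>x j\<bar> \<le> R \<and> \<bar>y j\<bar> \<le> R" for i x y
  proof -
    have "L i \<le> sum L K" using L K i by (intro member_le_sum) auto
    then have "L i * (\<Sum>j\<in>K. \<bar>x j - y j\<bar>) \<le> sum L K * (\<Sum>j\<in>K. \<bar>x j - y j\<bar>)" by (intro mult_right_mono sum_nonneg) auto
    moreover have "\<bar>g i x - g i y\<bar> \<le> L i * (\<Sum>j\<in>K. \<bar>x j - y j\<bar>)" using L i xy by blast
    ultimately show ?thesis by linarith
  qed
  moreover have "0 \<le> sum L K" using L by (auto intro: sum_nonneg)
  ultimately show ?thesis by blast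
qed

text \<open>Names of the scalar states. \<open>Om\<close> keeps the regressor indexing, so its index
  \<open>n - 1\<close>, the plant output, is not a state.\<close>

datatype coord = Xp nat | Om nat | Xm nat | XF nat nat | XFu nat | XW nat | Th nat

section \<open>The closed loop as one ordinary differential equation\<close>

context design
begin

definition coords :: "coord set" where
  "coords = Xp ` {..<n} \<union> Om ` {..<n - 1} \<union> (\<lambda>j. Om (n + j)) ` {..<n - 1} \<union> Xm ` {..<m} \<union>
    (\<lambda>(j, i). XF j i) ` ({..<2 * n - 1} \<times> {..<ns - 1}) \<union> XFu ` {..<ns - 1} \<union> XW ` {..<NW} \<union> Th ` {..<2 * n - 1}"

lemma finite_coords: "finite coords"
  by (simp add: coords_def)

lemma coords_mem:
  "i < n \<Longrightarrow> Xp i \<in> coords" "j < n - 1 \<Longrightarrow> Om j \<in> coords" "j < n - 1 \<Longrightarrow> Om (n + j) \<in> coords" "i < m \<Longrightarrow> Xm i \<in> coords"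
  "j < 2 * n - 1 \<Longrightarrow> i < ns - 1 \<Longrightarrow> XF j i \<in> coords" "i < ns - 1 \<Longrightarrow> XFu i \<in> coords" "i < NW \<Longrightarrow> XW i \<in> coords"
  "j < 2 * n - 1 \<Longrightarrow> Th j \<in> coords"
  by (auto simp: coords_def)

lemma omega2_index: "n + j \<noteq> n - Suc 0" "j + n \<noteq> n - Suc 0"
  using n_pos by auto

text \<open>These outputs are polynomials in the states. Plant, reference model and error filter
  have no feedthrough, so the feedback through \<open>ea\<close> is not an algebraic loop.\<close>

definition out_y where "out_y x = (\<Sum>i<n. vec_index cp i * x (Xp i))" for x :: "coord \<Rightarrow> real"
definition out_om where "out_om x j = (if j = n - 1 then out_y x else x (Om j))" for x :: "coord \<Rightarrow> real"
definition out_v where "out_v x = (\<Sum>j<2 * n - 1. x (Th j) * out_om x j)" for x :: "coord \<Rightarrow> real"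
definition out_ey where "out_ey x = out_y x - (\<Sum>i<m. vec_index cm i * x (Xm i))" for x :: "coord \<Rightarrow> real"
definition out_ze where "out_ze x j = (\<Sum>i<ns - 1. vec_index cF i * x (XF j i)) + dF * out_om x j" for x :: "coord \<Rightarrow> real"
definition out_echi where
  "out_echi x = (\<Sum>j<2 * n - 1. x (Th j) * out_ze x j) - ((\<Sum>i<ns - 1. vec_index cF i * x (XFu i)) + dF * out_v x)"
  for x :: "coord \<Rightarrow> real"
definition out_ea where "out_ea x = out_ey x + (\<Sum>i<NW. vec_index cW i * x (XW i))" for x :: "coord \<Rightarrow> real"

definition rhs :: "coord \<Rightarrow> (coord \<Rightarrow> real) \<Rightarrow> real" where
  "rhs c x = (case c of
      Xp i \<Rightarrow> (\<Sum>j<n. Ap $$ (i, j) * x (Xp j)) + vec_index bp i * out_v x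
    | Om i \<Rightarrow> if i < n - 1 then (\<Sum>j<n - 1. Lam $$ (i, j) * x (Om j)) + vec_index bl i * out_v x
        else (\<Sum>j<n - 1. Lam $$ (i - n, j) * x (Om (n + j))) + vec_index bl (i - n) * out_y x
    | Xm i \<Rightarrow> (\<Sum>j<m. Am $$ (i, j) * x (Xm j)) + vec_index l i * out_ey x
    | XF j i \<Rightarrow> (\<Sum>k<ns - 1. AF $$ (i, k) * x (XF j k)) + vec_index bF i * out_om x j
    | XFu i \<Rightarrow> (\<Sum>k<ns - 1. AF $$ (i, k) * x (XFu k)) + vec_index bF i * out_v x
    | XW i \<Rightarrow> (\<Sum>k<NW. AW $$ (i, k) * x (XW k)) + vec_index bW i * (out_echi x - out_ea x * (\<Sum>j<2 * n - 1. out_ze x j * out_ze x j))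
    | Th j \<Rightarrow> - gam * out_ea x * out_ze x j)"

text \<open>The coefficient of \<open>r\<close> in each equation. It is constant, so the
  discontinuous reference separates from the polynomial part and can be integrated on its
  own.\<close>

definition inp :: "coord \<Rightarrow> real" where
  "inp c = (case c of Xp i \<Rightarrow> vec_index bp i | Om i \<Rightarrow> if i < n - 1 then vec_index bl i else 0 | Xm i \<Rightarrow> vec_index bm i | _ \<Rightarrow> 0)"

text \<open>Induction over the polynomial expressions in the state: applied below to local Lipschitz continuity
  and to continuity in time.\<close>

lemma rhs_induct:
  assumes const: "\<And>a. \<P> (\<lambda>x. a)" and coord: "\<And>c. c \<in> coords \<Longrightarrow> \<P> (\<lambda>x. x c)"
    and add: "\<And>g h. \<P> g \<Longrightarrow> \<P> h \<Longrightarrow> \<P> (\<lambda>x. g x + h x)" and mult: "\<And>g h. \<P> g \<Longrightarrow> \<P> h \<Longrightarrow> \<P> (\<lambda>x. g x * h x)"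
  shows "c \<in> coords \<Longrightarrow> \<P> (rhs c)"
proof -
  have sum: "\<P> (\<lambda>x. \<Sum>i<k. g i x)" if "\<And>i. i < k \<Longrightarrow> \<P> (g i)" for g and k :: nat
    using that by (induction k) (auto intro: const add)
  have cmult: "\<P> (\<lambda>x. a * g x)" if "\<P> g" for a g by (rule mult[OF const that])
  have diff: "\<P> (\<lambda>x. g x - h x)" if "\<P> g" "\<P> h" for g h
    using add[OF that(1) cmult[OF that(2), of "- 1"]] by simp
  have y: "\<P> out_y" unfolding out_y_def by (intro sum cmult coord coords_mem)
  have om: "\<P> (\<lambda>x. out_om x j)" if "j < 2 * n - 1" for j
    by (rule index_cases[OF that]) (auto simp: out_om_def omega2_index y coord coords_mem)
  have v: "\<P> out_v" unfolding out_v_def by (intro sum mult om coord coords_mem)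
  have ey: "\<P> out_ey" unfolding out_ey_def by (intro diff y sum cmult coord coords_mem)
  have ze: "\<P> (\<lambda>x. out_ze x j)" if "j < 2 * n - 1" for j unfolding out_ze_def using that by (intro add om sum cmult coord coords_mem)
  have echi: "\<P> out_echi" unfolding out_echi_def by (intro diff add sum mult cmult ze v coord coords_mem)
  have ea: "\<P> out_ea" unfolding out_ea_def by (intro add ey sum cmult coord coords_mem)
  assume "c \<in> coords"
  then consider i where "c = Xp i" "i < n" | i where "c = Om i" "i < n - 1" | i where "c = Om (n + i)" "i < n - 1"
    | i where "c = Xm i" "i < m" | j i where "c = XF j i" "j < 2 * n - 1" "i < ns - 1" | i where "c = XFu i" "i < ns - 1"
    | i where "c = XW i" "i < NW" | j where "c = Th j" "j < 2 * n - 1"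
    unfolding coords_def by (elim UnE imageE) force+
  then show "\<P> (rhs c)"
  proof cases
    case 1 show ?thesis unfolding rhs_def 1 coord.case by (intro add sum cmult coord coords_mem v)
  next
    case 2
    have "rhs c = (\<lambda>x. (\<Sum>j<n - 1. Lam $$ (i, j) * x (Om j)) + vec_index bl i * out_v x)" using 2 by (auto simp: rhs_def)
    then show ?thesis by (simp only:) (intro add sum cmult coord coords_mem v)
  next
    case 3
    have "rhs c = (\<lambda>x. (\<Sum>j<n - 1. Lam $$ (i, j) * x (Om (n + j))) + vec_index bl i * out_y x)"
    proof -
      have "\<not> n + i < n - 1" by simp
      then show ?thesis unfolding 3(1) rhs_def coord.case by (simp only: if_False diff_add_inverse)
    qed
    then show ?thesis by (simp only:) (intro add sum cmult coord coords_mem y)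
  next
    case 4 show ?thesis unfolding rhs_def 4 coord.case by (intro add sum cmult coord coords_mem ey)
  next
    case 5 show ?thesis unfolding rhs_def 5(1) coord.case using 5(2) by (intro add sum cmult coord coords_mem om)
  next
    case 6 show ?thesis unfolding rhs_def 6 coord.case by (intro add sum cmult coord coords_mem v)
  next
    case 7 show ?thesis unfolding rhs_def 7 coord.case by (intro add diff mult[OF ea] sum cmult coord coords_mem echi mult ze)
  next
    case 8 show ?thesis unfolding rhs_def 8(1) coord.case using 8(2) by (intro mult[OF cmult[OF ea]] ze)
  qed
qed

text \<open>The interval is arbitrary, which makes the stability analysis available for local
  solutions.\<close>

lemma state_loop:
  assumes T: "time_domain I S" and r: "\<And>t. t \<in> I \<Longrightarrow> \<bar>r t\<bar> \<le> rb"
    and X: "\<And>c. c \<in> coords \<Longrightarrow> time_domain.sol I S (X c) (\<lambda>t. rhs c (\<lambda>c. X c t) + inp c * r t)"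
  shows "loop n m ns NW Z P Zm Pm L f lam lam1 Q R p q gg Ap Am Lam AF AW bp cp bm cm l bl bF cF bW cW go dF gam \<kappa> \<theta>s B I S
    (\<lambda>i. X (Xp i)) (\<lambda>i. X (Xm i)) (\<lambda>i. X (XFu i)) (\<lambda>i. X (XW i)) (\<lambda>j t. out_om (\<lambda>c. X c t) j) (\<lambda>i. X (Th i))
    (\<lambda>j t. out_ze (\<lambda>c. X c t) j) (\<lambda>j i. X (XF j i)) r (\<lambda>t. r t + out_v (\<lambda>c. X c t)) (\<lambda>t. out_y (\<lambda>c. X c t))
    (\<lambda>t. \<Sum>i<m. vec_index cm i * X (Xm i) t) (\<lambda>t. out_ey (\<lambda>c. X c t))
    (\<lambda>t. (\<Sum>i<ns - 1. vec_index cF i * X (XFu i) t) + dF * out_v (\<lambda>c. X c t))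
    (\<lambda>t. out_echi (\<lambda>c. X c t)) (\<lambda>t. \<Sum>i<NW. vec_index cW i * X (XW i) t) (\<lambda>t. out_ea (\<lambda>c. X c t)) rb"
proof -
  interpret time_domain I S by (rule T)
  show ?thesis
  proof
    fix i assume i: "i < n - 1"
    show "sol (\<lambda>t. out_om (\<lambda>c. X c t) i) (\<lambda>t. (\<Sum>j<n - 1. Lam $$ (i, j) * out_om (\<lambda>c. X c t) j) + vec_index bl i * (r t + out_v (\<lambda>c. X c t)))"
      by (rule sol_cong[OF X[OF coords_mem(2)[OF i]]]) (use i n_pos in \<open>auto simp: rhs_def inp_def out_om_def omega2_index algebra_simps\<close>)
    show "sol (\<lambda>t. out_om (\<lambda>c. X c t) (n + i)) (\<lambda>t. (\<Sum>j<n - 1. Lam $$ (i, j) * out_om (\<lambda>c. X c t) (n + j)) + vec_index bl i * out_y (\<lambda>c. X c t))"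
      by (rule sol_cong[OF X[OF coords_mem(3)[OF i]]]) (use i n_pos in \<open>auto simp: rhs_def inp_def out_om_def omega2_index algebra_simps\<close>)
  next
    fix i assume i: "i < n"
    show "sol (X (Xp i)) (\<lambda>t. (\<Sum>j<n. Ap $$ (i, j) * X (Xp j) t) + vec_index bp i * (r t + out_v (\<lambda>c. X c t)))"
      by (rule sol_cong[OF X[OF coords_mem(1)[OF i]]]) (auto simp: rhs_def inp_def algebra_simps)
  next
    fix i assume i: "i < m"
    show "sol (X (Xm i)) (\<lambda>t. (\<Sum>j<m. Am $$ (i, j) * X (Xm j) t) + (vec_index bm i * r t + vec_index l i * out_ey (\<lambda>c. X c t)))"
      by (rule sol_cong[OF X[OF coords_mem(4)[OF i]]]) (auto simp: rhs_def inp_def algebra_simps)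
  next
    fix j i assume ji: "j < 2 * n - 1" "i < ns - 1"
    show "sol (X (XF j i)) (\<lambda>t. (\<Sum>k<ns - 1. AF $$ (i, k) * X (XF j k) t) + vec_index bF i * out_om (\<lambda>c. X c t) j)"
      by (rule sol_cong[OF X[OF coords_mem(5)[OF ji]]]) (auto simp: rhs_def inp_def)
  next
    fix i assume i: "i < ns - 1"
    show "sol (X (XFu i)) (\<lambda>t. (\<Sum>k<ns - 1. AF $$ (i, k) * X (XFu k) t) + vec_index bF i * (\<Sum>j<2 * n - 1. X (Th j) t * out_om (\<lambda>c. X c t) j))"
      by (rule sol_cong[OF X[OF coords_mem(6)[OF i]]]) (auto simp: rhs_def inp_def out_v_def)
  next
    fix i assume i: "i < NW"
    show "sol (X (XW i)) (\<lambda>t. (\<Sum>k<NW. AW $$ (i, k) * X (XW k) t) + vec_index bW i *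
        (out_echi (\<lambda>c. X c t) - out_ea (\<lambda>c. X c t) * (\<Sum>j<2 * n - 1. (out_ze (\<lambda>c. X c t) j)\<^sup>2)))"
      by (rule sol_cong[OF X[OF coords_mem(7)[OF i]]]) (auto simp: rhs_def inp_def power2_eq_square)
  next
    fix j assume j: "j < 2 * n - 1"
    show "sol (X (Th j)) (\<lambda>t. - gam * out_ea (\<lambda>c. X c t) * out_ze (\<lambda>c. X c t) j)"
      by (rule sol_cong[OF X[OF coords_mem(8)[OF j]]]) (auto simp: rhs_def inp_def)
  qed (auto simp: r out_om_def out_ey_def out_ze_def out_v_def out_echi_def out_ea_def out_y_def)
qed

lemma states_bounded:
  assumes T: "time_domain I S" and r: "\<And>t. t \<in> I \<Longrightarrow> \<bar>r t\<bar> \<le> rb"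
    and X: "\<And>c. c \<in> coords \<Longrightarrow> time_domain.sol I S (X c) (\<lambda>t. rhs c (\<lambda>c. X c t) + inp c * r t)"
  shows "\<exists>M. \<forall>c\<in>coords. \<forall>t\<in>I. \<bar>X c t\<bar> \<le> M"
proof -
  note loop = state_loop[OF assms]
  interpret time_domain I S by (rule T)
  have om: "bdd (X (Om j))" if "j < 2 * n - 1" "j \<noteq> n - 1" for j
    using loop.signals_bounded(2)[OF loop that(1)] that(2) by (simp add: out_om_def)
  have "bdd (X c)" if "c \<in> coords" for c
  proof -
    have "bdd (X (Om (n + j)))" if "j < n - 1" for j by (rule om) (use that n_pos in auto)
    then show ?thesis
      using that loop.signals_bounded(1,3-6)[OF loop] loop.bdd_xW[OF loop] om unfolding coords_def by (elim UnE imageE) auto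
  qed
  then have "\<forall>c\<in>coords. \<exists>M. \<forall>t\<in>I. \<bar>X c t\<bar> \<le> M" by (simp add: bdd_def)
  then obtain M where M: "\<forall>c\<in>coords. \<forall>t\<in>I. \<bar>X c t\<bar> \<le> M c" by metis
  have "\<bar>X c t\<bar> \<le> (\<Sum>c\<in>coords. \<bar>M c\<bar>)" if c: "c \<in> coords" and t: "t \<in> I" for c t
  proof -
    have "\<bar>X c t\<bar> \<le> \<bar>M c\<bar>" using M c t abs_ge_self[of "M c"] by (meson order_trans)
    also have "\<dots> \<le> (\<Sum>c\<in>coords. \<bar>M c\<bar>)" using c finite_coords by (intro member_le_sum[of c coords "\<lambda>c. \<bar>M c\<bar>"]) auto
    finally show ?thesis .
  qed
  then show ?thesis by blast
qed

lemma states_exist: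
  fixes r :: "real \<Rightarrow> real" and x0 :: "coord \<Rightarrow> real"
  assumes fin: "\<And>T. finite {t \<in> {0..T}. \<not> continuous (at t within {0..}) r}" and bd: "\<And>t. 0 \<le> t \<Longrightarrow> \<bar>r t\<bar> \<le> rb"
  defines "S \<equiv> {t. 0 \<le> t \<and> \<not> continuous (at t within {0..}) r}"
  shows "time_domain {0..} S"
    and "\<exists>X. \<forall>c\<in>coords. X c 0 = x0 c \<and> time_domain.sol {0..} S (X c) (\<lambda>t. rhs c (\<lambda>c. X c t) + inp c * r t)"
proof -
  have S: "finite (S \<inter> {0..t})" for t
    using fin[of t] by (rule rev_finite_subset) (auto simp: S_def)
  show T0: "time_domain {0..} S" by standard (simp_all add: S)
  define h where "h c t = x0 c + inp c * integral {0..t} r" for c t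
  have prim: "continuous_on {0..} (\<lambda>t. integral {0..t} r)" "\<And>t. 0 \<le> t \<Longrightarrow> continuous (at t within {0..}) r \<Longrightarrow> ((\<lambda>t. integral {0..t} r) has_vector_derivative r t) (at t within {0..})"
    using primitive_piecewise_continuous[of r rb] fin bd by blast+
  have solX: "time_domain.sol I S (X c) (\<lambda>t. rhs c (\<lambda>c. X c t) + inp c * r t)"
    if I: "time_domain I {}" and cont: "\<And>c. c \<in> coords \<Longrightarrow> continuous_on I (X c)"
      and eq: "\<And>c t. c \<in> coords \<Longrightarrow> t \<in> I \<Longrightarrow> X c t = h c t + time_domain.J (\<lambda>s. rhs c (\<lambda>c. X c s)) t"
      and c: "c \<in> coords" for I X c
  proof -
    \<comment> \<open>The same interval is read twice: without exceptional times for the integral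
      equation, with the jump times for the differential equation.\<close>
    interpret TI: time_domain I "{}" by (rule I)
    interpret time_domain I S by unfold_locales (rule TI.zero_mem, erule TI.time_nonneg, erule (2) TI.time_down, rule S)
    have sub: "I \<subseteq> {0..}" using time_nonneg by auto
    have ri: "sol (\<lambda>t. integral {0..t} r) r" unfolding sol_def
    proof (intro conjI ballI)
      show "continuous_on I (\<lambda>t. integral {0..t} r)" using prim(1) sub by (rule continuous_on_subset)
      fix t assume "t \<in> I - S"
      then have "0 \<le> t" "continuous (at t within {0..}) r" using sub by (auto simp: S_def)
      then show "((\<lambda>t. integral {0..t} r) has_vector_derivative r t) (at t within I)"
        using prim(2) sub has_vector_derivative_within_subset by blast
    qed
    have "continuous_on I (\<lambda>s. rhs c (\<lambda>c. X c s))"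
      by (rule rhs_induct[where \<P> = "\<lambda>g. continuous_on I (\<lambda>s. g (\<lambda>c. X c s))"])
        (auto intro: continuous_intros cont c)
    then have "sol (\<lambda>t. (x0 c + inp c * integral {0..t} r) + J (\<lambda>s. rhs c (\<lambda>c. X c s)) t) (\<lambda>t. (0 + inp c * r t) + rhs c (\<lambda>c. X c t))"
      by (intro sol_add sol_const sol_cmult ri sol_J)
    then show ?thesis by (rule sol_cong) (use eq[OF c] in \<open>auto simp: h_def\<close>)
  qed
  have "\<exists>X. \<forall>c\<in>coords. continuous_on {0..} (X c) \<and> (\<forall>t\<ge>0. X c t = h c t + time_domain.J (\<lambda>s. rhs c (\<lambda>c. X c s)) t)"
  proof (rule ode_global[OF finite_coords])
    fix c assume "c \<in> coords"
    show "continuous_on {0..} (h c)" unfolding h_def by (intro continuous_intros prim(1))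
  next
    fix R :: real assume "0 \<le> R"
    have "loclip coords (rhs c)" if "c \<in> coords" for c
      by (rule rhs_induct[where \<P> = "loclip coords"]) (rule loclip_const loclip_coord loclip_add loclip_mult finite_coords that | assumption)+
    then show "\<exists>L\<ge>0. \<forall>c\<in>coords. \<forall>x y. (\<forall>j\<in>coords. \<bar>x j\<bar> \<le> R \<and> \<bar>y j\<bar> \<le> R) \<longrightarrow> \<bar>rhs c x - rhs c y\<bar> \<le> L * (\<Sum>j\<in>coords. \<bar>x j - y j\<bar>)"
      using \<open>0 \<le> R\<close> by (rule loclip_uniform[OF finite_coords])
  next
    \<comment> \<open>Here the adaptive stability analysis supplies the bound on an unspecified
      interval of existence.\<close>
    fix I X assume *: "time_domain I {}" "\<And>c. c \<in> coords \<Longrightarrow> continuous_on I (X c)"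
      "\<And>c t. c \<in> coords \<Longrightarrow> t \<in> I \<Longrightarrow> X c t = h c t + time_domain.J (\<lambda>s. rhs c (\<lambda>c. X c s)) t"
    interpret TI: time_domain I "{}" by (rule *(1))
    have "time_domain I S" by unfold_locales (rule TI.zero_mem, erule TI.time_nonneg, erule (2) TI.time_down, rule S)
    then show "\<exists>B. \<forall>c\<in>coords. \<forall>t\<in>I. \<bar>X c t\<bar> \<le> B"
      by (rule states_bounded[where r = r and rb = rb]) (use bd TI.time_nonneg solX[OF *] in auto)
  qed
  then obtain X where X: "\<And>c. c \<in> coords \<Longrightarrow> continuous_on {0..} (X c)"
    "\<And>c t. c \<in> coords \<Longrightarrow> t \<in> {0..} \<Longrightarrow> X c t = h c t + time_domain.J (\<lambda>s. rhs c (\<lambda>c. X c s)) t"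
    by (metis atLeast_iff)
  have TE: "time_domain {0..} {}" by unfold_locales auto
  interpret TE: time_domain "{0..}" "{}" by (rule TE)
  have "X c 0 = x0 c" if "c \<in> coords" for c using X(2)[OF that, of 0] by (simp add: h_def)
  then show "\<exists>X. \<forall>c\<in>coords. X c 0 = x0 c \<and> time_domain.sol {0..} S (X c) (\<lambda>t. rhs c (\<lambda>c. X c t) + inp c * r t)"
    using solX[OF TE X] by blast
qed

end

section \<open>Matching and the existence of the design data\<close>

lemma monic_factor: assumes "monic (a * b)" "monic a" shows "monic (b :: real poly)"
  using assms lead_coeff_mult[of a b] by simp

lemma coeff_diff_monic:
  assumes "monic a" "monic (b :: real poly)" "degree a = N" "degree b = N" "k \<ge> N" shows "coeff (a - b) k = 0"
  using assms by (cases "k = N") (auto simp: coeff_eq_0)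

lemma degree_less_if_coeff: assumes "\<And>k. k \<ge> N \<Longrightarrow> coeff p k = 0" "N > 0" shows "degree p < N"
  using assms by (metis leading_coeff_0_iff degree_0 not_le)

text \<open>The target characteristic polynomial is \<open>h Z\<close> with
  \<open>h = (s + 1)^ns\<close>. Modulo the characteristic polynomial, the change needed is
  \<open>h Z\<close>, a multiple of the plant numerator, hence reachable even if numerator and
  denominator share factors; \<open>h Z\<close> is Hurwitz because \<open>Z\<close> is.\<close>

lemma stabilizing_injection:
  assumes A: "A \<in> carrier_mat n n" "b \<in> carrier_vec n" "c \<in> carrier_vec n"
    and Z: "num A b c = Z" "monic Z" "degree Z + ns = n" "hurwitz_poly Z" "ns \<ge> 1"
  shows "\<exists>g. hurwitz_poly (char_poly (Matrix.mat n n (\<lambda>(i, j). A $$ (i, j) - vec_index g i * vec_index c j)))"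
proof -
  define h :: "real poly" where "h = [:1, 1:] ^ ns"
  have h: "monic h" "degree h = ns" "hurwitz_poly h" unfolding h_def using linear_power[of 1 ns] by auto
  have n: "n > 0" using Z by simp
  note \<chi> = char_poly_monic[OF A(1)]
  have hZ: "monic (h * Z)" "degree (h * Z) = n" using monic_mult[OF h(1) Z(2)] h Z by auto
  have "degree (h * Z - char_poly A) < n"
    by (rule degree_less_if_coeff[OF coeff_diff_monic[OF hZ(1) \<chi>(1) hZ(2) \<chi>(2)] n])
  moreover have "char_poly A dvd (h * Z - char_poly A) - h * num A b c" by (simp add: Z)
  ultimately obtain g where g: "g \<in> carrier_vec n" "num A g c = h * Z - char_poly A"
    using num_reachable[OF A(1) n A(2)] by blast
  have "char_poly (Matrix.mat n n (\<lambda>(i, j). A $$ (i, j) - vec_index g i * vec_index c j)) = h * Z"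
    using char_poly_output_injection[OF A(1) g(1) A(3)] g(2) by simp
  then show ?thesis using hurwitz_mult[OF h(3) Z(4)] by (intro exI[of _ g]) simp
qed

text \<open>The division identity \<open>lam1 Pm = Q P + R\<close> solves the matching equation, and controllability of the
  filters realizes \<open>Q\<close> and \<open>R\<close> by a constant parameter.\<close>

lemma matching_parameter:
  assumes Lam: "Lam \<in> carrier_mat (n - 1) (n - 1)" "bl \<in> carrier_vec (n - 1)" "controllable (n - 1) Lam bl"
    and Z: "monic Z" "degree Z + ns = n" "ns \<ge> 1" and P: "monic P" "degree P = n"
    and S: "monic S" "degree S = n - 1 + ns"
  shows "\<exists>Q R \<theta>s. S = Q * P + R \<and> degree Q + 1 = ns \<and> degree R < n \<and>
      char_poly Lam - (\<Sum>j<n - 1. smult (\<theta>s j) (num Lam bl (unit_vec (n - 1) j))) = Z * Q \<and>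
      smult (\<theta>s (n - 1)) (char_poly Lam) + (\<Sum>j<n - 1. smult (\<theta>s (n + j)) (num Lam bl (unit_vec (n - 1) j))) = - R"
proof -
  have n: "n > 0" using Z by simp
  define Q where "Q = S div P"
  define R where "R = S mod P"
  have SQ: "S = Q * P + R" by (simp add: Q_def R_def)
  have "P \<noteq> 0" using P by auto
  then have R: "degree R < n" using degree_mod_less[of P S] P n by (auto simp: R_def)
  have RS: "degree (- R) < degree S" using R S Z by simp
  have "S + - R = P * Q" by (simp add: SQ)
  moreover have "degree (S + - R) = n - 1 + ns" "monic (S + - R)"
    using degree_add_eq_left[OF RS] RS S by (auto simp: coeff_eq_0)
  ultimately have PQ: "monic (P * Q)" "degree (P * Q) = n - 1 + ns" by simp_all
  have mQ: "monic Q" by (rule monic_factor[OF PQ(1) P(1)])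
  then have Q: "degree Q = ns - 1" "monic Q" using monic_mult[OF P(1) mQ] PQ(2) P(2) n Z(3) by auto
  note \<chi> = char_poly_monic[OF Lam(1)]
  have ZQ: "monic (Z * Q)" "degree (Z * Q) = n - 1" using monic_mult[OF Z(1) Q(2)] Q Z by auto
  obtain v where v: "char_poly Lam - Z * Q = (\<Sum>j<n - 1. smult (v j) (num Lam bl (unit_vec (n - 1) j)))"
    using controllable_assign[OF Lam coeff_diff_monic[OF \<chi>(1) ZQ(1) \<chi>(2) ZQ(2)]] by blast
  \<comment> \<open>\<open>\<theta>s (n - 1)\<close> multiplies \<open>lam\<close>, which has degree
    exactly \<open>n - 1\<close>, and thus matches the top coefficient of \<open>- R\<close>; the
    filter outputs cover the lower degrees.\<close>
  define a where "a = - coeff R (n - 1)"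
  have "coeff (- R - smult a (char_poly Lam)) k = 0" if "k \<ge> n - 1" for k
  proof (cases "k = n - 1")
    case True
    then show ?thesis using \<chi> by (simp add: a_def)
  next
    case False
    then show ?thesis using that R \<chi> by (simp add: coeff_eq_0)
  qed
  then obtain w where w: "- R - smult a (char_poly Lam) = (\<Sum>j<n - 1. smult (w j) (num Lam bl (unit_vec (n - 1) j)))"
    using controllable_assign[OF Lam] by blast
  define \<theta>s where "\<theta>s j = (if j < n - 1 then v j else if j = n - 1 then a else w (j - n))" for j
  have 1: "(\<Sum>j<n - 1. smult (\<theta>s j) (num Lam bl (unit_vec (n - 1) j))) = char_poly Lam - Z * Q"
    unfolding v by (rule sum.cong) (auto simp: \<theta>s_def)
  have 2: "(\<Sum>j<n - 1. smult (\<theta>s (n + j)) (num Lam bl (unit_vec (n - 1) j))) = - R - smult a (char_poly Lam)"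
    unfolding w by (rule sum.cong) (auto simp: \<theta>s_def)
  have "\<theta>s (n - 1) = a" by (simp add: \<theta>s_def)
  then show ?thesis using SQ R Q Z 1 2 by (intro exI[of _ Q] exI[of _ R] exI[of _ \<theta>s]) auto
qed

lemma minimal_realization_strictly_proper:
  assumes "minimal_realization G (Fraction_Field.Fract b a)" "monic a" "degree b < degree a" "coprime a b"
  shows "ss_A G \<in> carrier_mat (degree a) (degree a)" "ss_dim G = degree a" "char_poly (ss_A G) = a"
    "num (ss_A G) (ss_b G) (ss_c G) = b" "ss_d G = 0"
proof -
  note m = minimal_realization_poly[OF assms(1,2) less_imp_le[OF assms(3)] assms(4)]
  show A: "ss_A G \<in> carrier_mat (degree a) (degree a)"
    using assms(1) m(1) by (simp add: minimal_realization_def realizes_def)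
  have "coeff (num (ss_A G) (ss_b G) (ss_c G)) (degree a) = 0" by (rule num_coeff_ge[OF A]) simp
  then have "ss_d G * coeff a (degree a) = coeff b (degree a)" using m(3) by (metis add_0 coeff_add coeff_smult)
  then show "ss_d G = 0" using assms(2,3) by (simp add: coeff_eq_0)
  then show "num (ss_A G) (ss_b G) (ss_c G) = b" using m(3) by simp
qed (use minimal_realization_poly[OF assms(1,2) less_imp_le[OF assms(3)] assms(4)] in auto)

lemma design_exists:
  fixes Z P Zm Pm Zl f :: "real poly"
  assumes plant_polys: "monic Z" "monic P" "degree P = n" "hurwitz_poly Z"
    and rel_degree: "degree Z + ns = n" "ns \<ge> 1"
    and plant_real: "Ap \<in> carrier_mat n n" "bp \<in> carrier_vec n" "cp \<in> carrier_vec n"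
      "char_poly Ap = P" "transfer_fun Ap bp cp = Fraction_Field.Fract Z P"
    and model_polys: "monic Zm" "monic Pm" "degree Pm = m" "degree Zm + ns = m" "hurwitz_poly Pm"
    and model_real: "bm \<in> carrier_vec m" "transfer_fun (observer_canonical_mat m Pm) bm (unit_vec m (m - 1)) = Fraction_Field.Fract Zm Pm"
    and filter_F: "monic f" "hurwitz_poly f" "degree f + 1 = ns" "minimal_realization F (Fraction_Field.Fract 1 f)"
    and gain_l: "l \<in> carrier_vec m" "transfer_fun (observer_canonical_mat m Pm) l (unit_vec m (m - 1)) = Fraction_Field.Fract L Pm"
    and Wf': "Wf' = Fraction_Field.Fract Zm (Pm + L) * inverse (Fraction_Field.Fract 1 f)"
      "strictly_positive_real Wf'" "minimal_realization Wf Wf'"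
    and controller: "Lam \<in> carrier_mat (n - 1) (n - 1)" "bl \<in> carrier_vec (n - 1)"
      "hurwitz_mat Lam" "controllable (n - 1) Lam bl" "Zm dvd char_poly Lam"
    and adaptation: "gam > 0"
  shows "\<exists>lam lam1 Q R p q gg go \<kappa> \<theta>s B. design n m ns (ss_dim Wf) Z P Zm Pm L f lam lam1 Q R p q gg
    Ap (observer_canonical_mat m Pm) Lam (ss_A F) (ss_A Wf) bp cp bm (unit_vec m (m - 1)) l bl (ss_b F) (ss_c F) (ss_b Wf) (ss_c Wf) go
    (ss_d F) gam \<kappa> \<theta>s B" and "ss_d Wf = 0" and "ss_dim F = ns - 1"
proof -
  let ?Am = "observer_canonical_mat m Pm" and ?cm = "unit_vec m (m - 1) :: real Matrix.vec"
  have nz: "P \<noteq> 0" "Pm \<noteq> 0" "f \<noteq> 0" using plant_polys model_polys filter_F by auto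
  have plant: "num Ap bp cp = Z"
    using plant_real(5) nz by (simp add: transfer_fun_num[OF plant_real(1-3)] plant_real(4) fract_eq_iff)
  have cAm: "char_poly ?Am = Pm" by (rule observer_canonical(1)[OF model_polys(2,3)])
  have model: "num ?Am bm ?cm = Zm" "num ?Am l ?cm = L"
    using model_real(2) gain_l(2) nz
    by (simp_all add: transfer_fun_num[OF observer_canonical_carrier _ unit_vec_carrier] model_real(1) gain_l(1) cAm fract_eq_iff)
  have m: "m > 0" using model_polys rel_degree by simp
  have "degree L < m" using degree_num[OF observer_canonical_carrier m, of Pm l ?cm] model(2) by simp
  then have PmL: "monic (Pm + L)" "degree (Pm + L) = m" using model_polys by (auto simp: coeff_eq_0 degree_add_eq_left)
  obtain go where go: "hurwitz_poly (char_poly (Matrix.mat n n (\<lambda>(i, j). Ap $$ (i, j) - vec_index go i * vec_index cp j)))"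
    using stabilizing_injection[OF plant_real(1-3) plant plant_polys(1) rel_degree(1) plant_polys(4) rel_degree(2)] by blast
  have F: "ss_A F \<in> carrier_mat (ns - 1) (ns - 1)" "char_poly (ss_A F) = f" "num (ss_A F) (ss_b F) (ss_c F) + smult (ss_d F) f = 1" "ss_dim F = ns - 1"
    using minimal_realization_poly[OF filter_F(4,1)] filter_F by (auto simp: minimal_realization_def realizes_def)
  note hLam = hurwitz_char_poly[OF controller(1,3)]
  obtain lam1 where lam1: "char_poly Lam = lam1 * Zm" using controller(5) by (metis dvd_def mult.commute)
  note \<chi> = char_poly_monic[OF controller(1)]
  have hZm: "hurwitz_poly Zm" using hLam hurwitz_factor[of Zm lam1] lam1 by (simp add: mult.commute)
  have mlam1: "monic lam1" using \<chi>(1) lam1 model_polys(1) monic_factor[of Zm lam1] by (simp add: mult.commute)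
  have "degree lam1 + degree Zm = n - 1" using monic_mult[OF mlam1 model_polys(1)] \<chi>(2) lam1 by simp
  then have S: "monic (lam1 * Pm)" "degree (lam1 * Pm) = n - 1 + ns"
    using monic_mult[OF mlam1 model_polys(2)] model_polys by auto
  obtain Q R \<theta>s where match: "lam1 * Pm = Q * P + R" "degree Q + 1 = ns" "degree R < n"
      "char_poly Lam - (\<Sum>j<n - 1. smult (\<theta>s j) (num Lam bl (unit_vec (n - 1) j))) = Z * Q"
      "smult (\<theta>s (n - 1)) (char_poly Lam) + (\<Sum>j<n - 1. smult (\<theta>s (n + j)) (num Lam bl (unit_vec (n - 1) j))) = - R"
    using matching_parameter[OF controller(1,2,4) plant_polys(1) rel_degree plant_polys(2,3) S] by blast
  \<comment> \<open>\<open>Zm f\<close> and \<open>Pm + L\<close> may have a common factor.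
    Minimality and positive realness concern the reduced fraction, so the factor \<open>gg\<close>
    is kept separately.\<close>
  obtain q p where qp: "quot_of_fract Wf' = (q, p)" by force
  have p: "monic p" using unit_factor_snd_quot_of_fract[of Wf'] qp by (simp add: unit_factor_poly_def one_pCons)
  have cop: "coprime p q" using coprime_quot_of_fract[of Wf'] qp by (simp add: coprime_commute)
  have W: "Wf' = Fraction_Field.Fract q p" using Fract_quot_of_fract[of Wf'] qp by simp
  have PmL0: "Pm + L \<noteq> 0" using PmL m by auto
  have "Wf' = Fraction_Field.Fract (Zm * f) (Pm + L)" unfolding Wf'(1) using nz by simp
  moreover have p0: "p \<noteq> 0" using p by auto
  ultimately have cross: "q * (Pm + L) = Zm * f * p" using W PmL0 by (simp add: fract_eq_iff)
  then have "p dvd q * (Pm + L)" by simp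
  then have "p dvd Pm + L" using cop by (simp add: coprime_dvd_mult_right_iff)
  then obtain gg where gg: "Pm + L = p * gg" by (elim dvdE)
  have "p * (Zm * f) = p * (q * gg)" using cross by (simp only: gg mult_ac)
  then have gg2: "Zm * f = q * gg" using p0 by simp
  have mgg: "monic gg" using PmL p monic_factor[of p gg] by (simp add: gg)
  have mZf: "monic (Zm * f)" "degree (Zm * f) + 1 = m" using monic_mult[OF model_polys(1) filter_F(1)] filter_F model_polys by auto
  have q: "monic q" using mZf mgg monic_factor[of gg q] by (simp add: gg2 mult.commute)
  have degs: "degree q + 1 = degree p" using monic_mult[OF q mgg] monic_mult[OF p mgg] mZf PmL gg gg2 by simp
  have "degree q < degree p" using degs by simp
  note Wr = minimal_realization_strictly_proper[OF Wf'(3)[unfolded W] p this cop]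
  obtain \<kappa> where \<kappa>: "\<kappa> > 0" "\<forall>s. poly (map_poly complex_of_real p) s = 0 \<longrightarrow> 2 * Re s < - (3 * \<kappa>)"
    "\<And>w::real. 0 \<le> Re (poly (map_poly complex_of_real q) (Complex (- \<kappa>) w) * cnj (poly (map_poly complex_of_real p) (Complex (- \<kappa>) w)))"
    using positive_real_reduced[OF Wf'(2) qp] by blast
  have hp: "hurwitz_poly p" unfolding hurwitz_poly_def
  proof (intro allI impI)
    fix s assume "poly (map_poly complex_of_real p) s = 0"
    then have "2 * Re s < - (3 * \<kappa>)" using \<kappa>(2) by blast
    then show "Re s < 0" using \<kappa>(1) by linarith
  qed
  \<comment> \<open>The roots of \<open>Pm + L = p gg\<close> are stable for two reasons: positive
    realness places those of \<open>p\<close>, and \<open>gg\<close> divides \<open>Zm f\<close>,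
    where \<open>Zm\<close> inherits stability from the controller filters.\<close>
  have "hurwitz_poly (Zm * f)" by (rule hurwitz_mult[OF hZm filter_F(2)])
  then have "hurwitz_poly gg" using hurwitz_factor[of gg q] by (simp add: gg2 mult.commute)
  then have hPmL: "hurwitz_poly (Pm + L)" unfolding gg by (rule hurwitz_mult[OF hp])
  obtain B where B: "(\<forall>i j. B i j = B j i) \<and> (\<forall>x. 0 \<le> qf (degree p) B x) \<and> (\<forall>x. (\<Sum>i<degree p. coeff q i * x i)\<^sup>2 \<le> qf (degree p) B x) \<and>
      (\<forall>x. 2 * (\<Sum>i<degree p. \<Sum>j<degree p. B i j * x i * x (Suc j))
       \<le> 2 * (\<Sum>i<degree p. coeff q i * x i) * (\<Sum>i\<le>degree p. coeff p i * x i) - 2 * \<kappa> * qf (degree p) B x)"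
    using kyp[OF p refl q degs \<kappa>] by (elim exE)
  note KYP = B[THEN conjunct1, rule_format] B[THEN conjunct2, THEN conjunct1, rule_format]
    B[THEN conjunct2, THEN conjunct2, THEN conjunct1, rule_format] B[THEN conjunct2, THEN conjunct2, THEN conjunct2, rule_format]
  note dW = Wr(2)
  have "design n m ns (degree p) Z P Zm Pm L f (char_poly Lam) lam1 Q R p q gg
    Ap ?Am Lam (ss_A F) (ss_A Wf) bp cp bm ?cm l bl (ss_b F) (ss_c F) (ss_b Wf) (ss_c Wf) go (ss_d F) gam \<kappa> \<theta>s B"
    by unfold_locales (rule KYP | fact | rule observer_canonical_carrier refl)+
  then show "\<exists>lam lam1 Q R p q gg go \<kappa> \<theta>s B. design n m ns (ss_dim Wf) Z P Zm Pm L f lam lam1 Q R p q gg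
    Ap ?Am Lam (ss_A F) (ss_A Wf) bp cp bm ?cm l bl (ss_b F) (ss_c F) (ss_b Wf) (ss_c Wf) go
    (ss_d F) gam \<kappa> \<theta>s B" unfolding dW by blast
  show "ss_d Wf = 0" by (rule Wr(5))
  show "ss_dim F = ns - 1" by (rule F)
qed

section \<open>Vector-valued signals\<close>

lemma mult_mat_vec_index:
  "A \<in> carrier_mat N N \<Longrightarrow> x \<in> carrier_vec N \<Longrightarrow> i < N \<Longrightarrow> vec_index (A *\<^sub>v x) i = (\<Sum>j<N. A $$ (i, j) * vec_index x j :: real)"
  by (simp add: scalar_prod_def atLeast0LessThan)

lemma affine_index:
  assumes "A \<in> carrier_mat N N" "x \<in> carrier_vec N" "b \<in> carrier_vec N" "i < N"
  shows "vec_index (A *\<^sub>v x + k \<cdot>\<^sub>v b) i = (\<Sum>j<N. A $$ (i, j) * vec_index x j) + vec_index b i * (k :: real)"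
proof -
  have "vec_index (A *\<^sub>v x + k \<cdot>\<^sub>v b) i = vec_index (A *\<^sub>v x) i + vec_index b i * k" using assms by simp
  then show ?thesis by (simp only: mult_mat_vec_index[OF assms(1,2,4)])
qed

lemma scalar_prod_sum: "x \<in> carrier_vec N \<Longrightarrow> scalar_prod c x = (\<Sum>i<N. vec_index c i * vec_index x i :: real)"
  by (simp add: scalar_prod_def atLeast0LessThan)

context time_domain
begin

lemma solves_ode_iff:
  assumes "I = {0..}" "R = {0..} - S"
  shows "solves_ode R N x g \<longleftrightarrow> (\<forall>t\<ge>0. x t \<in> carrier_vec N) \<and> (\<forall>i<N. sol (\<lambda>t. vec_index (x t) i) (\<lambda>t. vec_index (g t) i))"
  unfolding solves_ode_def sol_def assms(2) has_real_derivative_iff_has_vector_derivative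
  by (simp only: assms(1) imp_conjR all_conj_distrib)

lemma bounded_vec_signalI:
  assumes "I = {0..}" "\<And>t. 0 \<le> t \<Longrightarrow> x t \<in> carrier_vec N" "\<And>i. i < N \<Longrightarrow> bdd (\<lambda>t. vec_index (x t) i)"
  shows "bounded_vec_signal x"
proof -
  have "\<forall>i. \<exists>M. i < N \<longrightarrow> (\<forall>t\<in>I. \<bar>vec_index (x t) i\<bar> \<le> M)"
    using assms(3) unfolding bdd_def by (intro allI) simp
  then obtain M where "\<forall>i. i < N \<longrightarrow> (\<forall>t\<in>I. \<bar>vec_index (x t) i\<bar> \<le> M i)" by (rule choice[THEN exE])
  then have M: "\<bar>vec_index (x t) i\<bar> \<le> M i" if "i < N" "0 \<le> t" for i t using that assms(1) by simp
  have "\<bar>vec_index (x t) i\<bar> \<le> (\<Sum>i<N. \<bar>M i\<bar>)" if "0 \<le> t" "i < dim_vec (x t)" for t i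
  proof -
    have i: "i < N" using assms(2)[OF that(1)] that(2) by simp
    have "\<bar>vec_index (x t) i\<bar> \<le> \<bar>M i\<bar>" using M[OF i that(1)] by simp
    also have "\<dots> \<le> (\<Sum>i<N. \<bar>M i\<bar>)" using i by (intro member_le_sum[of i _ "\<lambda>i. \<bar>M i\<bar>"]) auto
    finally show ?thesis .
  qed
  then show ?thesis unfolding bounded_vec_signal_def by blast
qed

lemma bounded_signalI: "I = {0..} \<Longrightarrow> bdd v \<Longrightarrow> bounded_signal v"
  unfolding bdd_def bounded_signal_def bounded_iff by auto

end

text \<open>Adds the dimensions of the vectors and the properties of the reference, which the scalar
  formulation leaves open; it translates between vector equations and coordinates.\<close>

locale vec_design = design n m ns "ss_dim Wf" Z P Zm Pm L f lam lam1 Q R p q gg Ap Am Lam "ss_A F" "ss_A Wf"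
    bp cp bm cm l bl "ss_b F" "ss_c F" "ss_b Wf" "ss_c Wf" go "ss_d F" gam \<kappa> \<theta>s B
  for n m ns Z P Zm Pm L f lam lam1 Q R p q gg Ap Am Lam and F Wf :: state_space and bp cp bm cm l bl go gam \<kappa> \<theta>s B +
  fixes r :: "real \<Rightarrow> real" and rb :: real
  assumes dims: "bp \<in> carrier_vec n" "cp \<in> carrier_vec n" "bm \<in> carrier_vec m" "cm \<in> carrier_vec m" "l \<in> carrier_vec m"
      "bl \<in> carrier_vec (n - 1)" "ss_b F \<in> carrier_vec (ns - 1)" "ss_c F \<in> carrier_vec (ns - 1)" "ss_dim F = ns - 1"
      "ss_b Wf \<in> carrier_vec (ss_dim Wf)" "ss_c Wf \<in> carrier_vec (ss_dim Wf)" "ss_d Wf = 0"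
    and r_jumps: "\<And>T. finite {t \<in> {0..T}. \<not> continuous (at t within {0..}) r}"
    and r_bounded: "\<And>t. 0 \<le> t \<Longrightarrow> \<bar>r t\<bar> \<le> rb"
begin

definition jumps :: "real set" where
  "jumps = {t. 0 \<le> t \<and> \<not> continuous (at t within {0..}) r}"

lemma continuity_times: "continuity_times r = {0..} - jumps"
  by (auto simp: continuity_times_def jumps_def)

sublocale T: time_domain "{0..}" jumps
  unfolding jumps_def by (rule states_exist(1)[OF r_jumps r_bounded])

lemmas ode_iff = T.solves_ode_iff[OF refl continuity_times]

lemma omega_index:
  assumes "w1 \<in> carrier_vec (n - 1)" "w2 \<in> carrier_vec (n - 1)"
  shows "i < n - 1 \<Longrightarrow> vec_index (w1 @\<^sub>v vCons a w2) i = vec_index w1 i"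
    "vec_index (w1 @\<^sub>v vCons a w2) (n - 1) = a"
    "i < n - 1 \<Longrightarrow> vec_index (w1 @\<^sub>v vCons a w2) (n + i) = vec_index w2 i"
    "w1 @\<^sub>v vCons a w2 \<in> carrier_vec (2 * n - 1)"
proof -
  have d: "dim_vec w1 = n - 1" "dim_vec w2 = n - 1" using assms by auto
  show "i < n - 1 \<Longrightarrow> vec_index (w1 @\<^sub>v vCons a w2) i = vec_index w1 i" using d by simp
  show "vec_index (w1 @\<^sub>v vCons a w2) (n - 1) = a" using d by simp
  have "n + i - (n - 1) = Suc i" "\<not> n + i < n - 1" using n_pos by auto
  then show "i < n - 1 \<Longrightarrow> vec_index (w1 @\<^sub>v vCons a w2) (n + i) = vec_index w2 i" using d n_pos by simp
  show "w1 @\<^sub>v vCons a w2 \<in> carrier_vec (2 * n - 1)" using d n_pos by (intro carrier_vecI) simp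
qed

lemma loop_of_closed_loop:
  assumes "closed_loop n m 1 Ap bp cp Am bm cm l Lam bl F Wf gam r s"
  shows "loop n m ns (ss_dim Wf) Z P Zm Pm L f lam lam1 Q R p q gg Ap Am Lam (ss_A F) (ss_A Wf) bp cp bm cm l bl
    (ss_b F) (ss_c F) (ss_b Wf) (ss_c Wf) go (ss_d F) gam \<kappa> \<theta>s B {0..} jumps
    (\<lambda>i t. vec_index (sig_xp s t) i) (\<lambda>i t. vec_index (sig_xm s t) i) (\<lambda>i t. vec_index (sig_xFu s t) i) (\<lambda>i t. vec_index (sig_xW s t) i)
    (\<lambda>j t. vec_index (sig_omega s t) j) (\<lambda>j t. vec_index (sig_theta s t) j) (\<lambda>j t. vec_index (sig_zeta s t) j)
    (\<lambda>j i t. vec_index (sig_xF s t j) i) r (sig_u s) (sig_y s) (sig_ym s) (sig_ey s) (sig_Fu s) (sig_echi s) (sig_Wout s) (sig_ea s) rb"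
    (is ?loop)
    and "\<forall>t\<ge>0. sig_xp s t \<in> carrier_vec n \<and> sig_omega1 s t \<in> carrier_vec (n - 1) \<and> sig_omega2 s t \<in> carrier_vec (n - 1) \<and>
      sig_xm s t \<in> carrier_vec m \<and> (\<forall>j<2 * n - 1. sig_xF s t j \<in> carrier_vec (ns - 1)) \<and> sig_xFu s t \<in> carrier_vec (ns - 1) \<and>
      sig_xW s t \<in> carrier_vec (ss_dim Wf) \<and> sig_theta s t \<in> carrier_vec (2 * n - 1) \<and> sig_zeta s t \<in> carrier_vec (2 * n - 1)"
    and "\<forall>t\<ge>0. \<forall>i<n - 1. vec_index (sig_omega1 s t) i = vec_index (sig_omega s t) i \<and>
      vec_index (sig_omega2 s t) i = vec_index (sig_omega s t) (n + i)"
proof -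
  note H = assms[unfolded closed_loop_def Let_def]
  note pe = H[THEN conjunct1, unfolded plant_eqs_def ode_iff mult_1]
  note me = H[THEN conjunct2, THEN conjunct1, unfolded reference_model_eqs_def ode_iff]
  note ce = H[THEN conjunct2, THEN conjunct2, THEN conjunct1, unfolded controller_eqs_def ode_iff]
  note ee = H[THEN conjunct2, THEN conjunct2, THEN conjunct2, THEN conjunct1,
      unfolded error_eqs_def lti_op_def ode_iff dims(9,12) mult_zero_left add_0_right]
  note ue = H[THEN conjunct2, THEN conjunct2, THEN conjunct2, THEN conjunct2, unfolded update_law_def ode_iff]
  have C: "sig_xp s t \<in> carrier_vec n" "sig_omega1 s t \<in> carrier_vec (n - 1)" "sig_omega2 s t \<in> carrier_vec (n - 1)"
    "sig_xm s t \<in> carrier_vec m" "j < 2 * n - 1 \<Longrightarrow> sig_xF s t j \<in> carrier_vec (ns - 1)" "sig_xFu s t \<in> carrier_vec (ns - 1)"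
    "sig_xW s t \<in> carrier_vec (ss_dim Wf)" "sig_theta s t \<in> carrier_vec (2 * n - 1)" "sig_zeta s t \<in> carrier_vec (2 * n - 1)"
    "sig_omega s t = sig_omega1 s t @\<^sub>v vCons (sig_y s t) (sig_omega2 s t)" if "0 \<le> t" for t j
    using pe me ce ee ue that by simp_all
  have om_index: "i < n - 1 \<Longrightarrow> vec_index (sig_omega s t) i = vec_index (sig_omega1 s t) i"
    "vec_index (sig_omega s t) (n - 1) = sig_y s t"
    "i < n - 1 \<Longrightarrow> vec_index (sig_omega s t) (n + i) = vec_index (sig_omega2 s t) i"
    "sig_omega s t \<in> carrier_vec (2 * n - 1)" if "0 \<le> t" for t i
    using omega_index(1,3)[OF C(2,3)[OF that], of i "sig_y s t"] omega_index(2,4)[OF C(2,3)[OF that], of "sig_y s t"]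
    unfolding C(10)[OF that] by simp_all
  note om_carrier = om_index(4)
  show "\<forall>t\<ge>0. sig_xp s t \<in> carrier_vec n \<and> sig_omega1 s t \<in> carrier_vec (n - 1) \<and> sig_omega2 s t \<in> carrier_vec (n - 1) \<and>
      sig_xm s t \<in> carrier_vec m \<and> (\<forall>j<2 * n - 1. sig_xF s t j \<in> carrier_vec (ns - 1)) \<and> sig_xFu s t \<in> carrier_vec (ns - 1) \<and>
      sig_xW s t \<in> carrier_vec (ss_dim Wf) \<and> sig_theta s t \<in> carrier_vec (2 * n - 1) \<and> sig_zeta s t \<in> carrier_vec (2 * n - 1)"
    using C by simp
  show "\<forall>t\<ge>0. \<forall>i<n - 1. vec_index (sig_omega1 s t) i = vec_index (sig_omega s t) i \<and>
      vec_index (sig_omega2 s t) i = vec_index (sig_omega s t) (n + i)"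
    using om_index by simp
  have sp: "scalar_prod (sig_theta s t) (sig_omega s t) = (\<Sum>j<2 * n - 1. vec_index (sig_theta s t) j * vec_index (sig_omega s t) j)" if "0 \<le> t" for t
    by (rule scalar_prod_sum[OF om_carrier[OF that]])
  have zz: "scalar_prod (sig_zeta s t) (sig_zeta s t) = (\<Sum>j<2 * n - 1. (vec_index (sig_zeta s t) j)\<^sup>2)" if "0 \<le> t" for t
    using scalar_prod_sum[OF C(9)[OF that]] by (simp add: power2_eq_square)
  show ?loop
  proof
    fix t :: real assume "t \<in> {0..}"
    then have t: "0 \<le> t" by simp
    show "\<bar>r t\<bar> \<le> rb" by (rule r_bounded[OF t])
    show "sig_y s t = (\<Sum>i<n. vec_index cp i * vec_index (sig_xp s t) i)"
      using pe t scalar_prod_sum[OF C(1)[OF t], of cp] by simp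
    show "vec_index (sig_omega s t) (n - 1) = sig_y s t" by (rule om_index(2)[OF t])
    show "sig_u s t = r t + (\<Sum>j<2 * n - 1. vec_index (sig_theta s t) j * vec_index (sig_omega s t) j)"
      using ce t sp[OF t] by simp
    show "sig_ym s t = (\<Sum>i<m. vec_index cm i * vec_index (sig_xm s t) i)"
      using me t scalar_prod_sum[OF C(4)[OF t], of cm] by simp
    show "sig_ey s t = sig_y s t - sig_ym s t" using ee t by simp
    show "sig_Fu s t = (\<Sum>i<ns - 1. vec_index (ss_c F) i * vec_index (sig_xFu s t) i)
        + ss_d F * (\<Sum>j<2 * n - 1. vec_index (sig_theta s t) j * vec_index (sig_omega s t) j)"
      using ee t scalar_prod_sum[OF C(6)[OF t], of "ss_c F"] sp[OF t] by simp
    show "sig_echi s t = (\<Sum>j<2 * n - 1. vec_index (sig_theta s t) j * vec_index (sig_zeta s t) j) - sig_Fu s t"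
      using ee t scalar_prod_sum[OF C(9)[OF t], of "sig_theta s t"] by simp
    show "sig_Wout s t = (\<Sum>i<ss_dim Wf. vec_index (ss_c Wf) i * vec_index (sig_xW s t) i)"
      using ee t scalar_prod_sum[OF C(7)[OF t], of "ss_c Wf"] by simp
    show "sig_ea s t = sig_ey s t + sig_Wout s t" using ee t by simp
    fix j assume j: "j < 2 * n - 1"
    have "vec_index (sig_zeta s t) j = scalar_prod (ss_c F) (sig_xF s t j) + ss_d F * vec_index (sig_omega s t) j"
      using ee t j by simp
    then show "vec_index (sig_zeta s t) j = (\<Sum>i<ns - 1. vec_index (ss_c F) i * vec_index (sig_xF s t j) i) + ss_d F * vec_index (sig_omega s t) j"
      using scalar_prod_sum[OF C(5)[OF t j], of "ss_c F"] by simp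
  next
    fix i assume i: "i < n"
    have "T.sol (\<lambda>t. vec_index (sig_xp s t) i) (\<lambda>t. vec_index (Ap *\<^sub>v sig_xp s t + sig_u s t \<cdot>\<^sub>v bp) i)" using pe i by simp
    then show "T.sol (\<lambda>t. vec_index (sig_xp s t) i) (\<lambda>t. (\<Sum>j<n. Ap $$ (i, j) * vec_index (sig_xp s t) j) + vec_index bp i * sig_u s t)"
      by (rule T.sol_cong) (use i dims plant(1) in \<open>simp_all add: mult_mat_vec_index[OF plant(1) C(1)] del: index_mult_mat_vec\<close>)
  next
    fix i assume i: "i < n - 1"
    have "T.sol (\<lambda>t. vec_index (sig_omega1 s t) i) (\<lambda>t. vec_index (Lam *\<^sub>v sig_omega1 s t + sig_u s t \<cdot>\<^sub>v bl) i)" using ce i by simp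
    then show "T.sol (\<lambda>t. vec_index (sig_omega s t) i) (\<lambda>t. (\<Sum>j<n - 1. Lam $$ (i, j) * vec_index (sig_omega s t) j) + vec_index bl i * sig_u s t)"
      by (rule T.sol_cong) (use i dims ctrl(1) in \<open>simp_all add: om_index mult_mat_vec_index[OF ctrl(1) C(2)] del: index_mult_mat_vec\<close>)
    have "T.sol (\<lambda>t. vec_index (sig_omega2 s t) i) (\<lambda>t. vec_index (Lam *\<^sub>v sig_omega2 s t + sig_y s t \<cdot>\<^sub>v bl) i)" using ce i by simp
    then show "T.sol (\<lambda>t. vec_index (sig_omega s t) (n + i)) (\<lambda>t. (\<Sum>j<n - 1. Lam $$ (i, j) * vec_index (sig_omega s t) (n + j)) + vec_index bl i * sig_y s t)"
      by (rule T.sol_cong) (use i dims ctrl(1) in \<open>simp_all add: om_index mult_mat_vec_index[OF ctrl(1) C(3)] del: index_mult_mat_vec\<close>)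
  next
    fix i assume i: "i < m"
    have "T.sol (\<lambda>t. vec_index (sig_xm s t) i) (\<lambda>t. vec_index (Am *\<^sub>v sig_xm s t + r t \<cdot>\<^sub>v bm + (sig_y s t - sig_ym s t) \<cdot>\<^sub>v l) i)" using me i by simp
    moreover have "sig_ey s t = sig_y s t - sig_ym s t" if "0 \<le> t" for t using ee that by simp
    ultimately show "T.sol (\<lambda>t. vec_index (sig_xm s t) i) (\<lambda>t. (\<Sum>j<m. Am $$ (i, j) * vec_index (sig_xm s t) j) + (vec_index bm i * r t + vec_index l i * sig_ey s t))"
      by (elim T.sol_cong) (use i dims model(1) in \<open>simp_all add: mult_mat_vec_index[OF model(1) C(4)] del: index_mult_mat_vec\<close>)
  next
    fix j i assume j: "j < 2 * n - 1" and i: "i < ns - 1"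
    have "T.sol (\<lambda>t. vec_index (sig_xF s t j) i) (\<lambda>t. vec_index (ss_A F *\<^sub>v sig_xF s t j + vec_index (sig_omega s t) j \<cdot>\<^sub>v ss_b F) i)" using ee i j by simp
    then show "T.sol (\<lambda>t. vec_index (sig_xF s t j) i) (\<lambda>t. (\<Sum>k<ns - 1. ss_A F $$ (i, k) * vec_index (sig_xF s t j) k) + vec_index (ss_b F) i * vec_index (sig_omega s t) j)"
      by (rule T.sol_cong) (use i j dims filter(1) in \<open>simp_all add: mult_mat_vec_index[OF filter(1) C(5)] del: index_mult_mat_vec\<close>)
  next
    fix i assume i: "i < ns - 1"
    have "T.sol (\<lambda>t. vec_index (sig_xFu s t) i) (\<lambda>t. vec_index (ss_A F *\<^sub>v sig_xFu s t + (scalar_prod (sig_theta s t) (sig_omega s t)) \<cdot>\<^sub>v ss_b F) i)" using ee i by simp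
    then show "T.sol (\<lambda>t. vec_index (sig_xFu s t) i) (\<lambda>t. (\<Sum>k<ns - 1. ss_A F $$ (i, k) * vec_index (sig_xFu s t) k) +
        vec_index (ss_b F) i * (\<Sum>j<2 * n - 1. vec_index (sig_theta s t) j * vec_index (sig_omega s t) j))"
      by (rule T.sol_cong) (use i dims filter(1) sp in \<open>simp_all add: mult_mat_vec_index[OF filter(1) C(6)] del: index_mult_mat_vec\<close>)
  next
    fix i assume i: "i < ss_dim Wf"
    have "T.sol (\<lambda>t. vec_index (sig_xW s t) i) (\<lambda>t. vec_index (ss_A Wf *\<^sub>v sig_xW s t
        + (sig_echi s t - sig_ea s t * (scalar_prod (sig_zeta s t) (sig_zeta s t))) \<cdot>\<^sub>v ss_b Wf) i)" using ee i by simp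
    then show "T.sol (\<lambda>t. vec_index (sig_xW s t) i) (\<lambda>t. (\<Sum>k<ss_dim Wf. ss_A Wf $$ (i, k) * vec_index (sig_xW s t) k) +
        vec_index (ss_b Wf) i * (sig_echi s t - sig_ea s t * (\<Sum>j<2 * n - 1. (vec_index (sig_zeta s t) j)\<^sup>2)))"
    proof (rule T.sol_cong)
      fix t assume "t \<in> {0..} - jumps"
      then have t: "0 \<le> t" by simp
      show "vec_index (ss_A Wf *\<^sub>v sig_xW s t + (sig_echi s t - sig_ea s t * scalar_prod (sig_zeta s t) (sig_zeta s t)) \<cdot>\<^sub>v ss_b Wf) i =
        (\<Sum>k<ss_dim Wf. ss_A Wf $$ (i, k) * vec_index (sig_xW s t) k) +
        vec_index (ss_b Wf) i * (sig_echi s t - sig_ea s t * (\<Sum>j<2 * n - 1. (vec_index (sig_zeta s t) j)\<^sup>2))"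
        by (simp only: affine_index[OF errf(1) C(7)[OF t] dims(10) i] zz[OF t])
    qed simp
  next
    fix j assume j: "j < 2 * n - 1"
    have "T.sol (\<lambda>t. vec_index (sig_theta s t) j) (\<lambda>t. vec_index ((- gam * sig_ea s t) \<cdot>\<^sub>v sig_zeta s t) j)" using ue j by simp
    then show "T.sol (\<lambda>t. vec_index (sig_theta s t) j) (\<lambda>t. - gam * sig_ea s t * vec_index (sig_zeta s t) j)"
    proof (rule T.sol_cong)
      fix t assume "t \<in> {0..} - jumps"
      then have "sig_zeta s t \<in> carrier_vec (2 * n - 1)" using C(9) by simp
      then show "vec_index ((- gam * sig_ea s t) \<cdot>\<^sub>v sig_zeta s t) j = - gam * sig_ea s t * vec_index (sig_zeta s t) j" using j by simp
    qed simp
  qed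
qed

lemma closed_loop_bounded:
  assumes "closed_loop n m 1 Ap bp cp Am bm cm l Lam bl F Wf gam r s"
  shows "all_signals_bounded n s" and "(sig_ey s \<longlongrightarrow> 0) at_top"
proof -
  note * = loop_of_closed_loop[OF assms]
  note b = loop.signals_bounded[OF *(1)]
  show "(sig_ey s \<longlongrightarrow> 0) at_top" by (rule loop.ey_tendsto_0[OF *(1) refl])
  have om: "T.bdd (\<lambda>t. vec_index (sig_omega1 s t) i)" "T.bdd (\<lambda>t. vec_index (sig_omega2 s t) i)" if i: "i < n - 1" for i
  proof -
    have ij: "i < 2 * n - 1" "n + i < 2 * n - 1" using i by auto
    show "T.bdd (\<lambda>t. vec_index (sig_omega1 s t) i)" by (rule T.bdd_cong[OF b(2)[OF ij(1)]]) (use *(3) i in simp)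
    show "T.bdd (\<lambda>t. vec_index (sig_omega2 s t) i)" by (rule T.bdd_cong[OF b(2)[OF ij(2)]]) (use *(3) i in simp)
  qed
  show "all_signals_bounded n s" unfolding all_signals_bounded_def
    by (intro conjI allI impI; (rule T.bounded_signalI[OF refl] T.bounded_vec_signalI[OF refl]))
      (use *(2) in \<open>auto intro: b om loop.bdd_xW[OF *(1)] loop.bdd_ym[OF *(1)] loop.bdd_echi[OF *(1)]\<close>)
qed

definition signals_of :: "(coord \<Rightarrow> real \<Rightarrow> real) \<Rightarrow> signals" where
  "signals_of X = \<lparr>
    sig_xp = (\<lambda>t. Matrix.vec n (\<lambda>i. X (Xp i) t)),
    sig_omega1 = (\<lambda>t. Matrix.vec (n - 1) (\<lambda>i. X (Om i) t)),
    sig_omega2 = (\<lambda>t. Matrix.vec (n - 1) (\<lambda>i. X (Om (n + i)) t)),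
    sig_xm = (\<lambda>t. Matrix.vec m (\<lambda>i. X (Xm i) t)),
    sig_xF = (\<lambda>t j. Matrix.vec (ns - 1) (\<lambda>i. X (XF j i) t)),
    sig_xFu = (\<lambda>t. Matrix.vec (ns - 1) (\<lambda>i. X (XFu i) t)),
    sig_xW = (\<lambda>t. Matrix.vec (ss_dim Wf) (\<lambda>i. X (XW i) t)),
    sig_theta = (\<lambda>t. Matrix.vec (2 * n - 1) (\<lambda>j. X (Th j) t)),
    sig_u = (\<lambda>t. r t + out_v (\<lambda>c. X c t)),
    sig_y = (\<lambda>t. out_y (\<lambda>c. X c t)),
    sig_omega = (\<lambda>t. Matrix.vec (n - 1) (\<lambda>i. X (Om i) t) @\<^sub>v vCons (out_y (\<lambda>c. X c t)) (Matrix.vec (n - 1) (\<lambda>i. X (Om (n + i)) t))),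
    sig_ym = (\<lambda>t. \<Sum>i<m. vec_index cm i * X (Xm i) t),
    sig_ey = (\<lambda>t. out_ey (\<lambda>c. X c t)),
    sig_zeta = (\<lambda>t. Matrix.vec (2 * n - 1) (out_ze (\<lambda>c. X c t))),
    sig_Fu = (\<lambda>t. (\<Sum>i<ns - 1. vec_index (ss_c F) i * X (XFu i) t) + ss_d F * out_v (\<lambda>c. X c t)),
    sig_echi = (\<lambda>t. out_echi (\<lambda>c. X c t)),
    sig_Wout = (\<lambda>t. \<Sum>i<ss_dim Wf. vec_index (ss_c Wf) i * X (XW i) t),
    sig_ea = (\<lambda>t. out_ea (\<lambda>c. X c t))\<rparr>"

lemma closed_loop_signals_of:
  assumes X: "\<And>c. c \<in> coords \<Longrightarrow> T.sol (X c) (\<lambda>t. rhs c (\<lambda>c. X c t) + inp c * r t)"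
  shows "closed_loop n m 1 Ap bp cp Am bm cm l Lam bl F Wf gam r (signals_of X)"
proof -
  define om where "om t = Matrix.vec (n - 1) (\<lambda>i. X (Om i) t) @\<^sub>v vCons (out_y (\<lambda>c. X c t)) (Matrix.vec (n - 1) (\<lambda>i. X (Om (n + i)) t))" for t
  have om: "vec_index (om t) j = out_om (\<lambda>c. X c t) j" if "j < 2 * n - 1" for j t
  proof (rule index_cases[OF that])
    assume "j < n - 1"
    then show ?thesis by (simp add: out_om_def om_def)
  next
    assume "j = n - 1"
    then show ?thesis by (simp add: out_om_def om_def)
  next
    fix i assume i: "j = n + i" "i < n - 1"
    have "n + i - (n - 1) = Suc i" "\<not> n + i < n - 1" using n_pos by auto
    then show ?thesis using i n_pos by (simp add: out_om_def om_def omega2_index)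
  qed
  have om_carrier: "om t \<in> carrier_vec (2 * n - 1)" for t unfolding om_def by (rule omega_index(4)) auto
  have v: "scalar_prod (Matrix.vec (2 * n - 1) (\<lambda>j. X (Th j) t)) (om t) = out_v (\<lambda>c. X c t)" for t
    using om_carrier[of t] by (simp add: scalar_prod_sum[OF om_carrier] om out_v_def)
  have sp: "scalar_prod c (Matrix.vec N g) = (\<Sum>i<N. vec_index c i * g i)" for c and g :: "nat \<Rightarrow> real" and N :: nat
    by (simp add: scalar_prod_sum[OF vec_carrier])
  have mv: "i < N \<Longrightarrow> vec_index (A *\<^sub>v Matrix.vec N g) i = (\<Sum>j<N. A $$ (i, j) * g j)" if "A \<in> carrier_mat N N" for A i N and g :: "nat \<Rightarrow> real"
    by (simp add: mult_mat_vec_index[OF that vec_carrier] del: index_mult_mat_vec)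
  have sol: "T.sol (\<lambda>t. X c t) g" if "c \<in> coords" "\<And>t. rhs c (\<lambda>c. X c t) + inp c * r t = g t" for c g
    using X[OF that(1)] that(2) by simp
  have ode: "solves_ode (continuity_times r) N (\<lambda>t. Matrix.vec N (\<lambda>i. X (c i) t)) g"
    if "\<And>i. i < N \<Longrightarrow> c i \<in> coords" "\<And>i t. i < N \<Longrightarrow> rhs (c i) (\<lambda>c. X c t) + inp (c i) * r t = vec_index (g t) i" for N c g
    unfolding ode_iff by (intro conjI allI impI) (auto intro!: sol that)
  note d = carrier_vecD[OF dims(1)] carrier_vecD[OF dims(3)] carrier_vecD[OF dims(5)] carrier_vecD[OF dims(6)] carrier_vecD[OF dims(7)] carrier_vecD[OF dims(10)]
  have om2_mem: "Om (i + n) \<in> coords" if "i < n - Suc 0" for i using coords_mem(3)[of i] that by (simp add: add.commute)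
  note [simp del] = index_mult_mat_vec
  have plant': "plant_eqs (continuity_times r) n 1 Ap bp cp (signals_of X)"
    unfolding plant_eqs_def signals_of_def signals.simps
    by (intro conjI ode) (auto simp: coords_mem sp mv[OF plant(1)] d rhs_def inp_def out_y_def algebra_simps)
  have model': "reference_model_eqs (continuity_times r) m Am bm cm l r (signals_of X)"
    unfolding reference_model_eqs_def signals_of_def signals.simps
    by (intro conjI ode) (auto simp: coords_mem sp mv[OF model(1)] d rhs_def inp_def out_ey_def algebra_simps)
  have ctrl': "controller_eqs (continuity_times r) n Lam bl r (signals_of X)"
    unfolding controller_eqs_def signals_of_def signals.simps om_def[symmetric] v
    by (intro conjI ode) (auto simp: coords_mem om2_mem mv[OF ctrl(1), unfolded One_nat_def] d rhs_def inp_def algebra_simps)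
  have err': "error_eqs (continuity_times r) n F Wf (signals_of X)"
    unfolding error_eqs_def lti_op_def signals_of_def signals.simps om_def[symmetric] v dims(9,12)
    by (intro conjI allI impI ode)
      (auto simp: coords_mem sp om mv[OF filter(1), unfolded One_nat_def] mv[OF errf(1)] d rhs_def inp_def out_ey_def out_ze_def out_echi_def out_ea_def out_y_def algebra_simps)
  have upd': "update_law (continuity_times r) n gam (signals_of X)"
    unfolding update_law_def signals_of_def signals.simps
    by (rule ode) (auto simp: coords_mem rhs_def inp_def)
  show ?thesis unfolding closed_loop_def Let_def using plant' model' ctrl' err' upd' by blast
qed

lemma closed_loop_exists:
  assumes dim0: "xp0 \<in> carrier_vec n" "w10 \<in> carrier_vec (n - 1)" "w20 \<in> carrier_vec (n - 1)" "xm0 \<in> carrier_vec m"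
    "\<And>j. j < 2 * n - 1 \<Longrightarrow> xF0 j \<in> carrier_vec (ns - 1)" "xFu0 \<in> carrier_vec (ns - 1)" "xW0 \<in> carrier_vec (ss_dim Wf)" "th0 \<in> carrier_vec (2 * n - 1)"
  shows "\<exists>s. closed_loop n m 1 Ap bp cp Am bm cm l Lam bl F Wf gam r s \<and>
    sig_xp s 0 = xp0 \<and> sig_omega1 s 0 = w10 \<and> sig_omega2 s 0 = w20 \<and> sig_xm s 0 = xm0 \<and>
    (\<forall>j<2 * n - 1. sig_xF s 0 j = xF0 j) \<and> sig_xFu s 0 = xFu0 \<and> sig_xW s 0 = xW0 \<and> sig_theta s 0 = th0"
proof -
  define x0 where "x0 c = (case c of Xp i \<Rightarrow> vec_index xp0 i | Om i \<Rightarrow> if i < n - 1 then vec_index w10 i else vec_index w20 (i - n)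
    | Xm i \<Rightarrow> vec_index xm0 i | XF j i \<Rightarrow> vec_index (xF0 j) i | XFu i \<Rightarrow> vec_index xFu0 i | XW i \<Rightarrow> vec_index xW0 i | Th j \<Rightarrow> vec_index th0 j)" for c
  obtain X where X: "\<forall>c\<in>coords. X c 0 = x0 c \<and> T.sol (X c) (\<lambda>t. rhs c (\<lambda>c. X c t) + inp c * r t)"
    using states_exist(2)[OF r_jumps r_bounded, of x0, folded jumps_def] by blast
  then have X0: "\<And>c. c \<in> coords \<Longrightarrow> X c 0 = x0 c" by blast
  have "Matrix.vec N (\<lambda>i. X (c i) 0) = v" if "v \<in> carrier_vec N" "\<And>i. i < N \<Longrightarrow> c i \<in> coords \<and> x0 (c i) = vec_index v i" for N c v
    using that X0 by (intro eq_vecI) auto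
  note init = this
  have cl: "closed_loop n m 1 Ap bp cp Am bm cm l Lam bl F Wf gam r (signals_of X)" by (rule closed_loop_signals_of) (use X in blast)
  have "x0 (Om (n + i)) = vec_index w20 i" for i
  proof -
    have "\<not> n + i < n - 1" by simp
    then show ?thesis unfolding x0_def coord.case by (simp only: if_False diff_add_inverse)
  qed
  then have w20: "Matrix.vec (n - 1) (\<lambda>i. X (Om (n + i)) 0) = w20" by (intro init[OF dim0(3)] conjI coords_mem)
  have "sig_xp (signals_of X) 0 = xp0" "sig_omega1 (signals_of X) 0 = w10" "sig_omega2 (signals_of X) 0 = w20"
    "sig_xm (signals_of X) 0 = xm0" "j < 2 * n - 1 \<Longrightarrow> sig_xF (signals_of X) 0 j = xF0 j" "sig_xFu (signals_of X) 0 = xFu0"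
    "sig_xW (signals_of X) 0 = xW0" "sig_theta (signals_of X) 0 = th0" for j
    unfolding signals_of_def signals.simps
    using w20 init[OF dim0(1), of Xp] init[OF dim0(2), of Om] init[OF dim0(4), of Xm]
      init[OF dim0(5), of j "XF j"] init[OF dim0(6), of XFu] init[OF dim0(7), of XW] init[OF dim0(8), of Th]
    by (simp_all add: coords_mem x0_def)
  with cl show ?thesis by (intro exI[of _ "signals_of X"] conjI allI impI) assumption+
qed

end

theorem theorem5:
  fixes n m nstar :: nat
    and Z P Zm Pm Zl f :: "real poly"
    and kp kl \<gamma> :: real
    and Ap Am \<Lambda> :: "real Matrix.mat"
    and bp cp bm cm l bl :: "real Matrix.vec"
    and F Wf :: state_space
    and We' Wf' :: "real poly fract"
    and r :: "real \<Rightarrow> real"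
  assumes plant_polys: "lead_coeff Z = 1" "lead_coeff P = 1" "Polynomial.degree P = n" "hurwitz_poly Z"
    and rel_degree: "Polynomial.degree Z + nstar = n" "nstar \<ge> 1"
    and gain: "kp = 1"
    and plant_real: "Ap \<in> carrier_mat n n" "bp \<in> carrier_vec n" "cp \<in> carrier_vec n"
      "char_poly Ap = P" "transfer_fun Ap bp (kp \<cdot>\<^sub>v cp) = Fraction_Field.Fract (Polynomial.smult kp Z) P"
    and model_polys: "lead_coeff Zm = 1" "lead_coeff Pm = 1" "Polynomial.degree Pm = m"
      "Polynomial.degree Zm + nstar = m" "hurwitz_poly Pm"
    and model_real: "Am = observer_canonical_mat m Pm" "cm = unit_vec m (m - 1)"
      "bm \<in> carrier_vec m" "transfer_fun Am bm cm = Fraction_Field.Fract Zm Pm"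
    and ref: "bounded_signal r" "piecewise_continuous r"
    and filter_F: "lead_coeff f = 1" "hurwitz_poly f" "Polynomial.degree f + 1 = nstar"
      "minimal_realization F (Fraction_Field.Fract 1 f)"
    and gain_l: "l \<in> carrier_vec m" "transfer_fun Am l cm = Fraction_Field.Fract (Polynomial.smult kl Zl) Pm"
    and We': "We' = Fraction_Field.Fract Zm (Pm + Polynomial.smult kl Zl)"
    and Wf': "Wf' = We' * inverse (Fraction_Field.Fract 1 f)" "strictly_positive_real Wf'"
      "minimal_realization Wf Wf'"
    and controller: "\<Lambda> \<in> carrier_mat (n - 1) (n - 1)" "bl \<in> carrier_vec (n - 1)"
      "hurwitz_mat \<Lambda>" "controllable (n - 1) \<Lambda> bl" "Zm dvd char_poly \<Lambda>"
    and adaptation: "\<gamma> > 0"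
  shows "(\<forall>xp0 \<omega>10 \<omega>20 xm0 xF0 xFu0 xW0 \<theta>0.
            xp0 \<in> carrier_vec n \<and>
            \<omega>10 \<in> carrier_vec (n - 1) \<and> \<omega>20 \<in> carrier_vec (n - 1) \<and>
            xm0 \<in> carrier_vec m \<and>
            (\<forall>j < 2 * n - 1. xF0 j \<in> carrier_vec (ss_dim F)) \<and>
            xFu0 \<in> carrier_vec (ss_dim F) \<and> xW0 \<in> carrier_vec (ss_dim Wf) \<and>
            \<theta>0 \<in> carrier_vec (2 * n - 1) \<longrightarrow>
            (\<exists>s. closed_loop n m kp Ap bp cp Am bm cm l \<Lambda> bl F Wf \<gamma> r s \<and>
               sig_xp s 0 = xp0 \<and> sig_omega1 s 0 = \<omega>10 \<and> sig_omega2 s 0 = \<omega>20 \<and>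
               sig_xm s 0 = xm0 \<and> (\<forall>j < 2 * n - 1. sig_xF s 0 j = xF0 j) \<and>
               sig_xFu s 0 = xFu0 \<and> sig_xW s 0 = xW0 \<and> sig_theta s 0 = \<theta>0)) \<and>
         (\<forall>s. closed_loop n m kp Ap bp cp Am bm cm l \<Lambda> bl F Wf \<gamma> r s \<longrightarrow>
            all_signals_bounded n s \<and> (sig_ey s \<longlongrightarrow> 0) at_top)"
proof -
  obtain rb where rb: "\<And>t. 0 \<le> t \<Longrightarrow> \<bar>r t\<bar> \<le> rb"
    using ref(1) by (auto simp: bounded_signal_def bounded_iff)
  have jumps: "finite {t \<in> {0..T}. \<not> continuous (at t within {0..}) r}" for T
    using ref(2) by (simp add: piecewise_continuous_def)
  have cp: "1 \<cdot>\<^sub>v cp = cp" by (rule eq_vecI) auto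
  have plant: "transfer_fun Ap bp cp = Fraction_Field.Fract Z P" using plant_real(5) by (simp add: gain cp)
  note D = design_exists[OF plant_polys rel_degree plant_real(1-4) plant model_polys model_real(3) model_real(4)[unfolded model_real(1,2)]
      filter_F gain_l(1) gain_l(2)[unfolded model_real(1,2)] Wf'(1)[unfolded We'] Wf'(2,3) controller adaptation,
      folded model_real(1) model_real(2)]
  obtain lam lam1 Q R p q gg go \<kappa> \<theta>s B where "design n m nstar (ss_dim Wf) Z P Zm Pm (Polynomial.smult kl Zl) f lam lam1 Q R p q gg
    Ap Am \<Lambda> (ss_A F) (ss_A Wf) bp cp bm cm l bl (ss_b F) (ss_c F) (ss_b Wf) (ss_c Wf) go (ss_d F) \<gamma> \<kappa> \<theta>s B"
    using D(1) by (elim exE)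
  then interpret design n m nstar "ss_dim Wf" Z P Zm Pm "Polynomial.smult kl Zl" f lam lam1 Q R p q gg
    Ap Am \<Lambda> "ss_A F" "ss_A Wf" bp cp bm cm l bl "ss_b F" "ss_c F" "ss_b Wf" "ss_c Wf" go "ss_d F" \<gamma> \<kappa> \<theta>s B .
  have real: "ss_b F \<in> carrier_vec (ss_dim F)" "ss_c F \<in> carrier_vec (ss_dim F)"
    "ss_b Wf \<in> carrier_vec (ss_dim Wf)" "ss_c Wf \<in> carrier_vec (ss_dim Wf)"
    using filter_F(4) Wf'(3) by (auto simp: minimal_realization_def realizes_def)
  interpret vec_design n m nstar Z P Zm Pm "Polynomial.smult kl Zl" f lam lam1 Q R p q gg
    Ap Am \<Lambda> F Wf bp cp bm cm l bl go \<gamma> \<kappa> \<theta>s B r rb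
  proof unfold_locales
    show "cm \<in> carrier_vec m" by (simp add: model_real(2))
  qed (fact plant_real model_real gain_l controller D real[unfolded D(3)] real(3,4) jumps rb)+
  show ?thesis unfolding gain D(3)
    using closed_loop_exists closed_loop_bounded by blast
qed

end
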